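(* Let $p$ be an odd prime, let $G=H\times P$ with $H\cong C_2^5$ and $P\cong C_p$, and let $K\in \mathrm{Sup}_2^{\min}(G_{r})$. Then the S-ring $V(K,G)$ is a CI-S-ring.
   Context: For a finite group $G$ with identity $e$ and $X\subseteq G$ let $\underline{X}=\sum_{x\in X}x\in\mathbb{Z}G$. An S-ring over $G$ is a subring $\mathcal{A}\subseteq\mathbb{Z}G$ for which there is a partition $\mathcal{S}(\mathcal{A})$ of $G$ (the basic sets) such that $\{e\}\in\mathcal{S}(\mathcal{A})$, $X\in\mathcal{S}(\mathcal{A})$ implies $X^{-1}\in\mathcal{S}(\mathcal{A})$, and $\mathcal{A}$ is the $\mathbb{Z}$-span of $\{\underline{X}: X\in\mathcal{S}(\mathcal{A})\}$. For $X\subseteq G$ put $R(X)=\{(g,xg): g\in G, x\in X\}$. For a bijection $f$ of $G$ put $R(X)^f=\{(g^f,h^f):(g,h)\in R(X)\}$. $\mathrm{Aut}(\mathcal{A})$ is the group of all permutations $f$ of $G$ with $R(X)^f=R(X)$ for all $X\in\mathcal{S}(\mathcal{A})$. Let $\mathrm{Iso}(\mathcal{A})$ be the set of all permutations $f$ of $G$ such that $\{R(X)^f: X\in\mathcal{S}(\mathcal{A})\}=\{R(X'):X'\in\mathcal{S}(\mathcal{A}')\}$ for some S-ring $\mathcal{A}'$ over $G$. $\mathcal{A}$ is a CI-S-ring if $\mathrm{Iso}(\mathcal{A})=\mathrm{Aut}(\mathcal{A})\mathrm{Aut}(G)$. $G_{r}$ is the group of right translations $x\mapsto xg$ of $G$;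 $\mathrm{Sup}(G_{r})$ is the set of groups $K$ with $G_{r}\le K\le\mathrm{Sym}(G)$. For $K\in\mathrm{Sup}(G_{r})$, $V(K,G)$ is the S-ring over $G$ whose basic sets are the orbits of the point stabilizer $K_e$ on $G$. Two permutation groups on $\Omega$ are 2-equivalent if they have the same orbits on $\Omega^2$ (componentwise action); the 2-closure $K^{(2)}$ of $K$ is the largest group 2-equivalent to $K$. $\mathrm{Sup}_2(G_{r})=\{K\in\mathrm{Sup}(G_{r}): K^{(2)}=K\}$. A subgroup of $\mathrm{Sym}(G)$ is $G$-regular if it is regular and isomorphic to $G$. For $K_1\le K_2$ in $\mathrm{Sup}(G_{r})$ write $K_1\preceq_G K_2$ if every $G$-regular subgroup of $K_2$ is $K_2$-conjugate to some $G$-regular subgroup of $K_1$. $\mathrm{Sup}_2^{\min}(G_{r})$ is the set of minimal elements of $\mathrm{Sup}_2(G_{r})$ with respect to $\preceq_G$. *)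

theory Defs
  imports
    "HOL-Algebra.Subrings"
    "HOL-Algebra.Group_Action"
    "HOL-Algebra.Product_Groups"
    "HOL-Computational_Algebra.Primes"
    "HOL-Library.Disjoint_Sets"
    "HOL-Library.Indicator_Function"
begin

section \<open>The integral group ring and S-rings\<close>

text \<open>Elements of the integral group ring of a finite group are coefficient functions vanishing
  outside the carrier; \<^term>\<open>indicator X\<close> is then the formal sum of the elements of \<open>X\<close>.\<close>

definition group_ring :: "('a, 'b) monoid_scheme \<Rightarrow> ('a \<Rightarrow> int) ring" where
  "group_ring G =
    \<lparr>carrier = {a. \<forall>x. x \<notin> carrier G \<longrightarrow> a x = 0},
     monoid.mult = (\<lambda>a b x. if x \<in> carrier G
        then \<Sum>y\<in>carrier G. a y * b (inv\<^bsub>G\<^esub> y \<otimes>\<^bsub>G\<^esub> x) else 0),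
     monoid.one = indicator {\<one>\<^bsub>G\<^esub>},
     ring.zero = (\<lambda>x. 0),
     ring.add = (\<lambda>a b x. a x + b x)\<rparr>"

definition int_span :: "'a set set \<Rightarrow> ('a \<Rightarrow> int) set" where
  "int_span S = {a. \<exists>c :: 'a set \<Rightarrow> int. a = (\<lambda>x. \<Sum>X\<in>S. c X * indicator X x)}"

definition is_basic_sets ::
  "('a, 'b) monoid_scheme \<Rightarrow> ('a \<Rightarrow> int) set \<Rightarrow> 'a set set \<Rightarrow> bool" where
  "is_basic_sets G A S \<longleftrightarrow>
     partition_on (carrier G) S \<and>
     {\<one>\<^bsub>G\<^esub>} \<in> S \<and>
     (\<forall>X\<in>S. (\<lambda>x. inv\<^bsub>G\<^esub> x) ` X \<in> S) \<and>
     A = int_span S"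

definition S_ring :: "('a, 'b) monoid_scheme \<Rightarrow> ('a \<Rightarrow> int) set \<Rightarrow> bool" where
  "S_ring G A \<longleftrightarrow> subring A (group_ring G) \<and> (\<exists>S. is_basic_sets G A S)"

definition basic_sets :: "('a, 'b) monoid_scheme \<Rightarrow> ('a \<Rightarrow> int) set \<Rightarrow> 'a set set" where
  "basic_sets G A = (THE S. is_basic_sets G A S)"


section \<open>Isomorphisms of S-rings and the CI property\<close>

definition cayley_rel :: "('a, 'b) monoid_scheme \<Rightarrow> 'a set \<Rightarrow> ('a \<times> 'a) set" where
  "cayley_rel G X = {(g, x \<otimes>\<^bsub>G\<^esub> g) | g x. g \<in> carrier G \<and> x \<in> X}"

definition rel_image :: "('a \<Rightarrow> 'a) \<Rightarrow> ('a \<times> 'a) set \<Rightarrow> ('a \<times> 'a) set" where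
  "rel_image f R = {(f g, f h) | g h. (g, h) \<in> R}"

definition S_ring_Aut :: "('a, 'b) monoid_scheme \<Rightarrow> ('a \<Rightarrow> int) set \<Rightarrow> ('a \<Rightarrow> 'a) set" where
  "S_ring_Aut G A =
     {f \<in> Bij (carrier G).
        \<forall>X\<in>basic_sets G A. rel_image f (cayley_rel G X) = cayley_rel G X}"

definition S_ring_Iso :: "('a, 'b) monoid_scheme \<Rightarrow> ('a \<Rightarrow> int) set \<Rightarrow> ('a \<Rightarrow> 'a) set" where
  "S_ring_Iso G A =
     {f \<in> Bij (carrier G).
        \<exists>A'. S_ring G A' \<and>
          {rel_image f (cayley_rel G X) | X. X \<in> basic_sets G A} =
          {cayley_rel G X' | X'. X' \<in> basic_sets G A'}}"

text \<open>Permutations act on the right in the mathematical notation, so the elements of the product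
  \<open>Aut(A) Aut(G)\<close> are obtained by first applying some \<open>f \<in> Aut(A)\<close> and then some
  \<open>\<sigma> \<in> Aut(G)\<close>.\<close>

definition CI_S_ring :: "('a, 'b) monoid_scheme \<Rightarrow> ('a \<Rightarrow> int) set \<Rightarrow> bool" where
  "CI_S_ring G A \<longleftrightarrow>
     S_ring G A \<and>
     S_ring_Iso G A =
       {compose (carrier G) \<sigma> f | f \<sigma>. f \<in> S_ring_Aut G A \<and> \<sigma> \<in> auto G}"


section \<open>Permutation groups\<close>

abbreviation perm_group :: "'a set \<Rightarrow> ('a \<Rightarrow> 'a) set \<Rightarrow> ('a \<Rightarrow> 'a) monoid" where
  "perm_group \<Omega> K \<equiv> (BijGroup \<Omega>)\<lparr>carrier := K\<rparr>"

definition point_stabilizer :: "'a set \<Rightarrow> ('a \<Rightarrow> 'a) set \<Rightarrow> 'a \<Rightarrow> ('a \<Rightarrow> 'a) set" where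
  "point_stabilizer \<Omega> K x = stabilizer (perm_group \<Omega> K) (\<lambda>f. f) x"

definition two_orbits :: "'a set \<Rightarrow> ('a \<Rightarrow> 'a) set \<Rightarrow> ('a \<times> 'a) set set" where
  "two_orbits \<Omega> K = orbits (perm_group \<Omega> K) (\<Omega> \<times> \<Omega>) (\<lambda>f. map_prod f f)"

definition two_equivalent :: "'a set \<Rightarrow> ('a \<Rightarrow> 'a) set \<Rightarrow> ('a \<Rightarrow> 'a) set \<Rightarrow> bool" where
  "two_equivalent \<Omega> K L \<longleftrightarrow> two_orbits \<Omega> K = two_orbits \<Omega> L"

definition two_closure :: "'a set \<Rightarrow> ('a \<Rightarrow> 'a) set \<Rightarrow> ('a \<Rightarrow> 'a) set" where
  "two_closure \<Omega> K = (GREATEST L. subgroup L (BijGroup \<Omega>) \<and> two_equivalent \<Omega> K L)"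

definition regular_on :: "'a set \<Rightarrow> ('a \<Rightarrow> 'a) set \<Rightarrow> bool" where
  "regular_on \<Omega> L \<longleftrightarrow>
     transitive_action (perm_group \<Omega> L) \<Omega> (\<lambda>f. f) \<and>
     (\<forall>x\<in>\<Omega>. point_stabilizer \<Omega> L x = {\<one>\<^bsub>BijGroup \<Omega>\<^esub>})"

definition right_translations :: "('a, 'b) monoid_scheme \<Rightarrow> ('a \<Rightarrow> 'a) set" where
  "right_translations G = {\<lambda>x\<in>carrier G. x \<otimes>\<^bsub>G\<^esub> g | g. g \<in> carrier G}"

definition Sup_groups :: "('a, 'b) monoid_scheme \<Rightarrow> ('a \<Rightarrow> 'a) set set" where
  "Sup_groups G = {K. subgroup K (BijGroup (carrier G)) \<and> right_translations G \<subseteq> K}"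

definition Sup2_groups :: "('a, 'b) monoid_scheme \<Rightarrow> ('a \<Rightarrow> 'a) set set" where
  "Sup2_groups G = {K \<in> Sup_groups G. two_closure (carrier G) K = K}"

definition G_regular :: "('a, 'b) monoid_scheme \<Rightarrow> ('a \<Rightarrow> 'a) set \<Rightarrow> bool" where
  "G_regular G L \<longleftrightarrow>
     subgroup L (BijGroup (carrier G)) \<and>
     regular_on (carrier G) L \<and>
     perm_group (carrier G) L \<cong> G"

definition conjugate_under ::
  "('a, 'b) monoid_scheme \<Rightarrow> ('a \<Rightarrow> 'a) set \<Rightarrow> ('a \<Rightarrow> 'a) set \<Rightarrow> ('a \<Rightarrow> 'a) set \<Rightarrow> bool" where
  "conjugate_under G K L M \<longleftrightarrow>
     (\<exists>k\<in>K. M = k <#\<^bsub>BijGroup (carrier G)\<^esub> L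
               #>\<^bsub>BijGroup (carrier G)\<^esub> (inv\<^bsub>BijGroup (carrier G)\<^esub> k))"

definition preceq_G ::
  "('a, 'b) monoid_scheme \<Rightarrow> ('a \<Rightarrow> 'a) set \<Rightarrow> ('a \<Rightarrow> 'a) set \<Rightarrow> bool" where
  "preceq_G G K1 K2 \<longleftrightarrow>
     K1 \<in> Sup_groups G \<and> K2 \<in> Sup_groups G \<and> K1 \<subseteq> K2 \<and>
     (\<forall>L. G_regular G L \<and> L \<subseteq> K2 \<longrightarrow>
        (\<exists>M. G_regular G M \<and> M \<subseteq> K1 \<and> conjugate_under G K2 L M))"

definition Sup2_min :: "('a, 'b) monoid_scheme \<Rightarrow> ('a \<Rightarrow> 'a) set set" where
  "Sup2_min G = {K \<in> Sup2_groups G. \<forall>L\<in>Sup2_groups G. preceq_G G L K \<longrightarrow> L = K}"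

definition V_ring :: "('a \<Rightarrow> 'a) set \<Rightarrow> ('a, 'b) monoid_scheme \<Rightarrow> ('a \<Rightarrow> int) set" where
  "V_ring K G =
     int_span (orbits (perm_group (carrier G) (point_stabilizer (carrier G) K \<one>\<^bsub>G\<^esub>))
                (carrier G) (\<lambda>f. f))"


section \<open>Well-definedness\<close>

lemma indicator_sum_partition:
  fixes c :: "'a set \<Rightarrow> int"
  assumes "partition_on U S" "finite S" "X \<in> S" "x \<in> X"
  shows "(\<Sum>Y\<in>S. c Y * indicator Y x) = c X"
proof -
  have "c Y * indicator Y x = (if Y = X then c X else 0)" if "Y \<in> S" for Y
    using assms that by (auto simp: partition_on_def disjoint_def indicator_def)
  then have "(\<Sum>Y\<in>S. c Y * indicator Y x) = (\<Sum>Y\<in>S. if Y = X then c X else 0)"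
    by (intro sum.cong) auto
  then show ?thesis using assms by simp
qed

lemma int_span_same_block:
  assumes "partition_on U S" "finite S" "X \<in> S" "x \<in> X" "y \<in> U"
  shows "y \<in> X \<longleftrightarrow> (\<forall>a\<in>int_span S. a x = a y)"
proof
  assume "y \<in> X"
  then show "\<forall>a\<in>int_span S. a x = a y"
    using assms by (auto simp: int_span_def indicator_sum_partition)
next
  assume *: "\<forall>a\<in>int_span S. a x = a y"
  obtain Y where Y: "Y \<in> S" "y \<in> Y" using assms by (auto simp: partition_on_def)
  let ?c = "\<lambda>Z. if Z = X then 1 else 0 :: int"
  have "(\<lambda>x. \<Sum>Z\<in>S. ?c Z * indicator Z x) \<in> int_span S"
    unfolding int_span_def mem_Collect_eq by (rule exI[of _ ?c]) simp
  from bspec[OF * this]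
  have "(\<Sum>Z\<in>S. ?c Z * indicator Z x) = (\<Sum>Z\<in>S. ?c Z * indicator Z y)" .
  then have "?c X = ?c Y"
    using indicator_sum_partition[of U S X x ?c] indicator_sum_partition[of U S Y y ?c] assms Y
    by metis
  then show "y \<in> X" using Y by (auto split: if_splits)
qed

lemma is_basic_sets_unique:
  assumes "finite (carrier G)" "is_basic_sets G A S" "is_basic_sets G A T"
  shows "S = T"
proof -
  have sub: "S \<subseteq> T" if S: "is_basic_sets G A S" and T: "is_basic_sets G A T" for S T
  proof
    fix X assume X: "X \<in> S"
    have pS: "partition_on (carrier G) S" and pT: "partition_on (carrier G) T"
      and A: "A = int_span S" "A = int_span T"
      using S T by (auto simp: is_basic_sets_def)
    have fin: "finite S" "finite T"
      using finite_elements[OF assms(1)] pS pT by auto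
    have "X \<noteq> {}" using X pS by (auto simp: partition_on_def)
    then obtain x where x: "x \<in> X" "x \<in> carrier G"
      using X pS by (auto simp: partition_on_def)
    obtain Y where Y: "Y \<in> T" "x \<in> Y"
      using x pT by (auto simp: partition_on_def)
    have "X \<subseteq> carrier G" "Y \<subseteq> carrier G"
      using X Y pS pT by (auto simp: partition_on_def)
    moreover have "y \<in> X \<longleftrightarrow> y \<in> Y" if "y \<in> carrier G" for y
      using int_span_same_block[OF pS fin(1) X x(1) that]
        int_span_same_block[OF pT fin(2) Y that] A by simp
    ultimately have "X = Y" by blast
    then show "X \<in> T" using Y by simp
  qed
  from sub[OF assms(2,3)] sub[OF assms(3,2)] show ?thesis by blast
qed

lemma basic_sets_eq:
  "finite (carrier G) \<Longrightarrow> is_basic_sets G A S \<Longrightarrow> basic_sets G A = S"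
  unfolding basic_sets_def by (rule the_equality) (auto dest: is_basic_sets_unique)

lemma ring_group_ring:
  assumes "group G" and fin: "finite (carrier G)"
  shows "ring (group_ring G)"
proof -
  interpret group G by fact
  have assoc: "(\<Sum>y\<in>carrier G. (\<Sum>z\<in>carrier G. a z * b (inv\<^bsub>G\<^esub> z \<otimes>\<^bsub>G\<^esub> y)) * c (inv\<^bsub>G\<^esub> y \<otimes>\<^bsub>G\<^esub> x)) =
      (\<Sum>z\<in>carrier G. a z * (\<Sum>y\<in>carrier G. b y * c (inv\<^bsub>G\<^esub> y \<otimes>\<^bsub>G\<^esub> (inv\<^bsub>G\<^esub> z \<otimes>\<^bsub>G\<^esub> x))))"
    if x: "x \<in> carrier G" for a b c :: "'a \<Rightarrow> int" and x
  proof -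
    have cancel: "u \<otimes>\<^bsub>G\<^esub> z \<otimes>\<^bsub>G\<^esub> inv\<^bsub>G\<^esub> z = u" if "u \<in> carrier G" "z \<in> carrier G" for u z
      using that by (simp add: m_assoc)
    have shift: "(\<Sum>y\<in>carrier G. b (inv\<^bsub>G\<^esub> z \<otimes>\<^bsub>G\<^esub> y) * c (inv\<^bsub>G\<^esub> y \<otimes>\<^bsub>G\<^esub> x)) =
        (\<Sum>y\<in>carrier G. b y * c (inv\<^bsub>G\<^esub> y \<otimes>\<^bsub>G\<^esub> (inv\<^bsub>G\<^esub> z \<otimes>\<^bsub>G\<^esub> x)))" if z: "z \<in> carrier G" for z
      by (rule sum.reindex_bij_witness[of _ "\<lambda>y. z \<otimes>\<^bsub>G\<^esub> y" "\<lambda>y. inv\<^bsub>G\<^esub> z \<otimes>\<^bsub>G\<^esub> y"])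
        (use x z in \<open>simp_all add: m_assoc[symmetric] inv_mult_group cancel\<close>)
    have "(\<Sum>y\<in>carrier G. (\<Sum>z\<in>carrier G. a z * b (inv\<^bsub>G\<^esub> z \<otimes>\<^bsub>G\<^esub> y)) * c (inv\<^bsub>G\<^esub> y \<otimes>\<^bsub>G\<^esub> x)) =
        (\<Sum>z\<in>carrier G. \<Sum>y\<in>carrier G. a z * b (inv\<^bsub>G\<^esub> z \<otimes>\<^bsub>G\<^esub> y) * c (inv\<^bsub>G\<^esub> y \<otimes>\<^bsub>G\<^esub> x))"
      by (subst sum.swap) (simp add: sum_distrib_right)
    also have "\<dots> = (\<Sum>z\<in>carrier G. a z *
        (\<Sum>y\<in>carrier G. b (inv\<^bsub>G\<^esub> z \<otimes>\<^bsub>G\<^esub> y) * c (inv\<^bsub>G\<^esub> y \<otimes>\<^bsub>G\<^esub> x)))"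
      by (simp add: sum_distrib_left mult.assoc)
    also have "\<dots> = (\<Sum>z\<in>carrier G. a z *
        (\<Sum>y\<in>carrier G. b y * c (inv\<^bsub>G\<^esub> y \<otimes>\<^bsub>G\<^esub> (inv\<^bsub>G\<^esub> z \<otimes>\<^bsub>G\<^esub> x))))"
      by (intro sum.cong refl) (simp add: shift)
    finally show ?thesis .
  qed
  have l_unit: "(\<Sum>y\<in>carrier G. indicator {\<one>\<^bsub>G\<^esub>} y * a (inv\<^bsub>G\<^esub> y \<otimes>\<^bsub>G\<^esub> x)) = a x"
    if x: "x \<in> carrier G" for a :: "'a \<Rightarrow> int" and x
  proof -
    have "(\<Sum>y\<in>carrier G. indicator {\<one>\<^bsub>G\<^esub>} y * a (inv\<^bsub>G\<^esub> y \<otimes>\<^bsub>G\<^esub> x)) =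
        (\<Sum>y\<in>carrier G. if y = \<one>\<^bsub>G\<^esub> then a x else 0)"
      using x by (intro sum.cong) (auto simp: indicator_def)
    then show ?thesis using fin by simp
  qed
  have r_unit: "(\<Sum>y\<in>carrier G. a y * indicator {\<one>\<^bsub>G\<^esub>} (inv\<^bsub>G\<^esub> y \<otimes>\<^bsub>G\<^esub> x)) = a x"
    if x: "x \<in> carrier G" for a :: "'a \<Rightarrow> int" and x
  proof -
    have "inv\<^bsub>G\<^esub> y \<otimes>\<^bsub>G\<^esub> x = \<one>\<^bsub>G\<^esub> \<longleftrightarrow> y = x" if "y \<in> carrier G" for y
      using x that by (metis inv_closed inv_equality inv_inv l_inv)
    then have "(\<Sum>y\<in>carrier G. a y * indicator {\<one>\<^bsub>G\<^esub>} (inv\<^bsub>G\<^esub> y \<otimes>\<^bsub>G\<^esub> x)) =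
        (\<Sum>y\<in>carrier G. if y = x then a x else 0)"
      by (intro sum.cong) (auto simp: indicator_def)
    then show ?thesis using fin x by simp
  qed
  have "abelian_group (group_ring G)"
  proof (rule abelian_groupI, goal_cases)
    case (6 a)
    then show ?case
      by (intro bexI[of _ "\<lambda>x. - a x"]) (auto simp: group_ring_def)
  qed (auto simp: group_ring_def algebra_simps)
  moreover have "monoid (group_ring G)"
    by (rule monoidI) (auto simp: group_ring_def fun_eq_iff indicator_eq_0_iff assoc l_unit r_unit)
  ultimately show ?thesis
    by (rule ringI) (auto simp: group_ring_def fun_eq_iff algebra_simps sum.distrib)
qed

lemma two_closure_eq:
  assumes K: "subgroup K (BijGroup \<Omega>)"
  shows "two_closure \<Omega> K = {f \<in> Bij \<Omega>. \<forall>x\<in>\<Omega>. \<forall>y\<in>\<Omega>. \<exists>k\<in>K. k x = f x \<and> k y = f y}"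
    (is "_ = ?L")
proof -
  interpret B: group "BijGroup \<Omega>" by (rule group_BijGroup)
  have carr: "carrier (BijGroup \<Omega>) = Bij \<Omega>" by (simp add: BijGroup_def)
  have sub: "M \<subseteq> Bij \<Omega>" if "subgroup M (BijGroup \<Omega>)" for M
    using subgroup.subset[OF that] carr by simp
  have mult: "(f \<otimes>\<^bsub>BijGroup \<Omega>\<^esub> g) x = f (g x)" if "f \<in> Bij \<Omega>" "g \<in> Bij \<Omega>" "x \<in> \<Omega>" for f g x
    using that by (simp add: BijGroup_def compose_def)
  have one: "\<one>\<^bsub>BijGroup \<Omega>\<^esub> x = x" if "x \<in> \<Omega>" for x
    using that by (simp add: BijGroup_def)
  have in_dom: "f x \<in> \<Omega>" if "f \<in> Bij \<Omega>" "x \<in> \<Omega>" for f x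
    using that Bij_imp_funcset by blast
  have inv_l: "(inv\<^bsub>BijGroup \<Omega>\<^esub> f) (f x) = x" if "f \<in> Bij \<Omega>" "x \<in> \<Omega>" for f x
  proof -
    have "(inv\<^bsub>BijGroup \<Omega>\<^esub> f \<otimes>\<^bsub>BijGroup \<Omega>\<^esub> f) x = x"
      using that carr by (simp add: one)
    moreover have "inv\<^bsub>BijGroup \<Omega>\<^esub> f \<in> Bij \<Omega>" using B.inv_closed[of f] that carr by simp
    ultimately show ?thesis using mult[of "inv\<^bsub>BijGroup \<Omega>\<^esub> f" f x] that by simp
  qed
  have inv_r: "f ((inv\<^bsub>BijGroup \<Omega>\<^esub> f) x) = x" if "f \<in> Bij \<Omega>" "x \<in> \<Omega>" for f x
  proof -
    have "(f \<otimes>\<^bsub>BijGroup \<Omega>\<^esub> inv\<^bsub>BijGroup \<Omega>\<^esub> f) x = x"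
      using that carr by (simp add: one)
    moreover have "inv\<^bsub>BijGroup \<Omega>\<^esub> f \<in> Bij \<Omega>" using B.inv_closed[of f] that carr by simp
    ultimately show ?thesis using mult[of f "inv\<^bsub>BijGroup \<Omega>\<^esub> f" x] that by simp
  qed
  have orb: "orbit (perm_group \<Omega> M) (\<lambda>f. map_prod f f) (x, y) = {(f x, f y) | f. f \<in> M}" for M x y
    by (auto simp: orbit_def)
  have KL: "K \<subseteq> ?L" using sub[OF K] by blast
  have L: "subgroup ?L (BijGroup \<Omega>)"
  proof (rule B.subgroupI)
    show "?L \<subseteq> carrier (BijGroup \<Omega>)" using carr by auto
    show "?L \<noteq> {}" using KL subgroup.one_closed[OF K] by blast
  next
    fix f assume f: "f \<in> ?L"
    let ?g = "inv\<^bsub>BijGroup \<Omega>\<^esub> f"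
    have g: "?g \<in> Bij \<Omega>" using f carr B.inv_closed by simp
    have "\<exists>k\<in>K. k x = ?g x \<and> k y = ?g y" if "x \<in> \<Omega>" "y \<in> \<Omega>" for x y
    proof -
      have "?g x \<in> \<Omega>" "?g y \<in> \<Omega>" using g that in_dom by auto
      then obtain k where k: "k \<in> K" "k (?g x) = f (?g x)" "k (?g y) = f (?g y)"
        using f by blast
      then have "k (?g x) = x" "k (?g y) = y" using inv_r f that by auto
      then have "(inv\<^bsub>BijGroup \<Omega>\<^esub> k) x = ?g x" "(inv\<^bsub>BijGroup \<Omega>\<^esub> k) y = ?g y"
        using inv_l[of k] k(1) sub[OF K] \<open>?g x \<in> \<Omega>\<close> \<open>?g y \<in> \<Omega>\<close> by (metis subsetD)+
      then show ?thesis using subgroup.m_inv_closed[OF K k(1)] by blast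
    qed
    then show "?g \<in> ?L" using g by blast
  next
    fix f g assume f: "f \<in> ?L" and g: "g \<in> ?L"
    have fg: "f \<otimes>\<^bsub>BijGroup \<Omega>\<^esub> g \<in> Bij \<Omega>" using f g B.m_closed carr by simp
    have "\<exists>k\<in>K. k x = (f \<otimes>\<^bsub>BijGroup \<Omega>\<^esub> g) x \<and> k y = (f \<otimes>\<^bsub>BijGroup \<Omega>\<^esub> g) y"
      if xy: "x \<in> \<Omega>" "y \<in> \<Omega>" for x y
    proof -
      obtain k where k: "k \<in> K" "k x = g x" "k y = g y" using g xy by blast
      have "g x \<in> \<Omega>" "g y \<in> \<Omega>" using g xy in_dom by auto
      then obtain l where l: "l \<in> K" "l (g x) = f (g x)" "l (g y) = f (g y)" using f by blast
      have "k \<in> Bij \<Omega>" "l \<in> Bij \<Omega>" using k l sub[OF K] by auto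
      then have "(l \<otimes>\<^bsub>BijGroup \<Omega>\<^esub> k) x = (f \<otimes>\<^bsub>BijGroup \<Omega>\<^esub> g) x"
        "(l \<otimes>\<^bsub>BijGroup \<Omega>\<^esub> k) y = (f \<otimes>\<^bsub>BijGroup \<Omega>\<^esub> g) y"
        using f g k l xy by (auto simp: mult)
      then show ?thesis using subgroup.m_closed[OF K l(1) k(1)] by blast
    qed
    then show "f \<otimes>\<^bsub>BijGroup \<Omega>\<^esub> g \<in> ?L" using fg by blast
  qed
  have "{(f x, f y) | f. f \<in> K} = {(f x, f y) | f. f \<in> ?L}" if "x \<in> \<Omega>" "y \<in> \<Omega>" for x y
  proof (intro equalityI subsetI)
    fix z assume "z \<in> {(f x, f y) | f. f \<in> K}"
    then show "z \<in> {(f x, f y) | f. f \<in> ?L}" using KL by blast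
  next
    fix z assume "z \<in> {(f x, f y) | f. f \<in> ?L}"
    then obtain f where "f \<in> ?L" "z = (f x, f y)" by blast
    moreover then obtain k where "k \<in> K" "k x = f x" "k y = f y" using \<open>x \<in> \<Omega>\<close> \<open>y \<in> \<Omega>\<close> by blast
    ultimately have "z = (k x, k y)" "k \<in> K" by auto
    then show "z \<in> {(f x, f y) | f. f \<in> K}" by blast
  qed
  then have "orbit (perm_group \<Omega> K) (\<lambda>f. map_prod f f) z =
      orbit (perm_group \<Omega> ?L) (\<lambda>f. map_prod f f) z" if "z \<in> \<Omega> \<times> \<Omega>" for z
    using that unfolding orb by (cases z) (simp only: orb mem_Times_iff fst_conv snd_conv)
  then have eq: "two_equivalent \<Omega> K ?L"
    unfolding two_equivalent_def two_orbits_def orbits_def Setcompr_eq_image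
    by (intro image_cong) auto
  have max: "M \<subseteq> ?L" if M: "subgroup M (BijGroup \<Omega>)" "two_equivalent \<Omega> K M" for M
  proof
    fix f assume f: "f \<in> M"
    have "\<exists>k\<in>K. k x = f x \<and> k y = f y" if xy: "x \<in> \<Omega>" "y \<in> \<Omega>" for x y
    proof -
      have "orbit (perm_group \<Omega> M) (\<lambda>f. map_prod f f) (x, y) \<in> two_orbits \<Omega> K"
        using M(2) xy unfolding two_equivalent_def by (auto simp: two_orbits_def orbits_def)
      then obtain u v where uv: "u \<in> \<Omega>" "v \<in> \<Omega>"
        and e: "{(f x, f y) | f. f \<in> M} = {(f u, f v) | f. f \<in> K}"
        by (auto simp: two_orbits_def orbits_def orb)
      have "(x, y) \<in> {(f x, f y) | f. f \<in> M}"
        unfolding mem_Collect_eq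
        by (rule exI[of _ "\<one>\<^bsub>BijGroup \<Omega>\<^esub>"]) (simp add: subgroup.one_closed[OF M(1)] one xy)
      then obtain k where k: "k \<in> K" "x = k u" "y = k v" unfolding e by blast
      have "(f x, f y) \<in> {(f x, f y) | f. f \<in> M}" using f by blast
      then obtain l where l: "l \<in> K" "f x = l u" "f y = l v" unfolding e by blast
      have kl: "k \<in> Bij \<Omega>" "l \<in> Bij \<Omega>" using k l sub[OF K] by auto
      have "inv\<^bsub>BijGroup \<Omega>\<^esub> k \<in> Bij \<Omega>" using kl carr B.inv_closed by simp
      then have "(l \<otimes>\<^bsub>BijGroup \<Omega>\<^esub> inv\<^bsub>BijGroup \<Omega>\<^esub> k) x = f x"
        "(l \<otimes>\<^bsub>BijGroup \<Omega>\<^esub> inv\<^bsub>BijGroup \<Omega>\<^esub> k) y = f y"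
        using kl k(2,3) l(2,3) uv xy by (simp_all add: mult inv_l)
      then show ?thesis
        using subgroup.m_closed[OF K l(1) subgroup.m_inv_closed[OF K k(1)]] by blast
    qed
    then show "f \<in> ?L" using f sub[OF M(1)] by blast
  qed
  show ?thesis
    unfolding two_closure_def by (rule Greatest_equality) (use L eq max in auto)
qed

end

theory Submission
  imports Defs "HOL-Library.Poly_Mapping" "HOL-Library.Product_Plus" "HOL-Library.Z2"
    "HOL-Number_Theory.Cong" "HOL-Combinatorics.Permutations" "HOL-Algebra.Sylow"
begin

text \<open>By a Babai-type argument it suffices that all regular subgroups of \<open>K\<close> isomorphic to \<open>G\<close> are
  conjugate in \<open>K\<close>, which holds for every 2-closed \<open>K\<close> containing the translations. Schur's power map
  theorem determines the basic sets outside the largest block contained in the 2-part well enough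
  to conjugate the \<open>p\<close>-part \<open>B\<^sub>p\<close> of a regular subgroup \<open>B\<close> to a group with the same orbits as the
  \<open>p\<close>-part of the translation group. Sylow's theorem for \<open>p\<close> and then for 2 makes the generators of the
  \<open>p\<close>-parts agree up to a scalar on each orbit and puts the 2-parts into a common 2-group \<open>R\<close> that acts
  linearly on these orbits. On the orbit space \<open>E = F\<^sub>2\<^sup>5\<close> the 2-parts are then related by a bijection \<open>f0\<close>
  that is triangular for an \<open>R\<close>-invariant flag. Since \<open>K\<close> is 2-closed, \<open>f0\<close> may be replaced by any
  linear map that agrees with it up to the orbits of the stabiliser of 0 in \<open>R\<close> (with trivial scalar
  on the subgroup \<open>S\<close> where all fibrewise shifts in \<open>K\<close> agree). Such a linear map is provided for all
  \<open>2\<^sup>1\<^sup>6\<close> triangular maps by a finite certificate, obtained by computer search.\<close>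

section \<open>Linear tracking of triangular maps\<close>

text \<open>Sylow's theorem alone cannot finish: the two 2-parts lie in one 2-group
  \<open>R\<close>, but they need not be conjugate there. The conjugator is sought among the
  permutations that intertwine the two groups along a linear bijection \<open>sg\<close>. To lie in
  the 2-closed group \<open>K\<close> it has to agree on each pair of points with an element of
  \<open>K\<close>; the two transitive groups move one point of the pair to the base point, so that
  just the orbits of a point stabiliser matter. This is why orbit equivalence with \<open>f0\<close>
  suffices and equality is not asked for. The stabiliser elements at hand in every \<open>R\<close>
  are products of two translations with one element of the other 2-part; a walk composes them. The
  scalars are a second obstacle: over \<open>S\<close> no shift in \<open>K\<close> can repair a
  wrong scalar, so it must be right from the start, whereas elsewhere a shift that keeps the fibre
  over 0 adjusts it. Hence the levels in the walks. Of the 16 free bits, 11 are the values of the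
  last coordinate at the vectors of F_2^4 of weight at least 2, and 5 belong to the first four
  coordinates.\<close>

type_synonym v4 = "bool \<times> bool \<times> bool \<times> bool"

section \<open>Format of the certificate\<close>

text \<open>After a choice of bases along a flag, a regular elementary abelian 2-group on \<open>F\<^sub>2\<^sup>5\<close> is described by
  a triangular map \<open>(x, t) \<mapsto> (top4 c x, t + \<phi> x)\<close>. Its first four coordinates depend on the five bits \<open>c\<close>
  only, while \<open>\<phi>\<close> is an arbitrary function vanishing at the vectors of weight at most 1.\<close>

fun xor4 :: "v4 \<Rightarrow> v4 \<Rightarrow> v4" where
  "xor4 (a, b, c, d) (a', b', c', d') = (a \<noteq> a', b \<noteq> b', c \<noteq> c', d \<noteq> d')"

fun light :: "v4 \<Rightarrow> bool" where
  "light (a, b, c, d) \<longleftrightarrow> \<not> (a \<and> b) \<and> \<not> (a \<and> c) \<and> \<not> (a \<and> d) \<and> \<not> (b \<and> c) \<and> \<not> (b \<and> d) \<and> \<not> (c \<and> d)"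

text \<open>Coordinates run along the flag from the top quotient down, so the number of leading
  zeros tells how deep a vector lies. The zero vector shares the value 3 with the last unit vector;
  at zero only reflexivity is ever needed.\<close>

fun level :: "v4 \<Rightarrow> nat" where
  "level (a, b, c, d) = (if a then 0 else if b then Suc 0 else if c then Suc (Suc 0) else Suc (Suc (Suc 0)))"

text \<open>The saturation at three zeros matches the range of \<open>level\<close>; it reappears as
  \<open>min l 3\<close> in the relation \<open>RR\<close>.\<close>

fun in_level :: "nat \<Rightarrow> v4 \<Rightarrow> bool" where
  "in_level 0 _ = True"
| "in_level (Suc 0) (a, b, c, d) = (\<not> a)"
| "in_level (Suc (Suc 0)) (a, b, c, d) = (\<not> a \<and> \<not> b)"
| "in_level _ (a, b, c, d) = (\<not> a \<and> \<not> b \<and> \<not> c)"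

type_synonym coeffs = "bool \<times> bool \<times> bool \<times> bool \<times> bool"

text \<open>The general triangular map that fixes the unit vectors: nothing is left to choose in the
  first two coordinates, the third can be changed only at a = b = 1, the fourth by a function of (a,
  b, c) that vanishes in weight at most 1. The bits \<open>g12\<close>, \<open>g13\<close>,
  \<open>g23\<close>, \<open>g123\<close> are its values at the four remaining arguments, not
  polynomial coefficients.\<close>

fun top4 :: "coeffs \<Rightarrow> v4 \<Rightarrow> v4" where
  "top4 (al, g12, g13, g23, g123) (a, b, c, d) =
     (a, b, c \<noteq> (al \<and> a \<and> b),
      d \<noteq> (if a then if b then if c then g123 else g12 else c \<and> g13 else b \<and> c \<and> g23))"

fun parity :: "(v4 \<Rightarrow> bool) \<Rightarrow> v4 list \<Rightarrow> bool" where
  "parity \<phi> [] = False"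
| "parity \<phi> (x # G) = (\<phi> x \<noteq> parity \<phi> G)"

text \<open>Lists stand for formal sums over the field with two elements: a second occurrence
  removes the first.\<close>

fun toggle :: "v4 \<Rightarrow> v4 list \<Rightarrow> v4 list" where
  "toggle x [] = [x]"
| "toggle x (y # G) = (if x = y then G else y # toggle x G)"

text \<open>An empty result shows that the parity vanishes for every \<open>\<phi>\<close> that is
  zero on light vectors. In this way one computation treats all such functions at once.\<close>

fun cancel :: "v4 list \<Rightarrow> v4 list" where
  "cancel [] = []"
| "cancel (x # G) = (if light x then cancel G else toggle x (cancel G))"

fun nib :: "char \<Rightarrow> v4" where
  "nib (Char a b c d _ _ _ _) = (a, b, c, d)"

text \<open>A vector of \<open>F\<^sub>2\<^sup>4\<close> is encoded by the four low bits of a character, from \<open>@\<close> (zero) to \<open>O\<close>. Each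
  triple \<open>w, u, v\<close> of a walk replaces the derivative \<open>f u + f (u + w)\<close> by \<open>f v + f (v + w)\<close>; the list \<open>G\<close>
  collects the arguments whose \<open>\<phi>\<close>-values sum up to the last coordinate of the current point.\<close>

fun walk :: "(v4 \<Rightarrow> v4) \<Rightarrow> nat \<Rightarrow> string \<Rightarrow> v4 \<Rightarrow> v4 list \<Rightarrow> (v4 \<times> v4 list) option" where
  "walk f l (cw # cu # cv # s) z G =
     (let w = nib cw; u = nib cu; v = nib cv; u' = xor4 u w; v' = xor4 v w in
      if z = xor4 (f u) (f u') \<and> in_level l w \<and> in_level l (xor4 u v)
      then walk f l s (xor4 (f v) (f v')) (u # u' # v # v' # G) else None)"
| "walk f l s z G = (if s = [] then Some (z, G) else None)"

text \<open>For every \<open>c\<close> and each of the five vectors \<open>w\<close> on which the identity might not track the map: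
  \<open>Zero\<close> gives a walk from \<open>f w\<close> to \<open>w\<close> without \<open>\<phi>\<close>-contribution. \<open>Alts\<close> gives several walks to \<open>w\<close> up to
  the last coordinate. If one of them has even \<open>\<phi>\<close>-parity, then \<open>w\<close> is tracked by the identity as well;
  if all are odd, these equations for \<open>\<phi>\<close>, together with the case distinctions of the tree, are used
  at the leaves to verify a linear map \<open>\<sigma>\<close> on all 15 nonzero vectors.\<close>

datatype tree = Leaf string "(string \<times> string) list" | Br string tree tree
datatype entry = Zero string | Alts "string list" tree

fun scale :: "bool \<Rightarrow> v4 \<times> bool \<Rightarrow> v4 \<times> bool" where
  "scale b ((x1, x2, x3, x4), t) = ((b \<and> x1, b \<and> x2, b \<and> x3, b \<and> x4), b \<and> t)"

fun xor5 :: "v4 \<times> bool \<Rightarrow> v4 \<times> bool \<Rightarrow> v4 \<times> bool" where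
  "xor5 (x, s) (y, t) = (xor4 x y, s \<noteq> t)"

fun bit1 :: "char \<Rightarrow> bool" where
  "bit1 (Char a _ _ _ _ _ _ _) = a"

text \<open>The string lists the images of the four unit vectors, each as a vector of F_2^4 followed
  by its last bit. The fifth basis vector is kept fixed, because the last coordinate is added
  afterwards wherever \<open>lin\<close> is applied. The string ''A@B@D@H@'' encodes the
  identity.\<close>

fun lin :: "string \<Rightarrow> v4 \<Rightarrow> v4 \<times> bool" where
  "lin [c1, t1, c2, t2, c3, t3, c4, t4] (a, b, c, d) =
     xor5 (scale a (nib c1, bit1 t1)) (xor5 (scale b (nib c2, bit1 t2))
       (xor5 (scale c (nib c3, bit1 t3)) (scale d (nib c4, bit1 t4))))"
| "lin _ x = (x, False)"

text \<open>The letters \<open>A\<close> in the string mark the equations of the environment that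
  are to be added up.\<close>

fun select :: "string \<Rightarrow> (v4 list \<times> bool) list \<Rightarrow> v4 list \<times> bool" where
  "select (c # J) ((G, b) # env) =
     (case select J env of (G', b') \<Rightarrow> if bit1 c then (G @ G', b \<noteq> b') else (G', b'))"
| "select _ _ = ([], False)"

text \<open>The walk fixes the first four coordinates of its end point; the last one is a
  \<open>\<phi>\<close>-parity, which has to be a sum of parities already known from the
  environment.\<close>

definition check_path :: "(v4 \<Rightarrow> v4) \<Rightarrow> (v4 list \<times> bool) list \<Rightarrow> v4 \<Rightarrow> v4 \<times> bool \<Rightarrow> string \<Rightarrow> string \<Rightarrow> bool" where
  "check_path f env w t s J =
     (case walk f (level w) s (f w) [w] of None \<Rightarrow> False
      | Some (z, G) \<Rightarrow> (case select J env of (G', b) \<Rightarrow>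
          t = (z, b) \<and> cancel (G @ G') = []))"

fun check_paths :: "(v4 \<Rightarrow> v4) \<Rightarrow> (v4 list \<times> bool) list \<Rightarrow> string \<Rightarrow> v4 list \<Rightarrow> (string \<times> string) list \<Rightarrow> bool" where
  "check_paths f env \<sigma> [] _ = True"
| "check_paths f env \<sigma> (w # ws) ((s, J) # ps) =
     (check_path f env w (lin \<sigma> w) s J \<and> check_paths f env \<sigma> ws ps)"
| "check_paths f env \<sigma> _ _ = False"

definition all_v4 :: "v4 list" where
  "all_v4 = map nib ''ABCDEFGHIJKLMNO''"

fun check_tree :: "(v4 \<Rightarrow> v4) \<Rightarrow> (v4 list \<times> bool) list \<Rightarrow> tree \<Rightarrow> bool" where
  "check_tree f env (Leaf \<sigma> ps) = check_paths f env \<sigma> all_v4 ps"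
| "check_tree f env (Br G t u) =
     (check_tree f (env @ [(map nib G, False)]) t \<and> check_tree f (env @ [(map nib G, True)]) u)"

fun alts_env :: "(v4 \<Rightarrow> v4) \<Rightarrow> v4 \<Rightarrow> string list \<Rightarrow> (v4 list \<times> bool) list option" where
  "alts_env f w [] = Some []"
| "alts_env f w (s # ss) =
     (case walk f (level w) s (f w) [w] of None \<Rightarrow> None
      | Some (z, G) \<Rightarrow> if z = w then map_option ((#) (G, True)) (alts_env f w ss) else None)"

fun check_entry :: "(v4 \<Rightarrow> v4) \<Rightarrow> v4 \<Rightarrow> entry \<Rightarrow> bool" where
  "check_entry f w (Zero s) = check_path f [] w (w, False) s []"
| "check_entry f w (Alts ss t) =
     (case alts_env f w ss of None \<Rightarrow> False | Some env \<Rightarrow> check_tree f env t)"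

fun check_entries :: "(v4 \<Rightarrow> v4) \<Rightarrow> v4 list \<Rightarrow> entry list \<Rightarrow> bool" where
  "check_entries f [] [] = True"
| "check_entries f (w # ws) (e # es) = (check_entry f w e \<and> check_entries f ws es)"
| "check_entries f _ _ = False"

text \<open>Used for vectors of weight 2, whose leading one is never in the last place.\<close>

fun first_bit :: "v4 \<Rightarrow> v4" where
  "first_bit (a, b, c, d) = (a, \<not> a \<and> b, \<not> a \<and> \<not> b \<and> c, False)"

definition all_coeffs :: "coeffs list" where
  "all_coeffs = List.product [False, True] (List.product [False, True]
     (List.product [False, True] (List.product [False, True] [False, True])))"

text \<open>One row for each element of \<open>all_coeffs\<close>, in that order. The five entries
  of a row belong to G, K, M, N, O, that is to 1110, 1101, 1011, 0111, 1111, the vectors of weight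
  at least 3. In \<open>Alts\<close> an empty list of walks means that the tree alone covers all
  \<open>\<phi>\<close>.\<close>

definition certificate :: "entry list list" where
"certificate = [
 [Alts ['''',''G@A'',''G@B'',''G@C'',''G@H'',''G@I'',''G@J'',''G@K'']
    (Br ''I'' (Leaf ''A@BAD@H@'' [('''',''''),(''B@D'',''@A''),('''',''@@@A''),('''',''''),(''E@A'',''''),('''',''@A''),('''',''A''),('''',''''),('''',''@@@@@@@@A''),(''J@D'',''@@@@@A@@A''),(''K@C'',''@@@A''),(''L@D'',''''),(''M@C'',''@@@A@A@@A''),('''',''@@@@@A@@A''),('''',''@@@@A'')]) (Leaf ''AAB@D@H@'' [(''A@B'',''@@@A''),('''',''''),('''',''@@@A''),('''',''''),('''',''@@A''),(''F@B'',''''),('''',''A''),('''',''''),('''',''@@@@@@@@A''),(''J@B'',''''),(''K@B'',''@@@@@@@@A''),(''L@D'',''''),(''M@B'',''@@@@A''),('''',''@@@@@A@@A''),('''',''@@@@A'')])),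
   Alts ['''',''K@A'',''K@B'',''K@C'',''K@D'',''K@E'',''K@F'',''K@G'']
    (Br ''E'' (Leaf ''A@BAD@H@'' [('''',''''),(''B@H'',''@A''),('''',''@@@A''),('''',''''),('''',''@@@@@@@@A''),(''F@H'',''@@@@@A@@A''),(''G@C'',''@@@A''),('''',''''),(''I@A'',''''),('''',''@A''),('''',''A''),(''L@D'',''''),(''M@C'',''@@@A@A@@A''),('''',''@@@@@A@@A''),('''',''@@@@A'')]) (Leaf ''AAB@D@H@'' [(''A@B'',''@@@A''),('''',''''),('''',''@@@A''),('''',''''),('''',''@@@@@@@@A''),(''F@B'',''''),(''G@B'',''@@@@@@@@A''),('''',''''),('''',''@@A''),(''J@B'',''''),('''',''A''),(''L@D'',''''),(''M@B'',''@@@@A''),('''',''@@@@@A@@A''),('''',''@@@@A'')])),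
   Alts ['''',''M@A'',''M@B'',''M@C'',''M@D'',''M@E'',''M@F'',''M@G'']
    (Br ''C'' (Leaf ''A@B@DAH@'' [('''',''''),('''',''''),('''',''@@@@@@@@A''),(''D@H'',''@A''),('''',''@@@@@A''),(''F@H'',''@@@A@@@@A''),(''G@B'',''@@@@@A''),('''',''''),(''I@A'',''''),(''J@B'',''''),(''K@C'',''@@@@@@@@A''),('''',''@A''),('''',''A''),('''',''@@@A@@@@A''),('''',''@@A'')]) (Leaf ''AAB@D@H@'' [(''A@B'',''@@@@@@@@A''),('''',''''),('''',''@@@@@@@@A''),('''',''''),('''',''@@@@@A''),(''F@B'',''''),(''G@B'',''@@@@@A''),('''',''''),('''',''@@@@A''),(''J@B'',''''),(''K@B'',''@@@@A''),(''L@D'',''''),('''',''A''),('''',''@@@A@@@@A''),('''',''@@A'')])),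
   Alts ['''',''N@B'',''N@D'',''N@F'',''NAC'',''NAE'',''NAG'']
    (Br ''C'' (Leaf ''A@B@DAH@'' [('''',''''),('''',''''),('''',''@@@@@@@A''),(''D@H'',''@A''),(''E@C'',''@@@A@@@A''),('''',''@@@A''),(''G@A'',''@@@A''),('''',''''),(''I@A'',''''),(''J@B'',''''),(''K@C'',''@@@@@@@A''),('''',''@A''),(''M@A'',''@A''),('''',''A''),(''O@A'',''A'')]) (Leaf ''A@BAD@H@'' [('''',''''),(''B@D'',''@@@A''),('''',''@@@@@@@A''),('''',''''),(''E@A'',''''),('''',''@@@A''),(''G@A'',''@@@A''),('''',''''),(''I@A'',''''),('''',''@@A''),(''K@A'',''@@A''),(''L@D'',''''),(''M@C'',''A@@@@@@A''),('''',''A''),(''O@A'',''A'')])),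
   Alts ['''',''O@A'',''O@B'',''O@C'',''O@D'',''O@E'',''O@F'',''O@G'']
    (Br ''C'' (Leaf ''A@B@DAH@'' [('''',''''),('''',''''),('''',''@@@@@@@@A''),(''D@H'',''@@@A@@@@A''),(''E@B'',''@@@@@@@A''),(''F@H'',''@A''),('''',''@@@@@@@A''),('''',''''),(''I@A'',''''),(''J@B'',''''),(''K@C'',''@@@@@@@@A''),('''',''@@@A@@@@A''),('''',''@@A''),('''',''@A''),('''',''A'')]) (Leaf ''AAB@D@H@'' [(''A@B'',''@@@@@@@@A''),('''',''''),('''',''@@@@@@@@A''),('''',''''),(''E@B'',''@@@@@@@A''),(''F@B'',''''),('''',''@@@@@@@A''),('''',''''),(''I@B'',''@@@@A''),(''J@B'',''''),('''',''@@@@A''),('''',''@@@A@@@@A''),('''',''@@A''),(''N@B'',''@@@A@@@@A''),('''',''A'')]))],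
 [Alts [''G@A'',''G@B'',''G@C'',''G@I'',''G@J'',''G@K'',''GHA'',''OA@'',''OB@'',''OC@'']
    (Leaf ''AAB@D@H@'' [(''A@B'',''@@A''),('''',''''),('''',''@@A''),('''',''''),('''',''@A''),(''F@B'',''''),(''G@A'',''A''),('''',''''),(''I@B'',''A@A@@AA@@A''),('''',''A@@@A@A@A''),('''',''A@A@@AA@@A''),('''',''A@A@@@A@@A''),('''',''A@@@@@A@A''),(''N@B'',''A@A@@@A@@A''),(''GA@'',''@@@@@@A'')]),
   Zero ''CDACHD'',
   Zero ''EBAEHB'',
   Zero ''FACFBHFCA'',
   Alts [''GA@'',''GAH'',''GB@'',''GC@'',''GI@'',''GJ@'',''GK@'',''O@A'',''O@B'',''O@C'']
    (Leaf ''AAB@D@H@'' [(''A@B'',''AA@A''),('''',''''),('''',''AA@A''),('''',''''),('''',''AAA''),(''F@B'',''''),(''G@A'',''@A''),('''',''''),(''I@B'',''@@@A@@A@@A''),('''',''AA@@@A@@A''),('''',''@@@A@@A@@A''),('''',''AA@A@@@@@A''),('''',''@@@@@@@@A''),(''N@B'',''AA@A@@@@@A''),(''GA@'',''A'')])],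
 [Alts ['''',''G@B'',''G@C'',''G@H'',''G@J'',''G@K'',''OAF'',''G@AO@A'',''G@AOBA'',''G@AOCA'']
    (Leaf ''AAB@D@H@'' [(''A@B'',''@@A''),('''',''''),('''',''@@A''),('''',''''),('''',''@A''),(''F@B'',''''),('''',''A''),('''',''''),(''I@B'',''@@AA@A@A@A''),('''',''@@@AA@@AA''),('''',''@@AA@A@A@A''),('''',''@@AA@@@A@A''),('''',''@@@A@@@AA''),(''FB@'',''@@@A@@@A''),('''',''@@@A'')]),
   Zero ''CEACHE'',
   Zero ''ECAEHC'',
   Zero ''FBH'',
   Alts ['''',''GAI'',''O@B'',''O@C'',''O@D'',''O@E'',''O@G'',''GA@GBA'',''GA@GCA'',''GA@OA@'']
    (Leaf ''AAB@D@H@'' [(''A@B'',''A@@@@@A@A''),('''',''''),('''',''A@@@@@A@A''),('''',''''),('''',''A@@@@@AA''),(''F@B'',''''),('''',''@@@@@@A''),('''',''''),(''I@B'',''@@@@A''),('''',''A@@@@AAA''),('''',''@@@@A''),('''',''A@@A@@A@A''),('''',''@@A''),(''FB@'',''@@@@@@A@@A''),('''',''A'')])],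
 [Alts [''G@B'',''G@C'',''G@J'',''G@K'',''GAB'',''GHB'',''GIB'',''OB@'',''OBA'',''OC@'']
    (Leaf ''AAB@D@H@'' [(''A@B'',''@A''),('''',''''),('''',''@A''),('''',''''),('''',''A''),(''F@B'',''''),(''G@B'',''A''),('''',''''),(''I@B'',''AA@A@A@@@A''),('''',''A@A@@A@A''),('''',''AA@A@A@@@A''),('''',''AA@@@A@@@A''),('''',''A@@@@A@A''),(''FB@'',''@@@@AA@AA''),(''GB@'',''@@@@@A'')]),
   Zero ''CDACHD'',
   Zero ''EBAEHB'',
   Zero ''FBH'',
   Alts [''GB@'',''GBA'',''GBH'',''GBI'',''GC@'',''GJ@'',''GK@'',''O@B'',''O@C'',''OAB'']
    (Leaf ''AAB@D@H@'' [(''A@B'',''A@A@A''),('''',''''),('''',''A@A@A''),('''',''''),('''',''@@A''),(''F@B'',''''),(''G@B'',''@@A''),('''',''''),(''I@B'',''@@@@A@A@A''),('''',''A@A@@A@A''),('''',''@@@@A@A@A''),('''',''A@A@A@@@A''),('''',''@@@@@@@A''),(''FB@'',''@AA@@@@A@A''),(''GB@'',''A'')])],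
 [Alts ['''',''G@A'',''G@C'',''G@H'',''G@I'',''G@K'',''OBE'',''G@BO@B'',''G@BOAB'',''G@BOCB'']
    (Leaf ''A@BAD@H@'' [('''',''''),(''B@D'',''@A''),('''',''@@A''),('''',''''),(''E@A'',''''),('''',''@A''),('''',''A''),('''',''''),('''',''@@@AA@@AA''),(''J@D'',''@@@A@@@AA''),('''',''@@AA@A@A@A''),('''',''@@AA@@@A@A''),(''EA@'',''@@@A@@@A''),('''',''@@@A@@@AA''),('''',''@@@A'')]),
   Zero ''CEACHE'',
   Zero ''EAH'',
   Zero ''FCAFBHFAC'',
   Alts ['''',''GBJ'',''O@A'',''O@C'',''O@D'',''O@F'',''O@G'',''GB@GAB'',''GB@GCB'',''GB@OB@'']
    (Leaf ''A@BAD@H@'' [('''',''''),(''B@D'',''A@@@@@AA''),('''',''A@@@@@A@A''),('''',''''),(''E@A'',''''),('''',''A@@@@@AA''),('''',''@@@@@@A''),('''',''''),('''',''A@@@@AAA''),(''J@D'',''@@A''),('''',''@@@@A''),('''',''A@@A@@A@A''),(''EA@'',''@@@@@@A@@A''),('''',''@@A''),('''',''A'')])],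
 [Alts [''G@A'',''G@C'',''G@I'',''G@K'',''GBA'',''GHA'',''GJA'',''OA@'',''OAB'',''OC@'']
    (Leaf ''A@BAD@H@'' [('''',''''),(''B@D'',''A''),('''',''@A''),('''',''''),(''E@A'',''''),('''',''A''),(''G@A'',''A''),('''',''''),('''',''A@A@@A@A''),(''J@D'',''A@@@@A@A''),('''',''AA@A@A@@@A''),('''',''AA@@@A@@@A''),(''EA@'',''@@@@AA@AA''),('''',''A@@@@A@A''),(''GA@'',''@@@@@A'')]),
   Zero ''CDACHD'',
   Zero ''EAH'',
   Alts ['''',''FAC'',''FAI'',''FAK'',''N@B'',''N@D'',''N@F'']
    (Leaf ''A@BAD@H@'' [('''',''''),(''B@D'',''@@@@@@A''),(''C@DCE@'',''AA@@@@A''),('''',''''),(''E@A'',''''),('''',''@@@@@@A''),(''G@A'',''@@@@@@A''),('''',''''),(''AFN'',''@@A@@@A''),('''',''@@@@@A''),(''CDM'',''@@@A''),(''L@D'',''''),(''EAH'',''''),('''',''A''),(''GAH'',''@@@@@@A'')]),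
   Alts [''GA@'',''GAB'',''GAH'',''GAJ'',''GC@'',''GI@'',''GK@'',''O@A'',''O@C'',''OBA'']
    (Leaf ''A@BAD@H@'' [('''',''''),(''B@D'',''@@A''),('''',''A@A@A''),('''',''''),(''E@A'',''''),('''',''@@A''),(''G@A'',''@@A''),('''',''''),('''',''A@A@@A@A''),(''J@D'',''@@@@@@@A''),('''',''@@@@A@A@A''),('''',''A@A@A@@@A''),(''EA@'',''@AA@@@@A@A''),('''',''@@@@@@@A''),(''GA@'',''A'')])],
 [Alts ['''',''G@C'',''G@H'',''G@K'',''OAB'',''OAE'',''OAF'',''G@AGB@'',''G@AO@A'',''G@AOCA'']
    (Leaf ''AAB@D@H@'' [(''A@B'',''@A''),('''',''''),('''',''@A''),('''',''''),(''E@B'',''A''),(''F@B'',''''),('''',''A''),('''',''''),(''ADF'',''A@A@@@AAA''),('''',''@@A@@A@AA''),('''',''@AAA@@@@AA''),('''',''@AA@@@@@AA''),(''EAC'',''AAA@A@@@A''),(''FAC'',''@AA@@@@AA''),('''',''@@A'')]),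
   Alts ['''',''K@A'',''K@B'',''K@C'',''K@D'',''K@E'',''K@F'',''K@G'']
    (Leaf ''AAB@D@H@'' [(''A@B'',''@@@A''),('''',''''),('''',''@@@A''),('''',''''),(''MBC'',''@@@AAA''),(''F@B'',''''),(''G@C'',''@@@A''),('''',''''),('''',''@@A''),(''J@B'',''''),('''',''A''),(''L@D'',''''),(''M@B'',''@@@@A''),(''FBH'',''''),('''',''@@@@A'')]),
   Zero ''EAH'',
   Zero ''FBH'',
   Alts ['''',''GAB'',''GAI'',''GAJ'',''O@C'',''O@D'',''O@G'',''GA@GCA'',''GA@OA@'',''GA@OB@'']
    (Leaf ''AAB@D@H@'' [(''A@B'',''A@@@@@AA''),('''',''''),('''',''A@@@@@AA''),('''',''''),(''E@B'',''@@@@@@A''),(''F@B'',''''),('''',''@@@@@@A''),('''',''''),(''ADF'',''@AA@@@@@A''),('''',''A@@A@@A@@A''),('''',''@@@@@A''),('''',''A@@@A@AA''),(''EAC'',''A@@@@@@A@A''),(''FAC'',''@A@@@@AAA''),('''',''A'')])],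
 [Alts [''G@C'',''G@K'',''GAC'',''GBC'',''GHC'',''GIC'',''GJC'',''OC@'',''OCA'',''OCB'']
    (Leaf ''AAB@D@H@'' [(''A@B'',''A''),('''',''''),('''',''A''),('''',''''),(''ECA'',''A@AA''),(''F@B'',''''),(''G@C'',''A''),('''',''''),(''I@B'',''@A@@A@@A''),('''',''@@@@A@AA@A''),('''',''@A@@A@@A''),('''',''@@@@A@@A''),(''EAC'',''A@A@A@@A@A''),(''FB@'',''@@A@A@@AA''),(''GC@'',''@@@@A'')]),
   Zero ''CDACHD'',
   Zero ''EAH'',
   Zero ''FBH'',
   Alts [''GC@'',''GCA'',''GCB'',''GCH'',''GCI'',''GCJ'',''GK@'',''O@C'',''OAC'',''OBC'']
    (Leaf ''AAB@D@H@'' [(''A@B'',''@@@A''),('''',''''),('''',''@@@A''),('''',''''),(''ECA'',''@AAA''),(''F@B'',''''),(''G@C'',''@@@A''),('''',''''),(''I@B'',''A@@@@@AA''),('''',''@@@A@A@A@A''),('''',''A@@@@@AA''),('''',''@@@A@@@A''),(''EAC'',''@A@@@@@A@A''),(''FB@'',''@A@A@@@AA''),(''GC@'',''A'')])],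
 [Alts ['''',''G@A'',''G@B'',''G@H'',''G@I'',''G@J'',''OCD'',''G@CO@C'',''G@COAC'',''G@COBC'']
    (Leaf ''AAB@D@H@'' [(''A@D'',''@@A''),('''',''''),(''C@D'',''A''),('''',''''),('''',''@@A''),(''F@B'',''''),('''',''A''),('''',''''),(''I@D'',''@@@A@@@A@A''),('''',''@@@A@A@A@A''),(''CD@'',''@@@A@@AA''),('''',''@@@A@@@A''),('''',''@@@A@@@A@A''),(''N@B'',''@@@A@@@A''),('''',''@@@A'')]),
   Zero ''CAH'',
   Zero ''ECAEHC'',
   Zero ''FCAFBHFAC'',
   Alts ['''',''GCK'',''O@A'',''O@B'',''O@E'',''O@F'',''O@G'',''GC@GAC'',''GC@GBC'',''GC@OC@'']
    (Leaf ''AAB@D@H@'' [(''A@D'',''A@@@@@A@A''),('''',''''),(''C@D'',''@@@@@@A''),('''',''''),('''',''A@@@@@A@A''),(''F@B'',''''),('''',''@@@@@@A''),('''',''''),(''I@D'',''@@@A''),('''',''A@@@A@A@A''),(''CD@'',''AA@@@@@@@A''),('''',''@@@@@@A@@A''),('''',''@@@A''),(''N@B'',''@@@@@@A@@A''),('''',''A'')])],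
 [Alts [''G@A'',''G@B'',''G@I'',''G@J'',''GCA'',''GHA'',''GKA'',''OA@'',''OAC'',''OB@'']
    (Br ''C'' (Leaf ''I@B@D@H@'' [(''A@B'',''@@@@@@@@@@A''),('''',''''),('''',''@@@@@@@@@@A''),('''',''''),(''E@B'',''A@@@A@@@@@A''),(''F@B'',''''),('''',''A@@@A@@@@@A''),('''',''''),(''AB@'',''A@A@@A@A@@A''),('''',''A@@A@A@@@A''),('''',''@@@@@AAAA@A''),('''',''@@@@AA@AA''),(''EB@'',''@A@@AA@@@AA''),(''FAC'',''@A@@AA@A''),('''',''@@@@AA@@@@A'')]) (Leaf ''IAB@D@H@'' [(''A@B'',''@@@@@@@@@@A''),('''',''''),('''',''@@@@@@@@@@A''),('''',''''),(''E@B'',''A@@@A@@@@@A''),(''F@B'',''''),('''',''A@@@A@@@@@A''),('''',''''),(''AB@'',''A@A@@A@A@@A''),('''',''A@@A@A@@@A''),('''',''@@@@@AAAA@A''),('''',''@@@@AA@AA''),(''EB@'',''@A@@AA@@@AA''),(''FAC'',''@A@@AA@A''),('''',''@@@@AA@@@@A'')])),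
   Zero ''CAH'',
   Zero ''EBAEHB'',
   Alts ['''',''FAC'',''FAI'',''FAK'',''N@B'',''N@D'',''N@F'']
    (Leaf ''A@BAD@H@'' [('''',''''),(''B@D'',''@@@@@@A''),(''CDE'',''AA@@@@A''),('''',''''),(''E@A'',''''),('''',''@@@@@@A''),(''G@A'',''@@@@@@A''),('''',''''),(''AFN'',''@@A@@@A''),('''',''@@@@@A''),(''CMD'',''@@@A''),(''L@D'',''''),(''EBAEHB'',''''),('''',''A''),(''GAH'',''@@@@@@A'')]),
   Alts [''GA@'',''GAC'',''GAH'',''GAK'',''GB@'',''GI@'',''GJ@'',''O@A'',''O@B'',''OCA'']
    (Br ''C'' (Leaf ''I@B@D@H@'' [(''A@B'',''@@@@@@@@@@A''),('''',''''),('''',''@@@@@@@@@@A''),('''',''''),(''E@B'',''AA@@@@@@@@A''),(''F@B'',''''),('''',''AA@@@@@@@@A''),('''',''''),(''AB@'',''A@A@@A@A@@A''),('''',''A@A@@@A@A''),('''',''@@AA@@@A@AA''),('''',''@AA@@@@A@A''),(''EB@'',''@AA@A@@@A@A''),(''FAC'',''@AA@A@@A''),('''',''@AA@@@@@@@A'')]) (Leaf ''IAB@D@H@'' [(''A@B'',''@@@@@@@@@@A''),('''',''''),('''',''@@@@@@@@@@A''),('''',''''),(''E@B'',''AA@@@@@@@@A''),(''F@B'',''''),('''',''AA@@@@@@@@A''),('''',''''),(''AB@'',''A@A@@A@A@@A''),('''',''A@A@@@A@A''),('''',''@@AA@@@A@AA''),('''',''@AA@@@@A@A''),(''EB@'',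''@AA@A@@@A@A''),(''FAC'',''@AA@A@@A''),('''',''@AA@@@@@@@A'')]))],
 [Alts ['''',''G@B'',''G@H'',''G@J'',''OAC'',''OAD'',''OAF'',''G@AGC@'',''G@AO@A'',''G@AOBA'']
    (Leaf ''AAB@D@H@'' [(''A@D'',''@A''),('''',''''),(''C@D'',''A''),('''',''''),('''',''@A''),(''F@B'',''''),('''',''A''),('''',''''),(''ABF'',''A@A@@@AAA''),('''',''@@AA@@@@AA''),(''CAE'',''AAA@@A@@A''),('''',''@@A@A@@AA''),('''',''@@A@@@@@AA''),(''FAC'',''@AA@@@@AA''),('''',''@@A'')]),
   Zero ''CAH'',
   Alts ['''',''M@A'',''M@B'',''M@C'',''M@D'',''M@E'',''M@F'',''M@G'']
    (Leaf ''AAB@D@H@'' [(''A@D'',''@@@@@A''),('''',''''),(''KBC'',''@@@@A''),('''',''''),('''',''@@@@@A''),(''F@B'',''''),(''G@B'',''@@@@@A''),('''',''''),('''',''@@@@A''),(''J@B'',''''),(''K@B'',''@@@@A''),(''L@D'',''''),('''',''A''),(''FBH'',''''),('''',''@@A'')]),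
   Zero ''FBH'',
   Alts ['''',''GAC'',''GAI'',''GAK'',''O@B'',''O@E'',''O@G'',''GA@GBA'',''GA@OA@'',''GA@OC@'']
    (Leaf ''AAB@D@H@'' [(''A@D'',''A@@@@@AA''),('''',''''),(''C@D'',''@@@@@@A''),('''',''''),('''',''A@@@@@AA''),(''F@B'',''''),('''',''@@@@@@A''),('''',''''),(''ABF'',''@AA@@@@@A''),('''',''A@@@@AAA''),(''CAE'',''AA@A@@@A@A''),('''',''AA@@@@A@@A''),('''',''@@@@A''),(''FAC'',''@A@@@@AAA''),('''',''A'')])],
 [Alts [''G@B'',''G@J'',''GAB'',''GCB'',''GHB'',''GIB'',''GKB'',''OB@'',''OBA'',''OBC'']
    (Leaf ''AAB@D@H@'' [(''A@D'',''A''),('''',''''),(''CEA'',''A@AA''),('''',''''),('''',''A''),(''F@B'',''''),(''G@B'',''A''),('''',''''),(''I@D'',''A@@@A@@A''),('''',''AA@@A@@A''),(''CAE'',''A@AAA@AA@A''),('''',''@@@AA@@A@A''),('''',''A@@@A@@A''),(''FB@'',''@@A@A@@AA''),(''GB@'',''@@@@A'')]),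
   Zero ''CAH'',
   Zero ''EBAEHB'',
   Zero ''FBH'',
   Alts [''GB@'',''GBA'',''GBC'',''GBH'',''GBI'',''GBK'',''GJ@'',''O@B'',''OAB'',''OCB'']
    (Leaf ''AAB@D@H@'' [(''A@D'',''@@@A''),('''',''''),(''CEA'',''@AAA''),('''',''''),('''',''@@@A''),(''F@B'',''''),(''G@B'',''@@@A''),('''',''''),(''I@D'',''@@@@@@@A''),('''',''A@@A@@AA''),(''CAE'',''@AA@@A@A@A''),('''',''@@AA@@@A@A''),('''',''@@@@@@@A''),(''FB@'',''@A@A@@@AA''),(''GB@'',''A'')])],
 [Alts ['''',''G@A'',''G@H'',''G@I'',''OBC'',''OBD'',''OBE'',''G@BGC@'',''G@BO@B'',''G@BOAB'']
    (Leaf ''A@BAD@H@'' [('''',''''),(''B@D'',''@A''),(''C@D'',''A''),('''',''''),(''E@A'',''''),('''',''@A''),('''',''A''),('''',''''),('''',''@@AA@@@@AA''),(''BAE'',''A@A@@@AAA''),(''CAE'',''AAA@@A@@A''),('''',''@@A@A@@AA''),(''EA@'',''@@A@@@@@A''),('''',''@@A@@@@@AA''),('''',''@@A'')]),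
   Zero ''CAH'',
   Zero ''EAH'',
   Alts ['''',''N@B'',''N@D'',''N@F'',''NAC'',''NAE'',''NAG'']
    (Leaf ''A@BAD@H@'' [('''',''''),(''B@D'',''@@@A''),(''KAC'',''@@A''),('''',''''),(''E@A'',''''),('''',''@@@A''),(''G@A'',''@@@A''),('''',''''),(''I@A'',''''),('''',''@@A''),(''K@A'',''@@A''),(''L@D'',''''),(''EAH'',''''),('''',''A''),(''GBK'',''AA@@@A'')]),
   Alts ['''',''GBC'',''GBJ'',''GBK'',''O@A'',''O@F'',''O@G'',''GB@GAB'',''GB@OB@'',''GB@OC@'']
    (Leaf ''A@BAD@H@'' [('''',''''),(''B@D'',''A@@@@@AA''),(''C@D'',''@@@@@@A''),('''',''''),(''E@A'',''''),('''',''A@@@@@AA''),('''',''@@@@@@A''),('''',''''),('''',''A@@@@AAA''),(''BAE'',''@AA@@@@@A''),(''CAE'',''AA@A@@@A@A''),('''',''AA@@@@A@@A''),(''EA@'',''@@@@@@A@A''),('''',''@@@@A''),('''',''A'')])],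
 [Alts [''G@A'',''G@I'',''GBA'',''GCA'',''GHA'',''GJA'',''GKA'',''OA@'',''OAB'',''OAC'']
    (Leaf ''A@BAD@H@'' [('''',''''),(''B@D'',''A''),(''CEA'',''A@AA''),('''',''''),(''E@A'',''''),('''',''A''),(''G@A'',''A''),('''',''''),('''',''AA@@A@@A''),(''J@D'',''A@@@A@@A''),(''CAE'',''A@AAA@AA@A''),('''',''@@@AA@@A@A''),(''EA@'',''@@A@A@@AA''),('''',''A@@@A@@A''),(''GA@'',''@@@@A'')]),
   Zero ''CAH'',
   Zero ''EAH'',
   Zero ''FACFBHFCA'',
   Alts [''GA@'',''GAB'',''GAC'',''GAH'',''GAJ'',''GAK'',''GI@'',''O@A'',''OBA'',''OCA'']
    (Leaf ''A@BAD@H@'' [('''',''''),(''B@D'',''@@@A''),(''CEA'',''@AAA''),('''',''''),(''E@A'',''''),('''',''@@@A''),(''G@A'',''@@@A''),('''',''''),('''',''A@@A@@AA''),(''J@D'',''@@@@@@@A''),(''CAE'',''@AA@@A@A@A''),('''',''@@AA@@@A@A''),(''EA@'',''@A@A@@@AA''),('''',''@@@@@@@A''),(''GA@'',''A'')])],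
 [Alts ['''',''G@H'',''OAB'',''OAC'',''OAD'',''OAE'',''OAF'',''G@AGB@'',''G@AGC@'',''G@AO@A'']
    (Leaf ''AAB@D@H@'' [(''IBF'',''A@@@A@@@@A''),('''',''''),(''C@D'',''A''),('''',''''),(''E@B'',''A''),(''F@B'',''''),('''',''A''),('''',''''),(''ABF'',''AA@@@@A@AA''),('''',''@A@@@A@A@A''),(''CD@'',''AA@@A@@@AA''),('''',''@A@A@@@@AA''),(''EB@'',''AAA@@@@A@A''),(''FB@'',''@A@@@@@@@A''),('''',''@A'')]),
   Zero ''CAH'',
   Zero ''EAH'',
   Zero ''FBH'',
   Alts ['''',''GAB'',''GAC'',''GAI'',''GAJ'',''GAK'',''O@G'',''GA@OA@'',''GA@OB@'',''GA@OC@'']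
    (Leaf ''AAB@D@H@'' [(''IBF'',''A@A@@AA@@A''),('''',''''),(''C@D'',''@@@@@@A''),('''',''''),(''E@B'',''@@@@@@A''),(''F@B'',''''),('''',''@@@@@@A''),('''',''''),(''ABF'',''@@AA@@@A''),('''',''A@@@A@A@A''),(''CD@'',''A@@@@A@@@A''),('''',''A@A@@@A@@A''),(''EB@'',''AA@@@@@@A''),(''FB@'',''@@@@@@AA''),('''',''A'')])],
 [Alts []
    (Br ''C'' (Br ''E'' (Br ''O'' (Leaf ''I@B@D@H@'' [(''A@B'',''A''),('''',''''),('''',''A''),('''',''''),('''',''@A''),(''F@B'',''''),(''G@B'',''@A''),('''',''''),(''ABH'',''A''),(''J@B'',''''),(''K@C'',''A''),(''L@D'',''''),(''M@B'',''@@A''),(''FBH'',''''),('''',''@@A'')]) (Br ''N'' (Leaf ''I@B@D@H@'' [(''A@B'',''A''),('''',''''),('''',''A''),('''',''''),('''',''@A''),(''F@B'',''''),(''G@B'',''@A''),('''',''''),(''ABH'',''A''),(''J@B'',''''),(''K@C'',''A''),(''L@D'',''''),(''M@E'',''@A''),(''FBH'',''''),(''O@A'',''@@@A'')]) (Leaf ''A@JAD@H@'' [('''',''''),(''JDB'',''@@@A''),(''C@AKCE'',''AA@A''),('''',''''),(''E@A'',''''),(''F@H'',''@@@A''),(''G@H'',''@@A''),('''',''''),(''I@A'',''''),(''J@D'',''@@@A''),(''K@D'',''@@A''),(''L@D'',''''),(''EAH'',''''),('''',''@@@A''),('''',''@@A'')]))) (Br ''G'' (Leaf ''I@B@D@H@''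 [(''A@B'',''A''),('''',''''),('''',''A''),('''',''''),(''E@B'',''@@A''),(''F@B'',''''),('''',''@@A''),('''',''''),(''ABH'',''A''),(''J@B'',''''),(''K@C'',''A''),(''L@D'',''''),(''EABEHA'',''@@A''),(''FBH'',''''),(''O@G'',''@@A'')]) (Leaf ''IAB@D@H@'' [(''A@D'',''@A''),('''',''''),(''C@D'',''@@A''),('''',''''),('''',''@A''),(''F@B'',''''),('''',''@@A''),('''',''''),(''ADH'',''@A''),(''J@B'',''''),(''CADCHA'',''@@A''),(''L@D'',''''),(''M@E'',''@A''),(''FBH'',''''),(''O@G'',''@@A'')]))) (Br ''E'' (Br ''G'' (Leaf ''I@B@D@H@'' [(''A@D'',''@A''),('''',''''),(''C@D'',''@@A''),('''',''''),('''',''@A''),(''F@B'',''''),('''',''@@A''),('''',''''),(''ADH'',''@A''),(''J@B'',''''),(''CADCHA'',''@@A''),(''L@D'',''''),(''M@E'',''@A''),(''FBH'',''''),(''O@G'',''@@A'')]) (Leaf ''IAB@D@H@'' [(''A@B'',''A''),('''',''''),('''',''A''),('''',''''),(''E@B'',''@@A''),(''F@B'',''''),('''',''@@A''),('''',''''),(''ABH'',''A''),(''J@B'',''''),(''K@C'',''A''),(''L@D'',''''),(''EABEHA'',''@@A''),(''FBH'',''''),(''O@G'',''@@A'')])) (Br ''O'' (Br ''N'' (Leaf ''A@J@D@H@'' [('''',''''),(''JDB'',''@@@A''),(''C@AKCE'',''AA@A''),('''',''''),(''E@A'',''''),(''F@H'',''@@@A''),(''G@H'',''@@A''),('''',''''),(''I@A'',''''),(''J@D'',''@@@A''),(''K@D'',''@@A''),(''L@D'',''''),(''EAH'',''''),('''',''@@@A''),('''',''@@A'')])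 (Leaf ''IAB@D@H@'' [(''A@B'',''A''),('''',''''),('''',''A''),('''',''''),('''',''@A''),(''F@B'',''''),(''G@B'',''@A''),('''',''''),(''ABH'',''A''),(''J@B'',''''),(''K@C'',''A''),(''L@D'',''''),(''M@E'',''@A''),(''FBH'',''''),(''O@A'',''@@@A'')])) (Leaf ''IAB@D@H@'' [(''A@B'',''A''),('''',''''),('''',''A''),('''',''''),('''',''@A''),(''F@B'',''''),(''G@B'',''@A''),('''',''''),(''ABH'',''A''),(''J@B'',''''),(''K@C'',''A''),(''L@D'',''''),(''M@B'',''@@A''),(''FBH'',''''),('''',''@@A'')])))),
   Zero ''CAH'',
   Zero ''EAH'',
   Zero ''FBH'',
   Alts []
    (Br ''C'' (Br ''E'' (Br ''O'' (Leaf ''I@B@D@H@'' [(''A@B'',''A''),('''',''''),('''',''A''),('''',''''),('''',''@A''),(''F@B'',''''),(''G@B'',''@A''),('''',''''),(''ABH'',''A''),(''J@B'',''''),(''K@C'',''A''),(''L@D'',''''),(''M@B'',''@@A''),(''FBH'',''''),('''',''@@A'')]) (Br ''N'' (Leaf ''I@B@D@H@'' [(''A@B'',''A''),('''',''''),('''',''A''),('''',''''),('''',''@A''),(''F@B'',''''),(''G@B'',''@A''),('''',''''),(''ABH'',''A''),(''J@B'',''''),(''K@C'',''A''),(''L@D'',''''),(''M@E'',''@A''),(''FBH'',''''),(''O@A'',''@@@A'')]) (Leaf ''A@JAD@H@'' [('''',''''),(''JDB'',''@@@A''),(''C@AKCE'',''AA@A''),('''',''''),(''E@A'',''''),(''F@H'',''@@@A''),(''G@H'',''@@A''),('''',''''),(''I@A'',''''),(''J@D'',''@@@A''),(''K@D'',''@@A''),(''L@D'',''''),(''EAH'',''''),('''',''@@@A''),('''',''@@A'')])))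 (Br ''G'' (Leaf ''I@B@D@H@'' [(''A@B'',''A''),('''',''''),('''',''A''),('''',''''),(''E@B'',''@@A''),(''F@B'',''''),('''',''@@A''),('''',''''),(''ABH'',''A''),(''J@B'',''''),(''K@C'',''A''),(''L@D'',''''),(''EABEHA'',''@@A''),(''FBH'',''''),(''O@G'',''@@A'')]) (Leaf ''IAB@D@H@'' [(''A@D'',''@A''),('''',''''),(''C@D'',''@@A''),('''',''''),('''',''@A''),(''F@B'',''''),('''',''@@A''),('''',''''),(''ADH'',''@A''),(''J@B'',''''),(''CADCHA'',''@@A''),(''L@D'',''''),(''M@E'',''@A''),(''FBH'',''''),(''O@G'',''@@A'')]))) (Br ''E'' (Br ''G'' (Leaf ''I@B@D@H@'' [(''A@D'',''@A''),('''',''''),(''C@D'',''@@A''),('''',''''),('''',''@A''),(''F@B'',''''),('''',''@@A''),('''',''''),(''ADH'',''@A''),(''J@B'',''''),(''CADCHA'',''@@A''),(''L@D'',''''),(''M@E'',''@A''),(''FBH'',''''),(''O@G'',''@@A'')]) (Leaf ''IAB@D@H@'' [(''A@B'',''A''),('''',''''),('''',''A''),('''',''''),(''E@B'',''@@A''),(''F@B'',''''),('''',''@@A''),('''',''''),(''ABH'',''A''),(''J@B'',''''),(''K@C'',''A''),(''L@D'',''''),(''EABEHA'',''@@A''),(''FBH'',''''),(''O@G'',''@@A'')])) (Br ''O'' (Br ''N'' (Leaf ''A@J@D@H@'' [('''',''''),(''JDB'',''@@@A''),(''C@AKCE'',''AA@A''),('''',''''),(''E@A'',''''),(''F@H'',''@@@A''),(''G@H'',''@@A''),('''',''''),(''I@A'',''''),(''J@D'',''@@@A''),(''K@D'',''@@A''),(''L@D'',''''),(''EAH'',''''),('''',''@@@A''),('''',''@@A'')])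 (Leaf ''IAB@D@H@'' [(''A@B'',''A''),('''',''''),('''',''A''),('''',''''),('''',''@A''),(''F@B'',''''),(''G@B'',''@A''),('''',''''),(''ABH'',''A''),(''J@B'',''''),(''K@C'',''A''),(''L@D'',''''),(''M@E'',''@A''),(''FBH'',''''),(''O@A'',''@@@A'')])) (Leaf ''IAB@D@H@'' [(''A@B'',''A''),('''',''''),('''',''A''),('''',''''),('''',''@A''),(''F@B'',''''),(''G@B'',''@A''),('''',''''),(''ABH'',''A''),(''J@B'',''''),(''K@C'',''A''),(''L@D'',''''),(''M@B'',''@@A''),(''FBH'',''''),('''',''@@A'')]))))],
 [Zero ''CAD'',
   Alts [''K@A'',''K@B'',''K@E'',''K@F'',''KCA'',''KDA'',''KGA'',''OA@'',''OAC'',''OB@'']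
    (Br ''C'' (Leaf ''E@B@D@H@'' [(''A@B'',''@@@@@@@@@@A''),('''',''''),('''',''@@@@@@@@@@A''),('''',''''),(''AB@'',''A@A@@A@A@@A''),('''',''A@@A@A@@@A''),('''',''@@@@@AAAA@A''),('''',''''),(''I@B'',''A@@@A@@@@@A''),(''J@B'',''''),('''',''A@@@A@@@@@A''),('''',''@@@@AA@AA''),(''IB@'',''@A@@AA@@@AA''),(''JAC'',''@A@@AA@A''),('''',''@@@@AA@@@@A'')]) (Leaf ''EAB@D@H@'' [(''A@B'',''@@@@@@@@@@A''),('''',''''),('''',''@@@@@@@@@@A''),('''',''''),(''AB@'',''A@A@@A@A@@A''),('''',''A@@A@A@@@A''),('''',''@@@@@AAAA@A''),('''',''''),(''I@B'',''A@@@A@@@@@A''),(''J@B'',''''),('''',''A@@@A@@@@@A''),('''',''@@@@AA@AA''),(''IB@'',''@A@@AA@@@AA''),(''JAC'',''@A@@AA@A''),('''',''@@@@AA@@@@A'')])),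
   Zero ''IBAIDB'',
   Alts ['''',''JAC'',''JAE'',''JAG'',''N@B'',''N@D'',''N@F'']
    (Leaf ''A@BAD@H@'' [('''',''''),(''B@D'',''@@@@@@A''),(''CHI'',''AA@@@A''),('''',''''),(''AJN'',''@@A@@A''),('''',''@@@@@@A''),(''CMH'',''@@@A''),('''',''''),(''I@A'',''''),('''',''@@@@@A''),(''K@A'',''@@@@@A''),(''L@D'',''''),(''IBAIDB'',''''),('''',''A''),(''KAD'',''@@@@@A'')]),
   Alts [''KA@'',''KAC'',''KAD'',''KAG'',''KB@'',''KE@'',''KF@'',''O@A'',''O@B'',''OCA'']
    (Br ''C'' (Leaf ''E@B@D@H@'' [(''A@B'',''@@@@@@@@@@A''),('''',''''),('''',''@@@@@@@@@@A''),('''',''''),(''AB@'',''A@A@@A@A@@A''),('''',''A@A@@@A@A''),('''',''@@AA@@@A@AA''),('''',''''),(''I@B'',''AA@@@@@@@@A''),(''J@B'',''''),('''',''AA@@@@@@@@A''),('''',''@AA@@@@A@A''),(''IB@'',''@AA@A@@@A@A''),(''JAC'',''@AA@A@@A''),('''',''@AA@@@@@@@A'')]) (Leaf ''EAB@D@H@'' [(''A@B'',''@@@@@@@@@@A''),('''',''''),('''',''@@@@@@@@@@A''),('''',''''),(''AB@'',''A@A@@A@A@@A''),('''',''A@A@@@A@A''),('''',''@@AA@@@A@AA''),('''',''''),(''I@B'',''AA@@@@@@@@A''),(''J@B'',''''),('''',''AA@@@@@@@@A''),('''',''@AA@@@@A@A''),(''IB@'',''@AA@A@@@A@A''),(''J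AC'',''@AA@A@@A''),('''',''@AA@@@@@@@A'')]))],
 [Zero ''G@CCA@'',
   Zero ''CDAOGD'',
   Zero ''IBAIDB'',
   Zero ''BEAFBHBAE'',
   Zero ''CA@KDC''],
 [Zero ''CAD'',
   Zero ''GABCHE'',
   Zero ''IBAIDB'',
   Zero ''FBH'',
   Zero ''CE@GBAKCD''],
 [Zero ''CEDGAB'',
   Zero ''CDAOGD'',
   Zero ''IBAIDB'',
   Zero ''FBH'',
   Zero ''CA@KDC''],
 [Zero ''CAD'',
   Zero ''GBACHE'',
   Zero ''EAH'',
   Zero ''BEAFBHBAE'',
   Zero ''CE@GABKCD''],
 [Zero ''CEDGBA'',
   Zero ''CDAOGD'',
   Zero ''EAH'',
   Alts ['''',''JAC'',''JAE'',''JAG'',''N@B'',''N@D'',''N@F'']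
    (Leaf ''A@BAD@H@'' [('''',''''),(''B@D'',''@@@@@@A''),(''CHI'',''AA@@@A''),('''',''''),(''ANJ'',''@@A@@A''),('''',''@@@@@@A''),(''CMH'',''@@@A''),('''',''''),(''I@A'',''''),('''',''@@@@@A''),(''CDM'',''@@@A''),(''L@D'',''''),(''AJF'',''A@@A@AA''),('''',''A''),(''CAL'',''@@@@A'')]),
   Zero ''CA@KDC''],
 [Zero ''CAD'',
   Alts [''K@A'',''K@B'',''K@E'',''K@F'',''KCA'',''KDA'',''KGA'',''GABK@A'',''K@AO@C'']
    (Br ''C'' (Leaf ''E@B@D@H@'' [(''A@B'',''@@@@@@@@@A''),('''',''''),('''',''@@@@@@@@@A''),('''',''''),(''AF@'',''@@@@@AAAAA''),(''BEA'',''@@@@@AAAA''),('''',''A@@@@AA@AA''),('''',''''),(''ADN'',''@AA@AA@@@A''),(''BDL'',''A@A@AA@AA''),('''',''A@@@A@@@@A''),('''',''A@@@AA@@A''),(''ABL'',''A@@@AA@@AA''),(''BAM'',''A@AAAA@A''),('''',''@@@@AA@@@A'')]) (Leaf ''EAB@D@H@'' [(''A@B'',''@@@@@@@@@A''),('''',''''),('''',''@@@@@@@@@A''),('''',''''),(''AF@'',''@@@@@AAAAA''),(''BEA'',''@@@@@AAAA''),('''',''A@@@@AA@AA''),('''',''''),(''ADN'',''@AA@AA@@@A''),(''BDL'',''A@A@AA@AA''),('''',''A@@@A@@@@A''),('''',''A@@@AA@@A''),(''ABL'',''A@@@AA@@AA''),(''BAM'',''A@AAAA@A''),('''',''@@@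@AA@@@A'')])),
   Zero ''EAH'',
   Zero ''FBH'',
   Alts [''KA@'',''KAC'',''KAD'',''KAG'',''KB@'',''KE@'',''KF@'',''KA@GAB'',''O@CKA@'']
    (Br ''C'' (Leaf ''E@B@D@H@'' [(''A@B'',''@@@@@@@@@A''),('''',''''),('''',''@@@@@@@@@A''),('''',''''),(''AF@'',''@@AA@@@AAA''),(''BEA'',''@@AA@@@AA''),('''',''A@AA@@@@AA''),('''',''''),(''ADN'',''@AA@AA@@@A''),(''BDL'',''AAA@@A@AA''),('''',''AA@@@@@@@A''),('''',''AAA@@@@@A''),(''ABL'',''AAA@@@@@AA''),(''BAM'',''AAA@@AAA''),('''',''@AA@@@@@@A'')]) (Leaf ''EAB@D@H@'' [(''A@B'',''@@@@@@@@@A''),('''',''''),('''',''@@@@@@@@@A''),('''',''''),(''AF@'',''@@AA@@@AAA''),(''BEA'',''@@AA@@@AA''),('''',''A@AA@@@@AA''),('''',''''),(''ADN'',''@AA@AA@@@A''),(''BDL'',''AAA@@A@AA''),('''',''AA@@@@@@@A''),('''',''AAA@@@@@A''),(''ABL'',''AAA@@@@@AA''),(''BAM'',''AAA@@AAA''),('''',''@AA@@@@@@A'')]))],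
 [Zero ''G@CCA@'',
   Zero ''CDAOGD'',
   Zero ''EAH'',
   Zero ''FBH'',
   Zero ''CA@KDC''],
 [Zero ''CAD'',
   Zero ''CDAODG'',
   Zero ''IFAIDF'',
   Zero ''BAEFBHBEA'',
   Zero ''GCHCA@''],
 [Alts [''G@A'',''G@B'',''G@I'',''G@J'',''GCA'',''GHA'',''GKA'',''KA@'',''KAC'',''KB@'']
    (Br ''C'' (Leaf ''M@B@D@H@'' [(''A@B'',''@@@@@@@@@@A''),('''',''''),('''',''@@@@@@@@@@A''),('''',''''),(''E@B'',''A@@@A@@@@@A''),(''F@B'',''''),('''',''A@@@A@@@@@A''),('''',''''),(''EB@'',''@A@@@@@AAAA''),(''FAC'',''@A@@@@@@A''),('''',''@@@@@@@AA@A''),('''',''@@@@A@AAA''),(''AB@'',''A@@AA@@@A@A''),('''',''A@A@A@@AAA''),('''',''@@@@AA@@@@A'')]) (Leaf ''MAB@D@H@'' [(''A@B'',''@@@@@@@@@@A''),('''',''''),('''',''@@@@@@@@@@A''),('''',''''),(''E@B'',''A@@@A@@@@@A''),(''F@B'',''''),('''',''A@@@A@@@@@A''),('''',''''),(''EB@'',''@A@@@@@AAAA''),(''FAC'',''@A@@@@@@A''),('''',''@@@@@@@AA@A''),('''',''@@@@A@AAA''),(''AB@'',''A@@AA@@@A@A''),('''',''A@A@A@@AAA''),('''',''@@@@AA@@@@A'')])),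
   Alts [''GA@'',''GAC'',''GAH'',''GAK'',''GB@'',''GI@'',''GJ@'',''K@A'',''K@B'',''KCA'']
    (Br ''C'' (Leaf ''M@B@D@H@'' [(''A@B'',''@@@@@@@@@@A''),('''',''''),('''',''@@@@@@@@@@A''),('''',''''),(''E@B'',''AA@@@@@@@@A''),(''F@B'',''''),('''',''AA@@@@@@@@A''),('''',''''),(''EB@'',''@@@@A@@AAAA''),(''FAC'',''@@@@A@@@@A''),('''',''@@@@@@@A@AA''),('''',''@A@A@@@A@A''),(''AB@'',''AA@@@@A@@AA''),('''',''AA@@@A@AAA''),('''',''@AA@@@@@@@A'')]) (Leaf ''MAB@D@H@'' [(''A@B'',''@@@@@@@@@@A''),('''',''''),('''',''@@@@@@@@@@A''),('''',''''),(''E@B'',''AA@@@@@@@@A''),(''F@B'',''''),('''',''AA@@@@@@@@A''),('''',''''),(''EB@'',''@@@@A@@AAAA''),(''FAC'',''@@@@A@@@@A''),('''',''@@@@@@@A@AA''),('''',''@A@A@@@A@A''),(''AB@'',''AA@@@@A@@AA''),('''',''AA@@@A@AAA''),('''',''@AA@@@@@@@A'')])),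
   Zero ''AB@ADBM@E'',
   Alts ['''',''BAE'',''BAI'',''BAM'',''N@B'',''N@D'',''N@F'']
    (Leaf ''A@BAD@H@'' [('''',''''),(''B@D'',''@@@@@@A''),(''CDE'',''AA@@@@A''),('''',''''),(''E@A'',''''),('''',''@@@@@@A''),(''G@A'',''@@@@@@A''),('''',''''),(''ECK'',''@@A@@@A''),('''',''@@@@@A''),(''GIC'',''@@A''),(''L@D'',''''),(''ABDALF'',''AA@@A@A''),('''',''A''),(''CAL'',''@@@@A'')]),
   Zero ''O@DCAH''],
 [Zero ''CAD'',
   Zero ''CDAODG'',
   Zero ''AB@ADBM@E'',
   Zero ''FBH'',
   Zero ''GCHCA@''],
 [Zero ''CEDGAB'',
   Zero ''GBACHE'',
   Zero ''IFAIDF'',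
   Zero ''FBH'',
   Zero ''O@DCAH''],
 [Zero ''CAD'',
   Zero ''CDAODG'',
   Zero ''EAH'',
   Alts ['''',''BAE'',''BAI'',''BAM'',''N@B'',''N@D'',''N@F'']
    (Leaf ''A@BAD@H@'' [('''',''''),(''B@D'',''@@@@@@A''),(''CHI'',''A@A@@A''),('''',''''),(''E@A'',''''),('''',''@@@@@@A''),(''G@A'',''@@@@@@A''),('''',''''),(''ECK'',''@@A@@@A''),('''',''@@@@@A''),(''GIC'',''@@A''),(''L@D'',''''),(''EAH'',''''),('''',''A''),(''CM@'',''@@@A'')]),
   Zero ''GCHCA@''],
 [Zero ''CEDGBA'',
   Zero ''GABCHE'',
   Zero ''EAH'',
   Zero ''BAEFBHBEA'',
   Zero ''O@DCAH''],
 [Zero ''CAD'',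
   Zero ''CDAODG'',
   Zero ''EAH'',
   Zero ''FBH'',
   Zero ''GCHCA@''],
 [Alts [''KA@'',''KAC'',''KAD'',''KAG'',''KB@'',''KE@'',''KF@'',''G@CKA@'',''KA@OAB'']
    (Br ''FG'' (Br ''E'' (Leaf ''M@B@D@H@'' [(''A@B'',''@@@@@AAAAAA''),('''',''''),('''',''@@@@@AAAAAA''),('''',''''),(''ABD'',''@@@@@AAAAAA''),(''BAE'',''@@@@@AAAA''),('''',''A@@@@AA@AAA''),('''',''''),(''ADN'',''@AA@A@AAAAA''),(''BDL'',''AA@A@@AAA''),('''',''AA@@@AAAAAA''),('''',''AA@A@@@A''),(''AFH'',''A@@@AA@@AAA''),(''BEI'',''@A@@AA@A''),('''',''@AA@@AAAAAA'')]) (Leaf ''MAB@D@H@'' [(''A@B'',''@@@@@AAAAAA''),('''',''''),('''',''@@@@@AAAAAA''),('''',''''),(''ABD'',''@@@@@AAAAAA''),(''BAE'',''@@@@@AAAA''),('''',''A@@@@AA@AAA''),('''',''''),(''ADN'',''@AA@A@AAAAA''),(''BDL'',''AA@A@@AAA''),('''',''AA@@@AAAAAA''),('''',''AA@A@@@A''),(''AFH'',''A@@@AA@@AAA''),(''BEI'',''@A@@AA@A''),('''',''@AA@@AAAAAA'')])) (Br ''E'' (Leaf ''MAB@D@H@'' [(''A@B'',''@@@@@AAAAAA''),('''',''''),('''',''@@@@@AAAAAA''),('''',''''),(''ABD'',''@@@@@AAAAAA''),(''BAE'',''@@@@@AAAA''),('''',''A@@@@AA@AAA''),('''',''''),(''ADN'',''@AA@A@AAAAA''),(''BDL'',''AA@A@@AAA''),('''',''AA@@@AAAAAA''),('''',''AA@A@@@A''),(''AFH'',''A@@@AA@@AAA''),(''BEI'',''@A@@AA@A''),('''',''@AA@@AAAAAA'')])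 (Leaf ''M@B@D@H@'' [(''A@B'',''@@@@@AAAAAA''),('''',''''),('''',''@@@@@AAAAAA''),('''',''''),(''ABD'',''@@@@@AAAAAA''),(''BAE'',''@@@@@AAAA''),('''',''A@@@@AA@AAA''),('''',''''),(''ADN'',''@AA@A@AAAAA''),(''BDL'',''AA@A@@AAA''),('''',''AA@@@AAAAAA''),('''',''AA@A@@@A''),(''AFH'',''A@@@AA@@AAA''),(''BEI'',''@A@@AA@A''),('''',''@AA@@AAAAAA'')]))),
   Alts [''K@A'',''K@B'',''K@E'',''K@F'',''KCA'',''KDA'',''KGA'',''K@AG@C'',''OABK@A'']
    (Br ''FG'' (Br ''E'' (Leaf ''M@B@D@H@'' [(''A@B'',''@@AA@@@AAAA''),('''',''''),('''',''@@AA@@@AAAA''),('''',''''),(''ABD'',''@@AA@@@AAAA''),(''BAE'',''@@AA@@@AA''),('''',''A@AA@@@@AAA''),('''',''''),(''ADN'',''@A@AAA@AAAA''),(''BDL'',''A@@AA@AAA''),('''',''A@AAA@@AAAA''),('''',''A@@@A@AA''),(''AFH'',''AAA@@@@@AAA''),(''BEI'',''@AA@A@@A''),('''',''@@AAAA@AAAA'')]) (Leaf ''MAB@D@H@'' [(''A@B'',''@@AA@@@AAAA''),('''',''''),('''',''@@AA@@@AAAA''),('''',''''),(''ABD'',''@@AA@@@AAAA''),(''BAE'',''@@AA@@@AA''),('''',''A@AA@@@@AAA''),('''',''''),(''ADN'',''@A@AAA@AAAA''),(''BDL'',''A@@AA@AAA''),('''',''A@AAA@@AAAA''),('''',''A@@@A@AA''),(''AFH'',''AAA@@@@@AAA''),(''BEI'',''@AA@A@@A''),('''',''@@AAAA@AAAA'')]))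 (Br ''E'' (Leaf ''MAB@D@H@'' [(''A@B'',''@@AA@@@AAAA''),('''',''''),('''',''@@AA@@@AAAA''),('''',''''),(''ABD'',''@@AA@@@AAAA''),(''BAE'',''@@AA@@@AA''),('''',''A@AA@@@@AAA''),('''',''''),(''ADN'',''@A@AAA@AAAA''),(''BDL'',''A@@AA@AAA''),('''',''A@AAA@@AAAA''),('''',''A@@@A@AA''),(''AFH'',''AAA@@@@@AAA''),(''BEI'',''@AA@A@@A''),('''',''@@AAAA@AAAA'')]) (Leaf ''M@B@D@H@'' [(''A@B'',''@@AA@@@AAAA''),('''',''''),('''',''@@AA@@@AAAA''),('''',''''),(''ABD'',''@@AA@@@AAAA''),(''BAE'',''@@AA@@@AA''),('''',''A@AA@@@@AAA''),('''',''''),(''ADN'',''@A@AAA@AAAA''),(''BDL'',''A@@AA@AAA''),('''',''A@AAA@@AAAA''),('''',''A@@@A@AA''),(''AFH'',''AAA@@@@@AAA''),(''BEI'',''@AA@A@@A''),('''',''@@AAAA@AAAA'')]))),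
   Zero ''EAH'',
   Zero ''FBH'',
   Zero ''O@DCAH'']]"

text \<open>The evaluation runs over 32 coefficient vectors only: \<open>\<phi>\<close> enters
  through formal sums and through the case distinctions of the trees.\<close>

lemma certificate_checked:
  "list_all2 (\<lambda>c. check_entries (top4 c) (map nib ''GKMNO'')) all_coeffs certificate"
  by code_simp

section \<open>Soundness of the certificate\<close>

lemma parity_append: "parity \<phi> (G @ G') = (parity \<phi> G \<noteq> parity \<phi> G')"
  by (induction G) auto

lemma parity_toggle: "parity \<phi> (toggle x G) = (\<phi> x \<noteq> parity \<phi> G)"
  by (induction G) auto

lemma parity_cancel:
  assumes "\<And>x. light x \<Longrightarrow> \<not> \<phi> x"
  shows "parity \<phi> (cancel G) = parity \<phi> G"
  by (induction G) (use assms in \<open>auto simp: parity_toggle\<close>)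

lemma select_parity:
  assumes "\<forall>(G, b) \<in> set env. parity \<phi> G = b"
  shows "parity \<phi> (fst (select J env)) = snd (select J env)"
  using assms by (induction J env rule: select.induct) (auto simp: parity_append split: prod.splits)

lemma lin_zero: "lin \<sigma> (False, False, False, False) = ((False, False, False, False), False)"
proof -
  have "scale False x = ((False, False, False, False), False)" for x
    by (cases x) auto
  then show ?thesis
    by (cases "(\<sigma>, (False, False, False, False))" rule: lin.cases) auto
qed

lemma scale_xor: "scale (a \<noteq> b) x = xor5 (scale a x) (scale b x)"
  by (cases x) auto

lemma xor5_swap: "xor5 (xor5 a b) (xor5 c d) = xor5 (xor5 a c) (xor5 b d)"
proof -
  have *: "((p \<noteq> q) \<noteq> (r \<noteq> s)) = ((p \<noteq> r) \<noteq> (q \<noteq> s))" for p q r s :: bool by blast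
  obtain a1 a2 a3 a4 a5 b1 b2 b3 b4 b5 c1 c2 c3 c4 c5 d1 d2 d3 d4 d5
    where "a = ((a1, a2, a3, a4), a5)" "b = ((b1, b2, b3, b4), b5)"
      "c = ((c1, c2, c3, c4), c5)" "d = ((d1, d2, d3, d4), d5)"
    by (metis prod.exhaust)
  then show ?thesis by (simp only: xor5.simps xor4.simps *)
qed

lemma lin_xor: "lin \<sigma> (xor4 x y) = xor5 (lin \<sigma> x) (lin \<sigma> y)"
proof (cases "\<exists>c1 t1 c2 t2 c3 t3 c4 t4. \<sigma> = [c1, t1, c2, t2, c3, t3, c4, t4]")
  case True
  then obtain c1 t1 c2 t2 c3 t3 c4 t4 where \<sigma>: "\<sigma> = [c1, t1, c2, t2, c3, t3, c4, t4]" by blast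
  obtain a b c d where x: "x = (a, b, c, d)" by (cases x)
  obtain a' b' c' d' where y: "y = (a', b', c', d')" by (cases y)
  show ?thesis
    unfolding \<sigma> x y xor4.simps lin.simps scale_xor xor5_swap ..
next
  case False
  then have "lin \<sigma> z = (z, False)" for z
    by (induction \<sigma> z rule: lin.induct) auto
  then show ?thesis by simp
qed

lemma set_all_v4: "x \<in> set all_v4 \<or> x = (False, False, False, False)"
proof (cases x)
  case (fields a b c d)
  then show ?thesis
    by (cases a; cases b; cases c; cases d; simp add: all_v4_def)
qed

text \<open>The relation \<open>R l\<close> stands for lying in one orbit of the stabiliser of 0,
  with trivial scalar demanded once \<open>l\<close> is so large that the corresponding member of
  the flag lies in \<open>S\<close>. The assumption \<open>step\<close> is what the lemma
  \<open>generator\<close> will supply.\<close>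

locale tracking =
  fixes f :: "v4 \<Rightarrow> v4" and \<phi> :: "v4 \<Rightarrow> bool" and R :: "nat \<Rightarrow> v4 \<times> bool \<Rightarrow> v4 \<times> bool \<Rightarrow> bool"
  assumes light: "\<And>x. light x \<Longrightarrow> \<not> \<phi> x"
    and equivp: "\<And>l. equivp (R l)"
    and step: "\<And>l w u v s. in_level l w \<Longrightarrow> in_level l (xor4 u v) \<Longrightarrow>
      R l (xor4 (f u) (f (xor4 u w)), s \<noteq> (\<phi> u \<noteq> \<phi> (xor4 u w)))
          (xor4 (f v) (f (xor4 v w)), s \<noteq> (\<phi> v \<noteq> \<phi> (xor4 v w)))"
begin

text \<open>The bit \<open>s\<close> is universal, so that one statement about \<open>w\<close>
  covers both vectors of F_2^5 above it.\<close>

definition tracks :: "v4 \<Rightarrow> v4 \<times> bool \<Rightarrow> bool" where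
  "tracks w t \<longleftrightarrow> (\<forall>s. R (level w) (f w, s \<noteq> \<phi> w) (xor5 t ((False, False, False, False), s)))"


text \<open>Each triple changes the last coordinate by the four \<open>\<phi>\<close>-values that it
  pushes onto the list, so the difference of the two parities records the total change.\<close>

lemma walk_sound:
  "walk f l s z G = Some (z', G') \<Longrightarrow> R l (z, t) (z', t \<noteq> (parity \<phi> G \<noteq> parity \<phi> G'))"
proof (induction "length s" arbitrary: s z G t rule: less_induct)
  case less
  show ?case
  proof (cases "\<exists>cw cu cv s'. s = cw # cu # cv # s'")
    case True
    then obtain cw cu cv s' where s: "s = cw # cu # cv # s'" by blast
    define w u v where "w = nib cw" and "u = nib cu" and "v = nib cv"
    define b c where "b = (\<phi> u \<noteq> \<phi> (xor4 u w))" and "c = (\<phi> v \<noteq> \<phi> (xor4 v w))"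
    let ?z = "xor4 (f v) (f (xor4 v w))" and ?G = "u # xor4 u w # v # xor4 v w # G"
    from less.prems have z: "z = xor4 (f u) (f (xor4 u w))" "in_level l w" "in_level l (xor4 u v)"
      and rest: "walk f l s' ?z ?G = Some (z', G')"
      by (auto simp: s w_def u_def v_def Let_def split: if_splits)
    have t: "((t \<noteq> b) \<noteq> b) = t" by blast
    have "R l (z, t) (?z, (t \<noteq> b) \<noteq> c)"
      using step[OF z(2,3), of "t \<noteq> b"] unfolding b_def[symmetric] c_def[symmetric] z(1) t .
    moreover have "R l (?z, (t \<noteq> b) \<noteq> c) (z', ((t \<noteq> b) \<noteq> c) \<noteq> (parity \<phi> ?G \<noteq> parity \<phi> G'))"
      by (rule less.hyps[OF _ rest]) (simp add: s)
    moreover have "(((t \<noteq> b) \<noteq> c) \<noteq> (parity \<phi> ?G \<noteq> parity \<phi> G')) = (t \<noteq> (parity \<phi> G \<noteq> parity \<phi> G'))"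
      unfolding b_def c_def parity.simps by argo
    ultimately show ?thesis using equivp_transp[OF equivp] by simp
  next
    case False
    then have "walk f l s z G = (if s = [] then Some (z, G) else None)"
      by (cases "(f, l, s, z, G)" rule: walk.cases) auto
    then show ?thesis using less.prems equivp_reflp[OF equivp] by (auto split: if_splits)
  qed
qed

lemma check_path_sound:
  assumes "check_path f env w t s J" and env: "\<forall>(G, b) \<in> set env. parity \<phi> G = b"
  shows "tracks w t"
  unfolding tracks_def
proof
  fix r
  obtain z G where zG: "walk f (level w) s (f w) [w] = Some (z, G)"
    using assms(1) by (auto simp: check_path_def split: option.splits)
  obtain G' b where sel: "select J env = (G', b)" by (cases "select J env")
  have t: "t = (z, b)" and c: "cancel (G @ G') = []"
    using assms(1) by (auto simp: check_path_def zG sel)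
  have "parity \<phi> (G @ G') = False"
    using parity_cancel[where \<phi> = \<phi> and G = "G @ G'"] light c by simp
  then have b: "b = parity \<phi> G"
    using select_parity[OF env, of J] sel by (simp add: parity_append)
  have "R (level w) (f w, r \<noteq> \<phi> w) (z, (r \<noteq> \<phi> w) \<noteq> (parity \<phi> [w] \<noteq> parity \<phi> G))"
    by (rule walk_sound[OF zG])
  moreover have "((r \<noteq> \<phi> w) \<noteq> (parity \<phi> [w] \<noteq> parity \<phi> G)) = (b \<noteq> r)"
    using b by auto
  ultimately show "R (level w) (f w, r \<noteq> \<phi> w) (xor5 t ((False, False, False, False), r))"
    unfolding t by (cases z) simp
qed

lemma check_paths_sound:
  assumes "check_paths f env \<sigma> ws ps" "\<forall>(G, b) \<in> set env. parity \<phi> G = b" "w \<in> set ws"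
  shows "tracks w (lin \<sigma> w)"
  using assms
proof (induction ws arbitrary: ps)
  case (Cons v ws)
  then obtain s J ps' where "ps = (s, J) # ps'"
    by (cases ps) auto
  then have "check_path f env v (lin \<sigma> v) s J" "check_paths f env \<sigma> ws ps'"
    using Cons.prems by simp_all
  then show ?case using check_path_sound Cons.IH Cons.prems(2,3) by (metis set_ConsD)
qed simp

lemma check_tree_sound:
  assumes "check_tree f env t" "\<forall>(G, b) \<in> set env. parity \<phi> G = b"
  shows "\<exists>\<sigma>. \<forall>w \<in> set all_v4. tracks w (lin \<sigma> w)"
  using assms
proof (induction t arbitrary: env)
  case (Leaf \<sigma> ps)
  then have "check_paths f env \<sigma> all_v4 ps" by simp
  from check_paths_sound[OF this Leaf.prems(2)] show ?case by blast
next
  case (Br G t u)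
  show ?case
  proof (cases "parity \<phi> (map nib G)")
    case True
    show ?thesis by (rule Br.IH(2)[of "env @ [(map nib G, True)]"]) (use Br.prems True in auto)
  next
    case False
    show ?thesis by (rule Br.IH(1)[of "env @ [(map nib G, False)]"]) (use Br.prems False in auto)
  qed
qed

text \<open>A walk of even parity settles \<open>w\<close> at once. Hence all the walks may be taken
  to be odd when the tree is entered, and this is the initial set of equations.\<close>

lemma alts_env_sound:
  assumes "alts_env f w ss = Some env"
  shows "tracks w (w, False) \<or> (\<forall>(G, b) \<in> set env. parity \<phi> G = b)"
  using assms
proof (induction ss arbitrary: env)
  case (Cons s ss)
  then obtain G env' where 1: "walk f (level w) s (f w) [w] = Some (w, G)" "alts_env f w ss = Some env'"
    "env = (G, True) # env'"
    by (auto split: option.splits if_splits)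
  show ?case
  proof (cases "parity \<phi> G")
    case False
    have "tracks w (w, False)"
      unfolding tracks_def
    proof
      fix r
      have "((r \<noteq> \<phi> w) \<noteq> (parity \<phi> [w] \<noteq> parity \<phi> G)) = r" using False by auto
      then show "R (level w) (f w, r \<noteq> \<phi> w) (xor5 (w, False) ((False, False, False, False), r))"
        using walk_sound[OF 1(1), of "r \<noteq> \<phi> w"] by (cases w) simp
    qed
    then show ?thesis ..
  next
    case True
    then show ?thesis using Cons.IH[OF 1(2)] 1(3) by auto
  qed
qed simp

lemma check_entry_sound:
  assumes "check_entry f w e"
  shows "tracks w (w, False) \<or> (\<exists>\<sigma>. \<forall>w \<in> set all_v4. tracks w (lin \<sigma> w))"
proof (cases e)
  case (Zero s)
  then show ?thesis using assms check_path_sound[of "[]" w "(w, False)" s "[]"] by simp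
next
  case (Alts ss t)
  then obtain env where "alts_env f w ss = Some env" "check_tree f env t"
    using assms by (auto split: option.splits)
  then show ?thesis using alts_env_sound[of w ss env] check_tree_sound[of env t] by blast
qed

text \<open>An entry succeeds either for its own vector by the identity or for all vectors by one
  linear map. Different maps are never mixed, which is what makes the outcome linear.\<close>

lemma check_entries_sound:
  assumes "check_entries f ws es"
  shows "(\<forall>w\<in>set ws. tracks w (w, False)) \<or> (\<exists>\<sigma>. \<forall>w \<in> set all_v4. tracks w (lin \<sigma> w))"
  using assms
proof (induction ws arbitrary: es)
  case (Cons w ws)
  then obtain e es' where "es = e # es'" by (cases es) auto
  then have "check_entry f w e" "check_entries f ws es'" using Cons.prems by simp_all
  note sound = check_entry_sound[OF this(1)] Cons.IH[OF this(2)]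
  show ?case
  proof (cases "\<exists>\<sigma>. \<forall>w \<in> set all_v4. tracks w (lin \<sigma> w)")
    case False
    then have "tracks w (w, False)" "\<forall>w\<in>set ws. tracks w (w, False)" using sound by blast+
    then show ?thesis by simp
  qed blast
qed simp

end

lemma certificate_complete: "\<exists>es. check_entries (top4 c) (map nib ''GKMNO'') es"
proof -
  obtain a1 a2 a3 a4 a5 where c: "c = (a1, a2, a3, a4, a5)" by (cases c)
  have "c \<in> set all_coeffs"
    unfolding c by (cases a1; cases a2; cases a3; cases a4; cases a5; simp add: all_coeffs_def)
  then obtain i where "i < length all_coeffs" "all_coeffs ! i = c" by (auto simp: in_set_conv_nth)
  then show ?thesis using list_all2_nthD[OF certificate_checked] by blast
qed

lemma lin_id: "lin ''A@B@D@H@'' x = (x, False)"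
  by (cases x) simp

theorem linear_tracking:
  fixes c :: coeffs and \<phi> :: "v4 \<Rightarrow> bool" and R :: "nat \<Rightarrow> v4 \<times> bool \<Rightarrow> v4 \<times> bool \<Rightarrow> bool"
  assumes light: "\<And>x. light x \<Longrightarrow> \<not> \<phi> x"
    and equivp: "\<And>l. equivp (R l)"
    and step: "\<And>l w u v s. in_level l w \<Longrightarrow> in_level l (xor4 u v) \<Longrightarrow>
      R l (xor4 (top4 c u) (top4 c (xor4 u w)), s \<noteq> (\<phi> u \<noteq> \<phi> (xor4 u w)))
          (xor4 (top4 c v) (top4 c (xor4 v w)), s \<noteq> (\<phi> v \<noteq> \<phi> (xor4 v w)))"
  shows "\<exists>\<sigma>. \<forall>w s. R (level w) (top4 c w, s \<noteq> \<phi> w) (xor5 (lin \<sigma> w) ((False, False, False, False), s))"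
proof -
  let ?O = "(False, False, False, False)"
  let ?T = "\<lambda>w t. \<forall>s. R (level w) (top4 c w, s \<noteq> \<phi> w) (xor5 t (?O, s))"
  obtain al g12 g13 g23 g123 where c: "c = (al, g12, g13, g23, g123)" by (cases c)
  interpret tracking "top4 c" \<phi> R by unfold_locales (fact assms)+
  obtain es where "check_entries (top4 c) (map nib ''GKMNO'') es"
    using certificate_complete by blast
  from check_entries_sound[OF this]
  consider "\<forall>w\<in>set (map nib ''GKMNO''). ?T w (w, False)" | \<sigma> where "\<forall>w \<in> set all_v4. ?T w (lin \<sigma> w)"
    unfolding tracks_def by blast
  then have "\<exists>\<sigma>. \<forall>w \<in> set all_v4. ?T w (lin \<sigma> w)"
  proof cases
    case 1
    have "?T w (w, False)" if heavy: "w \<notin> set (map nib ''GKMNO'')" for w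
    proof
      fix s
      obtain x1 x2 x3 x4 where w: "w = (x1, x2, x3, x4)" by (cases w)
      show "R (level w) (top4 c w, s \<noteq> \<phi> w) (xor5 (w, False) (?O, s))"
      proof (cases "light w")
        case True
        then have "top4 c w = w" by (auto simp: w c)
        then show ?thesis using equivp_reflp[OF equivp] light[OF True] by (simp add: w)
      next
        case False
        \<comment> \<open>\<open>w\<close> is a sum of two unit vectors, at which the triangular map is the identity.\<close>
        define u where "u = first_bit w"
        have u: "light u" "light (xor4 u w)" "top4 c u = u" "top4 c (xor4 u w) = xor4 u w"
          "xor4 u (xor4 u w) = w" "in_level (level w) w" "in_level (level w) (xor4 ?O u)"
          using heavy False unfolding u_def w c
          by (cases x1; cases x2; cases x3; cases x4; simp)+
        have O: "xor4 ?O w = w" "top4 c ?O = ?O" "xor4 ?O (top4 c w) = top4 c w"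
          by (auto simp: w c)
        have "light ?O" by simp
        then show ?thesis
          using step[OF u(6,7), of s] light[OF u(1)] light[OF u(2)] light[of ?O] u O
          by (simp add: w)
      qed
    qed
    then have "?T w (lin ''A@B@D@H@'' w)" for w
      unfolding lin_id using 1 by (cases "w \<in> set (map nib ''GKMNO'')") blast+
    then show ?thesis by (intro exI ballI)
  next
    case (2 \<sigma>)
    then show ?thesis by (rule exI)
  qed
  then obtain \<sigma> where \<sigma>: "\<forall>w \<in> set all_v4. ?T w (lin \<sigma> w)" by blast
  have "?T ?O (lin \<sigma> ?O)"
    using equivp_reflp[OF equivp] light[of ?O] by (simp add: lin_zero c)
  then have "?T w (lin \<sigma> w)" for w
    using bspec[OF \<sigma>, of w] set_all_v4[of w] by metis
  then show ?thesis by (intro exI allI) blast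
qed

section \<open>Permutation groups of prime power order\<close>

text \<open>Orbit lengths divide a power of \<open>q\<close>, so modulo \<open>q\<close> only orbits
  of length 1 count. The action is a bare function obeying the laws on \<open>X\<close>, which
  spares a homomorphism at every use; inside the proof it is restricted to \<open>X\<close> to
  become one.\<close>

lemma (in group) p_group_fixed_points:
  fixes act :: "'a \<Rightarrow> 'x \<Rightarrow> 'x"
  assumes ord: "order G = q ^ n" and q: "prime q" and fin: "finite X"
    and closed: "\<And>g x. g \<in> carrier G \<Longrightarrow> x \<in> X \<Longrightarrow> act g x \<in> X"
    and one: "\<And>x. x \<in> X \<Longrightarrow> act \<one> x = x"
    and mult: "\<And>g h x. g \<in> carrier G \<Longrightarrow> h \<in> carrier G \<Longrightarrow> x \<in> X \<Longrightarrow> act (g \<otimes> h) x = act g (act h x)"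
  shows "[card {x \<in> X. \<forall>g\<in>carrier G. act g x = x} = card X] (mod q)"
proof -
  let ?\<phi> = "\<lambda>g. restrict (act g) X"
  have inv_l: "act (inv g) (act g x) = x" "act g (act (inv g) x) = x" if "g \<in> carrier G" "x \<in> X" for g x
    using that mult[of "inv g" g x] mult[of g "inv g" x] one by auto
  have Bij: "?\<phi> g \<in> Bij X" if g: "g \<in> carrier G" for g
  proof -
    have "bij_betw (act g) X X"
      by (rule bij_betw_byWitness[where f' = "act (inv g)"]) (use g inv_l closed in auto)
    then have "bij_betw (?\<phi> g) X X" by (simp add: bij_betw_restrict_eq)
    then show ?thesis by (simp add: Bij_def)
  qed
  interpret A: group_action G X ?\<phi>
    unfolding group_action_def group_hom_def group_hom_axioms_def
  proof (intro conjI is_group group_BijGroup)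
    show "?\<phi> \<in> hom G (BijGroup X)"
    proof (rule homI)
      fix g assume "g \<in> carrier G" then show "?\<phi> g \<in> carrier (BijGroup X)" using Bij by (simp add: BijGroup_def)
    next
      fix g h assume gh: "g \<in> carrier G" "h \<in> carrier G"
      show "?\<phi> (g \<otimes> h) = ?\<phi> g \<otimes>\<^bsub>BijGroup X\<^esub> ?\<phi> h"
        using Bij gh closed mult by (auto simp: BijGroup_def compose_def fun_eq_iff)
    qed
  qed
  let ?O = "orbits G X ?\<phi>" and ?F = "{x \<in> X. \<forall>g\<in>carrier G. act g x = x}"
  have fin_orb: "finite Y" if "Y \<in> ?O" for Y
  proof -
    have "Y \<subseteq> X" using that closed by (auto simp: orbits_def orbit_def)
    then show ?thesis using fin finite_subset by blast
  qed
  have finO: "finite ?O" using fin by (simp add: orbits_def Setcompr_eq_image)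
  have orb_self: "x \<in> orbit G ?\<phi> x" if "x \<in> X" for x using A.orbit_refl that by blast
  have card_orb: "q dvd card Y \<or> card Y = 1" if Y: "Y \<in> ?O" for Y
  proof -
    obtain x where x: "x \<in> X" "Y = orbit G ?\<phi> x" using Y unfolding orbits_def by blast
    have "card Y * card (stabilizer G ?\<phi> x) = q ^ n"
      using A.orbit_stabilizer_theorem[OF x(1)] x(2) ord by simp
    then have "card Y dvd q ^ n" by (metis dvd_triv_left)
    then obtain i where "card Y = q ^ i" using q divides_primepow_nat by blast
    then show ?thesis by (cases i) auto
  qed
  have sing: "card Y = 1 \<longleftrightarrow> (\<exists>x\<in>?F. Y = {x})" if YO: "Y \<in> ?O" for Y
  proof
    assume "card Y = 1"
    then obtain x where Y: "Y = {x}" by (auto simp: card_1_singleton_iff)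
    obtain x' where x': "x' \<in> X" "Y = orbit G ?\<phi> x'" using YO unfolding orbits_def by blast
    then have "x' = x" using orb_self Y by auto
    then have "\<forall>g\<in>carrier G. act g x = x" using x' Y by (auto simp: orbit_def)
    then show "\<exists>x\<in>?F. Y = {x}" using Y x' \<open>x' = x\<close> by auto
  qed auto
  have fix_orb: "{x} \<in> ?O" if "x \<in> ?F" for x
  proof -
    have "orbit G ?\<phi> x \<subseteq> {x}" using that by (auto simp: orbit_def)
    then have "orbit G ?\<phi> x = {x}" using orb_self[of x] that by blast
    then show ?thesis using that by (auto simp: orbits_def)
  qed
  have "card X = (\<Sum>Y\<in>?O. card Y)"
  proof -
    have part: "partition X ?O" by (rule A.orbit_partition)
    have dis: "pairwise disjnt ?O"
      using part unfolding partition_def pairwise_def disjnt_def by blast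
    have "\<Union> ?O = X" by (rule A.orbits_coverture)
    then show ?thesis using card_Union_disjoint[OF dis fin_orb] by simp
  qed
  also have "[(\<Sum>Y\<in>?O. card Y) = (\<Sum>Y\<in>?O. if card Y = 1 then 1 else 0)] (mod q)"
    by (rule cong_sum) (use card_orb in \<open>fastforce simp: cong_def\<close>)
  also have "(\<Sum>Y\<in>?O. if card Y = 1 then 1 else 0) = card {Y\<in>?O. card Y = 1}"
    using finO by (simp add: sum.If_cases Int_def)
  also have "{Y\<in>?O. card Y = 1} = (\<lambda>x. {x}) ` ?F" using sing fix_orb by auto
  also have "card ((\<lambda>x. {x}) ` ?F) = card ?F" by (rule card_image) (simp add: inj_on_def)
  finally show ?thesis by (rule cong_sym)
qed

text \<open>\<open>T\<close> acts on the right cosets of \<open>P\<close> through multiplication by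
  inverses. Their number \<open>m\<close> is prime to \<open>q\<close>, so some coset
  \<open>P #> g\<close> is fixed, and this means that \<open>g\<close> conjugates \<open>T\<close>
  into \<open>P\<close>.\<close>

lemma (in group) p_subgroup_in_sylow:
  assumes fin: "finite (carrier G)" and q: "prime q"
    and P: "subgroup P G" "card P * m = order G" "\<not> q dvd m"
    and T: "subgroup T G" "card T = q ^ n"
  shows "\<exists>g\<in>carrier G. \<forall>t\<in>T. g \<otimes> t \<otimes> inv g \<in> P"
proof -
  have PG: "P \<subseteq> carrier G" and TG: "T \<subseteq> carrier G" using P T subgroup.subset by auto
  interpret T: group "G\<lparr>carrier := T\<rparr>" using T(1) by (rule subgroup_imp_group)
  have Pc: "card P > 0" using P(1) fin by (metis card_gt_0_iff finite_subset PG subgroup.one_closed empty_iff)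
  have cardX: "card (rcosets P) = m"
    using lagrange[OF P(1)] P(2) Pc by (metis mult.commute mult_left_cancel less_not_refl2)
  have mem: "\<And>C. C \<in> rcosets P \<Longrightarrow> \<exists>g\<in>carrier G. C = P #> g" by (auto simp: RCOSETS_def)
  let ?X = "rcosets P"
  have "[card {C \<in> ?X. \<forall>t\<in>carrier (G\<lparr>carrier := T\<rparr>). C #> inv t = C} = card ?X] (mod q)"
  proof (rule T.p_group_fixed_points[OF _ q])
    show "order (G\<lparr>carrier := T\<rparr>) = q ^ n" using T(2) by (simp add: order_def)
    show "finite ?X" using fin by (simp add: RCOSETS_def)
  next
    fix t C assume t: "t \<in> carrier (G\<lparr>carrier := T\<rparr>)" "C \<in> ?X"
    then obtain g where g: "g \<in> carrier G" "C = P #> g" using mem by blast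
    have "C #> inv t = P #> (g \<otimes> inv t)" using g t TG PG by (auto simp: coset_mult_assoc)
    moreover have "g \<otimes> inv t \<in> carrier G" using g t TG by auto
    ultimately show "C #> inv t \<in> ?X" unfolding RCOSETS_def by blast
  next
    fix C assume "C \<in> ?X"
    then show "C #> inv \<one>\<^bsub>G\<lparr>carrier := T\<rparr>\<^esub> = C"
      using rcosets_subset_PowG[OF P(1)] coset_mult_one by (simp add: subset_iff)
  next
    fix t u C assume t: "t \<in> carrier (G\<lparr>carrier := T\<rparr>)" "u \<in> carrier (G\<lparr>carrier := T\<rparr>)" "C \<in> ?X"
    then have "C \<subseteq> carrier G" "t \<in> carrier G" "u \<in> carrier G"
      using rcosets_subset_PowG[OF P(1)] TG by auto
    then show "C #> inv (t \<otimes>\<^bsub>G\<lparr>carrier := T\<rparr>\<^esub> u) = C #> inv u #> inv t"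
      by (simp add: inv_mult_group coset_mult_assoc)
  qed
  then have cong: "[card {C \<in> ?X. \<forall>t\<in>T. C #> inv t = C} = m] (mod q)" by (simp add: cardX)
  have "card {C \<in> ?X. \<forall>t\<in>T. C #> inv t = C} \<noteq> 0"
  proof
    assume "card {C \<in> ?X. \<forall>t\<in>T. C #> inv t = C} = 0"
    with cong have "[m = 0] (mod q)" by (metis cong_sym)
    then show False using P(3) by (simp add: cong_0_iff)
  qed
  then have "{C \<in> ?X. \<forall>t\<in>T. C #> inv t = C} \<noteq> {}" by (metis card.empty)
  then obtain C where C: "C \<in> ?X" "\<forall>t\<in>T. C #> inv t = C" by blast
  then obtain g where g: "g \<in> carrier G" "C = P #> g" using mem by blast
  have "g \<otimes> t \<otimes> inv g \<in> P" if t: "t \<in> T" for t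
  proof -
    have t': "inv t \<in> T" "t \<in> carrier G" using subgroup.m_inv_closed[OF T(1) t] t TG by auto
    then have "P #> g #> t = P #> g" using bspec[OF C(2) t'(1)] g by simp
    moreover have "P #> g #> t = P #> (g \<otimes> t)" using PG g t' by (simp add: coset_mult_assoc)
    moreover have "g \<otimes> t \<in> P #> (g \<otimes> t)" using g t' P(1) rcos_self by simp
    ultimately have "g \<otimes> t \<in> P #> g" by simp
    then obtain x where "x \<in> P" "g \<otimes> t = x \<otimes> g" by (auto simp: r_coset_def)
    then show ?thesis using g t' PG by (auto simp: m_assoc)
  qed
  then show ?thesis using g by blast
qed

text \<open>Conjugating a Sylow subgroup back by the element that moves \<open>S\<close> into it
  leaves \<open>S\<close> in place, so that only \<open>T\<close> has to be moved.\<close>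

lemma (in group) p_subgroups_join:
  assumes fin: "finite (carrier G)" and q: "prime q"
    and S: "subgroup S G" "card S = q ^ s" and T: "subgroup T G" "card T = q ^ t"
  shows "\<exists>g\<in>carrier G. \<exists>R n. subgroup R G \<and> card R = q ^ n \<and> S \<subseteq> R \<and> (\<forall>t\<in>T. g \<otimes> t \<otimes> inv g \<in> R)"
proof -
  have "order G \<noteq> 0" using fin one_closed by (auto simp: order_def)
  then obtain a m where am: "order G = q ^ a * m" "\<not> q dvd m"
    using prime_power_canonical[OF q, of "order G"] by (auto simp: mult.commute)
  obtain P where P: "subgroup P G" "card P = q ^ a"
    using sylow_thm[OF q is_group am(1) fin] by blast
  have P2: "card P * m = order G" using P am by simp
  obtain g where g: "g \<in> carrier G" "\<And>x. x \<in> S \<Longrightarrow> g \<otimes> x \<otimes> inv g \<in> P"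
    using p_subgroup_in_sylow[OF fin q P(1) P2 am(2) S] by blast
  obtain h where h: "h \<in> carrier G" "\<And>x. x \<in> T \<Longrightarrow> h \<otimes> x \<otimes> inv h \<in> P"
    using p_subgroup_in_sylow[OF fin q P(1) P2 am(2) T] by blast
  let ?c = "\<lambda>x. inv g \<otimes> x \<otimes> g"
  have PG: "P \<subseteq> carrier G" "S \<subseteq> carrier G" "T \<subseteq> carrier G" using P S T subgroup.subset by auto
  have gi: "g \<otimes> (inv g \<otimes> w) = w" "inv g \<otimes> (g \<otimes> w) = w" if "w \<in> carrier G" for w
    using that g(1) by (simp_all add: m_assoc[symmetric])
  have cc: "?c (x \<otimes> y) = ?c x \<otimes> ?c y" if "x \<in> carrier G" "y \<in> carrier G" for x y
    using that g(1) by (simp add: m_assoc gi)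
  have hom: "?c \<in> hom G G" by (rule homI) (use g cc in auto)
  interpret gh: group_hom G G ?c
    using hom by (simp add: group_hom_def group_hom_axioms_def is_group)
  have R: "subgroup (?c ` P) G" by (rule gh.subgroup_img_is_subgroup[OF P(1)])
  have inj: "inj_on ?c P"
    using g PG by (auto simp: inj_on_def m_assoc subset_iff)
  have undo: "?c (g \<otimes> x \<otimes> inv g) = x" if "x \<in> carrier G" for x
    using that g(1) by (simp add: m_assoc gi)
  show ?thesis
  proof (intro bexI exI conjI ballI)
    show "subgroup (?c ` P) G" by (rule R)
    show "card (?c ` P) = q ^ a" using P(2) inj by (simp add: card_image)
    show "S \<subseteq> ?c ` P"
    proof
      fix x assume "x \<in> S"
      then show "x \<in> ?c ` P" using undo[of x] g(2)[of x] PG(2) by (intro image_eqI[of _ _ "g \<otimes> x \<otimes> inv g"]) auto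
    qed
    show "inv g \<otimes> h \<in> carrier G" using g h by simp
    fix x assume x: "x \<in> T"
    have "inv g \<otimes> h \<otimes> x \<otimes> inv (inv g \<otimes> h) = ?c (h \<otimes> x \<otimes> inv h)"
      using g(1) h(1) x PG(3) by (auto simp: m_assoc inv_mult_group subset_iff)
    then show "inv g \<otimes> h \<otimes> x \<otimes> inv (inv g \<otimes> h) \<in> ?c ` P" using h(2)[OF x] by blast
  qed
qed

section \<open>Groups of total permutations\<close>

definition PG :: "('a \<Rightarrow> 'a) set \<Rightarrow> ('a \<Rightarrow> 'a) monoid" where
  "PG S = \<lparr>carrier = S, monoid.mult = (\<circ>), one = id\<rparr>"

lemma PG_simps [simp]: "carrier (PG S) = S" "f \<otimes>\<^bsub>PG S\<^esub> g = f \<circ> g" "\<one>\<^bsub>PG S\<^esub> = id"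
  by (simp_all add: PG_def)

abbreviation pinv :: "('a \<Rightarrow> 'a) \<Rightarrow> 'a \<Rightarrow> 'a" where
  "pinv \<equiv> inv_into UNIV"

text \<open>Permutations are total functions that fix every point outside \<open>\<Omega>\<close>.
  Products and inverses are then plain composition and \<open>inv_into UNIV\<close>, with no
  restriction to a carrier.\<close>

definition pgrp :: "'a set \<Rightarrow> ('a \<Rightarrow> 'a) set \<Rightarrow> bool" where
  "pgrp \<Omega> S \<longleftrightarrow> id \<in> S \<and> (\<forall>k\<in>S. k permutes \<Omega>) \<and> (\<forall>k\<in>S. \<forall>l\<in>S. k \<circ> l \<in> S) \<and> (\<forall>k\<in>S. pinv k \<in> S)"

lemma group_PG: 
  assumes "pgrp \<Omega> S" shows "group (PG S)"
proof (rule groupI)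
  fix x assume "x \<in> carrier (PG S)"
  then show "\<exists>y\<in>carrier (PG S). y \<otimes>\<^bsub>PG S\<^esub> x = \<one>\<^bsub>PG S\<^esub>"
    using assms permutes_inv_o(2) by (intro bexI[of _ "pinv x"]) (auto simp: pgrp_def)
qed (use assms in \<open>auto simp: pgrp_def comp_assoc\<close>)

lemma inv_PG: 
  assumes "pgrp \<Omega> S" "k \<in> S" shows "inv\<^bsub>PG S\<^esub> k = pinv k"
proof -
  interpret group "PG S" using group_PG assms(1) by blast
  have "pinv k \<otimes>\<^bsub>PG S\<^esub> k = \<one>\<^bsub>PG S\<^esub>"
    using assms permutes_inv_o(2) by (auto simp: pgrp_def)
  then show ?thesis using inv_equality[of "pinv k" k] assms by (simp add: pgrp_def)
qed

lemma subgroup_PG: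
  assumes K: "pgrp \<Omega> K" and S: "pgrp \<Omega> S" "S \<subseteq> K" shows "subgroup S (PG K)"
proof -
  interpret group "PG K" using group_PG K by blast
  show ?thesis
    by (rule subgroupI) (use S inv_PG[OF K] in \<open>auto simp: pgrp_def subset_iff\<close>)
qed

lemma pgrp_subgroup:
  assumes K: "pgrp \<Omega> K" and S: "subgroup S (PG K)" shows "pgrp \<Omega> S" "S \<subseteq> K"
proof -
  show "S \<subseteq> K" using subgroup.subset[OF S] by simp
  then show "pgrp \<Omega> S"
    using subgroup.one_closed[OF S] subgroup.m_closed[OF S] subgroup.m_inv_closed[OF S] inv_PG[OF K] K
    by (auto simp: pgrp_def subset_iff)
qed

lemma finite_pgrp: "finite \<Omega> \<Longrightarrow> pgrp \<Omega> S \<Longrightarrow> finite S"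
  by (rule finite_subset[OF _ finite_permutations[of \<Omega>]]) (auto simp: pgrp_def)

lemma pgrp_join:
  assumes fin: "finite \<Omega>" and q: "prime q" and K: "pgrp \<Omega> K"
    and S: "pgrp \<Omega> S" "S \<subseteq> K" "card S = q ^ s" and T: "pgrp \<Omega> T" "T \<subseteq> K" "card T = q ^ t"
  shows "\<exists>k\<in>K. \<exists>R n. pgrp \<Omega> R \<and> R \<subseteq> K \<and> card R = q ^ n \<and> S \<subseteq> R \<and> (\<forall>t\<in>T. k \<circ> t \<circ> pinv k \<in> R)"
proof -
  interpret group "PG K" using group_PG K by blast
  have "finite (carrier (PG K))" using finite_pgrp[OF fin K] by simp
  from p_subgroups_join[OF this q subgroup_PG[OF K S(1,2)] S(3) subgroup_PG[OF K T(1,2)] T(3)]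
  obtain k R n where "k \<in> K" "subgroup R (PG K)" "card R = q ^ n" "S \<subseteq> R"
    "\<forall>t\<in>T. k \<circ> t \<circ> inv\<^bsub>PG K\<^esub> k \<in> R" by auto
  then show ?thesis using pgrp_subgroup[OF K] inv_PG[OF K] by (intro bexI[of _ k] exI[of _ R] exI[of _ n]) auto
qed

lemma pgrp_fixed:
  assumes fin: "finite \<Omega>" and q: "prime q" and S: "pgrp \<Omega> S" "card S = q ^ n" and X: "finite X"
    and closed: "\<And>g x. g \<in> S \<Longrightarrow> x \<in> X \<Longrightarrow> act g x \<in> X"
    and one: "\<And>x. x \<in> X \<Longrightarrow> act id x = x"
    and mult: "\<And>g h x. g \<in> S \<Longrightarrow> h \<in> S \<Longrightarrow> x \<in> X \<Longrightarrow> act (g \<circ> h) x = act g (act h x)"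
  shows "[card {x \<in> X. \<forall>g\<in>S. act g x = x} = card X] (mod q)"
proof -
  interpret group "PG S" using group_PG S by blast
  show ?thesis
    using p_group_fixed_points[of q n X act, OF _ q X] S(2) closed one mult by (simp add: order_def)
qed

section \<open>Maps with cycles of prime length\<close>

lemma funpow_mod_fixed:
  assumes "(r ^^ q) x = x" shows "(r ^^ (n mod q)) x = (r ^^ n) x"
proof -
  have "(r ^^ (q * m)) x = x" for m
    by (induction m) (auto simp: assms funpow_add)
  then show ?thesis
    by (metis comp_apply funpow_add mod_mult_div_eq mult.commute)
qed

text \<open>If the iterates i < j agree at \<open>z\<close>, then applying f another q - i times
  gives the period j - i, which is invertible modulo \<open>q\<close>. So 1 is a period as well,
  against \<open>f z \<noteq> z\<close>.\<close>

lemma funpow_inj_prime: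
  assumes q: "prime q" and ij: "i < q" "j < q" "(f ^^ i) z = (f ^^ j) z" and "(f ^^ q) z = z" and "f z \<noteq> z"
  shows "i = j"
proof (rule ccontr)
  assume "i \<noteq> j"
  have *: False if ij: "i < j" "j < q" "(f ^^ i) z = (f ^^ j) z" for i j
  proof -
    have "(f ^^ (q - i + i)) z = (f ^^ (q - i + j)) z" using ij by (simp only: funpow_add comp_apply)
    moreover have "q - i + i = q" "q - i + j = (j - i) + q" using ij by auto
    ultimately have "(f ^^ q) z = (f ^^ (j - i)) ((f ^^ q) z)" by (metis comp_apply funpow_add)
    then have d: "(f ^^ (j - i)) z = z" using \<open>(f ^^ q) z = z\<close> by simp
    have "\<not> q dvd j - i" using ij by (auto dest: dvd_imp_le)
    then have "coprime (j - i) q" using q by (metis coprime_commute prime_imp_coprime)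
    then obtain n where n: "[(j - i) * n = 1] (mod q)" using cong_solve_coprime_nat[of "j - i" q] by auto
    have "(f ^^ ((j - i) * n)) z = z"
      by (induction n) (auto simp: d funpow_add)
    moreover have "(f ^^ ((j - i) * n)) z = (f ^^ 1) z"
      using funpow_mod_fixed[OF \<open>(f ^^ q) z = z\<close>, of "(j - i) * n"]
        funpow_mod_fixed[OF \<open>(f ^^ q) z = z\<close>, of 1] n by (simp add: cong_def)
    ultimately show False using \<open>f z \<noteq> z\<close> by simp
  qed
  show False using *[of i j] *[of j i] ij \<open>i \<noteq> j\<close> by (metis linorder_neqE_nat)
qed

text \<open>All cycles of either map have length \<open>q\<close>.\<close>

lemma semiregular_conjugate:
  fixes r :: "'x \<Rightarrow> 'x" and s :: "'y \<Rightarrow> 'y"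
  assumes q: "prime q" and "finite X" "finite Y" "card X = card Y"
    and "\<And>x. x \<in> X \<Longrightarrow> r x \<in> X \<and> (r ^^ q) x = x \<and> r x \<noteq> x"
    and "\<And>y. y \<in> Y \<Longrightarrow> s y \<in> Y \<and> (s ^^ q) y = y \<and> s y \<noteq> y"
  shows "\<exists>\<pi>. bij_betw \<pi> X Y \<and> (\<forall>x\<in>X. \<pi> (r x) = s (\<pi> x))"
  using assms(2-)
proof (induction "card X" arbitrary: X Y rule: less_induct)
  case less
  show ?case
  proof (cases "X = {}")
    case True
    then have "Y = {}" using less.prems(2,3) by simp
    then show ?thesis using True by (auto simp: bij_betw_def)
  next
    case False
    then obtain x where x: "x \<in> X" by blast
    then obtain y where y: "y \<in> Y" using less.prems(1-3) by (metis card_eq_0_iff ex_in_conv)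
    have pos: "0 < q" using q prime_gt_0_nat by blast
    \<comment> \<open>One cycle of each map is matched step by step; the complements are invariant
      and left to the induction hypothesis.\<close>
    define Ox Oy where "Ox = (\<lambda>i. (r ^^ i) x) ` {..<q}" and "Oy = (\<lambda>i. (s ^^ i) y) ` {..<q}"
    have injx: "inj_on (\<lambda>i. (r ^^ i) x) {..<q}"
      by (rule inj_onI) (use funpow_inj_prime[OF q, where f = r and z = x] less.prems(4)[OF x] in auto)
    have injy: "inj_on (\<lambda>i. (s ^^ i) y) {..<q}"
      by (rule inj_onI) (use funpow_inj_prime[OF q, where f = s and z = y] less.prems(5)[OF y] in auto)
    have powx: "(r ^^ i) z \<in> X" if "z \<in> X" for i z using that less.prems(4) by (induction i) auto
    have powy: "(s ^^ i) z \<in> Y" if "z \<in> Y" for i z using that less.prems(5) by (induction i) auto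
    have sub: "Ox \<subseteq> X" "Oy \<subseteq> Y" using powx powy x y by (auto simp: Ox_def Oy_def)
    have cards: "card Ox = q" "card Oy = q" using injx injy by (auto simp: Ox_def Oy_def card_image)
    have stepx: "r ((r ^^ i) x) = (r ^^ (Suc i mod q)) x" for i
      using funpow_mod_fixed[of q r x "Suc i"] less.prems(4)[OF x] by simp
    have stepy: "s ((s ^^ i) y) = (s ^^ (Suc i mod q)) y" for i
      using funpow_mod_fixed[of q s y "Suc i"] less.prems(5)[OF y] by simp
    have rback: "z \<in> Ox" if "z \<in> X" "r z \<in> Ox" for z
    proof -
      have "(r ^^ (q - 1)) (r z) = z"
        using less.prems(4)[OF that(1)] pos by (metis Suc_diff_1 comp_apply funpow_Suc_right)
      moreover have "(r ^^ i) w \<in> Ox" if "w \<in> Ox" for i w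
        using that by (induction i) (use stepx pos in \<open>auto simp: Ox_def\<close>)
      ultimately show ?thesis using that(2) by metis
    qed
    have sback: "z \<in> Oy" if "z \<in> Y" "s z \<in> Oy" for z
    proof -
      have "(s ^^ (q - 1)) (s z) = z"
        using less.prems(5)[OF that(1)] pos by (metis Suc_diff_1 comp_apply funpow_Suc_right)
      moreover have "(s ^^ i) w \<in> Oy" if "w \<in> Oy" for i w
        using that by (induction i) (use stepy pos in \<open>auto simp: Oy_def\<close>)
      ultimately show ?thesis using that(2) by metis
    qed
    have "card (X - Ox) = card X - q" "card (Y - Oy) = card Y - q"
      using sub cards less.prems(1,2) by (auto simp: card_Diff_subset finite_subset)
    moreover have "card X > 0" using x less.prems(1) by (auto simp: card_gt_0_iff)
    ultimately have "card (X - Ox) < card X" "card (X - Ox) = card (Y - Oy)" using pos less.prems(3) by auto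
    then obtain \<pi> where \<pi>: "bij_betw \<pi> (X - Ox) (Y - Oy)" "\<forall>z\<in>X - Ox. \<pi> (r z) = s (\<pi> z)"
      using less.hyps[of "X - Ox" "Y - Oy"] less.prems rback sback by blast
    define \<rho> where "\<rho> z = (s ^^ (inv_into {..<q} (\<lambda>i. (r ^^ i) x) z)) y" for z
    have \<rho>: "\<rho> ((r ^^ i) x) = (s ^^ i) y" if "i < q" for i
      using inv_into_f_f[OF injx, of i] that by (simp add: \<rho>_def)
    have "bij_betw \<rho> Ox Oy"
    proof -
      have "\<rho> ` Ox = Oy" unfolding Ox_def Oy_def image_image using \<rho> by (intro image_cong) auto
      moreover from this have "inj_on \<rho> Ox" using cards sub less.prems(1) by (metis eq_card_imp_inj_on finite_subset)
      ultimately show ?thesis by (simp add: bij_betw_def)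
    qed
    moreover have "\<rho> (r z) = s (\<rho> z)" if z: "z \<in> Ox" for z
    proof -
      obtain i where i: "i < q" "z = (r ^^ i) x" using z by (auto simp: Ox_def)
      show ?thesis using \<rho>[of i] \<rho>[of "Suc i mod q"] i pos by (simp add: stepx stepy)
    qed
    moreover have "r z \<in> Ox" if "z \<in> Ox" for z using that stepx pos by (auto simp: Ox_def)
    moreover have "r z \<in> X - Ox" if "z \<in> X - Ox" for z using that rback less.prems(4) by blast
    ultimately have "\<forall>z\<in>X. (\<lambda>z. if z \<in> Ox then \<rho> z else \<pi> z) (r z) = s ((\<lambda>z. if z \<in> Ox then \<rho> z else \<pi> z) z)"
      using \<pi>(2) by auto
    moreover have "bij_betw (\<lambda>z. if z \<in> Ox then \<rho> z else \<pi> z) (Ox \<union> (X - Ox)) (Oy \<union> (Y - Oy))"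
      by (rule bij_betw_disjoint_Un[OF \<open>bij_betw \<rho> Ox Oy\<close> \<pi>(1)]) blast+
    moreover have "Ox \<union> (X - Ox) = X" "Oy \<union> (Y - Oy) = Y" using sub by blast+
    ultimately show ?thesis by (intro exI[of _ "\<lambda>z. if z \<in> Ox then \<rho> z else \<pi> z"]) simp
  qed
qed

section \<open>Schur relations over \<open>E \<times> C\<^sub>p\<close>\<close>

declare split_paired_All [simp del] split_paired_Ex [simp del]

text \<open>The error is kept as an explicit multiple of \<open>q\<close>, since the identity is
  used over the integers and reduced only after coefficients have been read off.\<close>

lemma freshmans_dream_sum_mod:
  fixes f :: "'i \<Rightarrow> 'a::comm_ring_1"
  assumes "finite X" and q: "prime q"
  shows "\<exists>r. (\<Sum>h\<in>X. f h) ^ q = (\<Sum>h\<in>X. f h ^ q) + of_nat q * r"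
  using assms(1)
proof (induction X)
  case empty
  then show ?case using prime_gt_0_nat[OF q] by (auto simp: zero_power intro: exI[of _ 0])
next
  case (insert x X)
  have two: "\<exists>r. (a + b) ^ q = a ^ q + b ^ q + of_nat q * r" for a b :: 'a
  proof -
    let ?t = "\<lambda>k. of_nat (q choose k) * a ^ k * b ^ (q - k)"
    have "\<exists>r. ?t k = of_nat q * r" if "k \<in> {1..<q}" for k
    proof -
      have "q dvd (q choose k)" using that by (intro dvd_choose_prime) (use q in auto)
      then obtain c where "q choose k = q * c" by blast
      then show ?thesis by (intro exI[of _ "of_nat c * a ^ k * b ^ (q - k)"]) (simp add: mult.assoc)
    qed
    then obtain r where r: "\<And>k. k \<in> {1..<q} \<Longrightarrow> ?t k = of_nat q * r k" by metis
    have "{..q} = insert 0 (insert q {1..<q})" using prime_gt_0_nat[OF q] by auto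
    then have "(a + b) ^ q = ?t 0 + (?t q + (\<Sum>k\<in>{1..<q}. ?t k))"
      using prime_gt_0_nat[OF q] by (simp add: binomial_ring)
    also have "(\<Sum>k\<in>{1..<q}. ?t k) = of_nat q * (\<Sum>k\<in>{1..<q}. r k)"
      by (simp add: r sum_distrib_left)
    finally show ?thesis by (auto intro!: exI[of _ "\<Sum>k\<in>{1..<q}. r k"])
  qed
  obtain r where r: "(\<Sum>h\<in>X. f h) ^ q = (\<Sum>h\<in>X. f h ^ q) + of_nat q * r" using insert.IH by blast
  obtain s where s: "(f x + (\<Sum>h\<in>X. f h)) ^ q = f x ^ q + (\<Sum>h\<in>X. f h) ^ q + of_nat q * s"
    using two by blast
  show ?case
    by (rule exI[of _ "r + s"]) (use insert.hyps in \<open>simp add: r s algebra_simps\<close>)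
qed

lemma poly_mapping_sum_single:
  "(\<Sum>k\<in>Poly_Mapping.keys r. Poly_Mapping.single k (Poly_Mapping.lookup r k)) = r"
  by (rule poly_mapping_eqI)
    (simp add: lookup_sum lookup_single when_def in_keys_iff)

text \<open>\<open>rel\<close> is membership in the same basic set of a Schur ring over \<open>E \<times> C\<^sub>p\<close>, with \<open>C\<^sub>p\<close> replaced
  by \<open>\<int>\<close>; assumption \<open>conv\<close> says that the functions constant on classes are closed under convolution.\<close>

locale srel =
  fixes p :: nat and rel :: "'e::{finite, ab_group_add} \<times> int \<Rightarrow> 'e \<times> int \<Rightarrow> bool" (infix "\<asymp>" 50)
  assumes prime_p: "prime p" and odd_p: "odd p"
    and char2: "\<And>x::'e. x + x = 0"
    and rel_refl: "g \<asymp> g"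
    and rel_sym: "g \<asymp> h \<Longrightarrow> h \<asymp> g"
    and rel_trans [trans]: "g \<asymp> h \<Longrightarrow> h \<asymp> k \<Longrightarrow> g \<asymp> k"
    and rel_cong: "[i = j] (mod int p) \<Longrightarrow> (x, i) \<asymp> (x, j)"
    and rel_zero: "(0, 0) \<asymp> (x, i) \<Longrightarrow> x = 0 \<and> int p dvd i"
    and rel_neg: "g \<asymp> h \<Longrightarrow> - g \<asymp> - h"
    and conv: "\<lbrakk>\<And>g h. g \<asymp> h \<Longrightarrow> \<phi> g = \<phi> h; \<And>g h. g \<asymp> h \<Longrightarrow> \<psi> g = (\<psi> h :: int); g \<asymp> g'\<rbrakk> \<Longrightarrow>
      (\<Sum>h\<in>UNIV \<times> {0..<int p}. \<phi> h * \<psi> (g - h)) = (\<Sum>h\<in>UNIV \<times> {0..<int p}. \<phi> h * \<psi> (g' - h))"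
begin

section \<open>Arithmetic of E x C_p\<close>

abbreviation reps :: "('e \<times> int) set" where
  "reps \<equiv> UNIV \<times> {0..<int p}"

definition eqp :: "'e \<times> int \<Rightarrow> 'e \<times> int \<Rightarrow> bool" (infix "\<doteq>" 50) where
  "g \<doteq> h \<longleftrightarrow> fst g = fst h \<and> [snd g = snd h] (mod int p)"

text \<open>For odd \<open>m\<close> this is the m-th power map, because E has exponent 2. For even
  \<open>m\<close> it is the power map with the odd exponent m + p.\<close>

definition mu :: "int \<Rightarrow> 'e \<times> int \<Rightarrow> 'e \<times> int" where
  "mu m g = (fst g, m * snd g)"

lemma mu_simps [simp]: "mu m (x, i) = (x, m * i)" "fst (mu m g) = fst g" "snd (mu m g) = m * snd g"
  by (simp_all add: mu_def)

lemma mu_mu: "mu m (mu n g) = mu (m * n) g"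
  by (simp add: mu_def mult.assoc)

lemma mu_diff: "mu m (g - h) = mu m g - mu m h"
  by (cases g; cases h) (simp add: algebra_simps)

lemma p_pos: "0 < p" and p_gt1: "1 < p" and p_gt2: "2 < p"
proof -
  show "0 < p" "1 < p" using prime_p prime_gt_0_nat prime_gt_1_nat by auto
  then show "2 < p" using odd_p by (cases "p = 2") auto
qed

lemma neg_e [simp]: "- x = (x::'e)"
  using char2[of x] by (rule minus_unique)

lemma diff_e [simp]: "x - y = x + (y::'e)"
  by (metis diff_conv_add_uminus neg_e)

lemma add_cancel_e [simp]: "x + (x + y) = (y::'e)"
  by (simp add: char2 flip: add.assoc)

lemma eqp_refl [simp]: "g \<doteq> g" by (simp add: eqp_def)

lemma eqp_sym: "g \<doteq> h \<Longrightarrow> h \<doteq> g" by (auto simp: eqp_def cong_sym)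

lemma eqp_rel: "g \<doteq> h \<Longrightarrow> g \<asymp> h"
  by (cases g; cases h) (simp add: eqp_def rel_cong)

lemma eqp_mu: "g \<doteq> h \<Longrightarrow> mu m g \<doteq> mu m h"
  by (auto simp: eqp_def intro: cong_scalar_left)

lemma eqp_diff: "g \<doteq> g' \<Longrightarrow> h \<doteq> h' \<Longrightarrow> g - h \<doteq> g' - h'"
  by (auto simp: eqp_def intro: cong_diff)

lemma eqp_trans: "g \<doteq> h \<Longrightarrow> h \<doteq> k \<Longrightarrow> g \<doteq> k"
  by (auto simp: eqp_def intro: cong_trans)

lemma ex_rep: "\<exists>h\<in>reps. g \<doteq> h"
  by (rule bexI[of _ "(fst g, snd g mod int p)"]) (use p_pos in \<open>auto simp: eqp_def cong_def\<close>)

lemma reps_unique: "g \<in> reps \<Longrightarrow> h \<in> reps \<Longrightarrow> g \<doteq> h \<Longrightarrow> g = h"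
  by (cases g; cases h) (auto simp: eqp_def cong_def)

lemma coprime_iff: "coprime m (int p) \<longleftrightarrow> \<not> int p dvd m"
  using prime_p by (metis coprime_commute prime_imp_coprime prime_nat_int_transfer
      coprime_absorb_left not_prime_unit)

lemma ex_inverse: 
  assumes "coprime m (int p)" shows "\<exists>n. coprime n (int p) \<and> [n * m = 1] (mod int p)"
proof -
  obtain n where n: "[m * n = 1] (mod int p)" using assms cong_solve_coprime_int by blast
  then have "coprime (m * n) (int p)" by (metis cong_imp_coprime cong_sym coprime_1_left)
  then show ?thesis using n by (auto simp: mult.commute)
qed

lemma sum_affine:
  fixes f :: "int \<Rightarrow> int"
  assumes per: "\<And>i j. [i = j] (mod int p) \<Longrightarrow> f i = f j" and m: "coprime m (int p)"
  shows "(\<Sum>i\<in>{0..<int p}. f (a + m * i)) = (\<Sum>i\<in>{0..<int p}. f i)"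
proof -
  obtain n where n: "[n * m = 1] (mod int p)" using ex_inverse[OF m] by blast
  have n': "[m * n = 1] (mod int p)" using n by (simp add: mult.commute)
  have A: "n * ((a + m * i) mod int p - a) mod int p = i" if "i \<in> {0..<int p}" for i
  proof -
    have "[n * ((a + m * i) mod int p - a) = n * (a + m * i - a)] (mod int p)"
      by (intro cong_mult cong_diff) (auto simp: cong_def)
    also have "n * (a + m * i - a) = (n * m) * i" by simp
    also have "[(n * m) * i = 1 * i] (mod int p)" by (rule cong_scalar_right) fact
    finally show ?thesis using that by (simp add: cong_def)
  qed
  have B: "(a + m * (n * (i - a) mod int p)) mod int p = i" if "i \<in> {0..<int p}" for i
  proof -
    have "[a + m * (n * (i - a) mod int p) = a + m * (n * (i - a))] (mod int p)"
      by (intro cong_mult cong_add) (auto simp: cong_def)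
    also have "a + m * (n * (i - a)) = a + (m * n) * (i - a)" by (simp add: mult.assoc)
    also have "[a + (m * n) * (i - a) = a + 1 * (i - a)] (mod int p)"
      by (intro cong_add cong_scalar_right n') simp
    finally show ?thesis using that by (simp add: cong_def)
  qed
  show ?thesis
  proof (rule sum.reindex_bij_witness[of _ "\<lambda>i. n * (i - a) mod int p" "\<lambda>i. (a + m * i) mod int p"])
    fix i assume "i \<in> {0..<int p}"
    then show "n * ((a + m * i) mod int p - a) mod int p = i"
      "(a + m * (n * (i - a) mod int p)) mod int p = i" using A B by blast+
    show "f ((a + m * i) mod int p) = f (a + m * i)" by (rule per) (simp add: cong_def)
  qed (use p_pos in auto)
qed

lemma sum_reps: "(\<Sum>h\<in>reps. F h) = (\<Sum>x\<in>UNIV. \<Sum>i\<in>{0..<int p}. F (x, i))"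
  by (simp add: sum.cartesian_product split_def)

lemma sum_reps_mu:
  fixes F :: "'e \<times> int \<Rightarrow> int"
  assumes per: "\<And>g h. g \<doteq> h \<Longrightarrow> F g = F h" and m: "coprime m (int p)"
  shows "(\<Sum>h\<in>reps. F (mu m h)) = (\<Sum>h\<in>reps. F h)"
proof -
  have "(\<Sum>i\<in>{0..<int p}. F (x, m * i)) = (\<Sum>i\<in>{0..<int p}. F (x, i))" for x
    using sum_affine[of "\<lambda>i. F (x, i)" m 0] per m by (simp add: eqp_def)
  then show ?thesis by (simp add: sum_reps)
qed

subsection \<open>Power maps\<close>

definition rinv :: "('e \<times> int \<Rightarrow> int) \<Rightarrow> bool" where
  "rinv \<phi> \<longleftrightarrow> (\<forall>g h. g \<asymp> h \<longrightarrow> \<phi> g = \<phi> h)"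

definition closed :: "('e \<times> int) set \<Rightarrow> bool" where
  "closed C \<longleftrightarrow> (\<forall>g h. g \<asymp> h \<longrightarrow> g \<in> C \<longrightarrow> h \<in> C)"

lemma closed_iff: "closed C \<Longrightarrow> g \<asymp> h \<Longrightarrow> g \<in> C \<longleftrightarrow> h \<in> C"
  unfolding closed_def using rel_sym by blast

text \<open>The coefficient of \<open>g\<close> in the n-th power of the group ring element
  belonging to \<open>C\<close>.\<close>

primrec walks :: "('e \<times> int) set \<Rightarrow> nat \<Rightarrow> 'e \<times> int \<Rightarrow> int" where
  "walks C 0 g = of_bool (g \<doteq> (0, 0))"
| "walks C (Suc n) g = (\<Sum>h\<in>reps. of_bool (h \<in> C) * walks C n (g - h))"

lemma rel_zero_iff: "g \<asymp> (0, 0) \<longleftrightarrow> g \<doteq> (0, 0)"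
proof
  assume "g \<asymp> (0, 0)"
  from rel_zero[of "fst g" "snd g"] rel_sym[OF this] show "g \<doteq> (0, 0)"
    by (simp add: eqp_def cong_0_iff)
qed (rule eqp_rel)

lemma walks_rel: "closed C \<Longrightarrow> g \<asymp> h \<Longrightarrow> walks C n g = walks C n h"
proof (induction n arbitrary: g h)
  case 0
  then have "g \<asymp> (0, 0) \<longleftrightarrow> h \<asymp> (0, 0)" using rel_trans rel_sym by blast
  then show ?case by (simp add: rel_zero_iff)
next
  case (Suc n)
  show ?case unfolding walks.simps
    by (rule conv[OF _ _ Suc.prems(2)]) (use Suc closed_iff in auto)
qed

text \<open>The coefficient at \<open>g\<close> of the image in the group ring of E x C_p. Products
  are formed in the group ring of E x Z, a commutative ring in which binomial coefficients can be
  used, and exponents are read modulo \<open>p\<close> only here.\<close>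

definition val :: "'e \<times> int \<Rightarrow> ('e \<times> int \<Rightarrow>\<^sub>0 int) \<Rightarrow> int" where
  "val g r = (\<Sum>k\<in>Poly_Mapping.keys r. of_bool (k \<doteq> g) * Poly_Mapping.lookup r k)"

lemma val_superset:
  "finite S \<Longrightarrow> Poly_Mapping.keys r \<subseteq> S \<Longrightarrow>
    val g r = (\<Sum>k\<in>S. of_bool (k \<doteq> g) * Poly_Mapping.lookup r k)"
  unfolding val_def by (rule sum.mono_neutral_left) (auto simp: in_keys_iff)

lemma val_add: "val g (r + s) = val g r + val g s"
proof -
  let ?S = "Poly_Mapping.keys r \<union> Poly_Mapping.keys s"
  have "val g (r + s) = (\<Sum>k\<in>?S. of_bool (k \<doteq> g) * Poly_Mapping.lookup (r + s) k)"
    by (rule val_superset) (use Poly_Mapping.keys_add[of r s] in auto)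
  also have "\<dots> = val g r + val g s"
    by (simp add: val_superset[of ?S] lookup_add algebra_simps sum.distrib)
  finally show ?thesis .
qed

lemma val_zero [simp]: "val g 0 = 0" by (simp add: val_def)

lemma val_sum: "val g (sum f S) = (\<Sum>x\<in>S. val g (f x))"
  by (induction S rule: infinite_finite_induct) (auto simp: val_add)

lemma val_single: "val g (Poly_Mapping.single k c) = of_bool (k \<doteq> g) * c"
  by (cases "c = 0") (auto simp: val_def)

lemma val_of_nat: "val g (of_nat n * r) = int n * val g r"
  by (induction n) (auto simp: val_add algebra_simps)

lemma val_single_mult: "val g (Poly_Mapping.single h 1 * r) = val (g - h) r"
proof -
  have eq: "h + k \<doteq> g \<longleftrightarrow> k \<doteq> g - h" for k
    by (cases g; cases h; cases k) (auto simp: eqp_def cong_iff_dvd_diff algebra_simps char2)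
  have "Poly_Mapping.single h 1 * r = (\<Sum>k\<in>Poly_Mapping.keys r. Poly_Mapping.single (h + k) (Poly_Mapping.lookup r k))"
    by (subst (1) poly_mapping_sum_single[of r, symmetric]) (simp add: sum_distrib_left mult_single)
  then show ?thesis
    by (simp add: val_sum val_single eq) (simp add: val_def)
qed

lemma val_power:
  "val g ((\<Sum>h\<in>{h\<in>reps. h \<in> C}. Poly_Mapping.single h 1) ^ n) = walks C n g"
proof (induction n arbitrary: g)
  case 0
  have "val g 1 = of_bool ((0, 0) \<doteq> g)"
    using val_single[of g 0 1] unfolding single_one by (simp add: zero_prod_def)
  then show ?case using eqp_sym[of g "(0, 0)"] eqp_sym[of "(0, 0)" g] by auto
next
  case (Suc n)
  have "val g ((\<Sum>h\<in>{h\<in>reps. h \<in> C}. Poly_Mapping.single h 1) ^ Suc n) =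
      (\<Sum>h\<in>{h\<in>reps. h \<in> C}. walks C n (g - h))"
    by (simp add: sum_distrib_right val_sum val_single_mult Suc)
  also have "\<dots> = (\<Sum>h\<in>reps. of_bool (h \<in> C) * walks C n (g - h))"
    by (rule sum.mono_neutral_cong_left) auto
  finally show ?case by simp
qed

lemma single_power:
  assumes "odd n"
  shows "Poly_Mapping.single h (1::int) ^ n = Poly_Mapping.single (mu (int n) h) 1"
proof -
  have "Poly_Mapping.single h (1::int) ^ n = Poly_Mapping.single (if even n then 0 else fst h, int n * snd h) 1"
  proof (induction n)
    case 0
    then show ?case using single_one[where ?'a = "'e \<times> int"] by (simp add: zero_prod_def)
  next
    case (Suc n)
    have "h + (if even n then 0 else fst h, int n * snd h) =
        (if even (Suc n) then 0 else fst h, int (Suc n) * snd h)"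
      by (simp add: prod_eq_iff char2 distrib_right)
    then show ?case
      using Suc by (simp only: power_Suc mult_single mult_1_left)
  qed
  then show ?thesis using assms by (simp add: mu_def)
qed

text \<open>Schur's theorem on power maps modulo a prime.\<close>

lemma power_map_mod:
  assumes C: "closed C" and q: "prime q" "odd q" and rel: "g \<asymp> g'"
  shows "[int (card {h\<in>reps. h \<in> C \<and> mu (int q) h \<doteq> g}) = int (card {h\<in>reps. h \<in> C \<and> mu (int q) h \<doteq> g'})] (mod int q)"
proof -
  let ?X = "{h\<in>reps. h \<in> C}"
  let ?s = "\<lambda>h. Poly_Mapping.single h (1::int)"
  obtain r where r: "(\<Sum>h\<in>?X. ?s h) ^ q = (\<Sum>h\<in>?X. ?s h ^ q) + of_nat q * r"
    using freshmans_dream_sum_mod[of ?X q ?s] q by auto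
  have *: "walks C q g = int (card {h\<in>reps. h \<in> C \<and> mu (int q) h \<doteq> g}) + int q * val g r" for g
  proof -
    have "walks C q g = (\<Sum>h\<in>?X. of_bool (mu (int q) h \<doteq> g)) + int q * val g r"
      by (simp only: val_power[symmetric] r val_add val_sum val_of_nat single_power[OF q(2)] val_single mult_1_right)
    also have "(\<Sum>h\<in>?X. of_bool (mu (int q) h \<doteq> g) :: int) = int (card (?X \<inter> {h. mu (int q) h \<doteq> g}))"
      by (subst sum_of_bool_eq) auto
    also have "?X \<inter> {h. mu (int q) h \<doteq> g} = {h\<in>reps. h \<in> C \<and> mu (int q) h \<doteq> g}" by auto
    finally show ?thesis .
  qed
  have "[walks C q g = walks C q g'] (mod int q)" using walks_rel[OF C rel] by simp
  then show ?thesis unfolding * by (simp add: cong_def)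
qed

text \<open>Since \<open>mu q\<close> is injective, exactly one element of the class of
  \<open>h\<close> is sent to \<open>mu q h\<close>. The corresponding number for \<open>g\<close>
  is then 1 modulo \<open>q\<close>, in particular not 0.\<close>

lemma mu_class_prime:
  assumes q: "prime q" "odd q" "q \<noteq> p" and rel: "mu (int q) h \<asymp> g"
  shows "\<exists>h'. h' \<asymp> h \<and> g \<doteq> mu (int q) h'"
proof -
  have cop: "coprime (int q) (int p)" using q prime_p by (simp add: primes_coprime)
  let ?C = "{h'. h' \<asymp> h}"
  have C: "closed ?C" unfolding closed_def using rel_trans rel_sym by blast
  have inj: "h1 \<doteq> h2" if "mu (int q) h1 \<doteq> mu (int q) h2" for h1 h2
    using that cop by (auto simp: eqp_def cong_mult_lcancel)
  obtain h0 where h0: "h0 \<in> reps" "h \<doteq> h0" using ex_rep by blast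
  have "{h'\<in>reps. h' \<in> ?C \<and> mu (int q) h' \<doteq> mu (int q) h} = {h0}"
  proof (intro equalityI subsetI)
    fix h' assume "h' \<in> {h'\<in>reps. h' \<in> ?C \<and> mu (int q) h' \<doteq> mu (int q) h}"
    then have "h' \<doteq> h0" "h' \<in> reps" using inj h0 eqp_trans by blast+
    then show "h' \<in> {h0}" using reps_unique h0 by blast
  qed (use h0 eqp_mu eqp_sym eqp_rel in auto)
  then have "[1 = int (card {h'\<in>reps. h' \<in> ?C \<and> mu (int q) h' \<doteq> g})] (mod int q)"
    using power_map_mod[OF C q(1,2) rel] by simp
  moreover have "\<not> [1 = 0] (mod int q)" using prime_gt_1_nat[OF q(1)] by (simp add: cong_def)
  ultimately have "card {h'\<in>reps. h' \<in> ?C \<and> mu (int q) h' \<doteq> g} \<noteq> 0" by (metis of_nat_0)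
  then have "{h'\<in>reps. h' \<in> ?C \<and> mu (int q) h' \<doteq> g} \<noteq> {}" by (metis card.empty)
  then show ?thesis using eqp_sym by blast
qed

text \<open>An odd exponent prime to \<open>p\<close> is a product of odd primes different from
  \<open>p\<close>; their power maps are applied one after the other.\<close>

lemma mu_class:
  assumes "odd n" "coprime n p" "mu (int n) h \<asymp> g"
  shows "\<exists>h'. h' \<asymp> h \<and> g \<doteq> mu (int n) h'"
  using assms
proof (induction n arbitrary: h g rule: less_induct)
  case (less n)
  show ?case
  proof (cases "n = 1")
    case True
    then have "mu (int n) k = k" for k by (simp add: mu_def)
    then show ?thesis using less.prems(3) rel_sym eqp_refl by metis
  next
    case False
    then obtain q where q: "prime q" "q dvd n" using prime_factor_nat by blast
    then obtain k where n: "n = q * k" by blast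
    have k: "k < n" "odd k" "odd q" "coprime k p" "q \<noteq> p"
      using less.prems n prime_gt_1_nat[OF q(1)] prime_p by (auto simp: odd_pos)
    have "mu (int q) (mu (int k) h) \<asymp> g" using less.prems(3) by (simp add: mu_mu n)
    then obtain h1 where h1: "h1 \<asymp> mu (int k) h" "g \<doteq> mu (int q) h1"
      using mu_class_prime[OF q(1)] k by blast
    then obtain h2 where h2: "h2 \<asymp> h" "h1 \<doteq> mu (int k) h2"
      using less.IH[OF k(1,2,4)] rel_sym by blast
    have "g \<doteq> mu (int q) (mu (int k) h2)" using h1 h2 eqp_mu eqp_trans by blast
    then show ?thesis using h2(1) by (auto simp: mu_mu n)
  qed
qed

text \<open>With n' inverse to n modulo \<open>p\<close>, the map \<open>mu n'\<close> takes
  \<open>mu n g\<close> into the class of \<open>h\<close>. Hence \<open>h\<close> comes under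
  \<open>mu n'\<close> from an element of the class of \<open>mu n g\<close>, and that element is
  \<open>mu n h\<close>.\<close>

lemma mu_rel:
  assumes m: "coprime m (int p)" and gh: "g \<asymp> h"
  shows "mu m g \<asymp> mu m h"
proof -
  \<comment> \<open>Only odd exponents act trivially on E. As \<open>p\<close> is odd, one of r and
    r + p is odd.\<close>
  have odd_rep: "\<exists>n::nat. odd n \<and> coprime n p \<and> [int n = m] (mod int p)" if "coprime m (int p)" for m
  proof -
    define r where "r = nat (m mod int p)"
    have r: "[int r = m] (mod int p)" using p_pos by (simp add: r_def cong_def)
    have "[int (r + p) = m] (mod int p)" using r by (simp add: cong_def)
    moreover have "coprime n p" if "[int n = m] (mod int p)" for n
      using that \<open>coprime m (int p)\<close> by (metis cong_imp_coprime cong_sym coprime_int_iff)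
    ultimately show ?thesis using r odd_p by (cases "odd r") (auto intro: exI[of _ r] exI[of _ "r + p"])
  qed
  obtain n where n: "odd n" "coprime n p" "[int n = m] (mod int p)" using odd_rep[OF m] by blast
  obtain m' where m': "coprime m' (int p)" "[m' * m = 1] (mod int p)" using ex_inverse[OF m] by blast
  obtain n' where n': "odd n'" "coprime n' p" "[int n' = m'] (mod int p)" using odd_rep[OF m'(1)] by blast
  have nn: "[int n' * int n = 1] (mod int p)"
    using cong_mult[OF n'(3) n(3)] m'(2) cong_trans by blast
  have id: "mu (int n') (mu (int n) k) \<doteq> k" "mu (int n) (mu (int n') k) \<doteq> k" for k
    using cong_scalar_right[OF nn, of "snd k"] by (auto simp: eqp_def mult.assoc mult.left_commute)
  have "mu (int n') (mu (int n) g) \<asymp> h" using id(1) eqp_rel gh rel_trans by blast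
  then obtain h1 where h1: "h1 \<asymp> mu (int n) g" "h \<doteq> mu (int n') h1"
    using mu_class[OF n'(1,2)] by blast
  have "mu (int n) h \<doteq> h1" using eqp_mu[OF h1(2)] id(2) eqp_trans by blast
  then have "mu (int n) h \<asymp> mu (int n) g" using h1 eqp_rel rel_trans by blast
  moreover have "mu m k \<asymp> mu (int n) k" for k
    by (rule eqp_rel) (auto simp: eqp_def intro: cong_scalar_right cong_sym[OF n(3)])
  ultimately show ?thesis using rel_trans rel_sym by blast
qed

subsection \<open>Rational classes\<close>

text \<open>Classes merged under all power maps prime to \<open>p\<close>: the traces of the basic
  sets.\<close>

definition rat :: "'e \<times> int \<Rightarrow> 'e \<times> int \<Rightarrow> bool" (infix "\<bowtie>" 50) where
  "g \<bowtie> h \<longleftrightarrow> (\<exists>m. coprime m (int p) \<and> g \<asymp> mu m h)"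

lemma mu_1 [simp]: "mu 1 g = g" by (simp add: mu_def)

lemma rel_rat: "g \<asymp> h \<Longrightarrow> g \<bowtie> h"
  unfolding rat_def by (rule exI[of _ 1]) simp

lemma rat_mu: "coprime m (int p) \<Longrightarrow> mu m g \<bowtie> g"
  unfolding rat_def using rel_refl by blast

lemma rat_trans: 
  assumes "g \<bowtie> h" "h \<bowtie> k" shows "g \<bowtie> k"
proof -
  obtain m n where "coprime m (int p)" "g \<asymp> mu m h" "coprime n (int p)" "h \<asymp> mu n k"
    using assms unfolding rat_def by blast
  then have "g \<asymp> mu (m * n) k" "coprime (m * n) (int p)"
    using mu_rel rel_trans by (auto simp flip: mu_mu)
  then show ?thesis unfolding rat_def by blast
qed

lemma rat_sym: 
  assumes "g \<bowtie> h" shows "h \<bowtie> g"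
proof -
  obtain m where m: "coprime m (int p)" "g \<asymp> mu m h" using assms unfolding rat_def by blast
  obtain n where n: "coprime n (int p)" "[n * m = 1] (mod int p)" using ex_inverse[OF m(1)] by blast
  have "mu n (mu m h) \<doteq> h"
    using cong_scalar_right[OF n(2), of "snd h"] by (auto simp: eqp_def mult.assoc)
  then have "h \<asymp> mu n g" using mu_rel[OF n(1) m(2)] eqp_rel rel_trans rel_sym by blast
  then show ?thesis using n unfolding rat_def by blast
qed

text \<open>Power maps fix \<open>(u, 0)\<close>, so a rational class containing such an element is
  a single class. All later equivalences without power maps are obtained from this or from
  \<open>rel_column\<close>.\<close>

lemma rat_zero_rel: "g \<bowtie> (u, 0) \<Longrightarrow> g \<asymp> (u, 0)"
  unfolding rat_def by auto

lemma rat_unit: "\<not> int p dvd i \<Longrightarrow> (x, i) \<bowtie> g \<longleftrightarrow> (x, 1) \<bowtie> g"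
proof -
  assume "\<not> int p dvd i"
  then have "(x, i) \<bowtie> (x, 1)" using rat_mu[of i "(x, 1)"] coprime_iff by simp
  then show ?thesis using rat_trans rat_sym by blast
qed

lemma rat_dvd: "int p dvd i \<Longrightarrow> (x, i) \<bowtie> g \<longleftrightarrow> (x, 0) \<bowtie> g"
proof -
  assume "int p dvd i"
  then have "(x, i) \<bowtie> (x, 0)" by (intro rel_rat rel_cong) (simp add: cong_0_iff)
  then show ?thesis using rat_trans rat_sym by blast
qed

text \<open>The automorphism \<open>mu m\<close> permutes the summands and preserves both functions,
  so the rational classes behave like a Schur relation of their own.\<close>

lemma conv_rat:
  fixes \<phi> \<psi> :: "'e \<times> int \<Rightarrow> int"
  assumes \<phi>: "\<And>g h. g \<bowtie> h \<Longrightarrow> \<phi> g = \<phi> h" and \<psi>: "\<And>g h. g \<bowtie> h \<Longrightarrow> \<psi> g = \<psi> h" and "g \<bowtie> g'"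
  shows "(\<Sum>h\<in>reps. \<phi> h * \<psi> (g - h)) = (\<Sum>h\<in>reps. \<phi> h * \<psi> (g' - h))"
proof -
  obtain m where m: "coprime m (int p)" "g \<asymp> mu m g'" using assms(3) unfolding rat_def by blast
  have per: "\<phi> h * \<psi> (mu m g' - h) = \<phi> h' * \<psi> (mu m g' - h')" if "h \<doteq> h'" for h h'
    using \<phi>[OF rel_rat[OF eqp_rel[OF that]]]
      \<psi>[OF rel_rat[OF eqp_rel[OF eqp_diff[OF eqp_refl that, of "mu m g'"]]]] by simp
  have "(\<Sum>h\<in>reps. \<phi> h * \<psi> (g - h)) = (\<Sum>h\<in>reps. \<phi> h * \<psi> (mu m g' - h))"
    by (rule conv[OF _ _ m(2)]) (use \<phi> \<psi> rel_rat in blast)+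
  also have "\<dots> = (\<Sum>h\<in>reps. \<phi> (mu m h) * \<psi> (mu m g' - mu m h))"
    by (rule sum_reps_mu[symmetric, where F = "\<lambda>h. \<phi> h * \<psi> (mu m g' - h)", OF per m(1)])
  also have "\<dots> = (\<Sum>h\<in>reps. \<phi> h * \<psi> (g' - h))"
    using \<phi>[OF rat_mu[OF m(1)]] \<psi>[OF rat_mu[OF m(1)]] by (simp flip: mu_diff)
  finally show ?thesis .
qed

definition cnt :: "('e \<times> int) set \<Rightarrow> 'e \<Rightarrow> nat" where
  "cnt C x = card {i \<in> {0..<int p}. (x, i) \<in> C}"

text \<open>The congruence for the prime \<open>p\<close> itself: \<open>mu p\<close> sends
  everything over \<open>x\<close> to \<open>(x, 0)\<close> and hits no element whose second
  coordinate is a unit.\<close>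

lemma cnt_mod:
  assumes C: "closed C" and rel: "(x, 0) \<asymp> (y, j)"
  shows "[int (cnt C x) = (if int p dvd j then int (cnt C y) else 0)] (mod int p)"
proof -
  have *: "card {h\<in>reps. h \<in> C \<and> mu (int p) h \<doteq> (y, j)} = (if int p dvd j then cnt C y else 0)" for y j
  proof (cases "int p dvd j")
    case True
    have "{h\<in>reps. h \<in> C \<and> mu (int p) h \<doteq> (y, j)} = Pair y ` {i \<in> {0..<int p}. (y, i) \<in> C}"
      using True by (auto simp: eqp_def cong_def mod_eq_0_iff_dvd)
    then show ?thesis using True by (simp add: cnt_def card_image inj_on_def)
  next
    case False
    then have "{h\<in>reps. h \<in> C \<and> mu (int p) h \<doteq> (y, j)} = {}"
      by (auto simp: eqp_def cong_def mod_eq_0_iff_dvd)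
    then show ?thesis using False by simp
  qed
  show ?thesis
    using power_map_mod[OF C prime_p odd_p rel] by (simp add: * of_nat_eq_0_iff split: if_splits)
qed

lemma rel_iff: "g \<asymp> h \<Longrightarrow> g \<asymp> k \<longleftrightarrow> h \<asymp> k"
  using rel_trans rel_sym by blast

lemma rat_iff: "g \<bowtie> h \<Longrightarrow> g \<bowtie> k \<longleftrightarrow> h \<bowtie> k"
  using rat_trans rat_sym by blast

text \<open>\<open>H1\<close> is the largest subgroup of the 2-part that is a union of classes.\<close>

definition H1 :: "'e set" where
  "H1 = {x. \<forall>y j. (x, 0) \<asymp> (y, j) \<longrightarrow> int p dvd j}"

definition low :: "'e \<times> int \<Rightarrow> bool" where
  "low g \<longleftrightarrow> fst g \<in> H1 \<and> int p dvd snd g"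

lemma low_rel: 
  assumes "g \<asymp> h" "low g" shows "low h"
proof -
  obtain x i y j where g: "g = (x, i)" and h: "h = (y, j)" by (cases g; cases h)
  have "(x, 0) \<asymp> (x, i)" using assms by (intro rel_cong) (auto simp: g low_def cong_def mod_eq_0_iff_dvd)
  then have x: "(x, 0) \<asymp> (y, j)" using assms(1) rel_trans unfolding g h by blast
  then have j: "int p dvd j" using assms(2) by (auto simp: g low_def H1_def)
  then have "(y, 0) \<asymp> (y, j)" by (intro rel_cong) (auto simp: cong_def mod_eq_0_iff_dvd)
  then have "(x, 0) \<asymp> (y, 0)" using x rel_trans rel_sym by blast
  moreover have "x \<in> H1" using assms(2) by (simp add: g low_def)
  ultimately have "y \<in> H1" using rel_trans unfolding H1_def by blast
  then show ?thesis using j by (simp add: h low_def)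
qed

lemma low_rat: "g \<bowtie> h \<Longrightarrow> low g \<longleftrightarrow> low h"
proof -
  assume "g \<bowtie> h"
  then obtain m where m: "coprime m (int p)" "g \<asymp> mu m h" unfolding rat_def by blast
  have "low (mu m h) \<longleftrightarrow> low h"
    using m(1) prime_p by (auto simp: low_def coprime_iff prime_dvd_mult_iff)
  then show ?thesis using low_rel m(2) rel_sym by blast
qed

lemma zero_H1 [simp]: "0 \<in> H1"
  using rel_zero unfolding H1_def by blast

text \<open>The number of ways to write an element as a sum from the two classes is constant on
  classes, and it is positive at \<open>h1 + h2\<close>.\<close>

lemma rel_sum:
  assumes "h1 + h2 \<asymp> g"
  shows "\<exists>h1' h2'. h1' \<asymp> h1 \<and> h2' \<asymp> h2 \<and> g = h1' + h2'"
proof -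
  let ?c = "\<lambda>g. \<Sum>h\<in>reps. of_bool (h \<asymp> h1) * (of_bool (g - h \<asymp> h2) :: int)"
  have eq: "?c (h1 + h2) = ?c g"
    by (rule conv[OF _ _ assms]) (subst rel_iff, assumption, rule refl)+
  obtain h where h: "h \<in> reps" "h1 \<doteq> h" using ex_rep by blast
  have "h1 + h2 - h \<doteq> h2" using eqp_diff[OF eqp_refl h(2), of "h1 + h2"] eqp_sym by simp
  then have "1 = (of_bool (h \<asymp> h1) * of_bool (h1 + h2 - h \<asymp> h2) :: int)"
    using eqp_rel eqp_sym[OF h(2)] by simp
  also have "\<dots> \<le> ?c (h1 + h2)"
    by (rule member_le_sum[where f = "\<lambda>h. of_bool (h \<asymp> h1) * of_bool (h1 + h2 - h \<asymp> h2)"])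
      (use h in auto)
  finally have "?c g \<noteq> 0" using eq by linarith
  then obtain h' where "of_bool (h' \<asymp> h1) * (of_bool (g - h' \<asymp> h2) :: int) \<noteq> 0"
    by (meson sum.neutral)
  then have "h' \<asymp> h1" "g - h' \<asymp> h2" by (auto split: if_splits)
  then show ?thesis by (intro exI[of _ h'] exI[of _ "g - h'"]) simp
qed

lemma add_H1: 
  assumes "x \<in> H1" "y \<in> H1" shows "x + y \<in> H1"
proof -
  have "int p dvd j" if "(x + y, 0) \<asymp> (w, j)" for w j
  proof -
    have "(x, 0) + (y, 0) \<asymp> (w, j)" using that by simp
    from rel_sum[OF this] obtain h k where h: "h \<asymp> (x, 0)" "k \<asymp> (y, 0)" "(w, j) = h + k" by blast
    have "low h" "low k"
      using low_rel[OF rel_sym[OF h(1)]] low_rel[OF rel_sym[OF h(2)]] assms by (auto simp: low_def)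
    then show ?thesis using h(3) by (cases h; cases k) (auto simp: low_def)
  qed
  then show ?thesis unfolding H1_def by blast
qed

section \<open>Projections of rational classes to E\<close>

lemma add_H1_iff: "x \<in> H1 \<Longrightarrow> x + y \<in> H1 \<longleftrightarrow> y \<in> H1"
  using add_H1 add_cancel_e by metis

definition Zs :: "'e \<times> int \<Rightarrow> 'e set" where
  "Zs g = {x. (x, 1) \<bowtie> g}"

text \<open>Over \<open>x\<close> outside \<open>H1\<close> the rational class of \<open>g\<close>
  has p - 1 or no elements with a unit as second coordinate and at most one with 0. Their total
  number is divisible by \<open>p\<close>, because \<open>(x, 0)\<close> is related to an element
  with a unit; so both kinds occur or neither does.\<close>

lemma rat_zero_iff:
  assumes "\<not> low g"
  shows "(x, 0) \<bowtie> g \<longleftrightarrow> x \<in> Zs g \<and> x \<notin> H1"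
proof (cases "x \<in> H1")
  case True
  then have "low (x, 0)" by (simp add: low_def)
  then show ?thesis using low_rat assms True by blast
next
  case False
  then obtain y j where yj: "(x, 0) \<asymp> (y, j)" "\<not> int p dvd j" unfolding H1_def by blast
  let ?C = "{h. h \<bowtie> g}"
  have "closed ?C" unfolding closed_def using rel_rat rat_trans rel_sym by blast
  from cnt_mod[OF this yj(1)] yj(2) have "int p dvd int (cnt ?C x)" by (simp add: cong_0_iff)
  moreover have "int (cnt ?C x) = (int p - 1) * of_bool (x \<in> Zs g) + of_bool ((x, 0) \<bowtie> g)"
  proof -
    have "{i \<in> {0..<int p}. (x, i) \<in> ?C} =
        (if x \<in> Zs g then {1..<int p} else {}) \<union> (if (x, 0) \<bowtie> g then {0} else {})"
    proof (intro Set.set_eqI)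
      fix i
      show "i \<in> {i \<in> {0..<int p}. (x, i) \<in> ?C} \<longleftrightarrow>
        i \<in> (if x \<in> Zs g then {1..<int p} else {}) \<union> (if (x, 0) \<bowtie> g then {0} else {})"
      proof (cases "i \<in> {1..<int p}")
        case True
        then have "\<not> int p dvd i" using zdvd_not_zless by auto
        then show ?thesis using True rat_unit[of i x g] by (auto simp: Zs_def)
      next
        case False
        then show ?thesis using p_pos by (cases "i = 0") auto
      qed
    qed
    then show ?thesis using p_pos by (auto simp: cnt_def)
  qed
  ultimately have "x \<in> Zs g \<longleftrightarrow> (x, 0) \<bowtie> g"
    using p_gt2 by (cases "x \<in> Zs g"; cases "(x, 0) \<bowtie> g") (auto dest: zdvd_imp_le)
  then show ?thesis using False by blast
qed

abbreviation Z0 :: "'e set" where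
  "Z0 \<equiv> Zs (0, 1)"

lemma not_low_unit [simp]: "\<not> low (x, 1)"
  using p_gt1 by (simp add: low_def)

lemma self_Zs: "\<not> low (x, i) \<Longrightarrow> x \<in> Zs (x, i)"
proof (cases "int p dvd i")
  case True
  moreover have "(x, i) \<bowtie> (x, i)" by (rule rel_rat) (rule rel_refl)
  ultimately show "\<not> low (x, i) \<Longrightarrow> ?thesis" using rat_dvd rat_zero_iff by blast
next
  case False
  moreover have "(x, i) \<bowtie> (x, i)" by (rule rel_rat) (rule rel_refl)
  ultimately show ?thesis using rat_unit[of i x "(x, i)"] by (simp add: Zs_def)
qed

text \<open>Hence a rational class that is not low is determined by its projection, and questions
  about it become questions about subsets of E.\<close>

lemma rat_iff_Zs:
  assumes "\<not> low g" "\<not> low (y, j)"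
  shows "(y, j) \<bowtie> g \<longleftrightarrow> y \<in> Zs g"
proof (cases "int p dvd j")
  case True
  then have "y \<notin> H1" using assms(2) by (simp add: low_def)
  then show ?thesis using rat_dvd[OF True] rat_zero_iff[OF assms(1)] by blast
next
  case False
  then show ?thesis using rat_unit[of j y g] by (simp add: Zs_def)
qed

text \<open>The coefficients of the square of a rational class are maximal at the elements that
  stabilise its projection to the 2-part, and they are constant on the class of \<open>(0, 1)\<close>.\<close>

lemma Zs_add:
  assumes z: "z \<in> Z0" and g: "\<not> low g" and x: "x \<in> Zs g"
  shows "z + x \<in> Zs g"
proof -
  define Z where "Z w = (of_bool (w \<in> Zs g) :: int)" for w
  define Z' where "Z' w = (of_bool ((w, 0) \<bowtie> g) :: int)" for w
  let ?\<phi> = "\<lambda>h. of_bool (h \<bowtie> g) :: int"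
  have Z'Z: "Z' w \<le> Z w" for w using rat_zero_iff[OF g, of w] by (auto simp: Z_def Z'_def)
  have Z01: "0 \<le> Z w" "Z w \<le> 1" "0 \<le> Z' w" "Z' w \<le> 1" for w by (auto simp: Z_def Z'_def)
  let ?A = "\<lambda>z. \<Sum>w\<in>UNIV. Z w * Z (z + w)" and ?B = "\<lambda>z. \<Sum>w\<in>UNIV. Z' w * Z (z + w)"
  \<comment> \<open>In the products at i and 1 - i only i = 0 and i = 1 involve a second coordinate
    divisible by \<open>p\<close>; the other p - 2 values of i all contribute the same.\<close>
  have c: "(\<Sum>h\<in>reps. ?\<phi> h * ?\<phi> ((v, 1) - h)) = (int p - 2) * ?A v + 2 * ?B v" for v
  proof -
    have inner: "(\<Sum>i\<in>{0..<int p}. ?\<phi> (w, i) * ?\<phi> ((v, 1) - (w, i))) =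
        Z' w * Z (v + w) + Z w * Z' (v + w) + (int p - 2) * (Z w * Z (v + w))" for w
    proof -
      define F where "F i = ?\<phi> (w, i) * ?\<phi> ((v, 1) - (w, i))" for i
      have "F i = Z w * Z (v + w)" if "i \<in> {2..<int p}" for i
      proof -
        have "\<not> int p dvd i" "\<not> int p dvd i - 1" using that zdvd_not_zless by auto
        then have "\<not> int p dvd i" "\<not> int p dvd 1 - i" by (auto simp: dvd_diff_commute)
        then show ?thesis using rat_unit[of i w g] rat_unit[of "1 - i" "v + w" g] by (simp add: F_def Z_def Zs_def)
      qed
      then have "(\<Sum>i\<in>{2..<int p}. F i) = (int p - 2) * (Z w * Z (v + w))"
        using p_gt2 by (simp add: of_nat_diff)
      moreover have "F 0 = Z' w * Z (v + w)" "F 1 = Z w * Z' (v + w)"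
        by (simp_all add: F_def Z_def Z'_def Zs_def)
      moreover have "{0..<int p} = insert 0 (insert 1 {2..<int p})" using p_gt2 by auto
      then have "(\<Sum>i\<in>{0..<int p}. F i) = F 0 + (F 1 + (\<Sum>i\<in>{2..<int p}. F i))" by simp
      ultimately show ?thesis unfolding F_def by simp
    qed
    have swap: "(\<Sum>w\<in>UNIV. Z w * Z' (v + w)) = ?B v"
      by (rule sum.reindex_bij_witness[of _ "\<lambda>w. v + w" "\<lambda>w. v + w"]) auto
    have "(\<Sum>h\<in>reps. ?\<phi> h * ?\<phi> ((v, 1) - h)) = (\<Sum>w\<in>UNIV. \<Sum>i\<in>{0..<int p}. ?\<phi> (w, i) * ?\<phi> ((v, 1) - (w, i)))"
      by (rule sum_reps)
    also have "\<dots> = ?B v + (\<Sum>w\<in>UNIV. Z w * Z' (v + w)) + (int p - 2) * ?A v"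
      unfolding inner by (simp add: sum.distrib sum_distrib_left)
    finally show ?thesis by (simp add: swap)
  qed
  have "(z, 1) \<bowtie> (0, 1)" using z by (simp add: Zs_def)
  \<comment> \<open>Both sums are largest at 0 and p - 2 is positive, so equality of the two totals
    forces \<open>?A z = ?A 0\<close> and then equality in each summand.\<close>
  then have "(int p - 2) * ?A z + 2 * ?B z = (int p - 2) * ?A 0 + 2 * ?B 0"
    unfolding c[symmetric] by (rule conv_rat[rotated 2]) (subst rat_iff, assumption, rule refl)+
  moreover have "?B z \<le> ?B 0"
  proof (rule sum_mono)
    fix w show "Z' w * Z (z + w) \<le> Z' w * Z (0 + w)"
      using Z'Z[of w] Z01[of w] Z01[of "z + w"] by (auto simp: Z_def Z'_def)
  qed
  moreover have le: "Z w * Z (z + w) \<le> Z w * Z (0 + w)" for w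
    by (auto simp: Z_def)
  then have "?A z \<le> ?A 0" by (intro sum_mono)
  ultimately have "(int p - 2) * ?A 0 \<le> (int p - 2) * ?A z" by linarith
  then have "?A 0 \<le> ?A z" using p_gt2 by (simp add: mult_le_cancel_left)
  then have "(\<Sum>w\<in>UNIV. Z w * Z (0 + w) - Z w * Z (z + w)) = 0"
    using \<open>?A z \<le> ?A 0\<close> by (simp add: sum_subtractf)
  then have "Z x * Z (0 + x) - Z x * Z (z + x) = 0"
    using le by (subst (asm) sum_nonneg_eq_0_iff) auto
  then show ?thesis using x by (auto simp: Z_def split: if_splits)
qed

lemma zero_Z0 [simp]: "0 \<in> Z0"
  unfolding Zs_def using rel_rat[OF rel_refl] by blast

lemma Z0_add: "x \<in> Z0 \<Longrightarrow> y \<in> Z0 \<Longrightarrow> x + y \<in> Z0"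
  by (rule Zs_add) auto

lemma Z0_closed: 
  assumes x: "x \<in> Z0" and rel: "(x, i) \<asymp> (y, j)"
  shows "y \<in> Z0"
proof (cases "low (x, i)")
  case False
  then have "\<not> low (y, j)" using low_rat[OF rel_rat[OF rel]] by blast
  moreover have "(x, i) \<bowtie> (0, 1)" using rat_iff_Zs[OF _ False] x by simp
  ultimately show ?thesis using rat_iff_Zs[of "(0, 1)" y j] rat_iff[OF rel_rat[OF rel]] by simp
next
  case True
  then have i: "int p dvd i" and j: "int p dvd j" and "x \<in> H1"
    using low_rel[OF rel] by (auto simp: low_def)
  have eq: "(x, 0) \<asymp> (y, 0)"
    using rel rel_cong[of 0 i x] rel_cong[of j 0 y] i j rel_trans
    by (metis cong_0_iff cong_sym)
  \<comment> \<open>A low element over \<open>Z0\<close> is a sum of two elements that are not low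
    and lie over \<open>Z0\<close>; \<open>rel_sum\<close> carries this decomposition over to
    \<open>(y, 0)\<close>.\<close>
  have "(x, 1) + (0, -1) \<asymp> (y, 0)" using eq by simp
  from rel_sum[OF this] obtain h k where h: "h \<asymp> (x, 1)" "k \<asymp> (0, -1)" "(y, 0) = h + k" by blast
  have mem: "fst g \<in> Z0" if "g \<bowtie> (0, 1)" for g
    using that rat_iff_Zs[of "(0, 1)" "fst g" "snd g"] low_rat[OF that] by simp
  have "(0, -1) \<bowtie> (0, 1)" using rat_mu[of "-1" "(0, 1)"] by simp
  then have "h \<bowtie> (0, 1)" "k \<bowtie> (0, 1)"
    using h x rel_rat rat_trans unfolding Zs_def by blast+
  then have "fst h + fst k \<in> Z0" using mem Z0_add by blast
  then show ?thesis using h(3) by (cases h; cases k) auto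
qed

text \<open>Split \<open>(x, i)\<close> as \<open>(x, 0)\<close> plus \<open>(0, i)\<close>. The
  first summand stays low and the second stays over \<open>Z0\<close>, which is contained in
  \<open>H1\<close>.\<close>

lemma H1_column_closed:
  assumes "Z0 \<subseteq> H1" "x \<in> H1" "(x, i) \<asymp> (y, j)"
  shows "y \<in> H1"
proof -
  have "(x, 0) + (0, i) \<asymp> (y, j)" using assms(3) by simp
  from rel_sum[OF this] obtain h k where h: "h \<asymp> (x, 0)" "k \<asymp> (0, i)" "(y, j) = h + k" by blast
  have "low h" using low_rel[OF rel_sym[OF h(1)]] assms(2) by (simp add: low_def)
  moreover have "fst k \<in> Z0" using Z0_closed[of 0 i "fst k" "snd k"] rel_sym[OF h(2)] by simp
  ultimately have "fst h + fst k \<in> H1" using assms(1) add_H1 by (auto simp: low_def)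
  then show ?thesis using h(3) by (cases h; cases k) auto
qed

text \<open>As soon as the projection of the class leaves \<open>H1\<close> at some
  \<open>u\<close>, the rational class contains \<open>(u, 0)\<close> and is a single class; adding
  \<open>z\<close> does not lead out of it. The disjunction \<open>free\<close> guarantees such a
  \<open>u\<close>, either \<open>x\<close> itself or a translate of it by an element of
  \<open>Z0\<close>.\<close>

lemma rel_free:
  assumes z: "z \<in> Z0" and low: "\<not> low (x, i)" "\<not> low (x + z, j)"
    and free: "(\<forall>h\<in>H1. x + h \<notin> Z0) \<or> \<not> Z0 \<subseteq> H1"
  shows "(x, i) \<asymp> (x + z, j)"
proof -
  let ?Z = "Zs (x, i)"
  have x: "x \<in> ?Z" by (rule self_Zs) fact
  obtain u where u: "u \<in> ?Z" "u \<notin> H1"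
  proof (cases "x \<in> H1")
    case True
    then have "\<not> Z0 \<subseteq> H1" using free by (metis char2 zero_Z0)
    then obtain z0 where z0: "z0 \<in> Z0" "z0 \<notin> H1" by blast
    then have "z0 + x \<in> ?Z" by (intro Zs_add low x)
    moreover have "z0 + x \<notin> H1" using add_H1_iff[OF True, of z0] z0 by (simp add: add.commute)
    ultimately show ?thesis using that by blast
  qed (use x that in blast)
  then have u: "(u, 0) \<bowtie> (x, i)" using rat_zero_iff low by blast
  have "x + z \<in> ?Z" using Zs_add[OF z low(1) x] by (simp add: add.commute)
  then have "(x + z, j) \<bowtie> (x, i)" using rat_iff_Zs low by blast
  then have "(x + z, j) \<asymp> (u, 0)" using rat_zero_rel rat_trans rat_sym u by blast
  moreover have "(x, i) \<asymp> (u, 0)" using rat_zero_rel rat_sym u by blast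
  ultimately show ?thesis using rel_trans rel_sym by blast
qed

text \<open>Here no element \<open>(u, 0)\<close> is available, and the class itself is shown to be
  invariant under translation by \<open>(z, 0)\<close>. Its autocorrelations along \<open>z\<close>
  and along 0 have the same total, because the fibres over w and w + z have equal size. They agree
  in sum at nonzero second coordinates, because \<open>(z, 1)\<close> is related to some
  \<open>(0, m)\<close>. So they agree at second coordinate 0.\<close>

lemma rel_column:
  assumes Z0: "Z0 \<subseteq> H1" and x: "x \<in> H1" and i: "\<not> int p dvd i" and z: "z \<in> Z0"
  shows "(x, i) \<asymp> (x + z, i)"
proof -
  define X where "X = {h. h \<asymp> (x, i)}"
  have X_iff: "g \<asymp> h \<Longrightarrow> g \<in> X \<longleftrightarrow> h \<in> X" for g h unfolding X_def using rel_iff by blast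
  have X_eqp: "g \<doteq> h \<Longrightarrow> g \<in> X \<longleftrightarrow> h \<in> X" for g h using X_iff eqp_rel by blast
  have low: "\<not> low (x, i)" using i by (simp add: low_def)
  have XH1: "w \<in> H1" "\<not> int p dvd j" "w \<in> Zs (x, i)" if "(w, j) \<in> X" for w j
  proof -
    show w: "w \<in> H1" using H1_column_closed[OF Z0 x] that rel_sym unfolding X_def by blast
    have nl: "\<not> low (w, j)" using that low low_rel unfolding X_def by blast
    then show "\<not> int p dvd j" using w by (simp add: low_def)
    show "w \<in> Zs (x, i)" using rat_iff_Zs[OF low nl] that rel_rat unfolding X_def by blast
  qed
  \<comment> \<open>The autocorrelation of \<open>X\<close>: it counts the pairs of elements of
    \<open>X\<close> with difference \<open>g\<close>.\<close>
  define S where "S g = (\<Sum>h\<in>reps. of_bool (h \<in> X) * (of_bool (h - g \<in> X) :: int))" for g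
  have S_rel: "S g = S g'" if "g \<asymp> g'" for g g'
  proof -
    have "(\<Sum>h\<in>reps. of_bool (h \<in> X) * (of_bool (- (g - h) \<in> X) :: int)) =
        (\<Sum>h\<in>reps. of_bool (h \<in> X) * of_bool (- (g' - h) \<in> X))"
    proof (rule conv[OF _ _ that])
      fix g h assume gh: "g \<asymp> h"
      show "of_bool (g \<in> X) = (of_bool (h \<in> X) :: int)" using X_iff[OF gh] by simp
      show "of_bool (- g \<in> X) = (of_bool (- h \<in> X) :: int)" using X_iff[OF rel_neg[OF gh]] by simp
    qed
    then show ?thesis by (simp add: S_def)
  qed
  define n where "n w = (\<Sum>j\<in>{0..<int p}. of_bool ((w, j) \<in> X) :: int)" for w
  have per: "of_bool ((w, i) \<in> X) = (of_bool ((w, j) \<in> X) :: int)" if "[i = j] (mod int p)" for w i j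
    using X_eqp[of "(w, i)" "(w, j)"] that by (simp add: eqp_def)
  \<comment> \<open>Multiplication by a unit carries the fibre of the class over \<open>w\<close> into the one over \<open>w'\<close>.\<close>
  have n_le: "n w \<le> n w'" if w': "w' \<in> Zs (x, i)" for w w'
  proof (cases "\<exists>j. (w, j) \<in> X")
    case False
    then show ?thesis by (auto simp: n_def intro: sum_nonneg)
  next
    case True
    then obtain j0 where j0: "(w, j0) \<in> X" by blast
    then have "coprime j0 (int p)" using XH1 coprime_iff by blast
    then obtain d where d: "coprime d (int p)" "[d * j0 = 1] (mod int p)" using ex_inverse by blast
    obtain m where m: "coprime m (int p)" "(w', 1) \<asymp> mu m (x, i)"
      using w' unfolding Zs_def rat_def by blast
    obtain k0 where k0: "coprime k0 (int p)" "[k0 * m = 1] (mod int p)" using ex_inverse[OF m(1)] by blast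
    have "mu k0 (mu m (x, i)) \<doteq> (x, i)"
      using cong_scalar_right[OF k0(2), of i] by (auto simp: eqp_def mult.assoc)
    then have "(w', k0) \<in> X"
      using mu_rel[OF k0(1) m(2)] eqp_rel rel_trans unfolding X_def by fastforce
    then have wk: "(w, j0) \<asymp> (w', k0)" using j0 rel_trans rel_sym unfolding X_def by blast
    have "(w', k0 * d * j) \<in> X" if j: "(w, j) \<in> X" for j
    proof -
      have "coprime j (int p)" using XH1(2)[OF j] coprime_iff by blast
      then have "coprime (j * d) (int p)" using d(1) by simp
      from mu_rel[OF this wk] have "(w, j * d * j0) \<asymp> (w', j * d * k0)" by simp
      moreover have "(w, j * d * j0) \<doteq> (w, j)"
        using cong_scalar_left[OF d(2), of j] by (simp add: eqp_def mult.assoc)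
      ultimately have "(w', j * d * k0) \<in> X" using X_iff X_eqp j by blast
      then show ?thesis by (simp add: mult_ac)
    qed
    then have "n w \<le> (\<Sum>j\<in>{0..<int p}. of_bool ((w', k0 * d * j) \<in> X))"
      unfolding n_def by (intro sum_mono) auto
    also have "\<dots> = n w'"
      using sum_affine[of "\<lambda>j. of_bool ((w', j) \<in> X)" "k0 * d" 0] per d k0 by (simp add: n_def)
    finally show ?thesis .
  qed
  have n_z: "n (w + z) = n w" for w
  proof -
    have ZX: "w + z \<in> Zs (x, i) \<longleftrightarrow> w \<in> Zs (x, i)"
      using Zs_add[OF z low, of w] Zs_add[OF z low, of "w + z"]
      by (auto simp: add.commute add.left_commute char2)
    show ?thesis
    proof (cases "w \<in> Zs (x, i)")
      case True
      then show ?thesis using n_le ZX by (metis order_antisym)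
    next
      case False
      then have "(w, j) \<notin> X" "(w + z, j) \<notin> X" for j using XH1(3) ZX by blast+
      then show ?thesis by (simp add: n_def)
    qed
  qed
  have total: "(\<Sum>t\<in>{0..<int p}. S (v, t)) = (\<Sum>w\<in>UNIV. n w * n (w + v))" for v
  proof -
    have shift: "(\<Sum>t\<in>{0..<int p}. of_bool ((w + v, j - t) \<in> X) :: int) = n (w + v)" for w j
      using sum_affine[of "\<lambda>j. of_bool ((w + v, j) \<in> X)" "-1" j] per by (simp add: n_def)
    have "(\<Sum>t\<in>{0..<int p}. S (v, t)) =
        (\<Sum>t\<in>{0..<int p}. \<Sum>w\<in>UNIV. \<Sum>j\<in>{0..<int p}. of_bool ((w, j) \<in> X) * of_bool ((w + v, j - t) \<in> X))"
      unfolding S_def sum_reps by simp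
    also have "\<dots> = (\<Sum>w\<in>UNIV. \<Sum>t\<in>{0..<int p}. \<Sum>j\<in>{0..<int p}. of_bool ((w, j) \<in> X) * of_bool ((w + v, j - t) \<in> X))"
      by (rule sum.swap)
    also have "\<dots> = (\<Sum>w\<in>UNIV. \<Sum>j\<in>{0..<int p}. \<Sum>t\<in>{0..<int p}. of_bool ((w, j) \<in> X) * of_bool ((w + v, j - t) \<in> X))"
      by (intro sum.cong refl sum.swap)
    also have "\<dots> = (\<Sum>w\<in>UNIV. n w * n (w + v))"
      unfolding sum_distrib_left[symmetric] shift unfolding n_def sum_distrib_right ..
    finally show ?thesis .
  qed
  have split: "(\<Sum>t\<in>{0..<int p}. f t) = f 0 + (\<Sum>t\<in>{1..<int p}. f t)" for f :: "int \<Rightarrow> int"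
  proof -
    have "{0..<int p} = insert 0 {1..<int p}" using p_pos by auto
    then show ?thesis by simp
  qed
  obtain m where m: "coprime m (int p)" "(z, 1) \<asymp> (0, m)"
    using z unfolding Zs_def rat_def by auto
  have "S (z, t) = S (0, m * t)" if "t \<in> {1..<int p}" for t
  proof -
    have "coprime t (int p)" using that zdvd_not_zless by (auto simp: coprime_iff)
    from mu_rel[OF this m(2)] show ?thesis by (intro S_rel) (simp add: mult.commute)
  qed
  then have "(\<Sum>t\<in>{1..<int p}. S (z, t)) = (\<Sum>t\<in>{1..<int p}. S (0, m * t))" by (intro sum.cong) auto
  also have "\<dots> = (\<Sum>t\<in>{1..<int p}. S (0, t))"
    using sum_affine[of "\<lambda>t. S (0, t)" m 0] S_rel[OF rel_cong] m(1)
    unfolding split[of "\<lambda>t. S (0, t)"] split[of "\<lambda>t. S (0, 0 + m * t)"] by simp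
  finally have "S (z, 0) = S (0, 0)"
    using total[of z] total[of 0] unfolding split n_z by simp
  \<comment> \<open>\<open>S (0, 0)\<close> is the size of \<open>X\<close>, so no element of
    \<open>X\<close> can fail to have its translate in \<open>X\<close>.\<close>
  then have "(\<Sum>h\<in>reps. of_bool (h \<in> X) - of_bool (h \<in> X) * (of_bool (h - (z, 0) \<in> X) :: int)) = 0"
    unfolding S_def sum_subtractf by (simp flip: zero_prod_def add: of_bool_conj[symmetric])
  moreover have "0 \<le> of_bool (h \<in> X) - of_bool (h \<in> X) * (of_bool (h - (z, 0) \<in> X) :: int)" for h by simp
  ultimately have *: "of_bool (h \<in> X) - of_bool (h \<in> X) * (of_bool (h - (z, 0) \<in> X) :: int) = 0"
    if "h \<in> reps" for h
    using that by (subst (asm) sum_nonneg_eq_0_iff) auto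
  obtain h where h: "h \<in> reps" "(x, i) \<doteq> h" using ex_rep by blast
  have "h \<in> X" using h(2) eqp_rel rel_sym unfolding X_def by blast
  then have "h - (z, 0) \<in> X" using *[OF h(1)] by (simp split: if_splits)
  moreover have "(x + z, i) \<doteq> h - (z, 0)" using eqp_diff[OF h(2) eqp_refl, of "(z, 0)"] by simp
  ultimately show ?thesis using X_eqp rel_sym unfolding X_def by blast
qed

end

section \<open>Aligning the orbits of the \<open>p\<close>-parts\<close>

lemma coset_count_rel:
  fixes D D' :: "'e::{finite, ab_group_add} set"
  assumes D: "0 \<in> D" "\<And>x y. x \<in> D \<Longrightarrow> y \<in> D \<Longrightarrow> x - y \<in> D"
    and D': "\<And>x y. x \<in> D' \<Longrightarrow> y \<in> D' \<Longrightarrow> x + y \<in> D'" "D \<subseteq> D'"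
  shows "card ((\<lambda>x. (+) x ` D) ` D') * card D = card D'"
proof -
  let ?c = "\<lambda>x. (+) x ` D"
  have self: "x \<in> ?c x" for x using D(1) by force
  have add: "u + v \<in> D" if "u \<in> D" "v \<in> D" for u v
    using D(2)[of u "0 - v"] D(2)[of 0 v] D(1) that by simp
  have mem: "?c x = ?c y" if xy: "x \<in> ?c y" for x y
  proof -
    obtain d where d: "d \<in> D" "x = y + d" using xy by blast
    show ?thesis
    proof (intro equalityI subsetI)
      fix z assume "z \<in> ?c x"
      then obtain e where e: "e \<in> D" "z = x + e" by blast
      then show "z \<in> ?c y" using d add by (intro image_eqI[of _ _ "d + e"]) (auto simp: add.assoc)
    next
      fix z assume "z \<in> ?c y"
      then obtain e where e: "e \<in> D" "z = y + e" by blast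
      then show "z \<in> ?c x" using d D(2) by (intro image_eqI[of _ _ "e - d"]) auto
    qed
  qed
  have dis: "pairwise disjnt (?c ` D')"
  proof (rule pairwiseI)
    fix A B assume "A \<in> ?c ` D'" "B \<in> ?c ` D'" and ne: "A \<noteq> B"
    then obtain x y where AB: "A = ?c x" "B = ?c y" by blast
    have "z \<notin> B" if "z \<in> A" for z
      using mem[of z x] mem[of z y] that ne unfolding AB by metis
    then show "disjnt A B" by (auto simp: disjnt_iff)
  qed
  have fin: "finite A" if "A \<in> ?c ` D'" for A using that by auto
  have "card A = card D" if "A \<in> ?c ` D'" for A using that by (auto intro: card_image)
  then have "sum card (?c ` D') = card (?c ` D') * card D" by simp
  then have "card (\<Union> (?c ` D')) = card (?c ` D') * card D"
    using card_Union_disjoint[OF dis fin] by simp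
  moreover have "\<Union> (?c ` D') = D'"
  proof (intro equalityI subsetI)
    fix z assume "z \<in> \<Union> (?c ` D')"
    then obtain x d where "x \<in> D'" "d \<in> D" "z = x + d" by blast
    then show "z \<in> D'" using D' by blast
  qed (use self in blast)
  ultimately show ?thesis by simp
qed

lemma coset_count:
  fixes D :: "'e::{finite, ab_group_add} set"
  assumes "0 \<in> D" "\<And>x y. x \<in> D \<Longrightarrow> y \<in> D \<Longrightarrow> x - y \<in> D"
  shows "card (range (\<lambda>x. (+) x ` D)) * card D = card (UNIV :: 'e set)"
  using coset_count_rel[of D UNIV] assms by simp

text \<open>\<open>pt\<close> parametrises the points by \<open>E \<times> \<int>\<close>, with the second coordinate relevant only modulo
  \<open>p\<close>; \<open>K\<close> is a 2-closed group of permutations that are the identity outside \<open>\<Omega>\<close>.\<close>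

locale regular_setup =
  fixes \<Omega> :: "'a set" and K :: "('a \<Rightarrow> 'a) set" and p :: nat
    and pt :: "'e::{finite, ab_group_add} \<times> int \<Rightarrow> 'a"
  assumes prime_p: "prime p" and odd_p: "odd p"
    and char2: "\<And>x::'e. x + x = 0" and card_e: "card (UNIV :: 'e set) = 32"
    and pt_eq: "pt g = pt h \<longleftrightarrow> fst g = fst h \<and> [snd g = snd h] (mod int p)"
    and pt_range: "range pt = \<Omega>"
    and K: "pgrp \<Omega> K"
    and two_closed: "f permutes \<Omega> \<Longrightarrow>
      (\<And>x y. x \<in> \<Omega> \<Longrightarrow> y \<in> \<Omega> \<Longrightarrow> \<exists>k\<in>K. k x = f x \<and> k y = f y) \<Longrightarrow> f \<in> K"
    and translation: "\<exists>t\<in>K. \<forall>h. t (pt h) = pt (g + h)"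
begin

section \<open>Points, translations and classes of differences\<close>

lemma pt_in [simp]: "pt g \<in> \<Omega>" using pt_range by blast

lemma pt_cases: assumes "\<omega> \<in> \<Omega>" obtains g where "\<omega> = pt g" using assms pt_range by blast

lemma p_pos: "0 < p" using prime_p prime_gt_0_nat by blast

lemma K_perm: "k \<in> K \<Longrightarrow> k permutes \<Omega>" and K_id: "id \<in> K"
  and K_comp: "k \<in> K \<Longrightarrow> l \<in> K \<Longrightarrow> k \<circ> l \<in> K" and K_inv: "k \<in> K \<Longrightarrow> pinv k \<in> K"
  using K by (auto simp: pgrp_def)

lemma K_in [simp]: "k \<in> K \<Longrightarrow> k \<omega> \<in> \<Omega> \<longleftrightarrow> \<omega> \<in> \<Omega>"
  using K_perm permutes_in_image by metis

lemma K_inj: "k \<in> K \<Longrightarrow> k x = k y \<longleftrightarrow> x = y"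
  using K_perm permutes_inj by (metis inj_eq)

lemma K_inv_l [simp]: "k \<in> K \<Longrightarrow> pinv k (k x) = x" and K_inv_r [simp]: "k \<in> K \<Longrightarrow> k (pinv k x) = x"
  using K_perm permutes_inverses by metis+

lemma perm_eqI:
  assumes "f permutes \<Omega>" "g permutes \<Omega>" "\<And>h. f (pt h) = g (pt h)" shows "f = g"
proof
  fix x show "f x = g x"
  proof (cases "x \<in> \<Omega>")
    case True
    then obtain h where "x = pt h" by (rule pt_cases)
    then show ?thesis using assms(3) by simp
  qed (use assms in \<open>simp add: permutes_not_in\<close>)
qed

definition tr :: "'e \<times> int \<Rightarrow> 'a \<Rightarrow> 'a" where
  "tr g = (SOME t. t \<in> K \<and> (\<forall>h. t (pt h) = pt (g + h)))"

lemma tr: "tr g \<in> K" "tr g (pt h) = pt (g + h)"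
proof -
  have "\<exists>t. t \<in> K \<and> (\<forall>h. t (pt h) = pt (g + h))" using translation by blast
  from someI_ex[OF this] show "tr g \<in> K" "tr g (pt h) = pt (g + h)" unfolding tr_def by blast+
qed

lemma tr_add: "tr (g + h) = tr g \<circ> tr h"
  by (rule perm_eqI) (auto simp: tr K_perm K_comp add.assoc)

text \<open>Orbits of the stabiliser of the base point, that is, the basic sets of the S-ring of
  \<open>K\<close> in coordinates.\<close>

definition rel :: "'e \<times> int \<Rightarrow> 'e \<times> int \<Rightarrow> bool" where
  "rel g h \<longleftrightarrow> (\<exists>k\<in>K. k (pt 0) = pt 0 \<and> k (pt g) = pt h)"

text \<open>Translations move the first point of a pair to the base point. Together with
  \<open>rel_pair\<close> this turns membership in the 2-closed group \<open>K\<close> into a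
  condition on differences.\<close>

lemma pair_rel:
  assumes k: "k \<in> K" "k (pt g) = pt g'" "k (pt h) = pt h'"
  shows "rel (h - g) (h' - g')"
proof -
  let ?k = "tr (- g') \<circ> k \<circ> tr g"
  have "?k \<in> K" using k tr K_comp by blast
  moreover have "?k (pt 0) = pt 0" "?k (pt (h - g)) = pt (h' - g')" using k tr by simp_all
  ultimately show ?thesis unfolding rel_def by blast
qed

lemma rel_pair:
  assumes "rel (h - g) (h' - g')"
  shows "\<exists>k\<in>K. k (pt g) = pt g' \<and> k (pt h) = pt h'"
proof -
  obtain k where k: "k \<in> K" "k (pt 0) = pt 0" "k (pt (h - g)) = pt (h' - g')"
    using assms unfolding rel_def by blast
  let ?k = "tr g' \<circ> k \<circ> tr (- g)"
  have "?k \<in> K" using k tr K_comp by blast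
  moreover have "?k (pt g) = pt g'" "?k (pt h) = pt h'" using k tr by (simp_all add: add.commute[of _ h])
  ultimately show ?thesis by blast
qed

abbreviation rp :: "('e \<times> int) set" where "rp \<equiv> UNIV \<times> {0..<int p}"

definition co :: "'a \<Rightarrow> 'e \<times> int" where
  "co \<omega> = (SOME g. g \<in> rp \<and> pt g = \<omega>)"

lemma co: assumes "\<omega> \<in> \<Omega>" shows "co \<omega> \<in> rp" "pt (co \<omega>) = \<omega>"
proof -
  obtain g where g: "\<omega> = pt g" using assms by (rule pt_cases)
  have "(fst g, snd g mod int p) \<in> rp \<and> pt (fst g, snd g mod int p) = \<omega>"
    using p_pos by (auto simp: g pt_eq cong_def)
  then have "\<exists>g. g \<in> rp \<and> pt g = \<omega>" by blast
  from someI_ex[OF this] show "co \<omega> \<in> rp" "pt (co \<omega>) = \<omega>" unfolding co_def by blast+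
qed

lemma co_pt: "fst (co (pt g)) = fst g" "[snd (co (pt g)) = snd g] (mod int p)"
  using co[of "pt g"] pt_eq by auto

lemma inj_pt: "inj_on pt rp"
  by (auto simp: inj_on_def pt_eq cong_def)

lemma bij_pt: "bij_betw pt rp \<Omega>"
proof -
  have "\<Omega> \<subseteq> pt ` rp" using co by (metis imageI subsetI)
  then show ?thesis using inj_pt by (auto simp: bij_betw_def)
qed

lemma finite_Omega: "finite \<Omega>" using bij_pt by (metis bij_betw_finite finite_SigmaI finite finite_atLeastLessThan_int)

sublocale srel p rel
proof
  fix g h k :: "'e \<times> int" and x y :: 'e and i j :: int
  show "prime p" "odd p" "x + x = 0" using prime_p odd_p char2 by auto
  show "rel g g" unfolding rel_def using K_id by (intro bexI[of _ id]) auto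
  show "rel h g" if gh: "rel g h"
  proof -
    obtain k where "k \<in> K" "k (pt 0) = pt 0" "k (pt g) = pt h" using gh unfolding rel_def by blast
    then have "pinv k \<in> K" "pinv k (pt 0) = pt 0" "pinv k (pt h) = pt g" using K_inv K_inv_l by metis+
    then show ?thesis unfolding rel_def by blast
  qed
  show "rel g k" if gh: "rel g h" "rel h k"
  proof -
    obtain k1 k2 where "k1 \<in> K" "k1 (pt 0) = pt 0" "k1 (pt g) = pt h" "k2 \<in> K" "k2 (pt 0) = pt 0" "k2 (pt h) = pt k"
      using gh unfolding rel_def by blast
    then show ?thesis unfolding rel_def using K_comp by (intro bexI[of _ "k2 \<circ> k1"]) auto
  qed
  show "rel (x, i) (x, j)" if "[i = j] (mod int p)"
    unfolding rel_def using K_id that by (intro bexI[of _ id]) (auto simp: pt_eq)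
  show "x = 0 \<and> int p dvd i" if "rel (0, 0) (x, i)"
  proof -
    have "pt 0 = pt (x, i)" using that unfolding rel_def by (auto simp: zero_prod_def)
    then show ?thesis by (auto simp: pt_eq cong_0_iff dest: cong_sym)
  qed
  show "rel (- g) (- h)" if gh: "rel g h"
  proof -
    obtain k where "k \<in> K" "k (pt 0) = pt 0" "k (pt g) = pt h" using gh unfolding rel_def by blast
    from pair_rel[OF this(1,3,2)] show ?thesis by simp
  qed
next
  fix \<phi> \<psi> :: "'e \<times> int \<Rightarrow> int" and g g' :: "'e \<times> int"
  assume \<phi>: "\<And>g h. rel g h \<Longrightarrow> \<phi> g = \<phi> h" and \<psi>: "\<And>g h. rel g h \<Longrightarrow> \<psi> g = \<psi> h" and "rel g g'"
  \<comment> \<open>This element of \<open>K\<close> fixes the base point and takes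
    \<open>pt g\<close> to \<open>pt g'\<close>, so it permutes the summands of the two convolutions
    into each other.\<close>
  then obtain k where k: "k \<in> K" "k (pt 0) = pt 0" "k (pt g) = pt g'" unfolding rel_def by blast
  have sum: "(\<Sum>h\<in>rp. F h) = (\<Sum>\<omega>\<in>\<Omega>. F (co \<omega>))" for F :: "'e \<times> int \<Rightarrow> int"
  proof -
    have "co (pt h) = h" if "h \<in> rp" for h
      using inj_onD[OF inj_pt] co[of "pt h"] that by simp
    then have "(\<Sum>h\<in>rp. F h) = (\<Sum>h\<in>rp. F (co (pt h)))" by (intro sum.cong) auto
    also have "\<dots> = (\<Sum>\<omega>\<in>\<Omega>. F (co \<omega>))" by (rule sum.reindex_bij_betw[OF bij_pt])
    finally show ?thesis .
  qed
  have "(\<Sum>h\<in>rp. \<phi> h * \<psi> (g - h)) = (\<Sum>\<omega>\<in>\<Omega>. \<phi> (co \<omega>) * \<psi> (g - co \<omega>))" by (rule sum)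
  also have "\<dots> = (\<Sum>\<omega>\<in>\<Omega>. \<phi> (co (k \<omega>)) * \<psi> (g' - co (k \<omega>)))"
  proof (rule sum.cong)
    fix \<omega> assume \<omega>: "\<omega> \<in> \<Omega>"
    then have \<omega>': "k (pt (co \<omega>)) = pt (co (k \<omega>))" using co k(1) by simp
    have "rel (co \<omega>) (co (k \<omega>))" using pair_rel[OF k(1,2) \<omega>'] by simp
    moreover have "rel (g - co \<omega>) (g' - co (k \<omega>))" using pair_rel[OF k(1) \<omega>' k(3)] .
    ultimately show "\<phi> (co \<omega>) * \<psi> (g - co \<omega>) = \<phi> (co (k \<omega>)) * \<psi> (g' - co (k \<omega>))" using \<phi> \<psi> by metis
  qed simp
  also have "\<dots> = (\<Sum>\<omega>\<in>\<Omega>. \<phi> (co \<omega>) * \<psi> (g' - co \<omega>))"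
    by (rule sum.reindex_bij_betw[OF permutes_imp_bij[OF K_perm[OF k(1)]], where g = "\<lambda>\<omega>. \<phi> (co \<omega>) * \<psi> (g' - co \<omega>)"])
  also have "\<dots> = (\<Sum>h\<in>rp. \<phi> h * \<psi> (g' - h))" by (rule sum[symmetric])
  finally show "(\<Sum>h\<in>rp. \<phi> h * \<psi> (g - h)) = (\<Sum>h\<in>rp. \<phi> h * \<psi> (g' - h))" .
qed

section \<open>Regular representations\<close>

lemma sum_zero_e [simp]: "x + y = 0 \<longleftrightarrow> x = (y::'e)"
  by (metis add_cancel_e add.right_neutral)

lemma add_cancel_e2 [simp]: "x + (y + x) = (y::'e)"
  by (simp add: add.commute)

lemma low_add: "low g \<Longrightarrow> low h \<Longrightarrow> low (g + h)"
  by (auto simp: low_def add_H1)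

lemma low_neg: "low (- g) \<longleftrightarrow> low g"
  by (simp add: low_def)

text \<open>A regular subgroup of \<open>K\<close> isomorphic to E x C_p, kept together with a
  parametrisation: a homomorphism from E x Z with kernel 0 x pZ whose image is transitive and
  semiregular.\<close>

definition regrep :: "('e \<times> int \<Rightarrow> 'a \<Rightarrow> 'a) \<Rightarrow> bool" where
  "regrep \<beta> \<longleftrightarrow> (\<forall>g. \<beta> g \<in> K) \<and> (\<forall>g h. \<beta> (g + h) = \<beta> g \<circ> \<beta> h) \<and>
     (\<forall>g. \<forall>\<omega>\<in>\<Omega>. \<beta> g \<omega> = \<omega> \<longrightarrow> fst g = 0 \<and> int p dvd snd g) \<and>
     (\<forall>g. fst g = 0 \<longrightarrow> int p dvd snd g \<longrightarrow> \<beta> g = id) \<and>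
     (\<forall>\<omega>\<in>\<Omega>. \<forall>\<omega>'\<in>\<Omega>. \<exists>g. \<beta> g \<omega> = \<omega>')"

lemma regrepD:
  assumes "regrep \<beta>"
  shows "\<beta> g \<in> K" "\<beta> (g + h) = \<beta> g \<circ> \<beta> h"
    "\<omega> \<in> \<Omega> \<Longrightarrow> \<beta> g \<omega> = \<omega> \<Longrightarrow> fst g = 0 \<and> int p dvd snd g"
    "fst g = 0 \<Longrightarrow> int p dvd snd g \<Longrightarrow> \<beta> g = id"
    "\<omega> \<in> \<Omega> \<Longrightarrow> \<omega>' \<in> \<Omega> \<Longrightarrow> \<exists>g. \<beta> g \<omega> = \<omega>'"
  using assms unfolding regrep_def by blast+

lemma regrep_conj:
  assumes \<beta>: "regrep \<beta>" and k: "k \<in> K"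
  shows "regrep (\<lambda>g. k \<circ> \<beta> g \<circ> pinv k)"
  unfolding regrep_def
proof (intro conjI allI ballI impI)
  fix g h show "k \<circ> \<beta> g \<circ> pinv k \<in> K" using K_comp K_inv k regrepD(1)[OF \<beta>] by blast
  show "k \<circ> \<beta> (g + h) \<circ> pinv k = k \<circ> \<beta> g \<circ> pinv k \<circ> (k \<circ> \<beta> h \<circ> pinv k)"
    using k by (auto simp: regrepD(2)[OF \<beta>])
next
  fix g \<omega> assume \<omega>: "\<omega> \<in> \<Omega>" "(k \<circ> \<beta> g \<circ> pinv k) \<omega> = \<omega>"
  then have "pinv k \<omega> \<in> \<Omega>" "\<beta> g (pinv k \<omega>) = pinv k \<omega>" using k K_inv by (simp, metis K_inv_l comp_apply)
  then show "fst g = 0" "int p dvd snd g" using regrepD(3)[OF \<beta>] by blast+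
next
  fix g :: "'e \<times> int" assume "fst g = 0" "int p dvd snd g"
  then show "k \<circ> \<beta> g \<circ> pinv k = id" using regrepD(4)[OF \<beta>] k by auto
next
  fix \<omega> \<omega>' assume "\<omega> \<in> \<Omega>" "\<omega>' \<in> \<Omega>"
  then have "pinv k \<omega> \<in> \<Omega>" "pinv k \<omega>' \<in> \<Omega>" using k K_inv by auto
  then obtain g where "\<beta> g (pinv k \<omega>) = pinv k \<omega>'" using regrepD(5)[OF \<beta>] by blast
  then have "(k \<circ> \<beta> g \<circ> pinv k) \<omega> = \<omega>'" using k by simp
  then show "\<exists>g. (k \<circ> \<beta> g \<circ> pinv k) \<omega> = \<omega>'" by blast
qed

lemma regrep_period: 
  assumes "regrep \<beta>" "fst g = fst h" "[snd g = snd h] (mod int p)" shows "\<beta> g = \<beta> h"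
proof -
  have "\<beta> (g - h) = id" using assms by (intro regrepD(4)) (auto simp: cong_iff_dvd_diff)
  moreover have "\<beta> ((g - h) + h) = \<beta> (g - h) \<circ> \<beta> h" by (rule regrepD(2)[OF assms(1)])
  ultimately show ?thesis by simp
qed

lemma regrep_tr: "regrep tr"
  unfolding regrep_def
proof (intro conjI allI ballI impI)
  fix g \<omega> assume "\<omega> \<in> \<Omega>" "tr g \<omega> = \<omega>"
  then obtain h where "pt (g + h) = pt h" by (metis tr(2) pt_cases)
  then show "fst g = 0" "int p dvd snd g" by (auto simp: pt_eq cong_iff_dvd_diff)
next
  fix g :: "'e \<times> int" assume "fst g = 0" "int p dvd snd g"
  then show "tr g = id" by (intro perm_eqI) (auto simp: K_perm tr K_id pt_eq cong_iff_dvd_diff)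
next
  fix \<omega> \<omega>' assume "\<omega> \<in> \<Omega>" "\<omega>' \<in> \<Omega>"
  then show "\<exists>g. tr g \<omega> = \<omega>'" by (metis tr(2) pt_cases diff_add_cancel)
qed (simp_all only: tr tr_add)

lemma pgrp_regrep:
  assumes \<beta>: "regrep \<beta>" and D: "0 \<in> D" "\<And>g h. g \<in> D \<Longrightarrow> h \<in> D \<Longrightarrow> g + h \<in> D" "\<And>g. g \<in> D \<Longrightarrow> - g \<in> D"
  shows "pgrp \<Omega> (\<beta> ` D)"
  unfolding pgrp_def
proof (intro conjI ballI)
  have z: "\<beta> 0 = id" using regrepD(4)[OF \<beta>, of 0] by simp
  then show "id \<in> \<beta> ` D" using D(1) by (metis imageI)
  fix k assume "k \<in> \<beta> ` D"
  then obtain g where g: "g \<in> D" "k = \<beta> g" by blast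
  show "k permutes \<Omega>" using K_perm regrepD(1)[OF \<beta>] g by blast
  have "\<beta> (- g) \<circ> k = id" "k \<circ> \<beta> (- g) = id" using regrepD(2)[OF \<beta>, of "- g" g] regrepD(2)[OF \<beta>, of g "- g"] z g by simp_all
  then have "pinv k = \<beta> (- g)" by (metis inv_unique_comp)
  then show "pinv k \<in> \<beta> ` D" using D(3) g by blast
  fix l assume "l \<in> \<beta> ` D"
  then obtain h where h: "h \<in> D" "l = \<beta> h" by blast
  then show "k \<circ> l \<in> \<beta> ` D" using regrepD(2)[OF \<beta>, of g h] D(2) g by (metis imageI)
qed

abbreviation cyc :: "('e \<times> int) set" where "cyc \<equiv> {0} \<times> UNIV"
abbreviation vec :: "('e \<times> int) set" where "vec \<equiv> UNIV \<times> {0}"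

lemma regrep_inj: "regrep \<beta> \<Longrightarrow> \<beta> g = \<beta> h \<longleftrightarrow> fst g = fst h \<and> [snd g = snd h] (mod int p)"
proof
  assume \<beta>: "regrep \<beta>" and eq: "\<beta> g = \<beta> h"
  have "\<beta> (g - h) \<circ> \<beta> h = \<beta> h" using regrepD(2)[OF \<beta>, of "g - h" h] eq by simp
  then have "\<beta> (g - h) (\<beta> h (pt 0)) = \<beta> h (pt 0)" by (metis comp_apply)
  from regrepD(3)[OF \<beta> _ this] show "fst g = fst h \<and> [snd g = snd h] (mod int p)"
    using regrepD(1)[OF \<beta>] by (auto simp: cong_iff_dvd_diff)
qed (use regrep_period in blast)

lemma card_cyc: assumes \<beta>: "regrep \<beta>" shows "card (\<beta> ` cyc) = p ^ 1"
proof -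
  have "\<beta> ` cyc = \<beta> ` ({0} \<times> {0..<int p})"
  proof (intro equalityI subsetI)
    fix k assume "k \<in> \<beta> ` cyc"
    then obtain i where "k = \<beta> (0, i)" by blast
    then have "k = \<beta> (0, i mod int p)" using regrep_period[OF \<beta>] by (auto simp: cong_def)
    then show "k \<in> \<beta> ` ({0} \<times> {0..<int p})" using p_pos by auto
  qed auto
  moreover have "inj_on \<beta> ({0} \<times> {0..<int p})"
    using regrep_inj[OF \<beta>] by (auto simp: inj_on_def cong_def)
  ultimately show ?thesis by (simp add: card_image card_cartesian_product)
qed

lemma card_vec: assumes \<beta>: "regrep \<beta>" shows "card (\<beta> ` vec) = 2 ^ 5"
proof -
  have "inj_on \<beta> vec" using regrep_inj[OF \<beta>] by (auto simp: inj_on_def)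
  then show ?thesis by (simp add: card_image card_cartesian_product card_e)
qed

lemma pgrp_cyc: "regrep \<beta> \<Longrightarrow> pgrp \<Omega> (\<beta> ` cyc)" and pgrp_vec: "regrep \<beta> \<Longrightarrow> pgrp \<Omega> (\<beta> ` vec)"
  by (rule pgrp_regrep; auto simp: zero_prod_def)+

text \<open>Order and index of a subgroup of E divide 32.\<close>

lemma p_ndvd_subgroup:
  assumes "0 \<in> D" "\<And>x y. x \<in> D \<Longrightarrow> y \<in> D \<Longrightarrow> x + y \<in> D"
  shows "\<not> p dvd card D" "\<not> p dvd card (range (\<lambda>x::'e. (+) x ` D))"
proof -
  have "card (range (\<lambda>x. (+) x ` D)) * card D = 2 ^ 5"
    using coset_count[of D] assms by (simp add: card_e)
  then have dvd: "card D dvd 2 ^ 5" "card (range (\<lambda>x. (+) x ` D)) dvd 2 ^ 5" by (metis dvd_triv_left dvd_triv_right)+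
  have "\<not> p dvd 2 ^ 5" using prime_p odd_p prime_dvd_power[of p 2 5] primes_dvd_imp_eq[of p 2] two_is_prime_nat by auto
  then show "\<not> p dvd card D" "\<not> p dvd card (range (\<lambda>x::'e. (+) x ` D))" using dvd dvd_trans by blast+
qed

text \<open>The elements over \<open>Z0\<close> form a union of classes, so the rows, that is the
  cosets of Z0 x C_p, are blocks of \<open>K\<close>. In the same way \<open>K_low\<close> makes
  blocks of the columns, the cosets of H1 x 0.\<close>

lemma K_Z0:
  assumes "k \<in> K" "\<omega> \<in> \<Omega>" "\<omega>' \<in> \<Omega>"
  shows "fst (co (k \<omega>)) + fst (co (k \<omega>')) \<in> Z0 \<longleftrightarrow> fst (co \<omega>) + fst (co \<omega>') \<in> Z0"
proof -
  have "rel (co \<omega> - co \<omega>') (co (k \<omega>) - co (k \<omega>'))"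
    using assms co by (intro pair_rel[of k]) auto
  then show ?thesis
    using Z0_closed[of "fst (co \<omega>) + fst (co \<omega>')"] Z0_closed[of "fst (co (k \<omega>)) + fst (co (k \<omega>'))"] rel_sym
    by (metis diff_e fst_diff prod.collapse)
qed

lemma K_low:
  assumes "k \<in> K" "\<omega> \<in> \<Omega>" "\<omega>' \<in> \<Omega>"
  shows "low (co (k \<omega>) - co (k \<omega>')) \<longleftrightarrow> low (co \<omega> - co \<omega>')"
proof -
  have "rel (co \<omega> - co \<omega>') (co (k \<omega>) - co (k \<omega>'))"
    using assms co by (intro pair_rel[of k]) auto
  then show ?thesis using low_rel rel_sym by blast
qed

lemma pgrp_fixed_ex:
  assumes q: "prime q" and S: "pgrp \<Omega> S" "card S = q ^ n" and X: "finite X" "\<not> q dvd card X"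
    and act: "\<And>g x. g \<in> S \<Longrightarrow> x \<in> X \<Longrightarrow> act g x \<in> X" "\<And>x. x \<in> X \<Longrightarrow> act id x = x"
    "\<And>g h x. g \<in> S \<Longrightarrow> h \<in> S \<Longrightarrow> x \<in> X \<Longrightarrow> act (g \<circ> h) x = act g (act h x)"
  shows "\<exists>x\<in>X. \<forall>g\<in>S. act g x = x"
proof (rule ccontr)
  assume "\<not> (\<exists>x\<in>X. \<forall>g\<in>S. act g x = x)"
  then have "{x \<in> X. \<forall>g\<in>S. act g x = x} = {}" by blast
  with pgrp_fixed[where act = act, OF finite_Omega q S X(1) act] have "[card X = 0] (mod q)"
    by (metis card.empty cong_sym)
  then show False using X(2) by (simp add: cong_0_iff)
qed

subsection \<open>Rows and columns\<close>

text \<open>The number of rows is prime to \<open>p\<close>, so the p-part of \<open>\<beta>\<close>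
  fixes one of them. As it commutes with the whole transitive group, it fixes all rows.\<close>

lemma row_fix:
  assumes \<beta>: "regrep \<beta>" and \<omega>: "\<omega> \<in> \<Omega>"
  shows "fst (co (\<beta> (0, i) \<omega>)) + fst (co \<omega>) \<in> Z0"
proof -
  define Row where "Row x = {\<omega>\<in>\<Omega>. fst (co \<omega>) + x \<in> Z0}" for x
  define f where "f C = {\<omega>\<in>\<Omega>. fst (co \<omega>) \<in> C}" for C
  have K_Row: "k ` Row x = Row (fst (co (k (pt (x, 0)))))" if k: "k \<in> K" for k x
  proof -
    have iff: "k \<omega> \<in> Row (fst (co (k (pt (x, 0))))) \<longleftrightarrow> \<omega> \<in> Row x" if "\<omega> \<in> \<Omega>" for \<omega>
      using K_Z0[OF k that, of "pt (x, 0)"] that k by (simp add: Row_def co_pt)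
    show ?thesis
    proof (intro equalityI subsetI)
      fix y assume "y \<in> k ` Row x"
      then obtain \<omega> where "\<omega> \<in> Row x" "y = k \<omega>" by blast
      then show "y \<in> Row (fst (co (k (pt (x, 0)))))" using iff[of \<omega>] by (simp add: Row_def)
    next
      fix y assume y: "y \<in> Row (fst (co (k (pt (x, 0)))))"
      then have "y \<in> \<Omega>" by (simp add: Row_def)
      then have "pinv k y \<in> \<Omega>" "k (pinv k y) = y" using k K_inv by simp_all
      then have "pinv k y \<in> Row x" using iff[of "pinv k y"] y by simp
      then show "y \<in> k ` Row x" using \<open>k (pinv k y) = y\<close> by (metis imageI)
    qed
  qed
  have Row_f: "Row x = f ((+) x ` Z0)" for x
  proof -
    have "w + x \<in> Z0 \<longleftrightarrow> w \<in> (+) x ` Z0" for w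
    proof
      assume "w + x \<in> Z0"
      then show "w \<in> (+) x ` Z0" by (intro image_eqI[of _ _ "w + x"]) (simp_all add: add.commute)
    next
      assume "w \<in> (+) x ` Z0"
      then obtain z where "z \<in> Z0" "w = x + z" by blast
      then show "w + x \<in> Z0" by (simp add: add.commute)
    qed
    then show ?thesis by (simp add: Row_def f_def)
  qed
  have inj_f: "inj f"
  proof (rule injI)
    fix C D assume "f C = f D"
    moreover have "w \<in> C \<longleftrightarrow> pt (w, 0) \<in> f C" for w C by (simp add: f_def co_pt)
    ultimately show "C = D" by blast
  qed
  have "range Row = f ` range (\<lambda>x. (+) x ` Z0)" using Row_f by auto
  then have "card (range Row) = card (range (\<lambda>x. (+) x ` Z0))"
    using inj_f by (simp add: card_image inj_on_subset)
  then have nd: "\<not> p dvd card (range Row)" using p_ndvd_subgroup(2)[of Z0] Z0_add by simp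
  have "\<exists>Y\<in>range Row. \<forall>k\<in>\<beta> ` cyc. k ` Y = Y"
  proof (rule pgrp_fixed_ex[OF prime_p pgrp_cyc[OF \<beta>] card_cyc[OF \<beta>] _ nd])
    fix k Y assume "k \<in> \<beta> ` cyc" "Y \<in> range Row"
    then show "k ` Y \<in> range Row" using K_Row regrepD(1)[OF \<beta>] by blast
  qed (auto simp: image_comp)
  then obtain x where x: "\<forall>k\<in>\<beta> ` cyc. k ` Row x = Row x" by blast
  let ?\<omega>0 = "pt (x, 0)"
  have "?\<omega>0 \<in> Row x" by (simp add: Row_def co_pt char2)
  then have "\<beta> (0, i) ?\<omega>0 \<in> Row x" using x by (metis image_eqI mem_Sigma_iff singletonI UNIV_I)
  then have 0: "fst (co (\<beta> (0, i) ?\<omega>0)) + fst (co ?\<omega>0) \<in> Z0" by (simp add: Row_def co_pt)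
  obtain g where g: "\<beta> g ?\<omega>0 = \<omega>" using regrepD(5)[OF \<beta>] \<omega> by (metis pt_in)
  have "\<beta> (0, i) \<omega> = \<beta> g (\<beta> (0, i) ?\<omega>0)"
    using regrepD(2)[OF \<beta>, of g "(0, i)"] regrepD(2)[OF \<beta>, of "(0, i)" g] g
    by (metis add.commute comp_apply)
  then show ?thesis
    using K_Z0[of "\<beta> g" "\<beta> (0, i) ?\<omega>0" ?\<omega>0] 0 g regrepD(1)[OF \<beta>] by simp
qed

text \<open>The size of a column is prime to \<open>p\<close>. If a nontrivial element of the p-part
  kept a column, the whole p-part would act on that column and fix a point, against
  regularity.\<close>

lemma col_free:
  assumes \<beta>: "regrep \<beta>" and i: "\<not> int p dvd i" and \<omega>: "\<omega> \<in> \<Omega>"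
  shows "\<not> low (co (\<beta> (0, i) \<omega>) - co \<omega>)"
proof
  assume low: "low (co (\<beta> (0, i) \<omega>) - co \<omega>)"
  define C where "C = {\<omega>'\<in>\<Omega>. low (co \<omega>' - co \<omega>)}"
  have step: "\<beta> (0, i) \<omega>' \<in> C" if "\<omega>' \<in> C" for \<omega>'
  proof -
    have "low (co (\<beta> (0, i) \<omega>') - co (\<beta> (0, i) \<omega>))"
      using K_low[OF regrepD(1)[OF \<beta>], of \<omega>' \<omega>] that \<omega> by (simp add: C_def)
    from low_add[OF this low] show ?thesis using that regrepD(1)[OF \<beta>] by (simp add: C_def)
  qed
  have pow: "\<beta> (0, int m * i) \<omega>' \<in> C" if "\<omega>' \<in> C" for m \<omega>'
  proof (induction m)
    case 0
    have "\<beta> (0, 0) = id" by (rule regrepD(4)[OF \<beta>]) auto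
    then show ?case using that by simp
  next
    case (Suc m)
    have "\<beta> (0, int (Suc m) * i) = \<beta> (0, i) \<circ> \<beta> (0, int m * i)"
      using regrepD(2)[OF \<beta>, of "(0, i)" "(0, int m * i)"] by (simp add: algebra_simps)
    then show ?case using step[OF Suc.IH] by simp
  qed
  \<comment> \<open>Multiples of the unit \<open>i\<close> exhaust the p-part.\<close>
  obtain n where n: "[n * i = 1] (mod int p)" using ex_inverse i coprime_iff by blast
  have all: "k \<omega>' \<in> C" if k: "k \<in> \<beta> ` cyc" "\<omega>' \<in> C" for k \<omega>'
  proof -
    obtain j where j: "k = \<beta> (0, j)" using k by blast
    define m where "m = nat (n * j mod int p)"
    have "[int m * i = (n * j) * i] (mod int p)" using p_pos by (intro cong_scalar_right) (simp add: m_def cong_def)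
    also have "(n * j) * i = (n * i) * j" by simp
    also have "[(n * i) * j = 1 * j] (mod int p)" by (rule cong_scalar_right[OF n])
    finally have "k = \<beta> (0, int m * i)" unfolding j by (intro regrep_period[OF \<beta>]) (auto dest: cong_sym)
    then show ?thesis using pow k(2) by simp
  qed
  have C_img: "C = (\<lambda>h. pt (co \<omega> + (h, 0))) ` H1"
  proof (intro equalityI subsetI)
    fix \<omega>' assume "\<omega>' \<in> C"
    then have c: "\<omega>' \<in> \<Omega>" "low (co \<omega>' - co \<omega>)" by (auto simp: C_def)
    have "pt (co \<omega>') = pt (co \<omega> + (fst (co \<omega>') + fst (co \<omega>), 0))"
      using c(2) by (auto simp: pt_eq low_def cong_iff_dvd_diff add.left_commute)
    then show "\<omega>' \<in> (\<lambda>h. pt (co \<omega> + (h, 0))) ` H1"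
      using c co(2) by (intro image_eqI[of _ _ "fst (co \<omega>') + fst (co \<omega>)"]) (auto simp: low_def)
  next
    fix \<omega>' assume "\<omega>' \<in> (\<lambda>h. pt (co \<omega> + (h, 0))) ` H1"
    then obtain h where h: "h \<in> H1" "\<omega>' = pt (co \<omega> + (h, 0))" by blast
    have "fst (co \<omega>') = fst (co \<omega>) + h" "[snd (co \<omega>') = snd (co \<omega>)] (mod int p)"
      using co_pt[of "co \<omega> + (h, 0)"] h by auto
    then show "\<omega>' \<in> C" using h by (auto simp: C_def low_def cong_iff_dvd_diff add.commute)
  qed
  have "inj_on (\<lambda>h. pt (co \<omega> + (h, 0))) H1" by (auto simp: inj_on_def pt_eq)
  then have nd: "\<not> p dvd card C"
    using p_ndvd_subgroup(1)[of H1] add_H1 by (simp add: C_img card_image)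
  have "finite C" using finite_Omega by (simp add: C_def)
  then have "\<exists>\<omega>'\<in>C. \<forall>k\<in>\<beta> ` cyc. k \<omega>' = \<omega>'"
    by (rule pgrp_fixed_ex[OF prime_p pgrp_cyc[OF \<beta>] card_cyc[OF \<beta>] _ nd]) (use all in auto)
  then obtain \<omega>' where "\<omega>' \<in> \<Omega>" "\<beta> (0, 1) \<omega>' = \<omega>'" by (auto simp: C_def)
  then have "int p dvd 1" using regrepD(3)[OF \<beta>, of \<omega>' "(0, 1)"] by simp
  then show False using prime_p by auto
qed

lemma permutesI_finite:
  assumes "\<And>\<omega>. \<omega> \<in> \<Omega> \<Longrightarrow> f \<omega> \<in> \<Omega>" "inj_on f \<Omega>" "\<And>\<omega>. \<omega> \<notin> \<Omega> \<Longrightarrow> f \<omega> = \<omega>"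
  shows "f permutes \<Omega>"
proof (rule bij_imp_permutes)
  have "f ` \<Omega> = \<Omega>" using endo_inj_surj[OF finite_Omega _ assms(2)] assms(1) by blast
  then show "bij_betw f \<Omega> \<Omega>" using assms(2) by (simp add: bij_betw_def)
qed (use assms in auto)

lemma regrep_0_add: "regrep \<beta> \<Longrightarrow> \<beta> (0, i) (\<beta> (0, j) \<omega>) = \<beta> (0, i + j) \<omega>"
  using regrepD(2)[of \<beta> "(0, i)" "(0, j)"] by simp

text \<open>Call the second coordinate of a point its height. An orbit of the p-part stays in a row
  and meets every height once. The map \<open>k\<close> slides a point along its orbit to height 0
  and lifts it back to its own height inside the fibre reached, so the orbit ends in one fibre. On a
  column \<open>k\<close> agrees with one element of \<open>K\<close>; between columns it changes
  differences only by elements of \<open>Z0\<close>, which keeps them in their classes.\<close>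

lemma align_orbits_narrow:
  assumes \<beta>: "regrep \<beta>" and Z0: "Z0 \<subseteq> H1"
  shows "\<exists>k\<in>K. \<forall>\<omega>\<in>\<Omega>. fst (co (k (\<beta> (0, 1) \<omega>))) = fst (co (k \<omega>))"
proof -
  note \<beta>K = regrepD(1)[OF \<beta>]
  \<comment> \<open>Two points of one orbit at equal height lie in one row, hence in one column
    because \<open>Z0\<close> is contained in \<open>H1\<close>; \<open>col_free\<close> excludes
    this.\<close>
  have uniq: "[j = j'] (mod int p)"
    if \<omega>: "\<omega> \<in> \<Omega>" and eq: "[snd (co (\<beta> (0, j) \<omega>)) = snd (co (\<beta> (0, j') \<omega>))] (mod int p)" for \<omega> j j'
  proof (rule ccontr)
    assume "\<not> [j = j'] (mod int p)"
    then have nd: "\<not> int p dvd j - j'" by (simp add: cong_iff_dvd_diff)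
    let ?\<omega> = "\<beta> (0, j') \<omega>"
    have 1: "?\<omega> \<in> \<Omega>" "\<beta> (0, j - j') ?\<omega> = \<beta> (0, j) \<omega>" using \<omega> \<beta>K by (simp_all add: regrep_0_add[OF \<beta>])
    have "fst (co (\<beta> (0, j) \<omega>)) + fst (co ?\<omega>) \<in> H1" using row_fix[OF \<beta> 1(1), of "j - j'"] 1(2) Z0 by auto
    then have "low (co (\<beta> (0, j) \<omega>) - co ?\<omega>)" using eq by (simp add: low_def cong_iff_dvd_diff)
    then show False using col_free[OF \<beta> nd 1(1)] 1(2) by simp
  qed
  have ex: "\<exists>j. int p dvd snd (co (\<beta> (0, j) \<omega>))" if \<omega>: "\<omega> \<in> \<Omega>" for \<omega>
  proof -
    let ?f = "\<lambda>j. snd (co (\<beta> (0, j) \<omega>))"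
    have range: "?f j \<in> {0..<int p}" for j using co(1)[of "\<beta> (0, j) \<omega>"] \<omega> \<beta>K by (auto simp: mem_Times_iff)
    have "inj_on ?f {0..<int p}"
    proof (rule inj_onI)
      fix j j' assume jj: "j \<in> {0..<int p}" "j' \<in> {0..<int p}" "?f j = ?f j'"
      then have "[j = j'] (mod int p)" using uniq[OF \<omega>, of j j'] by simp
      then show "j = j'" using jj by (simp add: cong_def)
    qed
    then have "?f ` {0..<int p} = {0..<int p}" using range by (intro endo_inj_surj) auto
    moreover have "0 \<in> {0..<int p}" using p_pos by simp
    ultimately have "0 \<in> ?f ` {0..<int p}" by (simp only:)
    then obtain j where "0 = ?f j" by (rule imageE)
    then show ?thesis by (intro exI[of _ j]) simp
  qed
  define J where "J \<omega> = (SOME j. int p dvd snd (co (\<beta> (0, j) \<omega>)))" for \<omega>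
  have J: "int p dvd snd (co (\<beta> (0, J \<omega>) \<omega>))" if "\<omega> \<in> \<Omega>" for \<omega>
    unfolding J_def using someI_ex[OF ex[OF that]] .
  have J_eq: "\<beta> (0, j) = \<beta> (0, J \<omega>)" if "\<omega> \<in> \<Omega>" "int p dvd snd (co (\<beta> (0, j) \<omega>))" for \<omega> j
    by (rule regrep_period[OF \<beta>])
      (use uniq[OF that(1), of j "J \<omega>"] J[OF that(1)] that(2) in \<open>simp_all add: cong_def mod_eq_0_iff_dvd\<close>)
  define k where "k \<omega> = (if \<omega> \<in> \<Omega> then tr (0, snd (co \<omega>)) (\<beta> (0, J \<omega>) \<omega>) else \<omega>)" for \<omega>
  have k_pt: "k \<omega> = pt (fst (co (\<beta> (0, J \<omega>) \<omega>)), snd (co \<omega>))" if \<omega>: "\<omega> \<in> \<Omega>" for \<omega>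
  proof -
    have "k \<omega> = tr (0, snd (co \<omega>)) (pt (co (\<beta> (0, J \<omega>) \<omega>)))" using \<omega> co \<beta>K by (simp add: k_def)
    then show ?thesis using J[OF \<omega>] by (simp add: tr pt_eq cong_iff_dvd_diff)
  qed
  have kfst: "fst (co (k \<omega>)) = fst (co (\<beta> (0, J \<omega>) \<omega>))" "[snd (co (k \<omega>)) = snd (co \<omega>)] (mod int p)"
    if "\<omega> \<in> \<Omega>" for \<omega> using k_pt[OF that] co_pt[of "(fst (co (\<beta> (0, J \<omega>) \<omega>)), snd (co \<omega>))"] by simp_all
  have krow: "fst (co (k \<omega>)) + fst (co \<omega>) \<in> Z0" if "\<omega> \<in> \<Omega>" for \<omega>
    using row_fix[OF \<beta> that] kfst(1)[OF that] by simp
  have snd_eq: "snd (co \<omega>) = snd (co \<omega>')" if "\<omega> \<in> \<Omega>" "\<omega>' \<in> \<Omega>" "int p dvd snd (co \<omega>) - snd (co \<omega>')" for \<omega> \<omega>'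
    using co(1)[OF that(1)] co(1)[OF that(2)] that(3)
    by (auto simp: mem_Times_iff cong_def simp flip: cong_iff_dvd_diff)
  \<comment> \<open>Points of one column have equal height and keep this property under
    \<open>K\<close>, so the same exponent brings all of them to height 0.\<close>
  have same: "tr (0, snd (co \<omega>)) \<circ> \<beta> (0, J \<omega>) = tr (0, snd (co \<omega>')) \<circ> \<beta> (0, J \<omega>')"
    if \<omega>: "\<omega> \<in> \<Omega>" "\<omega>' \<in> \<Omega>" and low: "low (co \<omega> - co \<omega>')" for \<omega> \<omega>'
  proof -
    have "low (co (\<beta> (0, J \<omega>) \<omega>) - co (\<beta> (0, J \<omega>) \<omega>'))" using K_low[OF \<beta>K \<omega>] low by simp
    then have "int p dvd snd (co (\<beta> (0, J \<omega>) \<omega>'))"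
      using J[OF \<omega>(1)] unfolding low_def snd_diff by (metis conjunct2 dvd_diff_commute diff_add_cancel dvd_add)
    then have "\<beta> (0, J \<omega>) = \<beta> (0, J \<omega>')" using J_eq \<omega>(2) by blast
    moreover have "snd (co \<omega>) = snd (co \<omega>')" using snd_eq[OF \<omega>] low by (simp add: low_def)
    ultimately show ?thesis by simp
  qed
  have k_in: "k \<omega> \<in> \<Omega>" if "\<omega> \<in> \<Omega>" for \<omega> using k_pt[OF that] by simp
  have free: "(\<forall>h\<in>H1. x + h \<notin> Z0) \<or> \<not> Z0 \<subseteq> H1" if "x \<notin> H1" for x
  proof -
    have "x + h \<notin> Z0" if "h \<in> H1" for h
      using add_H1_iff[OF that, of x] \<open>x \<notin> H1\<close> Z0 by (auto simp: add.commute)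
    then show ?thesis by blast
  qed
  have k_perm: "k permutes \<Omega>"
  proof (rule permutesI_finite[OF k_in])
    show "inj_on k \<Omega>"
    proof (rule inj_onI)
      fix \<omega> \<omega>' assume \<omega>: "\<omega> \<in> \<Omega>" "\<omega>' \<in> \<Omega>" and eq: "k \<omega> = k \<omega>'"
      have "fst (co \<omega>) + fst (co \<omega>') = (fst (co (k \<omega>)) + fst (co \<omega>)) + (fst (co (k \<omega>')) + fst (co \<omega>'))"
        by (simp add: eq add.commute add.left_commute)
      then have "fst (co \<omega>) + fst (co \<omega>') \<in> H1" using Z0_add[OF krow[OF \<omega>(1)] krow[OF \<omega>(2)]] Z0 by (metis subsetD)
      moreover have "[snd (co \<omega>) = snd (co \<omega>')] (mod int p)"
        using kfst(2)[OF \<omega>(1)] kfst(2)[OF \<omega>(2)] eq by (metis cong_sym cong_trans)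
      ultimately have "low (co \<omega> - co \<omega>')" by (simp add: low_def cong_iff_dvd_diff)
      note eq' = same[OF \<omega> this]
      have "k \<omega> = (tr (0, snd (co \<omega>)) \<circ> \<beta> (0, J \<omega>)) \<omega>" "k \<omega>' = (tr (0, snd (co \<omega>)) \<circ> \<beta> (0, J \<omega>)) \<omega>'"
        unfolding eq' using \<omega> eq' by (simp_all add: k_def fun_eq_iff)
      then have "(tr (0, snd (co \<omega>)) \<circ> \<beta> (0, J \<omega>)) \<omega> = (tr (0, snd (co \<omega>)) \<circ> \<beta> (0, J \<omega>)) \<omega>'"
        using eq by simp
      then show "\<omega> = \<omega>'" using K_inj[OF K_comp[OF tr(1) \<beta>K]] by blast
    qed
  next
    fix \<omega> assume "\<omega> \<notin> \<Omega>"
    then show "k \<omega> = \<omega>" by (simp add: k_def)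
  qed
  have "k \<in> K"
  proof (rule two_closed[OF k_perm])
    fix \<omega> \<omega>' assume \<omega>: "\<omega> \<in> \<Omega>" "\<omega>' \<in> \<Omega>"
    show "\<exists>l\<in>K. l \<omega> = k \<omega> \<and> l \<omega>' = k \<omega>'"
    proof (cases "low (co \<omega> - co \<omega>')")
      case True
      then show ?thesis using same[OF \<omega> True] \<omega> K_comp[OF tr(1) \<beta>K]
        by (intro bexI[of _ "tr (0, snd (co \<omega>)) \<circ> \<beta> (0, J \<omega>)"]) (simp_all add: k_def fun_eq_iff)
    next
      case False
      let ?d = "co \<omega>' - co \<omega>" and ?d' = "co (k \<omega>') - co (k \<omega>)"
      have nl: "\<not> low ?d" using False low_neg[of ?d] by simp
      \<comment> \<open>The displacement of the difference: both points stay in their rows, so it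
        lies in \<open>Z0\<close>.\<close>
      define z where "z = (fst (co (k \<omega>)) + fst (co \<omega>)) + (fst (co (k \<omega>')) + fst (co \<omega>'))"
      have z: "z \<in> Z0" unfolding z_def using Z0_add krow \<omega> by blast
      have d': "fst ?d' = fst ?d + z" by (simp add: z_def add.commute add.left_commute)
      have cong: "[snd ?d' = snd ?d] (mod int p)" using kfst(2)[OF \<omega>(1)] kfst(2)[OF \<omega>(2)] by (simp add: cong_diff)
      have "rel ?d ?d'"
      proof (cases "int p dvd snd ?d")
        case True
        then have "fst ?d \<notin> H1" using nl by (simp add: low_def)
        moreover then have "\<not> low (fst ?d + z, snd ?d')"
          using add_H1_iff[of z "fst ?d"] z Z0 by (auto simp: low_def add.commute)
        ultimately have "rel (fst ?d, snd ?d) (fst ?d + z, snd ?d')"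
          using nl by (intro rel_free[OF z] free) (simp_all only: prod.collapse not_False_eq_True)
        then show ?thesis by (simp only: d'[symmetric] prod.collapse)
      next
        case nd: False
        have "rel (fst ?d, snd ?d) (fst ?d + z, snd ?d)"
        proof (cases "fst ?d \<in> H1")
          case True
          then show ?thesis using rel_column[OF Z0 True nd z] by blast
        next
          case False
          have "\<not> low (fst ?d + z, snd ?d)" using nd by (simp add: low_def)
          then show ?thesis using nl False
            by (intro rel_free[OF z] free) (simp_all only: prod.collapse not_False_eq_True)
        qed
        also have "rel (fst ?d + z, snd ?d) (fst ?d + z, snd ?d')" by (rule rel_cong) (rule cong_sym[OF cong])
        finally show ?thesis by (simp only: d'[symmetric] prod.collapse)
      qed
      from rel_pair[OF this] show ?thesis using co \<omega> k_in by simp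
    qed
  qed
  moreover have "fst (co (k (\<beta> (0, 1) \<omega>))) = fst (co (k \<omega>))" if \<omega>: "\<omega> \<in> \<Omega>" for \<omega>
  proof -
    have b: "\<beta> (0, 1) \<omega> \<in> \<Omega>" using \<omega> \<beta>K by simp
    have eq: "\<beta> (0, J \<omega> - 1) (\<beta> (0, 1) \<omega>) = \<beta> (0, J \<omega>) \<omega>" by (simp add: regrep_0_add[OF \<beta>])
    then have "\<beta> (0, J \<omega> - 1) = \<beta> (0, J (\<beta> (0, 1) \<omega>))" using J[OF \<omega>] by (intro J_eq b) simp
    then show ?thesis using kfst(1)[OF b] kfst(1)[OF \<omega>] eq by simp
  qed
  ultimately show ?thesis by blast
qed

section \<open>Columns and the case of wide classes\<close>

definition col :: "'a \<Rightarrow> 'a set" where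
  "col \<omega> = {\<omega>'\<in>\<Omega>. low (co \<omega>' - co \<omega>)}"

lemma low_sym: "low (g - h) \<longleftrightarrow> low (h - g)"
  using low_neg[of "g - h"] by simp

lemma low_0 [simp]: "low 0" by (simp add: low_def)

lemma col_eq: 
  assumes "\<omega> \<in> \<Omega>" "\<omega>' \<in> \<Omega>" shows "col \<omega> = col \<omega>' \<longleftrightarrow> low (co \<omega> - co \<omega>')"
proof
  assume "col \<omega> = col \<omega>'"
  moreover have "\<omega> \<in> col \<omega>" using assms by (simp add: col_def)
  ultimately show "low (co \<omega> - co \<omega>')" by (simp add: col_def)
next
  assume l: "low (co \<omega> - co \<omega>')"
  then have l': "low (co \<omega>' - co \<omega>)" using low_sym by blast
  have "low (co x - co \<omega>) \<longleftrightarrow> low (co x - co \<omega>')" for x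
    using low_add[OF _ l, of "co x - co \<omega>"] low_add[OF _ l', of "co x - co \<omega>'"] by auto
  then show "col \<omega> = col \<omega>'" by (simp add: col_def)
qed

lemma K_col: 
  assumes k: "k \<in> K" and \<omega>: "\<omega> \<in> \<Omega>" shows "k ` col \<omega> = col (k \<omega>)"
proof (intro equalityI subsetI)
  fix y assume "y \<in> k ` col \<omega>"
  then obtain x where "x \<in> col \<omega>" "y = k x" by blast
  then show "y \<in> col (k \<omega>)" using K_low[OF k, of x \<omega>] \<omega> k by (simp add: col_def)
next
  fix y assume y: "y \<in> col (k \<omega>)"
  then have "pinv k y \<in> \<Omega>" "k (pinv k y) = y" using k K_inv by (simp_all add: col_def)
  then have "pinv k y \<in> col \<omega>" using K_low[OF k, of "pinv k y" \<omega>] \<omega> y by (simp add: col_def)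
  then show "y \<in> k ` col \<omega>" using \<open>k (pinv k y) = y\<close> by (metis imageI)
qed

text \<open>If a class of nontrivial columns is not confined to one coset of \<open>H1\<close>, then \<open>K\<close> induces all
  permutations of the columns of a block, so the generators of the two \<open>p\<close>-parts are conjugate.\<close>

lemma align_orbits_wide:
  assumes \<beta>: "regrep \<beta>" and Z0: "\<not> Z0 \<subseteq> H1"
  shows "\<exists>k\<in>K. \<forall>\<omega>\<in>\<Omega>. fst (co (k (\<beta> (0, 1) \<omega>))) = fst (co (k \<omega>))"
proof -
  note \<beta>K = regrepD(1)[OF \<beta>]
  let ?b = "\<beta> (0, 1)" and ?a = "tr (0, 1)"
  \<comment> \<open>Rows need not be unions of columns, so they are enlarged to the cosets of H1 +
    Z0, which are.\<close>
  define UU where "UU = {h + z | h z. h \<in> H1 \<and> z \<in> Z0}"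
  have UU_Z0: "z \<in> Z0 \<Longrightarrow> z \<in> UU" and UU_H1: "h \<in> H1 \<Longrightarrow> h \<in> UU" for z h
    unfolding UU_def by (force intro: exI[of _ 0])+
  have UU_add: "x + y \<in> UU" if xy: "x \<in> UU" "y \<in> UU" for x y
  proof -
    obtain h z h' z' where "x = h + z" "y = h' + z'" "h \<in> H1" "z \<in> Z0" "h' \<in> H1" "z' \<in> Z0"
      using xy unfolding UU_def by blast
    then have "x + y = (h + h') + (z + z')" "h + h' \<in> H1" "z + z' \<in> Z0" using add_H1 Z0_add by (auto simp: algebra_simps)
    then show ?thesis unfolding UU_def by blast
  qed
  define sU where "sU \<omega> \<omega>' \<longleftrightarrow> fst (co \<omega>) + fst (co \<omega>') \<in> UU" for \<omega> \<omega>'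
  have sU_refl: "sU \<omega> \<omega>" for \<omega> using UU_Z0[of 0] by (simp add: sU_def char2)
  have sU_sym: "sU \<omega> \<omega>' \<Longrightarrow> sU \<omega>' \<omega>" for \<omega> \<omega>' by (simp add: sU_def add.commute)
  have sU_trans: "sU \<omega> \<omega>'' " if "sU \<omega> \<omega>'" "sU \<omega>' \<omega>''" for \<omega> \<omega>' \<omega>''
    using UU_add[OF that[unfolded sU_def]] by (simp add: sU_def add.left_commute add.commute)
  have sU_low: "sU \<omega> \<omega>'" if "low (co \<omega> - co \<omega>')" for \<omega> \<omega>'
    using that UU_H1 by (simp add: sU_def low_def)
  define Cs where "Cs \<omega> = {col \<omega>' | \<omega>'. \<omega>' \<in> \<Omega> \<and> sU \<omega>' \<omega>}" for \<omega>
  have Cs_mem: "col \<omega>' \<in> Cs \<omega> \<longleftrightarrow> sU \<omega>' \<omega>" if "\<omega> \<in> \<Omega>" "\<omega>' \<in> \<Omega>" for \<omega> \<omega>'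
    unfolding Cs_def using that col_eq sU_low sU_trans by blast
  have Cs_eq: "Cs \<omega> = Cs \<omega>'" if "sU \<omega> \<omega>'" for \<omega> \<omega>'
    unfolding Cs_def using that sU_trans sU_sym by blast
  have sU_reg: "sU (\<gamma> (0, i) \<omega>) \<omega>" if "regrep \<gamma>" "\<omega> \<in> \<Omega>" for \<gamma> i \<omega>
    using row_fix[OF that] UU_Z0 by (simp add: sU_def)
  have cyc: "\<gamma> (0, 1) ` c \<in> Cs \<omega>" "(((`) (\<gamma> (0, 1))) ^^ n) c = \<gamma> (0, int n) ` c"
    "((`) (\<gamma> (0, 1)) ^^ p) c = c" "\<gamma> (0, 1) ` c \<noteq> c"
    if \<gamma>: "regrep \<gamma>" and \<omega>: "\<omega> \<in> \<Omega>" and c: "c \<in> Cs \<omega>" for \<gamma> \<omega> c n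
  proof -
    obtain \<omega>' where \<omega>': "\<omega>' \<in> \<Omega>" "sU \<omega>' \<omega>" "c = col \<omega>'" using c unfolding Cs_def by blast
    have im: "\<gamma> (0, 1) ` c = col (\<gamma> (0, 1) \<omega>')" using K_col[OF regrepD(1)[OF \<gamma>] \<omega>'(1)] \<omega>' by simp
    have in\<Omega>: "\<gamma> (0, 1) \<omega>' \<in> \<Omega>" using regrepD(1)[OF \<gamma>] \<omega>'(1) by simp
    show "\<gamma> (0, 1) ` c \<in> Cs \<omega>" unfolding im using Cs_mem[OF \<omega> in\<Omega>] sU_reg[OF \<gamma> \<omega>'(1)] \<omega>'(2) sU_trans by blast
    show pow: "(((`) (\<gamma> (0, 1))) ^^ n) c = \<gamma> (0, int n) ` c" for n
    proof (induction n)
      case 0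
      have "\<gamma> (0, 0) = id" by (rule regrepD(4)[OF \<gamma>]) auto
      then show ?case by simp
    next
      case (Suc n)
      have "\<gamma> (0, int (Suc n)) = \<gamma> (0, 1) \<circ> \<gamma> (0, int n)"
        using regrepD(2)[OF \<gamma>, of "(0, 1)" "(0, int n)"] by simp
      then show ?case using Suc by (simp add: image_comp)
    qed
    have "\<gamma> (0, int p) = id" by (rule regrepD(4)[OF \<gamma>]) auto
    then show "((`) (\<gamma> (0, 1)) ^^ p) c = c" using pow[of p] by simp
    show "\<gamma> (0, 1) ` c \<noteq> c"
    proof
      assume "\<gamma> (0, 1) ` c = c"
      then have "low (co (\<gamma> (0, 1) \<omega>') - co \<omega>')" using im \<omega>' col_eq[OF in\<Omega> \<omega>'(1)] by simp
      moreover have "\<not> int p dvd 1" using prime_p by auto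
      ultimately show False using col_free[OF \<gamma> _ \<omega>'(1)] by blast
    qed
  qed
  have finCs: "finite (Cs \<omega>)" for \<omega>
  proof -
    have "Cs \<omega> \<subseteq> col ` \<Omega>" unfolding Cs_def by blast
    then show ?thesis using finite_Omega finite_surj by blast
  qed
  define good where "good C \<pi> \<longleftrightarrow> bij_betw \<pi> C C \<and> (\<forall>c\<in>C. \<pi> (?b ` c) = ?a ` \<pi> c)" for C and \<pi> :: "'a set \<Rightarrow> 'a set"
  \<comment> \<open>The choice depends only on the set of columns, so all points of a block share
    it.\<close>
  define match where "match C = (SOME \<pi>. good C \<pi>)" for C
  have match: "good (Cs \<omega>) (match (Cs \<omega>))" if \<omega>: "\<omega> \<in> \<Omega>" for \<omega>
  proof -
    have "\<exists>\<pi>. good (Cs \<omega>) \<pi>" unfolding good_def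
    proof (rule semiregular_conjugate[OF prime_p finCs finCs refl])
      fix c assume c: "c \<in> Cs \<omega>"
      show "?b ` c \<in> Cs \<omega> \<and> ((`) ?b ^^ p) c = c \<and> ?b ` c \<noteq> c"
        by (intro conjI cyc(1)[OF \<beta> \<omega> c] cyc(3)[OF \<beta> \<omega> c] cyc(4)[OF \<beta> \<omega> c])
      show "?a ` c \<in> Cs \<omega> \<and> ((`) ?a ^^ p) c = c \<and> ?a ` c \<noteq> c"
        by (intro conjI cyc(1)[OF regrep_tr \<omega> c] cyc(3)[OF regrep_tr \<omega> c] cyc(4)[OF regrep_tr \<omega> c])
    qed
    then show ?thesis unfolding match_def by (rule someI_ex)
  qed
  define P where "P \<omega> = match (Cs \<omega>) (col \<omega>)" for \<omega>
  have P_in: "P \<omega> \<in> Cs \<omega>" if "\<omega> \<in> \<Omega>" for \<omega>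
    using match[OF that] Cs_mem[OF that that] sU_refl unfolding P_def good_def by (metis bij_betwE)
  have P_inj: "col \<omega> = col \<omega>'" if \<omega>: "\<omega> \<in> \<Omega>" "\<omega>' \<in> \<Omega>" and eq: "P \<omega> = P \<omega>'" for \<omega> \<omega>'
  proof -
    obtain \<omega>1 where \<omega>1: "\<omega>1 \<in> \<Omega>" "P \<omega> = col \<omega>1" using P_in[OF \<omega>(1)] unfolding Cs_def by blast
    have "sU \<omega>1 \<omega>" "sU \<omega>1 \<omega>'" using P_in[OF \<omega>(1)] P_in[OF \<omega>(2)] \<omega>1 Cs_mem \<omega> eq by metis+
    then have "Cs \<omega> = Cs \<omega>'" using Cs_eq sU_sym sU_trans by blast
    moreover have "col \<omega> \<in> Cs \<omega>" "col \<omega>' \<in> Cs \<omega>'" using Cs_mem \<omega> sU_refl by blast+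
    ultimately show ?thesis using match[OF \<omega>(1)] eq unfolding P_def good_def bij_betw_def by (metis inj_onD)
  qed
  define orb where "orb c = {\<beta> (0, int j) ` c | j :: nat. True}" for c :: "'a set"
  \<comment> \<open>One column is chosen in each orbit of the p-part on columns; there
    \<open>match\<close> is determined by its value at this column, because it intertwines the two
    generators.\<close>
  define c0 where "c0 c = (SOME c'. c' \<in> orb c)" for c
  define J where "J c = (SOME j :: nat. \<beta> (0, int j) ` c = c0 c)" for c
  have J: "\<beta> (0, int (J c)) ` c = c0 c" for c
  proof -
    have "orb c \<noteq> {}" unfolding orb_def by blast
    then have "c0 c \<in> orb c" unfolding c0_def by (metis some_in_eq)
    then have "\<exists>j. \<beta> (0, int j) ` c = c0 c" unfolding orb_def by auto
    then show ?thesis unfolding J_def by (rule someI_ex)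
  qed
  have c0_b: "c0 (?b ` c) = c0 c" for c
  proof -
    have "orb (?b ` c) = orb c"
    proof (intro equalityI subsetI)
      fix d assume "d \<in> orb (?b ` c)"
      then obtain j where "d = \<beta> (0, int j) ` (?b ` c)" unfolding orb_def by blast
      then have "d = \<beta> (0, int (Suc j)) ` c" by (simp add: image_image regrep_0_add[OF \<beta>] add.commute)
      then show "d \<in> orb c" unfolding orb_def by blast
    next
      fix d assume "d \<in> orb c"
      then obtain j where d: "d = \<beta> (0, int j) ` c" unfolding orb_def by blast
      have "\<beta> (0, int j) = \<beta> (0, int (j + (p - 1)) + 1)"
        using p_pos by (intro regrep_period[OF \<beta>]) (auto simp: of_nat_diff cong_def)
      then have "d = \<beta> (0, int (j + (p - 1))) ` (?b ` c)" unfolding d by (simp add: image_image regrep_0_add[OF \<beta>])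
      then show "d \<in> orb (?b ` c)" unfolding orb_def by blast
    qed
    then show ?thesis by (simp add: c0_def)
  qed
  \<comment> \<open>A translation realises \<open>match\<close> at the chosen column. Its component
    in E may be taken in \<open>Z0\<close>, since a component in \<open>H1\<close> does not change a
    column; in this way points stay in their rows.\<close>
  define shift where "shift \<omega> = (SOME g. fst g \<in> Z0 \<and> tr g ` c0 (col \<omega>) = match (Cs \<omega>) (c0 (col \<omega>)))" for \<omega>
  have shift: "fst (shift \<omega>) \<in> Z0" "tr (shift \<omega>) ` c0 (col \<omega>) = match (Cs \<omega>) (c0 (col \<omega>))" if \<omega>: "\<omega> \<in> \<Omega>" for \<omega>
  proof -
    let ?\<omega>0 = "\<beta> (0, int (J (col \<omega>))) \<omega>"
    have \<omega>0: "?\<omega>0 \<in> \<Omega>" "col ?\<omega>0 = c0 (col \<omega>)" using K_col[OF \<beta>K \<omega>] J[of "col \<omega>"] \<beta>K \<omega> by auto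
    have "sU ?\<omega>0 \<omega>" by (rule sU_reg[OF \<beta> \<omega>])
    then have Cs0: "Cs ?\<omega>0 = Cs \<omega>" using Cs_eq by blast
    obtain \<omega>1 where \<omega>1: "\<omega>1 \<in> \<Omega>" "sU \<omega>1 ?\<omega>0" "P ?\<omega>0 = col \<omega>1" using P_in[OF \<omega>0(1)] unfolding Cs_def by blast
    obtain h z where hz: "h \<in> H1" "z \<in> Z0" "fst (co \<omega>1) + fst (co ?\<omega>0) = h + z"
      using \<omega>1(2) unfolding sU_def UU_def by blast
    define g where "g = (z, snd (co \<omega>1) - snd (co ?\<omega>0))"
    have "tr g (pt (co ?\<omega>0)) = pt (g + co ?\<omega>0)" by (rule tr)
    then have t: "tr g ?\<omega>0 = pt (g + co ?\<omega>0)" using co(2)[OF \<omega>0(1)] by simp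
    have "fst (co (tr g ?\<omega>0)) = z + fst (co ?\<omega>0)" "[snd (co (tr g ?\<omega>0)) = snd (co \<omega>1)] (mod int p)"
      unfolding t using co_pt[of "g + co ?\<omega>0"] by (simp_all add: g_def)
    moreover have "z + fst (co ?\<omega>0) + fst (co \<omega>1) = h"
      using hz(3) by (metis add.assoc add.commute add_cancel_e2)
    ultimately have "low (co (tr g ?\<omega>0) - co \<omega>1)" using hz(1) by (simp add: low_def cong_iff_dvd_diff)
    then have "col (tr g ?\<omega>0) = col \<omega>1" using col_eq \<omega>1(1) t by simp
    then have "tr g ` c0 (col \<omega>) = match (Cs \<omega>) (c0 (col \<omega>))"
      using K_col[OF tr(1) \<omega>0(1)] \<omega>0(2) \<omega>1(3) Cs0 unfolding P_def by simp
    moreover have "fst g \<in> Z0" using hz by (simp add: g_def)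
    ultimately have "\<exists>g. fst g \<in> Z0 \<and> tr g ` c0 (col \<omega>) = match (Cs \<omega>) (c0 (col \<omega>))" by blast
    from someI_ex[OF this] show "fst (shift \<omega>) \<in> Z0" "tr (shift \<omega>) ` c0 (col \<omega>) = match (Cs \<omega>) (c0 (col \<omega>))"
      unfolding shift_def by blast+
  qed
  \<comment> \<open>Go to the chosen column by \<open>\<beta>\<close>, apply the shift, and come
    back equally many steps by translations: an element of \<open>K\<close> that has the effect of
    \<open>match\<close> on the column of \<open>\<omega>\<close>.\<close>
  define \<kappa> where "\<kappa> \<omega> = tr (0, - int (J (col \<omega>))) \<circ> tr (shift \<omega>) \<circ> \<beta> (0, int (J (col \<omega>)))" for \<omega>
  have \<kappa>K: "\<kappa> \<omega> \<in> K" for \<omega> unfolding \<kappa>_def using K_comp tr(1) \<beta>K by blast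
  define k where "k \<omega> = (if \<omega> \<in> \<Omega> then \<kappa> \<omega> \<omega> else \<omega>)" for \<omega>
  have k_in: "k \<omega> \<in> \<Omega>" if "\<omega> \<in> \<Omega>" for \<omega> using \<kappa>K that by (simp add: k_def)
  have \<kappa>_cong: "\<kappa> \<omega> = \<kappa> \<omega>'" if "\<omega> \<in> \<Omega>" "\<omega>' \<in> \<Omega>" "col \<omega> = col \<omega>'" for \<omega> \<omega>'
  proof -
    have "Cs \<omega> = Cs \<omega>'" using that col_eq sU_low Cs_eq by blast
    then show ?thesis using that(3) unfolding \<kappa>_def shift_def by simp
  qed
  have col_k: "col (k \<omega>) = P \<omega>" if \<omega>: "\<omega> \<in> \<Omega>" for \<omega>
  proof -
    let ?c = "col \<omega>" let ?j = "J ?c"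
    have "col (k \<omega>) = \<kappa> \<omega> ` ?c" using K_col[OF \<kappa>K \<omega>] \<omega> by (simp add: k_def)
    also have "\<dots> = tr (0, - int ?j) ` (tr (shift \<omega>) ` (\<beta> (0, int ?j) ` ?c))" by (simp add: \<kappa>_def image_comp)
    also have "\<dots> = tr (0, - int ?j) ` (match (Cs \<omega>) (\<beta> (0, int ?j) ` ?c))" using shift(2)[OF \<omega>] J by simp
    also have "match (Cs \<omega>) (\<beta> (0, int j) ` ?c) = tr (0, int j) ` P \<omega> \<and> \<beta> (0, int j) ` ?c \<in> Cs \<omega>" for j
    proof (induction j)
      case 0
      have "\<beta> (0, 0) = id" "tr (0, 0) = id" by (rule regrepD(4)[OF \<beta>] regrepD(4)[OF regrep_tr]; simp)+
      then show ?case using Cs_mem[OF \<omega> \<omega>] sU_refl by (simp add: P_def)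
    next
      case (Suc j)
      have b: "\<beta> (0, int (Suc j)) = ?b \<circ> \<beta> (0, int j)" using regrepD(2)[OF \<beta>, of "(0, 1)" "(0, int j)"] by simp
      have a: "tr (0, int (Suc j)) = ?a \<circ> tr (0, int j)" using regrepD(2)[OF regrep_tr, of "(0, 1)" "(0, int j)"] by simp
      show ?case using Suc match[OF \<omega>] cyc(1)[OF \<beta> \<omega>] unfolding good_def b a image_comp[symmetric] by auto
    qed
    then have "match (Cs \<omega>) (\<beta> (0, int ?j) ` ?c) = tr (0, int ?j) ` P \<omega>" by blast
    also have "tr (0, - int ?j) ` (tr (0, int ?j) ` P \<omega>) = P \<omega>"
    proof -
      have "tr (0, - int ?j) \<circ> tr (0, int ?j) = tr 0" using tr_add[of "(0, - int ?j)" "(0, int ?j)"] by (simp add: zero_prod_def)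
      also have "tr 0 = id" by (rule regrepD(4)[OF regrep_tr]) auto
      finally show ?thesis by (simp add: image_comp)
    qed
    finally show ?thesis .
  qed
  have krow: "fst (co (k \<omega>)) + fst (co \<omega>) \<in> Z0" if \<omega>: "\<omega> \<in> \<Omega>" for \<omega>
  proof -
    let ?\<omega>0 = "\<beta> (0, int (J (col \<omega>))) \<omega>"
    have "?\<omega>0 \<in> \<Omega>" using \<omega> \<beta>K by simp
    then have "k \<omega> = tr (0, - int (J (col \<omega>))) (tr (shift \<omega>) (pt (co ?\<omega>0)))" using \<omega> co by (simp add: k_def \<kappa>_def)
    then have "fst (co (k \<omega>)) = fst (shift \<omega>) + fst (co ?\<omega>0)" by (simp add: tr co_pt)
    then show ?thesis using Z0_add[OF shift(1)[OF \<omega>] row_fix[OF \<beta> \<omega>]] by (simp add: add.assoc)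
  qed
  have k_perm: "k permutes \<Omega>"
  proof (rule permutesI_finite[OF k_in])
    show "inj_on k \<Omega>"
    proof (rule inj_onI)
      fix \<omega> \<omega>' assume \<omega>: "\<omega> \<in> \<Omega>" "\<omega>' \<in> \<Omega>" and eq: "k \<omega> = k \<omega>'"
      then have "col \<omega> = col \<omega>'" using P_inj[OF \<omega>] col_k by metis
      then have "\<kappa> \<omega> \<omega> = \<kappa> \<omega> \<omega>'" using \<kappa>_cong[OF \<omega>] eq \<omega> by (simp add: k_def)
      then show "\<omega> = \<omega>'" using K_inj[OF \<kappa>K] by blast
    qed
  next
    fix \<omega> assume "\<omega> \<notin> \<Omega>"
    then show "k \<omega> = \<omega>" by (simp add: k_def)
  qed
  have "k \<in> K"
  proof (rule two_closed[OF k_perm])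
    fix \<omega> \<omega>' assume \<omega>: "\<omega> \<in> \<Omega>" "\<omega>' \<in> \<Omega>"
    show "\<exists>l\<in>K. l \<omega> = k \<omega> \<and> l \<omega>' = k \<omega>'"
    proof (cases "col \<omega> = col \<omega>'")
      case True
      then show ?thesis using \<kappa>_cong[OF \<omega> True] \<omega> \<kappa>K by (intro bexI[of _ "\<kappa> \<omega>"]) (simp_all add: k_def)
    next
      case False
      let ?d = "co \<omega>' - co \<omega>" and ?d' = "co (k \<omega>') - co (k \<omega>)"
      have "col (k \<omega>') \<noteq> col (k \<omega>)" using P_inj[OF \<omega>] col_k \<omega> False by metis
      then have nl: "\<not> low ?d" "\<not> low ?d'" using False col_eq \<omega> k_in by metis+
      define z where "z = (fst (co (k \<omega>)) + fst (co \<omega>)) + (fst (co (k \<omega>')) + fst (co \<omega>'))"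
      have z: "z \<in> Z0" unfolding z_def using Z0_add krow \<omega> by blast
      have d': "fst ?d' = fst ?d + z" by (simp add: z_def add.commute add.left_commute)
      have "rel (fst ?d, snd ?d) (fst ?d + z, snd ?d')"
        by (rule rel_free[OF z]) (use nl Z0 in \<open>simp_all only: d'[symmetric] prod.collapse, simp_all\<close>)
      then have "rel ?d ?d'" by (simp only: d'[symmetric] prod.collapse)
      from rel_pair[OF this] show ?thesis using co \<omega> k_in by simp
    qed
  qed
  moreover have "fst (co (k (?b \<omega>))) = fst (co (k \<omega>))" if \<omega>: "\<omega> \<in> \<Omega>" for \<omega>
  proof -
    let ?c = "col \<omega>"
    have b: "?b \<omega> \<in> \<Omega>" using \<omega> \<beta>K by simp
    have cb: "col (?b \<omega>) = ?b ` ?c" using K_col[OF \<beta>K \<omega>] by simp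
    have Cs: "Cs (?b \<omega>) = Cs \<omega>" using Cs_eq[OF sU_reg[OF \<beta> \<omega>]] .
    have c0: "c0 (col (?b \<omega>)) = c0 ?c" using cb c0_b by simp
    then have sh: "shift (?b \<omega>) = shift \<omega>" unfolding shift_def Cs by simp
    let ?j = "J ?c" and ?j' = "J (col (?b \<omega>))"
    \<comment> \<open>The exponents for \<open>\<omega>\<close> and for its image under
      \<open>?b\<close> differ by 1 modulo \<open>p\<close>, because both lead to the same chosen
      column. The images under \<open>k\<close> then differ by a translation inside a fibre.\<close>
    have "\<beta> (0, int ?j' + 1) ` ?c = \<beta> (0, int ?j) ` ?c"
      using J[of ?c] J[of "col (?b \<omega>)"] c0 unfolding cb by (simp add: image_image regrep_0_add[OF \<beta>])
    then have "col (\<beta> (0, int ?j' + 1) \<omega>) = col (\<beta> (0, int ?j) \<omega>)" using K_col[OF \<beta>K \<omega>] by simp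
    moreover have "\<beta> (0, int ?j' + 1) \<omega> = \<beta> (0, int ?j' + 1 - int ?j) (\<beta> (0, int ?j) \<omega>)"
      by (simp add: regrep_0_add[OF \<beta>])
    ultimately have "int p dvd int ?j' + 1 - int ?j"
      using col_free[OF \<beta>, of "int ?j' + 1 - int ?j" "\<beta> (0, int ?j) \<omega>"] col_eq \<omega> \<beta>K by (metis K_in)
    then have cong: "[int ?j' + 1 = int ?j] (mod int p)" by (simp add: cong_iff_dvd_diff)
    have "\<beta> (0, int ?j') (?b \<omega>) = \<beta> (0, int ?j) \<omega>"
      using regrep_period[OF \<beta>, of "(0, int ?j' + 1)" "(0, int ?j)"] cong by (simp add: regrep_0_add[OF \<beta>])
    then have kb: "k (?b \<omega>) = tr (0, - int ?j') (tr (shift \<omega>) (\<beta> (0, int ?j) \<omega>))"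
      using b by (simp add: k_def \<kappa>_def sh)
    have "tr (shift \<omega>) (\<beta> (0, int ?j) \<omega>) \<in> \<Omega>" using \<omega> \<beta>K tr(1) by simp
    then obtain g where g: "tr (shift \<omega>) (\<beta> (0, int ?j) \<omega>) = pt g" by (rule pt_cases)
    then show ?thesis using kb \<omega> by (simp add: k_def \<kappa>_def tr co_pt)
  qed
  ultimately show ?thesis by blast
qed

theorem align_orbits:
  assumes \<beta>: "regrep \<beta>"
  shows "\<exists>k\<in>K. \<forall>x i. \<exists>j. (k \<circ> \<beta> (0, 1) \<circ> pinv k) (pt (x, i)) = pt (x, j)"
proof -
  obtain k where k: "k \<in> K" "\<And>\<omega>. \<omega> \<in> \<Omega> \<Longrightarrow> fst (co (k (\<beta> (0, 1) \<omega>))) = fst (co (k \<omega>))"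
    using align_orbits_narrow[OF \<beta>] align_orbits_wide[OF \<beta>] by blast
  have "\<exists>j. (k \<circ> \<beta> (0, 1) \<circ> pinv k) (pt (x, i)) = pt (x, j)" for x i
  proof -
    let ?\<omega> = "pinv k (pt (x, i))"
    have \<omega>: "?\<omega> \<in> \<Omega>" "k ?\<omega> = pt (x, i)" using k(1) K_inv by auto
    have "k (\<beta> (0, 1) ?\<omega>) \<in> \<Omega>" using k(1) regrepD(1)[OF \<beta>] \<omega> by simp
    then have "k (\<beta> (0, 1) ?\<omega>) = pt (co (k (\<beta> (0, 1) ?\<omega>)))" using co by simp
    moreover have "fst (co (k (\<beta> (0, 1) ?\<omega>))) = x" using k(2)[OF \<omega>(1)] \<omega>(2) by (simp add: co_pt)
    ultimately show ?thesis by (metis comp_apply prod.collapse)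
  qed
  then show ?thesis using k(1) by blast
qed

end

section \<open>Aligning generators and 2-parts\<close>

lemma pgrp_subset:
  assumes K: "pgrp \<Omega> K" and "id \<in> S" "S \<subseteq> K" "\<And>k l. k \<in> S \<Longrightarrow> l \<in> S \<Longrightarrow> k \<circ> l \<in> S" "\<And>k. k \<in> S \<Longrightarrow> pinv k \<in> S"
  shows "pgrp \<Omega> S"
  using assms unfolding pgrp_def by blast

lemma pgrp_subset_card:
  assumes fin: "finite \<Omega>" and R: "pgrp \<Omega> R" "card R = q ^ n" and q: "prime q" and S: "pgrp \<Omega> S" "S \<subseteq> R"
  shows "\<exists>m. card S = q ^ m"
proof -
  interpret group "PG R" using group_PG R(1) by blast
  have "card (rcosets\<^bsub>PG R\<^esub> S) * card S = card R"
    using lagrange[OF subgroup_PG[OF R(1) S]] by (simp add: order_def)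
  then have "card S dvd q ^ n" using R(2) by (metis dvd_triv_right)
  then show ?thesis using q divides_primepow_nat by blast
qed

context regular_setup
begin

section \<open>Generators of the p-parts\<close>

lemma inv_eqI: "k \<in> K \<Longrightarrow> k x = y \<Longrightarrow> pinv k y = x"
  using K_inv_l by metis

text \<open>Sylow's theorem is applied inside the group \<open>F\<close> of elements that keep every
  fibre, so that the conjugator does not destroy the alignment of orbits.\<close>

lemma align_generators:
  assumes \<beta>: "regrep \<beta>" and fib: "\<And>x i. \<exists>j. \<beta> (0, 1) (pt (x, i)) = pt (x, j)"
  shows "\<exists>k\<in>K. \<exists>m. \<forall>x i. (k \<circ> \<beta> (0, 1) \<circ> pinv k) (pt (x, i)) = pt (x, i + m x)"
proof -
  define F where "F = {k\<in>K. \<forall>x i. \<exists>j. k (pt (x, i)) = pt (x, j)}"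
  have F_fib: "\<exists>j. k (pt (x, i)) = pt (x, j)" if "k \<in> F" for k x i
    using that unfolding F_def by blast
  have F_comp: "k \<circ> l \<in> F" if kl: "k \<in> F" "l \<in> F" for k l
  proof -
    have "\<exists>j. (k \<circ> l) (pt (x, i)) = pt (x, j)" for x i
    proof -
      obtain j where "l (pt (x, i)) = pt (x, j)" using F_fib[OF kl(2)] by blast
      then show ?thesis using F_fib[OF kl(1), of x j] by simp
    qed
    then show ?thesis using kl K_comp unfolding F_def by blast
  qed
  have F_inv: "pinv k \<in> F" if k: "k \<in> F" for k
  proof -
    have kK: "k \<in> K" using k unfolding F_def by blast
    have "\<exists>j. pinv k (pt (x, i)) = pt (x, j)" for x i
    proof -
      have "pinv k (pt (x, i)) \<in> \<Omega>" using kK K_inv by simp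
      then obtain g where g: "pinv k (pt (x, i)) = pt g" by (rule pt_cases)
      then have "k (pt (fst g, snd g)) = pt (x, i)" using kK by (metis K_inv_r prod.collapse)
      moreover obtain j where "k (pt (fst g, snd g)) = pt (fst g, j)" using F_fib[OF k] by blast
      ultimately have "fst g = x" by (simp add: pt_eq)
      then show ?thesis using g by (metis prod.collapse)
    qed
    then show ?thesis using kK K_inv unfolding F_def by blast
  qed
  have F: "pgrp \<Omega> F"
    by (rule pgrp_subset[OF K _ _ F_comp F_inv]) (auto simp: F_def K_id)
  have FK: "F \<subseteq> K" unfolding F_def by blast
  have pow: "\<beta> (0, int n) \<in> F" for n
  proof (induction n)
    case 0
    have "\<beta> (0, 0) = id" by (rule regrepD(4)[OF \<beta>]) auto
    moreover have "id \<in> F" using F unfolding pgrp_def by blast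
    ultimately show ?case by (metis of_nat_0)
  next
    case (Suc n)
    have "\<beta> (0, 1) \<in> F" using fib regrepD(1)[OF \<beta>] by (auto simp: F_def)
    moreover have "\<beta> (0, int (Suc n)) = \<beta> (0, 1) \<circ> \<beta> (0, int n)"
      using regrepD(2)[OF \<beta>, of "(0, 1)" "(0, int n)"] by simp
    ultimately show ?case using F_comp[OF _ Suc] by metis
  qed
  have T: "\<beta> ` cyc \<subseteq> F"
  proof
    fix k assume "k \<in> \<beta> ` cyc"
    then obtain i where "k = \<beta> (0, i)" by blast
    also have "\<dots> = \<beta> (0, int (nat (i mod int p)))"
      using p_pos by (intro regrep_period[OF \<beta>]) (auto simp: cong_def)
    finally show "k \<in> F" using pow by (simp only:)
  qed
  have S: "tr ` cyc \<subseteq> F" using tr by (auto simp: F_def)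
  obtain k R n where k: "k \<in> F" and R: "pgrp \<Omega> R" "R \<subseteq> F" "card R = p ^ n" "tr ` cyc \<subseteq> R"
    and conj: "\<forall>t\<in>\<beta> ` cyc. k \<circ> t \<circ> pinv k \<in> R"
    using pgrp_join[OF finite_Omega prime_p F pgrp_cyc[OF regrep_tr] S card_cyc[OF regrep_tr] pgrp_cyc[OF \<beta>] T card_cyc[OF \<beta>]]
    by blast
  have shift: "\<exists>c. \<forall>i. r (pt (x, i)) = pt (x, i + c)" if r: "r \<in> R" for r x
  proof -
    obtain c where c: "r (pt (x, 0)) = pt (x, c)" using r R(2) unfolding F_def by blast
    \<comment> \<open>The stabiliser of a point in the p-group \<open>R\<close> fixes a positive
      multiple of \<open>p\<close> points of the fibre, hence the whole fibre. On each fibre,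
      \<open>R\<close> therefore acts through translations only.\<close>
    define R0 where "R0 = {s\<in>R. s (pt (x, 0)) = pt (x, 0)}"
    have RK: "s \<in> K" if "s \<in> R" for s using that R(2) FK by blast
    have R0: "pgrp \<Omega> R0"
      by (rule pgrp_subset[OF R(1)]) (use R(1) RK inv_eqI in \<open>auto simp: R0_def pgrp_def\<close>)
    obtain l where l: "card R0 = p ^ l"
      using pgrp_subset_card[OF finite_Omega R(1,3) prime_p R0] by (auto simp: R0_def)
    define X where "X = (\<lambda>i. pt (x, i)) ` {0..<int p}"
    have X_mem: "pt (x, i) \<in> X" for i
      using p_pos by (auto simp: X_def image_iff pt_eq cong_def intro!: bexI[of _ "i mod int p"])
    have card_X: "card X = p" unfolding X_def by (subst card_image) (auto simp: inj_on_def pt_eq cong_def)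
    have fin: "finite X" by (simp add: X_def)
    let ?Fix = "{y \<in> X. \<forall>s\<in>R0. s y = y}"
    have "[card ?Fix = card X] (mod p)"
    proof (rule pgrp_fixed[OF finite_Omega prime_p R0 l fin])
      fix s y assume "s \<in> R0" "y \<in> X"
      then obtain i where "y = pt (x, i)" "s \<in> F" using R(2) by (auto simp: X_def R0_def)
      then obtain j where "s y = pt (x, j)" unfolding F_def by blast
      then show "s y \<in> X" using X_mem by simp
    qed auto
    then have "[card ?Fix = 0] (mod p)" using card_X by (simp add: cong_def)
    then have "p dvd card ?Fix" by (simp only: cong_0_iff)
    moreover have "pt (x, 0) \<in> ?Fix" using X_mem by (auto simp: R0_def)
    then have "card ?Fix \<noteq> 0" using fin by auto
    ultimately have "p \<le> card ?Fix" by (simp add: dvd_imp_le)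
    then have "?Fix = X" using card_X fin by (intro card_seteq) auto
    moreover have "tr (0, - c) \<circ> r \<in> R0"
    proof -
      have "tr (0, - c) \<in> R" using R(4) by blast
      then have "tr (0, - c) \<circ> r \<in> R" using r R(1) unfolding pgrp_def by blast
      then show ?thesis using c by (simp add: R0_def tr)
    qed
    ultimately have "(tr (0, - c) \<circ> r) (pt (x, i)) = pt (x, i)" for i using X_mem[of i] by blast
    then have "tr (0, c) (tr (0, - c) (r (pt (x, i)))) = pt (x, i + c)" for i by (simp add: tr add.commute)
    moreover have "tr (0, c) (tr (0, - c) y) = y" for y
    proof -
      have "tr 0 = id" by (rule regrepD(4)[OF regrep_tr]) auto
      then show ?thesis using tr_add[of "(0, c)" "(0, - c)"] by (simp add: zero_prod_def fun_eq_iff)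
    qed
    ultimately show ?thesis by metis
  qed
  have "k \<circ> \<beta> (0, 1) \<circ> pinv k \<in> R" using conj by auto
  then obtain m where "\<forall>x i. (k \<circ> \<beta> (0, 1) \<circ> pinv k) (pt (x, i)) = pt (x, i + m x)"
    using shift by metis
  then show ?thesis using k FK by blast
qed

text \<open>The 2-parts permute the fibres, so Sylow's theorem for 2 is applied in the group of
  fibrewise affine elements. It contains both 2-parts, and conjugation by its elements takes
  fibrewise shifts to fibrewise shifts.\<close>

definition affine :: "('a \<Rightarrow> 'a) \<Rightarrow> bool" where
  "affine k \<longleftrightarrow> (\<forall>x. \<exists>y c s. coprime c (int p) \<and> (\<forall>i. k (pt (x, i)) = pt (y, c * i + s)))"

lemma affine_comp: 
  assumes "affine k" "affine l" shows "affine (k \<circ> l)"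
  unfolding affine_def
proof
  fix x
  obtain y c s where l: "coprime c (int p)" "\<And>i. l (pt (x, i)) = pt (y, c * i + s)"
    using assms(2) unfolding affine_def by blast
  obtain z d t where k: "coprime d (int p)" "\<And>i. k (pt (y, i)) = pt (z, d * i + t)"
    using assms(1) unfolding affine_def by blast
  have "(k \<circ> l) (pt (x, i)) = pt (z, (d * c) * i + (d * s + t))" for i
    using l k by (simp add: algebra_simps)
  moreover have "coprime (d * c) (int p)" using l k by simp
  ultimately show "\<exists>y c s. coprime c (int p) \<and> (\<forall>i. (k \<circ> l) (pt (x, i)) = pt (y, c * i + s))" by blast
qed

lemma affine_inv:
  assumes a: "affine k" and k: "k \<in> K" shows "affine (pinv k)"
  unfolding affine_def
proof
  fix y
  have "pinv k (pt (y, 0)) \<in> \<Omega>" using k K_inv by simp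
  then obtain g where g: "pinv k (pt (y, 0)) = pt g" by (rule pt_cases)
  obtain z c s where c: "coprime c (int p)" "\<And>i. k (pt (fst g, i)) = pt (z, c * i + s)"
    using a unfolding affine_def by blast
  have "k (pt (fst g, snd g)) = pt (y, 0)" using g k by (metis K_inv_r prod.collapse)
  then have z: "z = y" using c(2)[of "snd g"] by (simp add: pt_eq)
  obtain d where d: "coprime d (int p)" "[d * c = 1] (mod int p)" using ex_inverse[OF c(1)] by blast
  have "pinv k (pt (y, j)) = pt (fst g, d * j + - d * s)" for j
  proof (rule inv_eqI[OF k])
    have "[c * (d * j + - d * s) + s = (d * c) * (j - s) + s] (mod int p)" by (simp add: algebra_simps)
    also have "[(d * c) * (j - s) + s = 1 * (j - s) + s] (mod int p)" by (intro cong_add cong_scalar_right d cong_refl)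
    finally show "k (pt (fst g, d * j + - d * s)) = pt (y, j)" unfolding c(2) z by (simp add: pt_eq)
  qed
  then show "\<exists>x c s. coprime c (int p) \<and> (\<forall>i. pinv k (pt (y, i)) = pt (x, c * i + s))" using d(1) by blast
qed

lemma shift_pow:
  assumes \<beta>: "regrep \<beta>" and m: "\<And>x i. \<beta> (0, 1) (pt (x, i)) = pt (x, i + m x)"
  shows "\<beta> (0, n) (pt (x, i)) = pt (x, i + n * m x)"
proof -
  have nat: "\<beta> (0, int n) (pt (x, i)) = pt (x, i + int n * m x)" for n i
  proof (induction n arbitrary: i)
    case 0
    have "\<beta> (0, 0) = id" by (rule regrepD(4)[OF \<beta>]) auto
    then show ?case by simp
  next
    case (Suc n)
    have "\<beta> (0, int (Suc n)) = \<beta> (0, int n) \<circ> \<beta> (0, 1)"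
      using regrepD(2)[OF \<beta>, of "(0, int n)" "(0, 1)"] by (simp add: add.commute)
    then show ?case using Suc by (simp add: m algebra_simps)
  qed
  have "\<beta> (0, n) = \<beta> (0, int (nat (n mod int p)))"
    using p_pos by (intro regrep_period[OF \<beta>]) (auto simp: cong_def)
  then have "\<beta> (0, n) (pt (x, i)) = pt (x, i + (n mod int p) * m x)" using nat[of "nat (n mod int p)"] p_pos by simp
  also have "\<dots> = pt (x, i + n * m x)"
    by (auto simp: pt_eq cong_def intro!: cong_add[unfolded cong_def] cong_mult[unfolded cong_def])
  finally show ?thesis .
qed

lemma shift_coprime:
  assumes \<beta>: "regrep \<beta>" and m: "\<And>x i. \<beta> (0, 1) (pt (x, i)) = pt (x, i + m x)"
  shows "coprime (m x) (int p)"
proof (rule ccontr)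
  assume "\<not> coprime (m x) (int p)"
  then have "\<beta> (0, 1) (pt (x, 0)) = pt (x, 0)" using coprime_iff by (simp add: m pt_eq cong_0_iff)
  then have "int p dvd 1" using regrepD(3)[OF \<beta>, of "pt (x, 0)" "(0, 1)"] by simp
  then show False using prime_p by auto
qed

text \<open>\<open>\<beta> (v, 0)\<close> commutes with \<open>\<beta> (0, 1)\<close>, which shifts
  the fibre over \<open>x\<close> by the unit \<open>m x\<close>. This forces an affine map from the
  fibre over x to the one over y, with slope m y divided by m x.\<close>

lemma affine_vec:
  assumes \<beta>: "regrep \<beta>" and m: "\<And>x i. \<beta> (0, 1) (pt (x, i)) = pt (x, i + m x)"
  shows "affine (\<beta> (v, 0))"
  unfolding affine_def
proof
  fix x
  have "\<beta> (v, 0) (pt (x, 0)) \<in> \<Omega>" using regrepD(1)[OF \<beta>] by simp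
  then obtain g where g: "\<beta> (v, 0) (pt (x, 0)) = pt g" by (rule pt_cases)
  obtain d where d: "coprime d (int p)" "[d * m x = 1] (mod int p)"
    using ex_inverse[OF shift_coprime[OF \<beta> m]] by blast
  have "\<beta> (v, 0) (pt (x, i)) = pt (fst g, (d * m (fst g)) * i + snd g)" for i
  proof -
    have "[(i * d) * m x = i] (mod int p)" using cong_scalar_left[OF d(2), of i] by (simp add: mult.assoc)
    then have "pt (x, i) = \<beta> (0, i * d) (pt (x, 0))" by (simp add: shift_pow[OF \<beta> m] pt_eq cong_sym)
    moreover have "\<beta> (v, 0) \<circ> \<beta> (0, i * d) = \<beta> (0, i * d) \<circ> \<beta> (v, 0)"
      using regrepD(2)[OF \<beta>, of "(v, 0)" "(0, i * d)"] regrepD(2)[OF \<beta>, of "(0, i * d)" "(v, 0)"] by simp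
    ultimately have "\<beta> (v, 0) (pt (x, i)) = \<beta> (0, i * d) (pt (fst g, snd g))" using g by (metis comp_apply prod.collapse)
    also have "\<dots> = pt (fst g, snd g + i * d * m (fst g))" by (rule shift_pow[OF \<beta> m])
    finally show ?thesis by (simp add: algebra_simps)
  qed
  moreover have "coprime (d * m (fst g)) (int p)" using d(1) shift_coprime[OF \<beta> m] by simp
  ultimately show "\<exists>y c s. coprime c (int p) \<and> (\<forall>i. \<beta> (v, 0) (pt (x, i)) = pt (y, c * i + s))" by blast
qed

lemma affine_tr: "affine (tr g)"
  unfolding affine_def
proof
  fix x
  have "tr g (pt (x, i)) = pt (fst g + x, 1 * i + snd g)" for i
    by (cases g) (simp add: tr add.commute)
  then show "\<exists>y c s. coprime c (int p) \<and> (\<forall>i. tr g (pt (x, i)) = pt (y, c * i + s))"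
    using coprime_1_left by blast
qed

lemma affine_conj_shift:
  assumes k: "affine k" "k \<in> K" and b: "\<And>x i. b (pt (x, i)) = pt (x, i + m x)"
  shows "\<exists>m. \<forall>x i. (k \<circ> b \<circ> pinv k) (pt (x, i)) = pt (x, i + m x)"
proof -
  have "\<exists>n. \<forall>i. (k \<circ> b \<circ> pinv k) (pt (y, i)) = pt (y, i + n)" for y
  proof -
    have "pinv k (pt (y, 0)) \<in> \<Omega>" using k K_inv by simp
    then obtain g where g: "pinv k (pt (y, 0)) = pt g" by (rule pt_cases)
    obtain z c s where c: "coprime c (int p)" "\<And>i. k (pt (fst g, i)) = pt (z, c * i + s)"
      using k unfolding affine_def by blast
    have "k (pt (fst g, snd g)) = pt (y, 0)" using g k by (metis K_inv_r prod.collapse)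
    then have z: "z = y" using c(2)[of "snd g"] by (simp add: pt_eq)
    obtain d where d: "[d * c = 1] (mod int p)" using ex_inverse[OF c(1)] by blast
    have "(k \<circ> b \<circ> pinv k) (pt (y, i)) = pt (y, i + c * m (fst g))" for i
    proof -
      have "[c * (d * (i - s)) + s = (d * c) * (i - s) + s] (mod int p)" by (simp add: algebra_simps)
      also have "[(d * c) * (i - s) + s = 1 * (i - s) + s] (mod int p)" by (intro cong_add cong_scalar_right d cong_refl)
      finally have e: "[c * (d * (i - s)) + s = i] (mod int p)" by simp
      then have "k (pt (fst g, d * (i - s))) = pt (y, i)" unfolding c(2) z by (simp add: pt_eq)
      then have "pinv k (pt (y, i)) = pt (fst g, d * (i - s))" by (rule inv_eqI[OF k(2)])
      then have "(k \<circ> b \<circ> pinv k) (pt (y, i)) = pt (y, (c * (d * (i - s)) + s) + c * m (fst g))"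
        by (simp add: b c(2) z algebra_simps)
      also have "\<dots> = pt (y, i + c * m (fst g))" using e by (simp add: pt_eq cong_add_rcancel)
      finally show ?thesis .
    qed
    then show ?thesis by blast
  qed
  then show ?thesis by metis
qed

text \<open>In contrast to \<open>affine\<close>, the elements of the common 2-group have no
  constant terms here: they preserve the section of all points \<open>pt (x, 0)\<close>.\<close>

definition aligned :: "('e \<times> int \<Rightarrow> 'a \<Rightarrow> 'a) \<Rightarrow> ('a \<Rightarrow> 'a) set \<Rightarrow> ('e \<Rightarrow> int) \<Rightarrow> bool" where
  "aligned \<beta> R m \<longleftrightarrow> regrep \<beta> \<and> pgrp \<Omega> R \<and> R \<subseteq> K \<and> (\<exists>n. card R = 2 ^ n) \<and>
     (\<forall>v. tr (v, 0) \<in> R) \<and> (\<forall>v. \<beta> (v, 0) \<in> R) \<and>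
     (\<forall>r\<in>R. \<forall>x. \<exists>y c. coprime c (int p) \<and> (\<forall>i. r (pt (x, i)) = pt (y, c * i))) \<and>
     (\<forall>x i. \<beta> (0, 1) (pt (x, i)) = pt (x, i + m x))"

theorem alignment:
  assumes \<beta>: "regrep \<beta>"
  shows "\<exists>k\<in>K. \<exists>R m. aligned (\<lambda>g. k \<circ> \<beta> g \<circ> pinv k) R m"
proof -
  have conj_conj: "l \<circ> (k \<circ> f \<circ> pinv k) \<circ> pinv l = (l \<circ> k) \<circ> f \<circ> pinv (l \<circ> k)" if "k \<in> K" "l \<in> K" for k l f
  proof -
    have "pinv (l \<circ> k) = pinv k \<circ> pinv l"
      using that K_perm permutes_bij o_inv_distrib by blast
    then show ?thesis by (simp add: comp_assoc)
  qed
  obtain k1 where k1: "k1 \<in> K" "\<And>x i. \<exists>j. (k1 \<circ> \<beta> (0, 1) \<circ> pinv k1) (pt (x, i)) = pt (x, j)"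
    using align_orbits[OF \<beta>] by blast
  define \<beta>1 where "\<beta>1 g = k1 \<circ> \<beta> g \<circ> pinv k1" for g
  have \<beta>1: "regrep \<beta>1" unfolding \<beta>1_def by (rule regrep_conj[OF \<beta> k1(1)])
  obtain k2 m2 where k2: "k2 \<in> K" "\<And>x i. (k2 \<circ> \<beta>1 (0, 1) \<circ> pinv k2) (pt (x, i)) = pt (x, i + m2 x)"
    using align_generators[OF \<beta>1] k1(2) unfolding \<beta>1_def by blast
  define \<beta>2 where "\<beta>2 g = k2 \<circ> \<beta>1 g \<circ> pinv k2" for g
  have \<beta>2: "regrep \<beta>2" unfolding \<beta>2_def by (rule regrep_conj[OF \<beta>1 k2(1)])
  have m2: "\<beta>2 (0, 1) (pt (x, i)) = pt (x, i + m2 x)" for x i using k2 by (simp add: \<beta>2_def)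
  define M where "M = {k\<in>K. affine k}"
  have "affine id" using affine_tr[of 0] regrepD(4)[OF regrep_tr, of 0] by simp
  then have M: "pgrp \<Omega> M"
    by (intro pgrp_subset[OF K]) (auto simp: M_def K_id K_comp K_inv affine_comp affine_inv)
  have S: "tr ` vec \<subseteq> M" using tr affine_tr by (auto simp: M_def)
  have T: "\<beta>2 ` vec \<subseteq> M" using affine_vec[OF \<beta>2 m2] regrepD(1)[OF \<beta>2] by (auto simp: M_def)
  obtain k3 R n where k3: "k3 \<in> M" and R: "pgrp \<Omega> R" "R \<subseteq> M" "card R = 2 ^ n" "tr ` vec \<subseteq> R"
    and conj': "\<forall>t\<in>\<beta>2 ` vec. k3 \<circ> t \<circ> pinv k3 \<in> R"
    using pgrp_join[OF finite_Omega two_is_prime_nat M pgrp_vec[OF regrep_tr] S card_vec[OF regrep_tr]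
        pgrp_vec[OF \<beta>2] T card_vec[OF \<beta>2]] by (elim bexE exE conjE)
  have conj: "k3 \<circ> \<beta>2 (v, 0) \<circ> pinv k3 \<in> R" for v using conj' by (rule bspec) simp
  have RK: "r \<in> K" "affine r" if "r \<in> R" for r using that R(2) by (auto simp: M_def)
  have trR: "tr (v, 0) \<in> R" for v using R(4) by blast
  have Rcomp: "r \<circ> s \<in> R" if "r \<in> R" "s \<in> R" for r s using that R(1) unfolding pgrp_def by blast
  define R0 where "R0 = {r\<in>R. \<exists>j. r (pt (0, 0)) = pt (0, j)}"
  have fib0: "\<exists>j. r (pt (0, i)) = pt (0, j)" if r: "r \<in> R0" for r i
  proof -
    have "r \<in> R" using r unfolding R0_def by blast
    then obtain y c s where c: "\<And>i. r (pt (0, i)) = pt (y, c * i + s)"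
      using RK(2) unfolding affine_def by blast
    have "y = 0" using r c[of 0] unfolding R0_def by (auto simp: pt_eq)
    then show ?thesis using c by blast
  qed
  have R0: "pgrp \<Omega> R0"
  proof (rule pgrp_subset[OF R(1)])
    fix r s assume rs: "r \<in> R0" "s \<in> R0"
    obtain j where "s (pt (0, 0)) = pt (0, j)" using rs unfolding R0_def by blast
    then show "r \<circ> s \<in> R0" using fib0[OF rs(1), of j] rs Rcomp unfolding R0_def by auto
  next
    fix r assume r: "r \<in> R0"
    then have "r \<in> R" unfolding R0_def by blast
    have "pinv r (pt (0, 0)) \<in> \<Omega>" using RK(1)[OF \<open>r \<in> R\<close>] K_inv by simp
    then obtain g where g: "pinv r (pt (0, 0)) = pt g" by (rule pt_cases)
    then have rg: "r (pt (fst g, snd g)) = pt (0, 0)" using RK(1)[OF \<open>r \<in> R\<close>] by (metis K_inv_r prod.collapse)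
    \<comment> \<open>The fibre over \<open>0\<close> is mapped onto itself, so its preimage is itself.\<close>
    obtain y c s where c: "coprime c (int p)" "\<And>i. r (pt (0, i)) = pt (y, c * i + s)"
      using RK(2)[OF \<open>r \<in> R\<close>] unfolding affine_def by blast
    have y: "y = 0" using r c(2)[of 0] unfolding R0_def by (auto simp: pt_eq)
    obtain d where d: "[d * c = 1] (mod int p)" using ex_inverse[OF c(1)] by blast
    have "[c * (- d * s) + s = (d * c) * (- s) + s] (mod int p)" by (simp add: algebra_simps)
    also have "[(d * c) * (- s) + s = 1 * (- s) + s] (mod int p)" by (intro cong_add cong_scalar_right d cong_refl)
    finally have "r (pt (0, - d * s)) = pt (0, 0)" unfolding c(2) y by (simp add: pt_eq)
    then have "pinv r (pt (0, 0)) = pt (0, - d * s)" by (rule inv_eqI[OF RK(1)[OF \<open>r \<in> R\<close>]])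
    then show "pinv r \<in> R0" using R(1) \<open>r \<in> R\<close> unfolding R0_def pgrp_def by blast
  qed (use R(1) in \<open>auto simp: R0_def pgrp_def\<close>)
  obtain l where l: "card R0 = 2 ^ l"
    using pgrp_subset_card[OF finite_Omega R(1,3) two_is_prime_nat R0] by (auto simp: R0_def)
  define X where "X = (\<lambda>i. pt (0, i)) ` {0..<int p}"
  have X_mem: "pt (0, i) \<in> X" for i
    using p_pos by (auto simp: X_def image_iff pt_eq cong_def intro!: bexI[of _ "i mod int p"])
  have card_X: "card X = p" unfolding X_def by (subst card_image) (auto simp: inj_on_def pt_eq cong_def)
  \<comment> \<open>The fibre over 0 has an odd number of points, so the 2-group \<open>R0\<close>
    fixes one of them.\<close>
  have "\<exists>x\<in>X. \<forall>r\<in>R0. r x = x"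
  proof (rule pgrp_fixed_ex[OF two_is_prime_nat R0 l])
    show "finite X" "\<not> 2 dvd card X" using card_X odd_p by (auto simp: X_def)
    fix r x assume "r \<in> R0" "x \<in> X"
    then obtain i j where "x = pt (0, i)" "r x = pt (0, j)" using fib0 unfolding X_def by blast
    then show "r x \<in> X" using X_mem by simp
  qed auto
  then obtain i0 where i0: "\<And>r. r \<in> R0 \<Longrightarrow> r (pt (0, i0)) = pt (0, i0)" by (auto simp: X_def)
  have sec0: "\<exists>y. r (pt (0, i0)) = pt (y, i0)" if r: "r \<in> R" for r
  proof -
    have "r (pt (0, 0)) \<in> \<Omega>" using RK(1)[OF r] by simp
    then obtain g where g: "r (pt (0, 0)) = pt g" by (rule pt_cases)
    have "tr (fst g, 0) \<circ> r \<in> R0"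
      using Rcomp[OF trR r] g unfolding R0_def by (auto simp: tr char2 plus_prod_def)
    then have "tr (fst g, 0) (r (pt (0, i0))) = pt (0, i0)" using i0 by (metis comp_apply)
    then have "tr (fst g, 0) (tr (fst g, 0) (r (pt (0, i0)))) = pt (fst g, i0)" by (simp add: tr)
    moreover have "tr (fst g, 0) (tr (fst g, 0) y) = y" for y
    proof -
      have "tr 0 = id" by (rule regrepD(4)[OF regrep_tr]) auto
      then show ?thesis using tr_add[of "(fst g, 0)" "(fst g, 0)"] by (simp add: zero_prod_def char2 fun_eq_iff)
    qed
    ultimately show ?thesis by metis
  qed
  \<comment> \<open>The translations by E lie in \<open>R\<close> and preserve heights, so the fixed
    point over 0 spreads to an invariant section at height \<open>i0\<close>.\<close>
  have sec: "\<exists>y. r (pt (x, i0)) = pt (y, i0)" if r: "r \<in> R" for r x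
    using sec0[OF Rcomp[OF r trR[of x]]] by (simp add: tr)
  \<comment> \<open>Lowering the invariant section to height 0 removes the constant terms of the
    affine maps.\<close>
  define t where "t = tr (0, - i0)"
  have tK: "t \<in> K" "affine t" using tr affine_tr by (auto simp: t_def)
  have tinv: "pinv t = tr (0, i0)"
  proof -
    have "tr 0 = id" by (rule regrepD(4)[OF regrep_tr]) auto
    then have "t \<circ> tr (0, i0) = id" "tr (0, i0) \<circ> t = id"
      using tr_add[of "(0, - i0)" "(0, i0)"] tr_add[of "(0, i0)" "(0, - i0)"] by (simp_all add: t_def zero_prod_def)
    then show ?thesis by (metis inv_unique_comp)
  qed
  define R' where "R' = (\<lambda>r. t \<circ> r \<circ> pinv t) ` R"
  have inj: "inj_on (\<lambda>r. t \<circ> r \<circ> pinv t) R"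
  proof (rule inj_onI)
    fix r s assume "t \<circ> r \<circ> pinv t = t \<circ> s \<circ> pinv t"
    then have "(t \<circ> r \<circ> pinv t) (t x) = (t \<circ> s \<circ> pinv t) (t x)" for x by simp
    then have "t (r x) = t (s x)" for x using tK(1) by simp
    then show "r = s" using K_inj[OF tK(1)] by auto
  qed
  have R': "pgrp \<Omega> R'" "R' \<subseteq> K" "card R' = 2 ^ n"
  proof -
    show "R' \<subseteq> K" using RK(1) tK(1) K_comp K_inv by (auto simp: R'_def)
    show "card R' = 2 ^ n" using R(3) inj by (simp add: R'_def card_image)
    show "pgrp \<Omega> R'"
    proof (rule pgrp_subset[OF K _ \<open>R' \<subseteq> K\<close>])
      have "t \<circ> id \<circ> pinv t = id" using tK(1) by auto
      then show "id \<in> R'" using R(1) unfolding R'_def pgrp_def by (metis imageI)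
      fix r assume "r \<in> R'"
      then obtain r0 where r0: "r0 \<in> R" "r = t \<circ> r0 \<circ> pinv t" unfolding R'_def by blast
      have "pinv r = t \<circ> pinv r0 \<circ> pinv t"
      proof (rule inv_unique_comp)
        show "r \<circ> (t \<circ> pinv r0 \<circ> pinv t) = id" "t \<circ> pinv r0 \<circ> pinv t \<circ> r = id"
          using r0 tK(1) RK(1)[OF r0(1)] by auto
      qed
      then show "pinv r \<in> R'" using r0(1) R(1) unfolding R'_def pgrp_def by blast
      fix s assume "s \<in> R'"
      then obtain s0 where s0: "s0 \<in> R" "s = t \<circ> s0 \<circ> pinv t" unfolding R'_def by blast
      have "r \<circ> s = t \<circ> (r0 \<circ> s0) \<circ> pinv t" using tK(1) by (auto simp: r0 s0)
      then show "r \<circ> s \<in> R'" using Rcomp[OF r0(1) s0(1)] unfolding R'_def by blast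
    qed
  qed
  have lin: "\<exists>y c. coprime c (int p) \<and> (\<forall>i. r (pt (x, i)) = pt (y, c * i))" if "r \<in> R'" for r x
  proof -
    obtain r0 where r0: "r0 \<in> R" "r = t \<circ> r0 \<circ> pinv t" using \<open>r \<in> R'\<close> unfolding R'_def by blast
    obtain y c s where c: "coprime c (int p)" "\<And>i. r0 (pt (x, i)) = pt (y, c * i + s)"
      using RK(2)[OF r0(1)] unfolding affine_def by blast
    have s: "[c * i0 + s = i0] (mod int p)" using sec[OF r0(1), of x] c(2)[of i0] by (auto simp: pt_eq)
    have "r (pt (x, i)) = pt (y, c * i)" for i
    proof -
      have "r (pt (x, i)) = pt (y, c * (i0 + i) + s - i0)" by (simp add: r0 tinv tr c(2)) (simp add: t_def tr)
      moreover have "[c * (i0 + i) + s - i0 = c * i] (mod int p)"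
        using s by (simp add: cong_iff_dvd_diff algebra_simps)
      ultimately show ?thesis by (simp add: pt_eq)
    qed
    then show ?thesis using c(1) by blast
  qed
  have trR': "tr (v, 0) \<in> R'" for v
  proof -
    have "t \<circ> tr (v, 0) \<circ> pinv t = tr ((0, - i0) + (v, 0) + (0, i0))" unfolding tinv by (simp only: tr_add t_def)
    then have "t \<circ> tr (v, 0) \<circ> pinv t = tr (v, 0)" by simp
    then show ?thesis using trR[of v] unfolding R'_def by (metis imageI)
  qed
  define k where "k = t \<circ> (k3 \<circ> (k2 \<circ> k1))"
  have k3K: "k3 \<in> K" "affine k3" using k3 by (auto simp: M_def)
  have kK: "k \<in> K" unfolding k_def using tK(1) k3K k2(1) k1(1) K_comp by blast
  have eq: "k \<circ> \<beta> g \<circ> pinv k = t \<circ> (k3 \<circ> \<beta>2 g \<circ> pinv k3) \<circ> pinv t" for g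
    unfolding k_def \<beta>2_def \<beta>1_def using conj_conj k1(1) k2(1) k3K(1) tK(1) K_comp by simp
  obtain m3 where m3: "\<And>x i. (k3 \<circ> \<beta>2 (0, 1) \<circ> pinv k3) (pt (x, i)) = pt (x, i + m3 x)"
    using affine_conj_shift[OF k3K(2,1) m2] by blast
  obtain m where m: "\<And>x i. (t \<circ> (k3 \<circ> \<beta>2 (0, 1) \<circ> pinv k3) \<circ> pinv t) (pt (x, i)) = pt (x, i + m x)"
    using affine_conj_shift[OF tK(2,1) m3] by blast
  have "aligned (\<lambda>g. k \<circ> \<beta> g \<circ> pinv k) R' m"
    unfolding aligned_def
  proof (intro conjI allI ballI)
    show "regrep (\<lambda>g. k \<circ> \<beta> g \<circ> pinv k)" by (rule regrep_conj[OF \<beta> kK])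
    show "k \<circ> \<beta> (v, 0) \<circ> pinv k \<in> R'" for v unfolding eq R'_def using conj by blast
    show "(k \<circ> \<beta> (0, 1) \<circ> pinv k) (pt (x, i)) = pt (x, i + m x)" for x i unfolding eq by (rule m)
  qed (use R' lin trR' in blast)+
  then show ?thesis using kK by blast
qed

end

section \<open>Reduction to triangular maps\<close>

text \<open>The analogue of \<open>in_level\<close> for all five coordinates and without saturation;
  in an adapted basis it describes membership in the (5 - l)-th member of a flag.\<close>

fun lead :: "nat \<Rightarrow> v4 \<times> bool \<Rightarrow> bool" where
  "lead 0 _ = True"
| "lead (Suc 0) ((a, b, c, d), t) = (\<not> a)"
| "lead (Suc (Suc 0)) ((a, b, c, d), t) = (\<not> a \<and> \<not> b)"
| "lead (Suc (Suc (Suc 0))) ((a, b, c, d), t) = (\<not> a \<and> \<not> b \<and> \<not> c)"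
| "lead (Suc (Suc (Suc (Suc 0)))) ((a, b, c, d), t) = (\<not> a \<and> \<not> b \<and> \<not> c \<and> \<not> d)"
| "lead _ ((a, b, c, d), t) = (\<not> a \<and> \<not> b \<and> \<not> c \<and> \<not> d \<and> \<not> t)"

abbreviation O5 :: "v4 \<times> bool" where "O5 \<equiv> ((False, False, False, False), False)"

lemma xor5_zero_iff: "xor5 x y = O5 \<longleftrightarrow> x = y"
  by (cases x; cases y) auto

text \<open>Preserving every congruence of the flag in both directions makes each coordinate its own
  argument plus a function of the earlier ones. Fixing the unit vectors of F_2^4 normalises these
  functions to vanish in weight at most 1.\<close>

lemma triangular_form:
  fixes f :: "v4 \<times> bool \<Rightarrow> v4 \<times> bool"
  assumes lead: "\<And>l x y. l \<le> 5 \<Longrightarrow> lead l (xor5 (f x) (f y)) \<longleftrightarrow> lead l (xor5 x y)"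
    and f0: "f O5 = O5" and f1: "f ((True, False, False, False), False) = ((True, False, False, False), False)"
    and f2: "f ((False, True, False, False), False) = ((False, True, False, False), False)"
    and f3: "f ((False, False, True, False), False) = ((False, False, True, False), False)"
    and f4: "f ((False, False, False, True), False) = ((False, False, False, True), False)"
  shows "\<exists>c \<phi>. (\<forall>x. light x \<longrightarrow> \<not> \<phi> x) \<and> (\<forall>x t. f (x, t) = (top4 c x, t \<noteq> \<phi> x))"
proof -
  define p1 where "p1 x = fst (fst (f x))" for x
  define p2 where "p2 x = fst (snd (fst (f x)))" for x
  define p3 where "p3 x = fst (snd (snd (fst (f x))))" for x
  define p4 where "p4 x = snd (snd (snd (fst (f x))))" for x
  define p5 where "p5 x = snd (f x)" for x
  have fx: "f x = ((p1 x, p2 x, p3 x, p4 x), p5 x)" for x by (simp add: p1_def p2_def p3_def p4_def p5_def)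
  have P1: "p1 ((a, b, c, d), t) = p1 ((a', b', c', d'), t') \<longleftrightarrow> a = a'" for a b c d t a' b' c' d' t'
    using lead[of 1 "((a, b, c, d), t)" "((a', b', c', d'), t')"] by (simp add: fx)
  have P2: "p1 ((a, b, c, d), t) = p1 ((a', b', c', d'), t') \<and> p2 ((a, b, c, d), t) = p2 ((a', b', c', d'), t')
      \<longleftrightarrow> a = a' \<and> b = b'" for a b c d t a' b' c' d' t'
    using lead[of 2 "((a, b, c, d), t)" "((a', b', c', d'), t')"] by (simp add: fx eval_nat_numeral)
  have P3: "p1 ((a, b, c, d), t) = p1 ((a', b', c', d'), t') \<and> p2 ((a, b, c, d), t) = p2 ((a', b', c', d'), t')
      \<and> p3 ((a, b, c, d), t) = p3 ((a', b', c', d'), t')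
      \<longleftrightarrow> a = a' \<and> b = b' \<and> c = c'" for a b c d t a' b' c' d' t'
    using lead[of 3 "((a, b, c, d), t)" "((a', b', c', d'), t')"] by (simp add: fx eval_nat_numeral)
  have P4: "p1 ((a, b, c, d), t) = p1 ((a', b', c', d'), t') \<and> p2 ((a, b, c, d), t) = p2 ((a', b', c', d'), t')
      \<and> p3 ((a, b, c, d), t) = p3 ((a', b', c', d'), t') \<and> p4 ((a, b, c, d), t) = p4 ((a', b', c', d'), t')
      \<longleftrightarrow> a = a' \<and> b = b' \<and> c = c' \<and> d = d'" for a b c d t a' b' c' d' t'
    using lead[of 4 "((a, b, c, d), t)" "((a', b', c', d'), t')"] by (simp add: fx eval_nat_numeral)
  have P5: "p1 ((a, b, c, d), t) = p1 ((a', b', c', d'), t') \<and> p2 ((a, b, c, d), t) = p2 ((a', b', c', d'), t')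
      \<and> p3 ((a, b, c, d), t) = p3 ((a', b', c', d'), t') \<and> p4 ((a, b, c, d), t) = p4 ((a', b', c', d'), t')
      \<and> p5 ((a, b, c, d), t) = p5 ((a', b', c', d'), t')
      \<longleftrightarrow> a = a' \<and> b = b' \<and> c = c' \<and> d = d' \<and> t = t'" for a b c d t a' b' c' d' t'
    using lead[of 5 "((a, b, c, d), t)" "((a', b', c', d'), t')"] by (simp add: fx eval_nat_numeral)
  note u0 = f0[unfolded fx] and u1 = f1[unfolded fx] and u2 = f2[unfolded fx] and u3 = f3[unfolded fx] and u4 = f4[unfolded fx]
  have q1: "p1 ((a, b, c, d), t) = a" for a b c d t
    using P1[of a b c d t False False False False False] u0 by (cases a) auto
  have q2: "p2 ((a, b, c, d), t) = b" for a b c d t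
    using P2[of a b c d t a False False False False] q1 u0 u1 by (cases a; cases b) auto
  have q3: "p3 ((a, b, c, d), t) = (p3 ((a, b, False, False), False) \<noteq> c)" for a b c d t
    using P3[of a b c d t a b False False False] q1 q2 by auto
  have q4: "p4 ((a, b, c, d), t) = (p4 ((a, b, c, False), False) \<noteq> d)" for a b c d t
    using P4[of a b c d t a b c False False] q1 q2 q3[of a b c d t] q3[of a b c False False] by auto
  have q5: "p5 ((a, b, c, d), t) = (p5 ((a, b, c, d), False) \<noteq> t)" for a b c d t
    using P5[of a b c d t a b c d False] q1 q2 q3[of a b c d t] q3[of a b c d False]
      q4[of a b c d t] q4[of a b c d False] by auto
  define c where "c = (p3 ((True, True, False, False), False), p4 ((True, True, False, False), False),
    p4 ((True, False, True, False), False), p4 ((False, True, True, False), False), p4 ((True, True, True, False), False))"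
  define \<phi> where "\<phi> x = p5 (x, False)" for x
  have "\<not> \<phi> x" if "light x" for x
  proof -
    obtain x1 x2 x3 x4 where x: "x = (x1, x2, x3, x4)" by (cases x)
    show ?thesis using that u0 u1 u2 u3 u4 unfolding x \<phi>_def
      by (cases x1; cases x2; cases x3; cases x4) auto
  qed
  moreover have "f (x, t) = (top4 c x, t \<noteq> \<phi> x)" for x t
  proof -
    obtain x1 x2 x3 x4 where x: "x = (x1, x2, x3, x4)" by (cases x)
    have 3: "p3 (x, t) = (x3 \<noteq> (p3 ((True, True, False, False), False) \<and> x1 \<and> x2))"
      unfolding x using q3[of x1 x2 x3 x4 t] u0 u1 u2 by (cases x1; cases x2) auto
    have 4: "p4 (x, t) = (x4 \<noteq> (if x1 then if x2 then if x3 then p4 ((True, True, True, False), False)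
        else p4 ((True, True, False, False), False) else x3 \<and> p4 ((True, False, True, False), False)
        else x2 \<and> x3 \<and> p4 ((False, True, True, False), False)))"
      unfolding x using q4[of x1 x2 x3 x4 t] u0 u1 u2 u3 by (cases x1; cases x2; cases x3) auto
    have 5: "p5 (x, t) = (t \<noteq> \<phi> x)" unfolding x \<phi>_def using q5[of x1 x2 x3 x4 t] by auto
    have 12: "p1 (x, t) = x1" "p2 (x, t) = x2" unfolding x by (rule q1 q2)+
    show ?thesis unfolding fx 12 3 4 5 unfolding x c_def top4.simps ..
  qed
  ultimately show ?thesis by blast
qed

lemma lead_level: "lead l (w, s) \<Longrightarrow> l \<le> 5 \<Longrightarrow> w \<noteq> (False, False, False, False) \<Longrightarrow> l \<le> level w"
proof -
  assume l: "lead l (w, s)" "l \<le> 5" "w \<noteq> (False, False, False, False)"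
  obtain a b c d where w: "w = (a, b, c, d)" by (cases w)
  have "l = 0 \<or> l = 1 \<or> l = 2 \<or> l = 3 \<or> l = 4 \<or> l = 5" using l(2) by auto
  then show ?thesis using l unfolding w by (elim disjE) (auto simp: eval_nat_numeral)
qed

section \<open>Flags and adapted bases\<close>

lemma card_v5: "card (UNIV :: (v4 \<times> bool) set) = 32"
  by (simp add: UNIV_Times_UNIV[symmetric] card_cartesian_product del: UNIV_Times_UNIV)

text \<open>Basis vectors are numbered from the bottom of the flag and coordinates from the top,
  hence \<open>v 4\<close> goes with the first coordinate and \<open>v 0\<close> with the
  last.\<close>

definition comb :: "(nat \<Rightarrow> 'e::ab_group_add) \<Rightarrow> v4 \<times> bool \<Rightarrow> 'e" where
  "comb v = (\<lambda>((a, b, c, d), t). (if a then v 4 else 0) + ((if b then v 3 else 0) +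
     ((if c then v 2 else 0) + ((if d then v 1 else 0) + (if t then v 0 else 0)))))"

locale flag =
  fixes F :: "nat \<Rightarrow> 'e::{finite, ab_group_add} set" and v :: "nat \<Rightarrow> 'e"
  assumes char2: "\<And>x::'e. x + x = 0" and card_e: "card (UNIV :: 'e set) = 32"
    and F_zero: "0 \<in> F j" and F_add: "j \<le> 5 \<Longrightarrow> x \<in> F j \<Longrightarrow> y \<in> F j \<Longrightarrow> x + y \<in> F j"
    and F_0: "F 0 = {0}" and F_mono: "j < 5 \<Longrightarrow> F j \<subseteq> F (Suc j)"
    and v_in: "j < 5 \<Longrightarrow> v j \<in> F (Suc j)" and v_out: "j < 5 \<Longrightarrow> v j \<notin> F j"
begin

lemma step_in: "j < 5 \<Longrightarrow> y \<in> F j \<Longrightarrow> (if b then v j else 0) + y \<in> F (Suc j)"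
  using F_add[of "Suc j" "v j" y] v_in[of j] F_mono[of j] by auto

lemma step_iff: "j < 5 \<Longrightarrow> y \<in> F j \<Longrightarrow> (if b then v j else 0) + y \<in> F j \<longleftrightarrow> \<not> b"
proof -
  assume j: "j < 5" and y: "y \<in> F j"
  have "v j + y \<notin> F j"
  proof
    assume "v j + y \<in> F j"
    then have "(v j + y) + y \<in> F j" using F_add j y by simp
    then show False using v_out[OF j] by (simp add: add.assoc char2)
  qed
  then show ?thesis using y by auto
qed

lemma comb_lead:
  assumes "l \<le> 5" shows "comb v z \<in> F (5 - l) \<longleftrightarrow> lead l z"
proof -
  obtain a b c d t where z: "z = ((a, b, c, d), t)" by (metis prod.exhaust)
  define y1 where "y1 = (if t then v 0 else 0)"
  define y2 where "y2 = (if d then v 1 else 0) + y1"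
  define y3 where "y3 = (if c then v 2 else 0) + y2"
  define y4 where "y4 = (if b then v 3 else 0) + y3"
  define y5 where "y5 = (if a then v 4 else 0) + y4"
  have y5: "comb v z = y5" by (simp add: comb_def z y1_def y2_def y3_def y4_def y5_def)
  have 1: "y1 \<in> F 1" "y1 \<in> F 0 \<longleftrightarrow> \<not> t" using step_in[of 0 0 t] step_iff[of 0 0 t] F_0 by (auto simp: y1_def)
  have 2: "y2 \<in> F 2" "y2 \<in> F 1 \<longleftrightarrow> \<not> d" using step_in[of 1 y1 d] step_iff[of 1 y1 d] 1
    by (simp_all add: y2_def numeral_2_eq_2)
  have 3: "y3 \<in> F 3" "y3 \<in> F 2 \<longleftrightarrow> \<not> c" using step_in[of 2 y2 c] step_iff[of 2 y2 c] 2
    by (simp_all add: y3_def numeral_3_eq_3 numeral_2_eq_2)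
  have 4: "y4 \<in> F 4" "y4 \<in> F 3 \<longleftrightarrow> \<not> b" using step_in[of 3 y3 b] step_iff[of 3 y3 b] 3
    by (simp_all add: y4_def eval_nat_numeral)
  have 5: "y5 \<in> F 5" "y5 \<in> F 4 \<longleftrightarrow> \<not> a" using step_in[of 4 y4 a] step_iff[of 4 y4 a] 4
    by (simp_all add: y5_def eval_nat_numeral)
  have mono: "F 0 \<subseteq> F 1" "F 1 \<subseteq> F 2" "F 2 \<subseteq> F 3" "F 3 \<subseteq> F 4"
    using F_mono[of 0] F_mono[of 1] F_mono[of 2] F_mono[of 3] by (simp_all add: eval_nat_numeral)
  have e: "\<not> a \<Longrightarrow> y5 = y4" "\<not> b \<Longrightarrow> y4 = y3" "\<not> c \<Longrightarrow> y3 = y2" "\<not> d \<Longrightarrow> y2 = y1"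
    by (simp_all add: y5_def y4_def y3_def y2_def)
  have f3: "y5 \<in> F 3 \<longleftrightarrow> \<not> a \<and> \<not> b" using 5 4 mono e by (metis subsetD)
  have f2: "y5 \<in> F 2 \<longleftrightarrow> \<not> a \<and> \<not> b \<and> \<not> c" using f3 3 mono e by (metis subsetD)
  have f1: "y5 \<in> F 1 \<longleftrightarrow> \<not> a \<and> \<not> b \<and> \<not> c \<and> \<not> d" using f2 2 mono e by (metis subsetD)
  have f0: "y5 \<in> F 0 \<longleftrightarrow> \<not> a \<and> \<not> b \<and> \<not> c \<and> \<not> d \<and> \<not> t" using f1 1 mono e by (metis subsetD)
  have "l = 0 \<or> l = 1 \<or> l = 2 \<or> l = 3 \<or> l = 4 \<or> l = 5" using assms by auto
  then have "y5 \<in> F (5 - l) \<longleftrightarrow> lead l ((a, b, c, d), t)"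
    using 5 f3 f2 f1 f0 by (elim disjE) (simp_all add: eval_nat_numeral)
  then show ?thesis using y5 z by simp
qed

lemma comb_xor: "comb v (xor5 x y) = comb v x + comb v y"
proof -
  have h: "(if p \<noteq> q then w else 0) = (if p then w else 0) + (if q then w else (0::'e))" for p q w
    by (auto simp: char2)
  obtain a b c d t where x: "x = ((a, b, c, d), t)" by (metis prod.exhaust)
  obtain a' b' c' d' t' where y: "y = ((a', b', c', d'), t')" by (metis prod.exhaust)
  show ?thesis unfolding x y comb_def xor5.simps xor4.simps prod.case h by (simp only: ac_simps)
qed

lemma bij_comb: "bij (comb v)"
proof -
  have "inj (comb v)"
  proof (rule injI)
    fix x y assume "comb v x = comb v y"
    then have "comb v (xor5 x y) \<in> F (5 - 5)" using F_zero by (simp add: comb_xor char2)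
    then have "lead 5 (xor5 x y)" using comb_lead[of 5] by simp
    then have "xor5 x y = O5" by (cases "xor5 x y") (auto simp: eval_nat_numeral)
    then show "x = y" by (simp add: xor5_zero_iff)
  qed
  moreover then have "range (comb v) = UNIV"
    using card_v5 card_e by (intro card_subset_eq) (simp_all add: card_image)
  ultimately show ?thesis by (simp add: bij_def)
qed

end

locale aligned_setup = regular_setup \<Omega> K p pt
  for \<Omega> :: "'a set" and K p and pt :: "'e::{finite, ab_group_add} \<times> int \<Rightarrow> 'a" +
  fixes \<beta> :: "'e \<times> int \<Rightarrow> 'a \<Rightarrow> 'a" and R :: "('a \<Rightarrow> 'a) set" and m :: "'e \<Rightarrow> int"
  assumes al: "aligned \<beta> R m"
begin

section \<open>Action of the 2-group on the fibres\<close>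

lemma \<beta>: "regrep \<beta>" and R_grp: "pgrp \<Omega> R" and R_K: "R \<subseteq> K" and R_card: "\<exists>n. card R = 2 ^ n"
  and tr_R: "tr (v, 0) \<in> R" and \<beta>_R: "\<beta> (v, 0) \<in> R"
  and R_lin: "r \<in> R \<Longrightarrow> \<exists>y c. coprime c (int p) \<and> (\<forall>i. r (pt (x, i)) = pt (y, c * i))"
  and \<beta>_m: "\<beta> (0, 1) (pt (x, i)) = pt (x, i + m x)"
  using al unfolding aligned_def by blast+

lemma R_comp: "r \<in> R \<Longrightarrow> s \<in> R \<Longrightarrow> r \<circ> s \<in> R" and R_inv: "r \<in> R \<Longrightarrow> pinv r \<in> R" and R_id: "id \<in> R"
  using R_grp unfolding pgrp_def by blast+

text \<open>An element of the 2-group permutes the fibres and is a scalar on each;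
  \<open>mul\<close> reads the scalar off at height 1.\<close>

definition act :: "('a \<Rightarrow> 'a) \<Rightarrow> 'e \<Rightarrow> 'e" where "act r x = fst (co (r (pt (x, 0))))"
definition mul :: "('a \<Rightarrow> 'a) \<Rightarrow> 'e \<Rightarrow> int" where "mul r x = snd (co (r (pt (x, 1))))"

lemma R_pt: assumes "r \<in> R" shows "r (pt (x, i)) = pt (act r x, mul r x * i)" "coprime (mul r x) (int p)"
proof -
  obtain y c where c: "coprime c (int p)" "\<And>i. r (pt (x, i)) = pt (y, c * i)" using R_lin[OF assms] by blast
  have "act r x = y" by (simp add: act_def c(2) co_pt)
  moreover have mc: "[mul r x = c] (mod int p)" using co_pt(2)[of "(y, c)"] by (simp add: mul_def c(2))
  ultimately show "r (pt (x, i)) = pt (act r x, mul r x * i)"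
    using cong_scalar_right[OF mc, of i] by (simp add: c(2) pt_eq cong_sym)
  show "coprime (mul r x) (int p)" using mc c(1) by (metis cong_imp_coprime cong_sym)
qed

lemma act_eqI: "r \<in> R \<Longrightarrow> r (pt (x, i)) = pt (y, j) \<Longrightarrow> act r x = y \<and> [mul r x * i = j] (mod int p)"
  using R_pt(1)[of r x i] by (simp add: pt_eq)

lemma act_comp: "r \<in> R \<Longrightarrow> s \<in> R \<Longrightarrow> act (r \<circ> s) x = act r (act s x)"
  by (rule act_eqI[THEN conjunct1, of _ x 0 _ 0]) (auto simp: R_comp R_pt)

lemma mul_comp: "r \<in> R \<Longrightarrow> s \<in> R \<Longrightarrow> [mul (r \<circ> s) x = mul r (act s x) * mul s x] (mod int p)"
  using act_eqI[of "r \<circ> s" x 1 "act r (act s x)" "mul r (act s x) * mul s x"] by (simp add: R_comp R_pt)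

lemma act_tr [simp]: "act (tr (v, 0)) x = v + x" and mul_tr: "[mul (tr (v, 0)) x = 1] (mod int p)"
  using act_eqI[of "tr (v, 0)" x 1 "v + x" 1] by (simp_all add: tr_R tr)

lemma act_id [simp]: "act id x = x" by (simp add: act_def co_pt)

lemma act_inv: "r \<in> R \<Longrightarrow> act (pinv r) (act r x) = x" "r \<in> R \<Longrightarrow> act r (act (pinv r) x) = x"
proof -
  assume r: "r \<in> R"
  then have "r \<in> K" using R_K by blast
  then have "pinv r \<circ> r = id" "r \<circ> pinv r = id" by (auto simp: fun_eq_iff)
  then show "act (pinv r) (act r x) = x" "act r (act (pinv r) x) = x"
    using act_comp[OF R_inv[OF r] r] act_comp[OF r R_inv[OF r]] by (metis act_id)+
qed

definition T :: "('e \<Rightarrow> int) set" where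
  "T = {t. \<exists>k\<in>K. \<forall>x i. k (pt (x, i)) = pt (x, i + t x)}"

definition eqv :: "'e \<Rightarrow> 'e \<Rightarrow> bool" where
  "eqv x y \<longleftrightarrow> (\<forall>t\<in>T. [t x = t y] (mod int p))"

lemma eqv_refl: "eqv x x" and eqv_sym: "eqv x y \<Longrightarrow> eqv y x" and eqv_trans: "eqv x y \<Longrightarrow> eqv y z \<Longrightarrow> eqv x z"
  unfolding eqv_def by (auto intro: cong_sym cong_trans)

lemma m_T: "m \<in> T" using \<beta>_m regrepD(1)[OF \<beta>] unfolding T_def by blast

text \<open>Conjugation by \<open>r\<close> brings the shift over \<open>act r x\<close> back to
  \<open>x\<close>, divided by the scalar; \<open>d\<close> supplies the inverse scalars.\<close>

lemma T_conj:
  assumes t: "t \<in> T" and r: "r \<in> R" and d: "\<And>x. [d x * mul r x = 1] (mod int p)"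
  shows "(\<lambda>x. d x * t (act r x)) \<in> T"
proof -
  obtain k where k: "k \<in> K" "\<And>x i. k (pt (x, i)) = pt (x, i + t x)" using t unfolding T_def by blast
  have rK: "r \<in> K" using r R_K by blast
  have "(pinv r \<circ> k \<circ> r) (pt (x, i)) = pt (x, i + d x * t (act r x))" for x i
  proof -
    have "[mul r x * (i + d x * t (act r x)) = mul r x * i + (d x * mul r x) * t (act r x)] (mod int p)"
      by (simp add: algebra_simps)
    also have "[mul r x * i + (d x * mul r x) * t (act r x) = mul r x * i + 1 * t (act r x)] (mod int p)"
      by (intro cong_add cong_scalar_right d cong_refl)
    finally have "r (pt (x, i + d x * t (act r x))) = k (r (pt (x, i)))"
      by (simp add: R_pt(1)[OF r] k pt_eq)
    from inv_eqI[OF rK this] show ?thesis by simp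
  qed
  moreover have "pinv r \<circ> k \<circ> r \<in> K" using rK k K_comp K_inv by blast
  ultimately show ?thesis unfolding T_def by blast
qed

lemma ex_mul_inverse: assumes "r \<in> R" shows "\<exists>d. \<forall>x. [d x * mul r x = 1] (mod int p) \<and> coprime (d x) (int p)"
proof -
  have "\<exists>e. [e * mul r x = 1] (mod int p) \<and> coprime e (int p)" for x
    using ex_inverse[OF R_pt(2)[OF assms]] by blast
  then show ?thesis by metis
qed

lemma one_T: "(\<lambda>x. 1) \<in> T"
  unfolding T_def using tr(1)[of "(0, 1)"] by (auto simp: tr(2) add.commute intro!: bexI[of _ "tr (0, 1)"])

text \<open>Conjugating the constant shift 1 shows that the inverse scalars \<open>d\<close> form an
  element of \<open>T\<close>, so they agree at equivalent points. Dividing by them gives the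
  equivalence of the images.\<close>

lemma eqv_act:
  assumes r: "r \<in> R" and xy: "eqv x y" shows "eqv (act r x) (act r y)" "[mul r x = mul r y] (mod int p)"
proof -
  obtain d where d: "\<And>x. [d x * mul r x = 1] (mod int p)" "\<And>x. coprime (d x) (int p)"
    using ex_mul_inverse[OF r] by blast
  have dT: "[d x = d y] (mod int p)" using T_conj[OF one_T r d(1)] xy unfolding eqv_def by auto
  have "[t (act r x) = t (act r y)] (mod int p)" if t: "t \<in> T" for t
  proof -
    have "[d x * t (act r x) = d y * t (act r y)] (mod int p)" using T_conj[OF t r d(1)] xy unfolding eqv_def by auto
    also have "[d y * t (act r y) = d x * t (act r y)] (mod int p)" by (rule cong_scalar_right[OF cong_sym[OF dT]])
    finally show ?thesis using d(2) by (simp add: cong_mult_lcancel)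
  qed
  then show "eqv (act r x) (act r y)" unfolding eqv_def by blast
  have "[d x * mul r x = d y * mul r y] (mod int p)" using d(1) by (metis cong_sym cong_trans)
  also have "[d y * mul r y = d x * mul r y] (mod int p)" by (rule cong_scalar_right[OF cong_sym[OF dT]])
  finally show "[mul r x = mul r y] (mod int p)" using d(2) by (simp add: cong_mult_lcancel)
qed

lemma eqv_add: "eqv x y \<Longrightarrow> eqv (v + x) (v + y)"
  using eqv_act(1)[OF tr_R, of x y v] by simp

definition S :: "'e set" where "S = {x. eqv x 0}"

text \<open>For a subgroup \<open>D\<close> the last clause says, in terms of differences, that
  \<open>R\<close> permutes the cosets of \<open>D\<close>.\<close>

definition blk :: "'e set \<Rightarrow> bool" where
  "blk D \<longleftrightarrow> 0 \<in> D \<and> (\<forall>x\<in>D. \<forall>y\<in>D. x + y \<in> D) \<and>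
     (\<forall>r\<in>R. \<forall>x y. x + y \<in> D \<longrightarrow> act r x + act r y \<in> D)"

lemma eqv_S: "eqv x y \<longleftrightarrow> x + y \<in> S"
proof
  assume "eqv x y" from eqv_add[OF this, of y] show "x + y \<in> S" by (simp add: S_def char2 add.commute)
next
  assume "x + y \<in> S"
  then have "eqv (x + y) 0" by (simp add: S_def)
  from eqv_add[OF this, of y] show "eqv x y" by (simp add: add.commute)
qed

lemma blk_S: "blk S"
  unfolding blk_def
proof (intro conjI ballI allI impI)
  show "0 \<in> S" using eqv_refl by (simp add: S_def)
  fix x y assume "x \<in> S" "y \<in> S"
  then have "eqv x 0" "eqv y 0" by (auto simp: S_def)
  then have "eqv x y" using eqv_sym eqv_trans by blast
  then show "x + y \<in> S" by (simp add: eqv_S)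
next
  fix r x y assume "r \<in> R" "x + y \<in> S"
  then show "act r x + act r y \<in> S" using eqv_act(1) eqv_S by blast
qed

lemma blk_act_iff: "blk D \<Longrightarrow> r \<in> R \<Longrightarrow> act r x + act r y \<in> D \<longleftrightarrow> x + y \<in> D"
  unfolding blk_def using act_inv(1)[of r] R_inv[of r] by metis

section \<open>Invariant flags\<close>

lemma blk_UNIV: "blk UNIV" and blk_zero: "blk {0}" by (auto simp: blk_def)

lemma card_blk: assumes "blk D" shows "\<exists>n\<le>5. card D = 2 ^ n"
proof -
  have "card (range (\<lambda>x. (+) x ` D)) * card D = 2 ^ 5"
    using coset_count[of D] assms card_e by (simp add: blk_def)
  then have "card D dvd 2 ^ 5" by (metis dvd_triv_right)
  then show ?thesis using divides_primepow_nat[OF two_is_prime_nat] by blast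
qed

text \<open>The stabiliser of 0 in the 2-group \<open>R\<close> permutes the cosets of
  \<open>D\<close> in \<open>D'\<close>, an even number, and fixes \<open>D\<close>. So it fixes a
  second coset, and the union of the two is the new block.\<close>

lemma blk_extend:
  assumes D: "blk D" and D': "blk D'" and sub: "D \<subset> D'"
  shows "\<exists>D''. blk D'' \<and> D \<subset> D'' \<and> D'' \<subseteq> D' \<and> card D'' = 2 * card D"
proof -
  define R0 where "R0 = {r\<in>R. act r 0 = 0}"
  have R0R: "r \<in> R" "act r 0 = 0" if "r \<in> R0" for r using that by (auto simp: R0_def)
  have R0: "pgrp \<Omega> R0"
  proof (rule pgrp_subset[OF R_grp])
    fix r assume r: "r \<in> R0"
    then show "pinv r \<in> R0" using R_inv act_inv(1)[of r 0] by (simp add: R0_def)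
    fix s assume "s \<in> R0"
    then show "r \<circ> s \<in> R0" using r R_comp act_comp by (simp add: R0_def)
  qed (auto simp: R0_def R_id)
  obtain n where "card R = 2 ^ n" using R_card by blast
  then obtain l where l: "card R0 = 2 ^ l"
    using pgrp_subset_card[OF finite_Omega R_grp _ two_is_prime_nat R0] by (auto simp: R0_def)
  let ?c = "\<lambda>x. (+) x ` D"
  have cmem: "y \<in> ?c x \<longleftrightarrow> y + x \<in> D" for x y
  proof
    assume "y + x \<in> D"
    then show "y \<in> ?c x" by (intro image_eqI[of _ _ "y + x"]) (simp_all add: add.commute)
  next
    assume "y \<in> ?c x"
    then obtain z where "z \<in> D" "y = x + z" by blast
    then show "y + x \<in> D" by (simp add: add.commute)
  qed
  have im: "act r ` ?c x = ?c (act r x)" if r: "r \<in> R" for r x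
  proof (intro equalityI subsetI)
    fix y assume "y \<in> act r ` ?c x"
    then obtain w where w: "w \<in> ?c x" "y = act r w" by blast
    then show "y \<in> ?c (act r x)" using blk_act_iff[OF D r] cmem by blast
  next
    fix y assume y: "y \<in> ?c (act r x)"
    then have "act r (act (pinv r) y) + act r x \<in> D" using cmem act_inv(2)[OF r] by metis
    then have "act (pinv r) y \<in> ?c x" using blk_act_iff[OF D r] cmem by blast
    then show "y \<in> act r ` ?c x" using act_inv(2)[OF r] by (metis imageI)
  qed
  let ?X = "?c ` D'"
  have count: "card ?X * card D = card D'"
    using D D' sub by (intro coset_count_rel) (auto simp: blk_def)
  obtain i j where ij: "card D = 2 ^ i" "card D' = 2 ^ j" using card_blk D D' by blast
  have "card D < card D'" using sub by (simp add: psubset_card_mono)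
  then have "i < j" using ij by simp
  then have "card ?X * 2 ^ i = 2 ^ (j - i) * 2 ^ i" using count ij by (simp flip: power_add)
  then have "card ?X = 2 ^ (j - i)" by simp
  then have even: "even (card ?X)" using \<open>i < j\<close> by simp
  let ?Fix = "{C \<in> ?X. \<forall>r\<in>R0. act r ` C = C}"
  have "[card ?Fix = card ?X] (mod 2)"
  proof (rule pgrp_fixed[OF finite_Omega two_is_prime_nat R0 l])
    show "finite ?X" by simp
    fix r C assume rC: "r \<in> R0" "C \<in> ?X"
    then obtain x where x: "x \<in> D'" "C = ?c x" by blast
    have "act r x + act r 0 \<in> D'" using blk_act_iff[OF D' R0R(1)[OF rC(1)], of x 0] x by simp
    then have "act r x \<in> D'" using R0R(2)[OF rC(1)] by simp
    moreover have "act r ` C = ?c (act r x)" using im[OF R0R(1)[OF rC(1)]] x(2) by simp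
    ultimately show "act r ` C \<in> ?X" by simp
  next
    fix C assume "C \<in> ?X" then show "act id ` C = C" by simp
  next
    fix r s C assume rs: "r \<in> R0" "s \<in> R0"
    show "act (r \<circ> s) ` C = act r ` act s ` C"
      unfolding image_image using act_comp[OF R0R(1)[OF rs(1)] R0R(1)[OF rs(2)]] by simp
  qed
  then have "card ?Fix mod 2 = card ?X mod 2" by (simp only: cong_def)
  then have even_Fix: "even (card ?Fix)" using even by (simp only: even_iff_mod_2_eq_zero)
  have D_fix: "D \<in> ?Fix"
  proof -
    have D0: "D = ?c 0" by simp
    have "act r ` D = D" if "r \<in> R0" for r using im[of r 0] R0R[OF that] D0 by simp
    moreover have "D \<in> ?X" using D' by (intro image_eqI[of _ _ 0]) (auto simp: blk_def)
    ultimately show ?thesis by blast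
  qed
  have "?Fix \<noteq> {D}"
  proof
    assume "?Fix = {D}"
    then have "card ?Fix = 1" by simp
    then show False using even_Fix by simp
  qed
  then obtain C where C: "C \<in> ?Fix" "C \<noteq> D" using D_fix by blast
  then obtain x where x: "x \<in> D'" "C = ?c x" by blast
  have Dadd: "u + w \<in> D" if "u \<in> D" "w \<in> D" for u w using D that by (simp add: blk_def)
  have xD: "x \<notin> D"
  proof
    assume "x \<in> D"
    then have "y + x \<in> D \<longleftrightarrow> y \<in> D" for y
      using Dadd[of y x] Dadd[of "y + x" x] by (auto simp: add.assoc char2)
    then have "C = D" using cmem x by blast
    then show False using C by blast
  qed
  define D'' where "D'' = D \<union> C"
  have mem: "y \<in> D'' \<longleftrightarrow> y \<in> D \<or> y + x \<in> D" for y using cmem x by (auto simp: D''_def)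
  have "blk D''"
    unfolding blk_def
  proof (intro conjI ballI allI impI)
    show "0 \<in> D''" using D by (simp add: mem blk_def)
    fix u w assume "u \<in> D''" "w \<in> D''"
    then have "u \<in> D \<or> u + x \<in> D" "w \<in> D \<or> w + x \<in> D" by (simp_all only: mem)
    moreover have "(u + x) + (w + x) = u + w" "u + (w + x) = (u + w) + x" "(u + x) + w = (u + w) + x"
      by (simp_all add: ac_simps)
    ultimately show "u + w \<in> D''" unfolding mem using Dadd by metis
  next
    fix r u w assume r: "r \<in> R" and uw: "u + w \<in> D''"
    show "act r u + act r w \<in> D''"
    proof (cases "u + w \<in> D")
      case True
      then show ?thesis using blk_act_iff[OF D r] by (simp add: mem)
    next
      case False
      then have uwC: "u + w \<in> C" using uw by (simp add: D''_def)
      \<comment> \<open>Translations before and after turn an arbitrary \<open>r\<close> into an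
        element of the stabiliser of 0 with the same effect on the difference.\<close>
      let ?r = "tr (act r w, 0) \<circ> r \<circ> tr (w, 0)"
      have rR: "?r \<in> R" using r tr_R R_comp by blast
      have ar: "act ?r y = act r w + act r (w + y)" for y
        using act_comp r tr_R R_comp by simp
      have "?r \<in> R0" using rR ar[of 0] by (simp add: R0_def char2)
      then have "act ?r ` C = C" using C by blast
      then have "act ?r (u + w) \<in> C" using uwC by blast
      then have "act r u + act r w \<in> C" unfolding ar by (simp add: add.commute)
      then show ?thesis by (simp add: D''_def)
    qed
  qed
  moreover have "D \<subset> D''"
  proof -
    have "x + x \<in> D" using D by (simp add: blk_def char2)
    then have "x \<in> D''" using mem by blast
    then show ?thesis using xD unfolding D''_def by blast
  qed
  moreover have "D'' \<subseteq> D'" 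
  proof -
    have "C \<subseteq> D'" using x sub D' by (auto simp: blk_def)
    then show ?thesis using sub by (auto simp: D''_def)
  qed
  moreover have "card D'' = 2 * card D"
  proof -
    have "D \<inter> C = {}"
    proof -
      have "y + x \<notin> D" if "y \<in> D" for y
        using Dadd[OF that, of "y + x"] xD by auto
      then show ?thesis using cmem x by blast
    qed
    moreover have "card C = card D" unfolding x(2) by (rule card_image) simp
    ultimately show ?thesis unfolding D''_def by (subst card_Un_disjoint) auto
  qed
  ultimately show ?thesis by blast
qed

text \<open>The flag has to pass through \<open>S\<close>, because trivial scalars are demanded
  exactly there; comparability with \<open>S\<close> is the invariant of the successive
  choices.\<close>

lemma ex_flag:
  "\<exists>F d. (\<forall>j\<le>5. blk (F j) \<and> card (F j) = 2 ^ j) \<and> (\<forall>j<5. F j \<subset> F (Suc j)) \<and> d \<le> 5 \<and> F d = S"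
proof -
  let ?P = "\<lambda>j D. j \<le> (5::nat) \<longrightarrow> blk D \<and> card D = 2 ^ j \<and> (D \<subseteq> S \<or> S \<subseteq> D)"
  have "\<exists>F. \<forall>j. ?P j (F j) \<and> (j < 5 \<longrightarrow> F j \<subset> F (Suc j))"
  proof (rule dependent_nat_choice)
    show "\<exists>D. ?P 0 D" using blk_zero blk_S by (intro exI[of _ "{0}"]) (auto simp: blk_def)
    fix D j assume D: "?P j D"
    show "\<exists>D'. ?P (Suc j) D' \<and> (j < 5 \<longrightarrow> D \<subset> D')"
    proof (cases "j < 5")
      case True
      then have D: "blk D" "card D = 2 ^ j" "D \<subseteq> S \<or> S \<subseteq> D" using D by auto
      show ?thesis
      proof (cases "D \<subset> S")
        case True
        from blk_extend[OF D(1) blk_S True] show ?thesis using D(2) by (auto simp: psubset_eq)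
      next
        case False
        then have SD: "S \<subseteq> D" using D(3) by auto
        have "card D \<noteq> card (UNIV :: 'e set)"
        proof -
          have "(2::nat) ^ j < 2 ^ 5" using \<open>j < 5\<close> by (intro power_strict_increasing) auto
          then show ?thesis using D(2) card_e by simp
        qed
        then have "D \<subset> UNIV" by auto
        from blk_extend[OF D(1) blk_UNIV this] obtain D'' where
          D'': "blk D''" "D \<subset> D''" "card D'' = 2 * card D" by blast
        then have "?P (Suc j) D'' \<and> (j < 5 \<longrightarrow> D \<subset> D'')" using D(2) SD by auto
        then show ?thesis by blast
      qed
    qed auto
  qed
  then obtain F where F0: "\<forall>j. ?P j (F j) \<and> (j < 5 \<longrightarrow> F j \<subset> F (Suc j))" ..
  have F: "?P j (F j)" "j < 5 \<Longrightarrow> F j \<subset> F (Suc j)" for j using F0[rule_format, of j] by simp_all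
  obtain d where d: "d \<le> 5" "card S = 2 ^ d" using card_blk[OF blk_S] by blast
  have "F d = S" using F(1)[of d] d by (metis card_subset_eq finite)
  moreover have "\<forall>j\<le>5. blk (F j) \<and> card (F j) = 2 ^ j" "\<forall>j<5. F j \<subset> F (Suc j)" using F by auto
  ultimately show ?thesis using d(1) by (intro exI[of _ F] exI[of _ d] conjI)
qed

text \<open>The orbit map of the second 2-part at 0. It carries addition on E to the action of that
  group and need not be additive.\<close>

definition f0 :: "'e \<Rightarrow> 'e" where "f0 v = act (\<beta> (v, 0)) 0"

lemma \<beta>_add: "\<beta> (u + v, 0) = \<beta> (u, 0) \<circ> \<beta> (v, 0)"
  using regrepD(2)[OF \<beta>, of "(u, 0)" "(v, 0)"] by simp

lemma f0_add: "f0 (u + v) = act (\<beta> (u, 0)) (f0 v)"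
  unfolding f0_def \<beta>_add by (rule act_comp[OF \<beta>_R \<beta>_R])

lemma \<beta>_zero: "\<beta> (0, 0) = id" by (rule regrepD(4)[OF \<beta>]) auto

lemma f0_zero: "f0 0 = 0" by (simp add: f0_def \<beta>_zero)

lemma f0_inj: "f0 u = f0 v \<Longrightarrow> u = v"
proof -
  assume "f0 u = f0 v"
  then have "\<beta> (u, 0) (pt (0, 0)) = \<beta> (v, 0) (pt (0, 0))" using R_pt(1)[OF \<beta>_R] by (simp add: f0_def)
  then have "\<beta> (v + u, 0) (pt (0, 0)) = \<beta> (v + v, 0) (pt (0, 0))" by (simp add: \<beta>_add)
  then have "\<beta> (v + u, 0) (pt (0, 0)) = pt (0, 0)" by (simp add: char2 \<beta>_zero)
  then have "v + u = 0" using regrepD(3)[OF \<beta>, of "pt (0, 0)" "(v + u, 0)"] by simp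
  then show "u = v" by simp
qed

lemma bij_f0: "bij f0"
  using f0_inj by (simp add: bij_def finite_UNIV_inj_surj inj_def)

text \<open>The element \<open>\<beta> (u, 0)\<close> of \<open>R\<close> takes the pair 0,
  \<open>f0 (u + v)\<close> to the pair \<open>f0 u\<close>, \<open>f0 v\<close>. So the preimage of
  a block is a subgroup although \<open>f0\<close> is not linear.\<close>

lemma f0_blk: "blk D \<Longrightarrow> f0 u + f0 v \<in> D \<longleftrightarrow> f0 (u + v) \<in> D"
proof -
  assume D: "blk D"
  have "f0 u = act (\<beta> (u, 0)) 0" "f0 v = act (\<beta> (u, 0)) (f0 (u + v))"
    using f0_add[of u "u + v"] by (simp_all add: f0_def)
  then show ?thesis using blk_act_iff[OF D \<beta>_R[of u], of 0 "f0 (u + v)"] by simp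
qed

text \<open>\<open>\<beta> (u, 0)\<close> commutes with \<open>\<beta> (0, 1)\<close>, so its scalar
  converts the shift over \<open>x\<close> into the shift over the image.\<close>

lemma mul_\<beta>: "[mul (\<beta> (u, 0)) x * m x = m (act (\<beta> (u, 0)) x)] (mod int p)"
proof -
  have "\<beta> (u, 0) \<circ> \<beta> (0, 1) = \<beta> (0, 1) \<circ> \<beta> (u, 0)"
    using regrepD(2)[OF \<beta>, of "(u, 0)" "(0, 1)"] regrepD(2)[OF \<beta>, of "(0, 1)" "(u, 0)"] by simp
  then have "\<beta> (u, 0) (\<beta> (0, 1) (pt (x, 0))) = \<beta> (0, 1) (\<beta> (u, 0) (pt (x, 0)))" by (metis comp_apply)
  then show ?thesis by (simp add: \<beta>_m R_pt(1)[OF \<beta>_R] pt_eq)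
qed

definition RE :: "'e \<Rightarrow> 'e \<Rightarrow> bool" where
  "RE x y \<longleftrightarrow> (\<exists>r\<in>R. act r 0 = 0 \<and> act r x = y)"

text \<open>The scalar is asked for at 0 only; by \<open>eqv_act\<close> it is then trivial on all
  of \<open>S\<close>.\<close>

definition RS :: "'e \<Rightarrow> 'e \<Rightarrow> bool" where
  "RS x y \<longleftrightarrow> (\<exists>r\<in>R. act r 0 = 0 \<and> act r x = y \<and> [mul r 0 = 1] (mod int p))"

lemma RS_RE: "RS x y \<Longrightarrow> RE x y" unfolding RS_def RE_def by blast

lemma mul_id: "[mul id x = 1] (mod int p)"
  using act_eqI[of id x 1 x 1] R_id by simp

lemma mul_inv: "r \<in> R \<Longrightarrow> act r x = x \<Longrightarrow> [mul r x = 1] (mod int p) \<Longrightarrow> [mul (pinv r) x = 1] (mod int p)"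
proof -
  assume r: "r \<in> R" "act r x = x" "[mul r x = 1] (mod int p)"
  have "r \<in> K" using r R_K by blast
  then have "pinv r \<circ> r = id" by (auto simp: fun_eq_iff)
  then have "[1 = mul (pinv r) x * mul r x] (mod int p)"
    using mul_comp[OF R_inv[OF r(1)] r(1), of x] mul_id[of x] r(2) by (metis cong_sym cong_trans)
  also have "[mul (pinv r) x * mul r x = mul (pinv r) x * 1] (mod int p)" by (rule cong_scalar_left[OF r(3)])
  finally show ?thesis by (simp add: cong_sym)
qed

lemma equivp_RE: "equivp RE"
proof (rule equivpI)
  show "reflp RE" unfolding reflp_def RE_def using R_id by (metis act_id)
  show "symp RE" unfolding symp_def RE_def using R_inv act_inv(1) by metis
  show "transp RE" unfolding transp_def RE_def using R_comp act_comp by metis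
qed

lemma equivp_RS: "equivp RS"
proof (rule equivpI)
  show "reflp RS" unfolding reflp_def RS_def using R_id mul_id by (metis act_id)
  show "symp RS"
  proof (rule sympI)
    fix x y assume "RS x y"
    then obtain r where r: "r \<in> R" "act r 0 = 0" "act r x = y" "[mul r 0 = 1] (mod int p)" unfolding RS_def by blast
    then show "RS y x" unfolding RS_def
      using R_inv act_inv(1)[OF r(1), of 0] act_inv(1)[OF r(1), of x] mul_inv[OF r(1,2,4)]
      by (intro bexI[of _ "pinv r"]) auto
  qed
  show "transp RS"
  proof (rule transpI)
    fix x y z assume "RS x y" "RS y z"
    then obtain r s where r: "r \<in> R" "act r 0 = 0" "act r x = y" "[mul r 0 = 1] (mod int p)"
      and s: "s \<in> R" "act s 0 = 0" "act s y = z" "[mul s 0 = 1] (mod int p)" unfolding RS_def by blast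
    have "[mul (s \<circ> r) 0 = 1 * 1] (mod int p)"
      using mul_comp[OF s(1) r(1), of 0] cong_mult[OF s(4) r(4)] r(2) by (metis cong_trans)
    then show "RS x z" unfolding RS_def using r s R_comp act_comp by (intro bexI[of _ "s \<circ> r"]) auto
  qed
qed

text \<open>The path 0, \<open>f0 u\<close>, \<open>f0 v\<close>, 0 given by a translation, an
  element of \<open>\<beta>\<close> and another translation. The same element takes the derivative
  of \<open>f0\<close> at \<open>u\<close> in direction \<open>w\<close> to the derivative at
  \<open>v\<close>: this is one step of a walk, and its scalar is the quotient of
  \<open>m (f0 v)\<close> by \<open>m (f0 u)\<close>.\<close>

lemma generator:
  "\<exists>r\<in>R. act r 0 = 0 \<and> act r (f0 u + f0 (u + w)) = f0 v + f0 (v + w) \<and> [mul r 0 * m (f0 u) = m (f0 v)] (mod int p)"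
proof -
  let ?b = "\<beta> (u + v, 0)"
  let ?r = "tr (f0 v, 0) \<circ> (?b \<circ> tr (f0 u, 0))"
  have mem: "?b \<circ> tr (f0 u, 0) \<in> R" "?r \<in> R" using \<beta>_R tr_R R_comp by blast+
  have ar: "act ?r x = f0 v + act ?b (f0 u + x)" for x
    using act_comp[OF tr_R mem(1)] act_comp[OF \<beta>_R tr_R] by simp
  have b: "act ?b (f0 x) = f0 (u + v + x)" for x using f0_add[of "u + v" x] by simp
  have "act ?r 0 = 0" using b[of u] by (simp add: ar char2 ac_simps)
  moreover have "act ?r (f0 u + f0 (u + w)) = f0 v + f0 (v + w)" using b[of "u + w"] by (simp add: ar ac_simps)
  moreover have "[mul ?r 0 * m (f0 u) = m (f0 v)] (mod int p)"
  proof -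
    have "[mul ?r 0 = mul (tr (f0 v, 0)) (act (?b \<circ> tr (f0 u, 0)) 0) * mul (?b \<circ> tr (f0 u, 0)) 0] (mod int p)"
      by (rule mul_comp[OF tr_R mem(1)])
    also have "[mul (tr (f0 v, 0)) (act (?b \<circ> tr (f0 u, 0)) 0) * mul (?b \<circ> tr (f0 u, 0)) 0 =
        1 * (mul ?b (act (tr (f0 u, 0)) 0) * mul (tr (f0 u, 0)) 0)] (mod int p)"
      by (rule cong_mult[OF mul_tr mul_comp[OF \<beta>_R tr_R]])
    also have "[1 * (mul ?b (act (tr (f0 u, 0)) 0) * mul (tr (f0 u, 0)) 0) = 1 * (mul ?b (f0 u) * 1)] (mod int p)"
      using cong_scalar_left[OF mul_tr, of "mul ?b (f0 u)" "f0 u" 0] by simp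
    finally have "[mul ?r 0 * m (f0 u) = mul ?b (f0 u) * m (f0 u)] (mod int p)" by (intro cong_scalar_right) simp
    also have "[mul ?b (f0 u) * m (f0 u) = m (act ?b (f0 u))] (mod int p)" by (rule mul_\<beta>)
    finally show ?thesis using b[of u] by (simp add: ac_simps)
  qed
  ultimately show ?thesis using mem(2) by blast
qed

end

section \<open>A linear map that tracks the orbit map\<close>

context aligned_setup begin

lemma ex_linear:
  "\<exists>sg. (\<forall>u v. sg (u + v) = sg u + sg v) \<and> (\<forall>u. RE (f0 u) (sg u)) \<and> (\<forall>u. f0 u \<in> S \<longrightarrow> RS (f0 u) (sg u))"
proof -
  obtain F d where F: "\<And>j. j \<le> 5 \<Longrightarrow> blk (F j)" "\<And>j. j \<le> 5 \<Longrightarrow> card (F j) = 2 ^ j"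
    "\<And>j. j < 5 \<Longrightarrow> F j \<subset> F (Suc j)" and d: "d \<le> 5" "F d = S"
    using ex_flag by blast
  have "\<exists>w. w \<in> F (Suc j) \<and> w \<notin> F j" if "j < 5" for j using F(3)[OF that] by blast
  then obtain vv where vv: "\<And>j. j < 5 \<Longrightarrow> vv j \<in> F (Suc j) \<and> vv j \<notin> F j" by metis
  define F1 where "F1 j = (if j \<le> 5 then F j else UNIV)" for j
  interpret A: flag F1 vv
  proof
    show "0 \<in> F1 j" for j using F(1)[of j] by (auto simp: F1_def blk_def)
    show "x + y \<in> F1 j" if "j \<le> 5" "x \<in> F1 j" "y \<in> F1 j" for j x y using F(1)[of j] that by (auto simp: F1_def blk_def)
    have "card (F 0) = 1" "0 \<in> F 0" using F(1,2)[of 0] by (auto simp: blk_def)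
    then show "F1 0 = {0}" by (auto simp: F1_def card_1_singleton_iff)
    show "F1 j \<subseteq> F1 (Suc j)" if "j < 5" for j using F(3)[OF that] that by (auto simp: F1_def)
  qed (use char2 card_e vv in \<open>auto simp: F1_def\<close>)
  \<comment> \<open>These vectors are adapted to the preimage of the flag, and with respect to the
    two bases \<open>f0\<close> fixes the unit vectors, as the normal form requires.\<close>
  define ww where "ww j = inv_into UNIV f0 (vv j)" for j
  have ww: "f0 (ww j) = vv j" for j using bij_f0 by (simp add: ww_def bij_is_surj surj_f_inv_f)
  interpret B: flag "\<lambda>j. f0 -` F1 j" ww
  proof
    show "0 \<in> f0 -` F1 j" for j using A.F_zero by (simp add: f0_zero)
    show "x + y \<in> f0 -` F1 j" if "j \<le> 5" "x \<in> f0 -` F1 j" "y \<in> f0 -` F1 j" for j x y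
      using f0_blk[of "F j" x y] A.F_add[of j "f0 x" "f0 y"] F(1)[of j] that by (simp add: F1_def)
    show "f0 -` F1 0 = {0}"
    proof (intro equalityI subsetI)
      fix x assume "x \<in> f0 -` F1 0"
      then have "f0 x = f0 0" using A.F_0 f0_zero by simp
      then show "x \<in> {0}" using f0_inj by blast
    qed (use A.F_0 f0_zero in simp)
    show "f0 -` F1 j \<subseteq> f0 -` F1 (Suc j)" if "j < 5" for j using A.F_mono[OF that] by blast
    show "ww j \<in> f0 -` F1 (Suc j)" "ww j \<notin> f0 -` F1 j" if "j < 5" for j
      using A.v_in[OF that] A.v_out[OF that] ww by auto
  qed (use char2 card_e in auto)
  define lam where "lam = comb vv"
  define rho where "rho = comb ww"
  have bij: "bij lam" "bij rho" unfolding lam_def rho_def by (rule A.bij_comb B.bij_comb)+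
  define fl where "fl z = inv_into UNIV lam (f0 (rho z))" for z
  have lam_fl: "lam (fl z) = f0 (rho z)" for z using bij by (simp add: fl_def bij_is_surj surj_f_inv_f)
  have fl_eq: "fl z = z'" if "lam z' = f0 (rho z)" for z z'
    using that bij lam_fl by (metis bij_is_inj injD)
  have rel: "lead l (xor5 (fl x) (fl y)) \<longleftrightarrow> lead l (xor5 x y)" if l: "l \<le> 5" for l x y
  proof -
    have "lead l (xor5 (fl x) (fl y)) \<longleftrightarrow> lam (xor5 (fl x) (fl y)) \<in> F1 (5 - l)"
      unfolding lam_def by (rule A.comb_lead[OF l, symmetric])
    also have "lam (xor5 (fl x) (fl y)) = f0 (rho x) + f0 (rho y)"
      unfolding lam_fl[symmetric] by (simp add: lam_def A.comb_xor)
    also have "f0 (rho x) + f0 (rho y) \<in> F1 (5 - l) \<longleftrightarrow> f0 (rho x + rho y) \<in> F1 (5 - l)"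
      using f0_blk[OF F(1)[of "5 - l"]] by (simp add: F1_def)
    also have "\<dots> \<longleftrightarrow> comb ww (xor5 x y) \<in> f0 -` F1 (5 - l)" by (simp add: B.comb_xor rho_def)
    also have "\<dots> \<longleftrightarrow> lead l (xor5 x y)" by (rule B.comb_lead[OF l])
    finally show ?thesis .
  qed
  have fixed: "fl O5 = O5" "fl ((True, False, False, False), False) = ((True, False, False, False), False)"
    "fl ((False, True, False, False), False) = ((False, True, False, False), False)"
    "fl ((False, False, True, False), False) = ((False, False, True, False), False)"
    "fl ((False, False, False, True), False) = ((False, False, False, True), False)"
    by (rule fl_eq, simp add: lam_def rho_def comb_def ww f0_zero)+
  have "\<exists>c \<phi>. (\<forall>x. light x \<longrightarrow> \<not> \<phi> x) \<and> (\<forall>x t. fl (x, t) = (top4 c x, t \<noteq> \<phi> x))"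
    by (rule triangular_form) (fact rel fixed)+
  then obtain c \<phi> where c\<phi>: "(\<forall>x. light x \<longrightarrow> \<not> \<phi> x) \<and> (\<forall>x t. fl (x, t) = (top4 c x, t \<noteq> \<phi> x))"
    by (elim exE)
  have \<phi>: "\<not> \<phi> x" if "light x" for x by (rule c\<phi>[THEN conjunct1, THEN spec, THEN mp, OF that])
  have fl: "fl (x, t) = (top4 c x, t \<noteq> \<phi> x)" for x t using c\<phi>[THEN conjunct2, rule_format] .
  \<comment> \<open>Vectors with \<open>l\<close> leading zeros span \<open>F (5 - l)\<close>.
    Trivial scalars are demanded once this subgroup lies in \<open>S\<close>; the cut at 3 is that
    of \<open>in_level\<close>.\<close>
  define RR where "RR l z z' = (if F (5 - min l 3) \<subseteq> S then RS (lam z) (lam z') else RE (lam z) (lam z'))" for l z z'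
  have equivp_lam: "equivp (\<lambda>z z'. r (lam z) (lam z'))" if r: "equivp r" for r
    by (rule equivpI; rule reflpI sympI transpI) (blast intro: equivp_reflp[OF r] equivp_symp[OF r] equivp_transp[OF r])+
  have equivp: "equivp (RR l)" for l
  proof (cases "F (5 - min l 3) \<subseteq> S")
    case True
    then have "RR l = (\<lambda>z z'. RS (lam z) (lam z'))" by (intro ext) (simp add: RR_def)
    then show ?thesis using equivp_lam[OF equivp_RS] by simp
  next
    case False
    then have "RR l = (\<lambda>z z'. RE (lam z) (lam z'))" by (intro ext) (simp add: RR_def)
    then show ?thesis using equivp_lam[OF equivp_RE] by simp
  qed
  have step: "RR l (xor4 (top4 c u) (top4 c (xor4 u w)), s \<noteq> (\<phi> u \<noteq> \<phi> (xor4 u w)))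
      (xor4 (top4 c v) (top4 c (xor4 v w)), s \<noteq> (\<phi> v \<noteq> \<phi> (xor4 v w)))"
    if uv: "in_level l (xor4 u v)" for l w u v s
  proof -
    let ?U = "rho (u, False)" and ?V = "rho (v, False)" and ?W = "rho (w, s)"
    have lam: "lam (xor4 (top4 c u) (top4 c (xor4 u w)), s \<noteq> (\<phi> u \<noteq> \<phi> (xor4 u w))) =
        f0 (rho (u, False)) + f0 (rho (u, False) + ?W)" for u
    proof -
      have b: "(s \<noteq> (\<phi> u \<noteq> \<phi> (xor4 u w))) = ((False \<noteq> \<phi> u) \<noteq> (s \<noteq> \<phi> (xor4 u w)))" by argo
      have "(xor4 (top4 c u) (top4 c (xor4 u w)), s \<noteq> (\<phi> u \<noteq> \<phi> (xor4 u w))) =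
          xor5 (fl (u, False)) (fl (xor4 u w, s))"
        unfolding fl xor5.simps b ..
      then have "lam (xor4 (top4 c u) (top4 c (xor4 u w)), s \<noteq> (\<phi> u \<noteq> \<phi> (xor4 u w))) =
          f0 (rho (u, False)) + f0 (rho (xor4 u w, s))"
        unfolding lam_fl[symmetric] by (simp add: lam_def A.comb_xor)
      moreover have "rho (xor4 u w, s) = rho (u, False) + ?W"
        using B.comb_xor[of "(u, False)" "(w, s)"] by (simp add: rho_def)
      ultimately show ?thesis by simp
    qed
    obtain r where r: "r \<in> R" "act r 0 = 0" "act r (f0 ?U + f0 (?U + ?W)) = f0 ?V + f0 (?V + ?W)"
      "[mul r 0 * m (f0 ?U) = m (f0 ?V)] (mod int p)" using generator by blast
    show ?thesis
    proof (cases "F (5 - min l 3) \<subseteq> S")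
      case False
      then show ?thesis using r unfolding RR_def lam RE_def by auto
    next
      case True
      \<comment> \<open>The level condition puts \<open>f0 ?U + f0 ?V\<close> into a member of the
        flag inside \<open>S\<close>. The shifts at the two points then agree, and their quotient,
        the scalar of the generator, is 1.\<close>
      have "lead (min l 3) (xor5 (u, False) (v, False))"
      proof -
        have "l = 0 \<or> l = 1 \<or> l = 2 \<or> (\<exists>k. l = Suc (Suc (Suc k)))" by presburger
        then show ?thesis using uv by (cases "xor4 u v") (elim disjE; auto simp: eval_nat_numeral)
      qed
      then have "comb ww (xor5 (u, False) (v, False)) \<in> f0 -` F1 (5 - min l 3)"
        using B.comb_lead[of "min l 3"] by auto
      then have "f0 (?U + ?V) \<in> F (5 - min l 3)" unfolding B.comb_xor rho_def by (simp add: F1_def)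
      then have "f0 ?U + f0 ?V \<in> S" using f0_blk[OF F(1)[of "5 - min l 3"]] True by auto
      then have "eqv (f0 ?U) (f0 ?V)" by (simp add: eqv_S)
      then have "[m (f0 ?U) = m (f0 ?V)] (mod int p)" using m_T unfolding eqv_def by blast
      then have "[mul r 0 * m (f0 ?U) = 1 * m (f0 ?U)] (mod int p)" using r(4) by (metis cong_sym cong_trans mult_1)
      then have "[mul r 0 = 1] (mod int p)" using shift_coprime[OF \<beta> \<beta>_m] by (simp only: cong_mult_rcancel)
      then show ?thesis using r True unfolding RR_def lam RS_def by auto
    qed
  qed
  have "\<exists>\<sigma>. \<forall>w s. RR (level w) (top4 c w, s \<noteq> \<phi> w) (xor5 (lin \<sigma> w) ((False, False, False, False), s))"
    by (rule linear_tracking) (fact \<phi> equivp | erule step)+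
  then obtain \<sigma> where \<sigma>0: "\<forall>w s. RR (level w) (top4 c w, s \<noteq> \<phi> w) (xor5 (lin \<sigma> w) ((False, False, False, False), s))" ..
  note \<sigma> = \<sigma>0[rule_format]
  define sg5 where "sg5 z = xor5 (lin \<sigma> (fst z)) ((False, False, False, False), snd z)" for z
  define sg where "sg u = lam (sg5 (inv_into UNIV rho u))" for u
  have sg_rho: "sg (rho z) = lam (sg5 z)" for z using bij by (simp add: sg_def bij_is_inj)
  have rho_ex: "\<exists>w s. u = rho (w, s)" for u using bij by (metis bij_pointE surj_pair)
  have "sg (u + v) = sg u + sg v" for u v
  proof -
    obtain x where x: "u = rho x" using rho_ex by blast
    obtain y where y: "v = rho y" using rho_ex by blast
    have "sg5 (xor5 x y) = xor5 (sg5 x) (sg5 y)"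
    proof -
      obtain w s where xx: "x = (w, s)" by (cases x)
      obtain w' s' where yy: "y = (w', s')" by (cases y)
      have z: "((False, False, False, False), s \<noteq> s') = xor5 ((False, False, False, False), s) ((False, False, False, False), s')"
        by simp
      show ?thesis unfolding sg5_def xx yy xor5.simps(1) fst_conv snd_conv lin_xor z xor5_swap[of "lin \<sigma> w"] ..
    qed
    moreover have "u + v = rho (xor5 x y)" unfolding x y by (simp add: rho_def B.comb_xor)
    ultimately show ?thesis unfolding x y sg_rho by (simp add: sg_rho lam_def A.comb_xor)
  qed
  moreover have main: "RR (level w) (fl (w, s)) (sg5 (w, s))" for w s using \<sigma>[of w s] by (simp add: fl sg5_def)
  have "RE (f0 u) (sg u)" for u
  proof -
    obtain w s where u: "u = rho (w, s)" using rho_ex by blast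
    show ?thesis using main[of w s] RS_RE unfolding RR_def u sg_rho lam_fl by (auto split: if_splits)
  qed
  moreover have "RS (f0 u) (sg u)" if S: "f0 u \<in> S" for u
  proof -
    obtain w s where u: "u = rho (w, s)" using rho_ex by blast
    show ?thesis
    proof (cases "w = (False, False, False, False)")
      case True
      \<comment> \<open>At w = 0 only the last coordinate is left, and there both maps agree
        exactly.\<close>
      have "fl (w, s) = sg5 (w, s)" using \<phi>[of w] True by (cases c) (simp add: fl sg5_def lin_zero)
      then have "f0 u = sg u" by (metis u lam_fl sg_rho)
      then show ?thesis using equivp_reflp[OF equivp_RS] by simp
    next
      case False
      \<comment> \<open>Membership in \<open>S = F d\<close> means 5 - d leading zeros. So the level
        of \<open>w\<close> is in the range where \<open>RR\<close> is \<open>RS\<close>.\<close>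
      have "lam (fl (w, s)) \<in> F1 (5 - (5 - d))" using S d by (simp add: u lam_fl F1_def)
      then have "lead (5 - d) (fl (w, s))" using A.comb_lead[of "5 - d"] by (simp add: lam_def)
      moreover have xor_O5: "xor5 z O5 = z" for z by (cases z rule: prod.exhaust; cases "fst z") auto
      ultimately have "lead (5 - d) (xor5 (fl (w, s)) (fl O5))" unfolding fixed by simp
      then have "lead (5 - d) (w, s)" using rel[of "5 - d" "(w, s)" O5] xor_O5[of "(w, s)"] by simp
      then have l: "5 - d \<le> level w" using lead_level[of "5 - d" w s] False by simp
      have l3: "level w \<le> 3" by (cases w) simp
      have mono: "F i \<subseteq> F j" if "i \<le> j" "j \<le> 5" for i j
        using that
      proof (induction j rule: dec_induct)
        case (step n)
        then have "F i \<subseteq> F n" "F n \<subseteq> F (Suc n)" using F(3)[of n] by auto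
        then show ?case by blast
      qed simp
      have "5 - min (level w) 3 \<le> d" using l l3 by linarith
      then have "F (5 - min (level w) 3) \<subseteq> S" using mono d by blast
      then show ?thesis using main[of w s] unfolding RR_def u sg_rho lam_fl by simp
    qed
  qed
  ultimately show ?thesis by blast
qed

end

section \<open>Conjugacy of regular subgroups\<close>

context aligned_setup begin

section \<open>Fibrewise shifts\<close>

lemma T_add: "s \<in> T \<Longrightarrow> t \<in> T \<Longrightarrow> (\<lambda>x. s x + t x) \<in> T"
proof -
  assume "s \<in> T" "t \<in> T"
  then obtain k l where k: "k \<in> K" "\<And>x i. k (pt (x, i)) = pt (x, i + s x)"
    and l: "l \<in> K" "\<And>x i. l (pt (x, i)) = pt (x, i + t x)" unfolding T_def by blast
  have "l \<circ> k \<in> K" using k l K_comp by blast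
  moreover have "(l \<circ> k) (pt (x, i)) = pt (x, i + (s x + t x))" for x i using k l by (simp add: add.assoc)
  ultimately show ?thesis unfolding T_def by blast
qed

lemma T_const: "(\<lambda>x. c) \<in> T"
  unfolding T_def using tr(1)[of "(0, c)"] by (auto simp: tr(2) add.commute intro!: bexI[of _ "tr (0, c)"])

lemma T_scale: "t \<in> T \<Longrightarrow> (\<lambda>x. int n * t x) \<in> T"
proof (induction n)
  case 0
  then show ?case using T_const[of 0] by simp
next
  case (Suc n)
  then show ?case using T_add[of t "\<lambda>x. int n * t x"] by (simp add: algebra_simps)
qed

text \<open>\<open>T\<close> contains the constants and is closed under sums and multiples, so a
  shift that tells \<open>x\<close> from \<open>y\<close> can be made to vanish at \<open>y\<close>
  and then scaled.\<close>

lemma T_separate: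
  assumes "\<not> eqv x y" shows "\<exists>t\<in>T. [t y = 0] (mod int p) \<and> [t x = c] (mod int p)"
proof -
  obtain t where t: "t \<in> T" "\<not> [t x = t y] (mod int p)" using assms unfolding eqv_def by blast
  then have "\<not> int p dvd t x - t y" by (simp add: cong_iff_dvd_diff)
  then have "coprime (t x - t y) (int p)" using coprime_iff by blast
  then obtain e where e: "[e * (t x - t y) = 1] (mod int p)" using ex_inverse by blast
  define n where "n = nat ((c * e) mod int p)"
  have n: "[int n = c * e] (mod int p)" using p_pos by (simp add: n_def cong_def)
  define s where "s z = int n * t z + (- int n * t y)" for z
  have "s \<in> T" using T_add[OF T_scale[OF t(1), of n] T_const[of "- int n * t y"]] by (simp add: s_def[abs_def])
  moreover have "s y = 0" by (simp add: s_def)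
  moreover have "[s x = c] (mod int p)"
  proof -
    have "s x = int n * (t x - t y)" by (simp add: s_def algebra_simps)
    moreover have "[int n * (t x - t y) = c * e * (t x - t y)] (mod int p)" using n by (rule cong_scalar_right)
    moreover have "[c * (e * (t x - t y)) = c * 1] (mod int p)" using e by (rule cong_scalar_left)
    ultimately show ?thesis by (metis cong_trans mult.assoc mult_1_right)
  qed
  ultimately show ?thesis by force
qed

text \<open>If \<open>f0 w\<close> is equivalent to 0 the multipliers already agree; otherwise a fibrewise shift in \<open>K\<close>
  that fixes the fibre over 0 corrects the second coordinate.\<close>

lemma track_point:
  assumes d0: "[d0 * m 0 = 1] (mod int p)" and RE: "RE (f0 w) y" and RS: "f0 w \<in> S \<Longrightarrow> RS (f0 w) y"
  shows "\<exists>k\<in>K. k (pt (0, 0)) = pt (0, 0) \<and> k (pt (y, j)) = pt (f0 w, d0 * m (f0 w) * j)"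
proof (cases "f0 w \<in> S")
  case True
  then have "RS y (f0 w)" using RS equivp_symp[OF equivp_RS] by blast
  then obtain r where r: "r \<in> R" "act r 0 = 0" "act r y = f0 w" "[mul r 0 = 1] (mod int p)" unfolding RS_def by blast
  have "act r y + act r 0 \<in> S" using True r by simp
  then have "y + 0 \<in> S" using blk_act_iff[OF blk_S r(1)] by blast
  then have "[mul r y = mul r 0] (mod int p)" using eqv_act(2)[OF r(1)] by (simp add: eqv_S)
  then have mr: "[mul r y = 1] (mod int p)" using r(4) by (metis cong_trans)
  have "eqv (f0 w) 0" using True by (simp add: S_def)
  then have "[m (f0 w) = m 0] (mod int p)" using m_T unfolding eqv_def by blast
  then have "[d0 * m (f0 w) = 1] (mod int p)" using d0 cong_scalar_left[of "m (f0 w)" "m 0" "int p" d0] by (metis cong_trans)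
  then have "[mul r y = d0 * m (f0 w)] (mod int p)" using mr by (metis cong_sym cong_trans)
  then have "r (pt (y, j)) = pt (f0 w, d0 * m (f0 w) * j)"
    using cong_scalar_right[of "mul r y" "d0 * m (f0 w)" "int p" j] by (simp add: R_pt(1)[OF r(1)] r(3) pt_eq)
  moreover have "r (pt (0, 0)) = pt (0, 0)" by (simp add: R_pt(1)[OF r(1)] r(2))
  ultimately show ?thesis using r(1) R_K by blast
next
  case False
  have "RE y (f0 w)" using RE equivp_symp[OF equivp_RE] by blast
  then obtain r where r: "r \<in> R" "act r 0 = 0" "act r y = f0 w" unfolding RE_def by blast
  have "\<not> eqv (f0 w) 0" using False by (simp add: S_def)
  from T_separate[OF this] obtain t where t: "t \<in> T" "[t 0 = 0] (mod int p)"
    "[t (f0 w) = d0 * m (f0 w) * j - mul r y * j] (mod int p)" by blast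
  obtain k where k: "k \<in> K" "\<And>x i. k (pt (x, i)) = pt (x, i + t x)" using t(1) unfolding T_def by blast
  have "[mul r y * j + t (f0 w) = mul r y * j + (d0 * m (f0 w) * j - mul r y * j)] (mod int p)"
    using t(3) by (intro cong_add cong_refl)
  then have "(k \<circ> r) (pt (y, j)) = pt (f0 w, d0 * m (f0 w) * j)"
    by (simp add: R_pt(1)[OF r(1)] r(3) k pt_eq)
  moreover have "(k \<circ> r) (pt (0, 0)) = pt (0, 0)" using t(2) by (simp add: R_pt(1)[OF r(1)] r(2) k pt_eq)
  moreover have "k \<circ> r \<in> K" using r(1) R_K k(1) K_comp by blast
  ultimately show ?thesis by blast
qed

lemma aligned_conjugate: "\<exists>\<tau>\<in>K. \<forall>g. \<exists>g'. \<beta> g = \<tau> \<circ> tr g' \<circ> pinv \<tau>"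
proof -
  obtain sg where sg: "\<And>u v. sg (u + v) = sg u + sg v" "\<And>u. RE (f0 u) (sg u)" "\<And>u. f0 u \<in> S \<Longrightarrow> RS (f0 u) (sg u)"
    using ex_linear by blast
  have sg_inj: "u = v" if "sg u = sg v" for u v
  proof -
    have "sg (u + v) = 0" using that sg(1) by (simp add: char2)
    then have "RE 0 (f0 (u + v))" using sg(2)[of "u + v"] equivp_symp[OF equivp_RE] by metis
    then have "f0 (u + v) = f0 0" unfolding RE_def using f0_zero by auto
    then have "u + v = 0" by (rule f0_inj)
    then show ?thesis by simp
  qed
  then have "bij sg" by (simp add: bij_def finite_UNIV_inj_surj inj_def)
  have sg_0: "sg 0 = 0" using sg(1)[of 0 0] by simp
  have m0: "coprime (m x) (int p)" for x using shift_coprime[OF \<beta> \<beta>_m] .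
  obtain d0 where d0: "[d0 * m 0 = 1] (mod int p)" "coprime d0 (int p)" using ex_inverse[OF m0] by blast
  define h where "h x = inv_into UNIV sg x" for x
  have h: "sg (h x) = x" "h (sg x) = x" for x using \<open>bij sg\<close>
    by (simp_all add: h_def bij_is_surj surj_f_inv_f bij_is_inj)
  \<comment> \<open>The fibre over \<open>sg v\<close> goes to the one over \<open>f0 v\<close>. The
    factor \<open>d0 * m (f0 v)\<close> turns the translation (0, 1) into
    \<open>\<beta> (0, d0)\<close>, and \<open>d0\<close> is chosen to make \<open>\<tau>\<close>
    the identity on the fibre over 0.\<close>
  define \<tau> where "\<tau> \<omega> = (if \<omega> \<in> \<Omega> then pt (f0 (h (fst (co \<omega>))), d0 * m (f0 (h (fst (co \<omega>)))) * snd (co \<omega>)) else \<omega>)" for \<omega>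
  have \<tau>: "\<tau> (pt (sg v, i)) = pt (f0 v, d0 * m (f0 v) * i)" for v i
    using cong_scalar_left[OF co_pt(2)[of "(sg v, i)"], of "d0 * m (f0 v)"]
    by (simp add: \<tau>_def co_pt(1) h pt_eq)
  have pt_sg: "\<exists>v i. \<omega> = pt (sg v, i)" if "\<omega> \<in> \<Omega>" for \<omega>
    using that by (metis h(1) pt_cases prod.collapse)
  have comm: "\<tau> (tr (sg v, i) \<omega>) = \<beta> (v, d0 * i) (\<tau> \<omega>)" if \<omega>: "\<omega> \<in> \<Omega>" for v i \<omega>
  proof -
    obtain u j where u: "\<omega> = pt (sg u, j)" using pt_sg[OF \<omega>] by blast
    have "\<beta> (v, d0 * i) = \<beta> (v, 0) \<circ> \<beta> (0, d0 * i)" using regrepD(2)[OF \<beta>, of "(v, 0)" "(0, d0 * i)"] by simp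
    then have "\<beta> (v, d0 * i) (\<tau> \<omega>) =
        pt (act (\<beta> (v, 0)) (f0 u), mul (\<beta> (v, 0)) (f0 u) * (d0 * m (f0 u) * j + d0 * i * m (f0 u)))"
      by (simp add: u \<tau> shift_pow[OF \<beta> \<beta>_m] R_pt(1)[OF \<beta>_R])
    also have "\<dots> = pt (f0 (v + u), d0 * m (f0 (v + u)) * (i + j))"
    proof -
      have "[mul (\<beta> (v, 0)) (f0 u) * m (f0 u) * (d0 * (i + j)) = m (f0 (v + u)) * (d0 * (i + j))] (mod int p)"
        using mul_\<beta>[of v "f0 u"] by (intro cong_scalar_right) (simp add: f0_add)
      then show ?thesis by (simp add: pt_eq f0_add[symmetric] algebra_simps)
    qed
    also have "\<dots> = \<tau> (pt (sg (v + u), i + j))" by (simp only: \<tau>)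
    also have "\<dots> = \<tau> (tr (sg v, i) \<omega>)" by (simp add: u tr(2) sg(1))
    finally show ?thesis ..
  qed
  have perm: "\<tau> permutes \<Omega>"
  proof (rule permutesI_finite)
    show "\<tau> \<omega> \<in> \<Omega>" if "\<omega> \<in> \<Omega>" for \<omega> using that by (simp add: \<tau>_def)
    show "\<tau> \<omega> = \<omega>" if "\<omega> \<notin> \<Omega>" for \<omega> using that by (simp add: \<tau>_def)
    show "inj_on \<tau> \<Omega>"
    proof (rule inj_onI)
      fix a b assume ab: "a \<in> \<Omega>" "b \<in> \<Omega>" "\<tau> a = \<tau> b"
      obtain u i where u: "a = pt (sg u, i)" using pt_sg[OF ab(1)] by blast
      obtain v j where v: "b = pt (sg v, j)" using pt_sg[OF ab(2)] by blast
      have e: "f0 u = f0 v" "[d0 * m (f0 u) * i = d0 * m (f0 v) * j] (mod int p)" using ab(3) unfolding u v \<tau> pt_eq fst_conv snd_conv by blast+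
      then have uv: "u = v" using f0_inj by blast
      have "coprime (d0 * m (f0 v)) (int p)" using d0(2) m0 by simp
      then have "[i = j] (mod int p)" using e(2) uv by (simp add: cong_mult_lcancel)
      then show "a = b" using uv by (simp add: u v pt_eq)
    qed
  qed
  \<comment> \<open>By \<open>comm\<close>, a translation before and an element of
    \<open>\<beta>\<close> after \<open>\<tau>\<close> reduce any pair to one that contains the base
    point, and \<open>track_point\<close> treats that pair.\<close>
  have "\<exists>k\<in>K. k a = \<tau> a \<and> k b = \<tau> b" if ab: "a \<in> \<Omega>" "b \<in> \<Omega>" for a b
  proof -
    obtain u i where u: "a = pt (sg u, i)" using pt_sg[OF ab(1)] by blast
    let ?t = "tr (sg u, i)" and ?b = "\<beta> (u, d0 * i)"
    have K: "?t \<in> K" "?b \<in> K" using tr(1) regrepD(1)[OF \<beta>] by blast+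
    have a: "a = ?t (pt (0, 0))" by (simp add: u tr(2))
    obtain v j where v: "pinv ?t b = pt (sg v, j)" using pt_sg[of "pinv ?t b"] K ab(2) K_inv by auto
    then have b: "b = ?t (pt (sg v, j))" using K(1) by (metis K_inv_r)
    obtain k where k: "k \<in> K" "k (pt (0, 0)) = pt (0, 0)" "k (pt (sg v, j)) = pt (f0 v, d0 * m (f0 v) * j)"
      using track_point[OF d0(1) sg(2,3)] by blast
    have "\<tau> (pt (0, 0)) = pt (0, 0)" using \<tau>[of 0 0] by (simp add: sg_0 f0_zero)
    then have "\<tau> a = ?b (k (pt (0, 0)))" "\<tau> b = ?b (k (pt (sg v, j)))"
      unfolding a b using comm[of "pt (0, 0)" u i] comm[of "pt (sg v, j)" u i] k by (simp_all add: \<tau>)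
    then have "(?b \<circ> k \<circ> pinv ?t) a = \<tau> a" "(?b \<circ> k \<circ> pinv ?t) b = \<tau> b" using a b K(1) by simp_all
    moreover have "?b \<circ> k \<circ> pinv ?t \<in> K" using K k(1) K_comp K_inv by blast
    ultimately show ?thesis by blast
  qed
  from two_closed[OF perm this] have \<tau>K: "\<tau> \<in> K" .
  have "\<beta> (v, i) = \<tau> \<circ> tr (sg v, m 0 * i) \<circ> pinv \<tau>" for v i
  proof (rule perm_eqI)
    show "\<beta> (v, i) permutes \<Omega>" using regrepD(1)[OF \<beta>] K_perm by blast
    show "\<tau> \<circ> tr (sg v, m 0 * i) \<circ> pinv \<tau> permutes \<Omega>" by (intro K_perm K_comp K_inv \<tau>K tr(1))
    fix x
    have "[d0 * m 0 * i = 1 * i] (mod int p)" using d0(1) by (rule cong_scalar_right)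
    then have "\<beta> (v, d0 * (m 0 * i)) = \<beta> (v, i)" by (intro regrep_period[OF \<beta>]) (simp_all add: mult.assoc)
    then show "\<beta> (v, i) (pt x) = (\<tau> \<circ> tr (sg v, m 0 * i) \<circ> pinv \<tau>) (pt x)"
      using comm[of "pinv \<tau> (pt x)" v "m 0 * i"] \<tau>K K_inv by simp
  qed
  then show ?thesis using \<tau>K by (metis prod.collapse)
qed

end

theorem (in regular_setup) regular_conjugate:
  assumes \<beta>: "regrep \<beta>" shows "\<exists>k\<in>K. \<forall>g. \<exists>g'. \<beta> g = k \<circ> tr g' \<circ> pinv k"
proof -
  obtain k R m where k: "k \<in> K" and al: "aligned (\<lambda>g. k \<circ> \<beta> g \<circ> pinv k) R m" using alignment[OF \<beta>] by blast
  interpret aligned_setup \<Omega> K p pt "\<lambda>g. k \<circ> \<beta> g \<circ> pinv k" R m by unfold_locales (rule al)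
  obtain \<tau> where \<tau>: "\<tau> \<in> K" "\<And>g. \<exists>g'. k \<circ> \<beta> g \<circ> pinv k = \<tau> \<circ> tr g' \<circ> pinv \<tau>" using aligned_conjugate by blast
  have "pinv k \<circ> \<tau> \<in> K" using k \<tau>(1) K_comp K_inv by blast
  moreover have "\<exists>g'. \<beta> g = (pinv k \<circ> \<tau>) \<circ> tr g' \<circ> pinv (pinv k \<circ> \<tau>)" for g
  proof -
    obtain g' where g': "k \<circ> \<beta> g \<circ> pinv k = \<tau> \<circ> tr g' \<circ> pinv \<tau>" using \<tau>(2) by blast
    have "\<beta> g x = ((pinv k \<circ> \<tau>) \<circ> tr g' \<circ> pinv (pinv k \<circ> \<tau>)) x" for x
    proof -
      have "pinv (pinv k \<circ> \<tau>) x = pinv \<tau> (k x)"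
        by (rule inv_eqI[OF \<open>pinv k \<circ> \<tau> \<in> K\<close>]) (simp add: k \<tau>(1))
      then show ?thesis using fun_cong[OF g', of "k x"] k by (simp, metis K_inv_l)
    qed
    then show ?thesis by blast
  qed
  ultimately show ?thesis by blast
qed

section \<open>Schur rings of permutation groups\<close>

locale translation_group = group G for G (structure) +
  fixes M :: "('a \<Rightarrow> 'a) set"
  assumes fin: "finite (carrier G)" and M: "pgrp (carrier G) M"
    and transl: "g \<in> carrier G \<Longrightarrow> \<exists>t\<in>M. \<forall>x\<in>carrier G. t x = x \<otimes> g"
begin

section \<open>The S-ring of a group containing the translations\<close>

lemma M_perm: "k \<in> M \<Longrightarrow> k permutes carrier G" and M_id: "id \<in> M"
  and M_comp: "k \<in> M \<Longrightarrow> l \<in> M \<Longrightarrow> k \<circ> l \<in> M" and M_inv: "k \<in> M \<Longrightarrow> pinv k \<in> M"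
  using M by (auto simp: pgrp_def)

lemma M_in [simp]: "k \<in> M \<Longrightarrow> k x \<in> carrier G \<longleftrightarrow> x \<in> carrier G"
  using M_perm permutes_in_image by metis

lemma M_inv_l [simp]: "k \<in> M \<Longrightarrow> pinv k (k x) = x" and M_inv_r [simp]: "k \<in> M \<Longrightarrow> k (pinv k x) = x"
  using M_perm permutes_inverses by metis+

definition orb :: "'a \<Rightarrow> 'a set" where "orb x = {k x | k. k \<in> M \<and> k \<one> = \<one>}"

definition orbs :: "'a set set" where "orbs = orb ` carrier G"

lemma orb_self: "x \<in> orb x"
  unfolding orb_def mem_Collect_eq by (rule exI[of _ id]) (simp add: M_id)

lemma orb_sub: "x \<in> carrier G \<Longrightarrow> orb x \<subseteq> carrier G"
  unfolding orb_def by auto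

lemma orb_trans: "y \<in> orb x \<Longrightarrow> z \<in> orb y \<Longrightarrow> z \<in> orb x"
proof -
  assume "y \<in> orb x" "z \<in> orb y"
  then obtain k l where k: "k \<in> M" "k \<one> = \<one>" "y = k x" and l: "l \<in> M" "l \<one> = \<one>" "z = l y"
    unfolding orb_def by blast
  then have "l \<circ> k \<in> M \<and> (l \<circ> k) \<one> = \<one> \<and> z = (l \<circ> k) x" using M_comp by simp
  then show ?thesis unfolding orb_def by blast
qed

lemma orb_sym: "y \<in> orb x \<Longrightarrow> x \<in> orb y"
proof -
  assume "y \<in> orb x"
  then obtain k where k: "k \<in> M" "k \<one> = \<one>" "y = k x" unfolding orb_def by blast
  then have "pinv k \<in> M \<and> pinv k \<one> = \<one> \<and> x = pinv k y" using M_inv M_inv_l by metis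
  then show ?thesis unfolding orb_def by blast
qed

lemma orb_eq: "y \<in> orb x \<Longrightarrow> orb y = orb x"
  using orb_trans orb_sym by blast

text \<open>Right translations leave the quotient of a pair unchanged and move its first point to
  the identity, so orbits on pairs are the Cayley relations of orbits of the stabiliser.\<close>

lemma quotient_orb:
  assumes k: "k \<in> M" and a: "a \<in> carrier G" and b: "b \<in> carrier G"
  shows "k b \<otimes> inv (k a) \<in> orb (b \<otimes> inv a)"
proof -
  have ka: "k a \<in> carrier G" "k b \<in> carrier G" using k a b by auto
  obtain s where s: "s \<in> M" "\<And>x. x \<in> carrier G \<Longrightarrow> s x = x \<otimes> a" using transl[OF a] by blast
  obtain t where t: "t \<in> M" "\<And>x. x \<in> carrier G \<Longrightarrow> t x = x \<otimes> inv (k a)" using transl[of "inv (k a)"] ka by auto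
  have "t \<circ> (k \<circ> s) \<in> M" using s(1) t(1) k M_comp by blast
  moreover have "(t \<circ> (k \<circ> s)) \<one> = \<one>" using ka a by (simp add: s(2) t(2))
  moreover have "(t \<circ> (k \<circ> s)) (b \<otimes> inv a) = k b \<otimes> inv (k a)" using ka a b by (simp add: s(2) t(2) m_assoc)
  ultimately show ?thesis unfolding orb_def mem_Collect_eq
    by (intro exI[of _ "t \<circ> (k \<circ> s)"] conjI) (simp_all only:)
qed

lemma orb_quotient:
  assumes "a \<in> carrier G" "b \<in> carrier G" "c \<in> carrier G" "d \<in> carrier G" "d \<otimes> inv c \<in> orb (b \<otimes> inv a)"
  shows "\<exists>k\<in>M. k a = c \<and> k b = d"
proof -
  obtain k where k: "k \<in> M" "k \<one> = \<one>" "d \<otimes> inv c = k (b \<otimes> inv a)" using assms(5) unfolding orb_def by blast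
  obtain s where s: "s \<in> M" "\<And>x. x \<in> carrier G \<Longrightarrow> s x = x \<otimes> inv a" using transl[of "inv a"] assms by auto
  obtain t where t: "t \<in> M" "\<And>x. x \<in> carrier G \<Longrightarrow> t x = x \<otimes> c" using transl[of c] assms by auto
  have "t \<circ> (k \<circ> s) \<in> M" using s(1) t(1) k M_comp by blast
  moreover have "(t \<circ> (k \<circ> s)) a = c" using assms k(2) by (simp add: s(2) t(2))
  moreover have "(t \<circ> (k \<circ> s)) b = d" using assms by (simp add: s(2) t(2) k(3)[symmetric] m_assoc)
  ultimately show ?thesis by blast
qed

lemma partition_orbs: "partition_on (carrier G) orbs"
proof (rule partition_onI)
  show "\<Union> orbs = carrier G" using orb_self orb_sub unfolding orbs_def by blast
  show "disjnt X Y" if "X \<in> orbs" "Y \<in> orbs" "X \<noteq> Y" for X Y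
    using that orb_eq unfolding orbs_def disjnt_iff by blast
  show "{} \<notin> orbs" using orb_self unfolding orbs_def by blast
qed

lemma orb_one: "orb \<one> = {\<one>}"
  using orb_self[of \<one>] unfolding orb_def by auto

lemma inv_orb: assumes x: "x \<in> carrier G" shows "(\<lambda>y. inv y) ` orb x = orb (inv x)"
proof -
  have sub: "inv y \<in> orb (inv x)" if x: "x \<in> carrier G" and y: "y \<in> orb x" for x y
  proof -
    obtain k where k: "k \<in> M" "k \<one> = \<one>" "y = k x" using y unfolding orb_def by blast
    have "y \<in> carrier G" using x k by simp
    then show ?thesis using quotient_orb[OF k(1) x one_closed] k x by simp
  qed
  show ?thesis
  proof (intro equalityI subsetI)
    fix z assume "z \<in> orb (inv x)"
    then have "inv z \<in> orb (inv (inv x))" "z \<in> carrier G" using sub[of "inv x" z] orb_sub[of "inv x"] x by auto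
    then show "z \<in> (\<lambda>y. inv y) ` orb x" using x by (intro image_eqI[of _ _ "inv z"]) auto
  qed (use sub x in blast)
qed

lemma int_span_orbs:
  "int_span orbs = {a. (\<forall>x. x \<notin> carrier G \<longrightarrow> a x = 0) \<and> (\<forall>x\<in>carrier G. \<forall>y\<in>orb x. a y = a x)}" (is "_ = ?R")
proof (intro equalityI subsetI)
  have fo: "finite orbs" using fin unfolding orbs_def by simp
  note sum = indicator_sum_partition[OF partition_orbs fo]
  fix a
  {
    assume "a \<in> int_span orbs"
    then obtain c where a: "a = (\<lambda>x. \<Sum>X\<in>orbs. c X * indicator X x)" unfolding int_span_def by blast
    have "a x = 0" if "x \<notin> carrier G" for x
      unfolding a using that orb_sub by (intro sum.neutral) (auto simp: orbs_def indicator_def)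
    moreover have "a y = a x" if "x \<in> carrier G" "y \<in> orb x" for x y
      unfolding a using sum[of "orb x" x c] sum[of "orb x" y c] that orb_self by (auto simp: orbs_def)
    ultimately show "a \<in> ?R" by blast
  next
    assume a: "a \<in> ?R"
    define c where "c X = a (SOME x. x \<in> X)" for X
    have "a x = (\<Sum>X\<in>orbs. c X * indicator X x)" for x
    proof (cases "x \<in> carrier G")
      case True
      have "(SOME y. y \<in> orb x) \<in> orb x" using orb_self by (metis someI)
      then have "c (orb x) = a x" using a True unfolding c_def by blast
      then show ?thesis using sum[of "orb x" x c] True orb_self by (simp add: orbs_def)
    next
      case False
      then have "(\<Sum>X\<in>orbs. c X * indicator X x) = 0"
        using orb_sub by (intro sum.neutral) (auto simp: orbs_def indicator_def)
      then show ?thesis using a False by simp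
    qed
    then show "a \<in> int_span orbs" unfolding int_span_def by blast
  }
qed

lemma is_basic_sets_orbs: "is_basic_sets G (int_span orbs) orbs"
  unfolding is_basic_sets_def using partition_orbs orb_one inv_orb
  by (auto simp: orbs_def intro!: image_eqI[of _ orb])

text \<open>Let \<open>k\<close> fix the identity and take \<open>x\<close> to \<open>y\<close>.
  Replacing \<open>w\<close> by \<open>k w\<close> in the sum keeps every factor in its
  orbit.\<close>

lemma convolution_invariant:
  fixes a b :: "'a \<Rightarrow> int"
  assumes a: "a \<in> int_span orbs" and b: "b \<in> int_span orbs" and x: "x \<in> carrier G" and y: "y \<in> orb x"
  shows "(\<Sum>z\<in>carrier G. a z * b (inv z \<otimes> y)) = (\<Sum>z\<in>carrier G. a z * b (inv z \<otimes> x))"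
proof -
  obtain k where k: "k \<in> M" "k \<one> = \<one>" "y = k x" using y unfolding orb_def by blast
  have yc: "y \<in> carrier G" using k x by simp
  have flip: "(\<Sum>z\<in>carrier G. a z * b (inv z \<otimes> u)) = (\<Sum>w\<in>carrier G. a (u \<otimes> inv w) * b w)" if u: "u \<in> carrier G" for u
    by (rule sum.reindex_bij_witness[of _ "\<lambda>w. u \<otimes> inv w" "\<lambda>z. inv z \<otimes> u"])
      (use u in \<open>auto simp: inv_mult_group m_assoc[symmetric] intro: arg_cong[of _ _ a] arg_cong[of _ _ b]\<close>,
       simp_all add: m_assoc)
  have "(\<Sum>w\<in>carrier G. a (y \<otimes> inv w) * b w) = (\<Sum>w\<in>carrier G. a (y \<otimes> inv (k w)) * b (k w))"
    by (rule sum.reindex_bij_betw[symmetric]) (use M_perm[OF k(1)] in \<open>simp add: permutes_imp_bij\<close>)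
  also have "\<dots> = (\<Sum>w\<in>carrier G. a (x \<otimes> inv w) * b w)"
  proof (rule sum.cong[OF refl])
    fix w assume w: "w \<in> carrier G"
    have "y \<otimes> inv (k w) \<in> orb (x \<otimes> inv w)" using quotient_orb[OF k(1) w x] k(3) by simp
    then have "a (y \<otimes> inv (k w)) = a (x \<otimes> inv w)" using a x w unfolding int_span_orbs by blast
    moreover have "k w \<in> orb w" using k unfolding orb_def by blast
    then have "b (k w) = b w" using b w unfolding int_span_orbs by blast
    ultimately show "a (y \<otimes> inv (k w)) * b (k w) = a (x \<otimes> inv w) * b w" by simp
  qed
  finally show ?thesis using flip[OF x] flip[OF yc] by simp
qed

lemma S_ring_orbs: "S_ring G (int_span orbs)"
proof -
  interpret R: ring "group_ring G" by (rule ring_group_ring[OF group_axioms fin])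
  have car: "carrier (group_ring G) = {a. \<forall>x. x \<notin> carrier G \<longrightarrow> a x = 0}" by (simp add: group_ring_def)
  have "subring (int_span orbs) (group_ring G)"
  proof (rule R.subringI)
    show sub: "int_span orbs \<subseteq> carrier (group_ring G)" unfolding int_span_orbs car by blast
    have "indicator {\<one>} y = (indicator {\<one>} x :: int)" if "x \<in> carrier G" "y \<in> orb x" for x y
    proof -
      have "y = \<one> \<longleftrightarrow> x = \<one>" using that orb_sym[of y x] orb_one by auto
      then show ?thesis by (simp add: indicator_def)
    qed
    then show "\<one>\<^bsub>group_ring G\<^esub> \<in> int_span orbs" unfolding int_span_orbs group_ring_def by (auto simp: indicator_def)
    fix a assume a: "a \<in> int_span orbs"
    have "(\<lambda>x. - a x) \<oplus>\<^bsub>group_ring G\<^esub> a = \<zero>\<^bsub>group_ring G\<^esub>" by (simp add: group_ring_def)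
    moreover have "(\<lambda>x. - a x) \<in> carrier (group_ring G)" using a sub car by auto
    ultimately have "\<ominus>\<^bsub>group_ring G\<^esub> a = (\<lambda>x. - a x)" using subsetD[OF sub a] by (intro R.minus_equality)
    then show "\<ominus>\<^bsub>group_ring G\<^esub> a \<in> int_span orbs" using a unfolding int_span_orbs by auto
    fix b assume b: "b \<in> int_span orbs"
    show "a \<oplus>\<^bsub>group_ring G\<^esub> b \<in> int_span orbs" using a b unfolding int_span_orbs group_ring_def by auto
    show "a \<otimes>\<^bsub>group_ring G\<^esub> b \<in> int_span orbs"
      unfolding int_span_orbs mem_Collect_eq
    proof (intro conjI allI impI ballI)
      fix x y assume x: "x \<in> carrier G" and y: "y \<in> orb x"
      then have "y \<in> carrier G" using orb_sub by blast
      then show "(a \<otimes>\<^bsub>group_ring G\<^esub> b) y = (a \<otimes>\<^bsub>group_ring G\<^esub> b) x"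
        using convolution_invariant[OF a b x y] x by (simp add: group_ring_def)
    qed (simp add: group_ring_def)
  qed
  then show ?thesis using is_basic_sets_orbs unfolding S_ring_def by blast
qed

lemma basic_sets_orbs: "basic_sets G (int_span orbs) = orbs"
  by (rule basic_sets_eq[OF fin is_basic_sets_orbs])

lemma cayley_rel_iff:
  assumes "X \<subseteq> carrier G"
  shows "(g, h) \<in> cayley_rel G X \<longleftrightarrow> g \<in> carrier G \<and> h \<in> carrier G \<and> h \<otimes> inv g \<in> X"
proof
  assume "(g, h) \<in> cayley_rel G X"
  then show "g \<in> carrier G \<and> h \<in> carrier G \<and> h \<otimes> inv g \<in> X" using assms
    by (auto simp: cayley_rel_def m_assoc)
next
  assume *: "g \<in> carrier G \<and> h \<in> carrier G \<and> h \<otimes> inv g \<in> X"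
  then have "h = (h \<otimes> inv g) \<otimes> g" by (simp add: m_assoc)
  then show "(g, h) \<in> cayley_rel G X" using * unfolding cayley_rel_def by blast
qed

lemma mem_rel_image: "(a, b) \<in> R \<Longrightarrow> (f a, f b) \<in> rel_image f R"
  unfolding rel_image_def by blast

lemma M_preserves: assumes k: "k \<in> M" and X: "X \<in> orbs" shows "rel_image k (cayley_rel G X) = cayley_rel G X"
proof -
  obtain x where x: "x \<in> carrier G" "X = orb x" using X unfolding orbs_def by blast
  have Xc: "X \<subseteq> carrier G" using x orb_sub by blast
  have sub: "(l a, l b) \<in> cayley_rel G X" if l: "l \<in> M" and ab: "(a, b) \<in> cayley_rel G X" for l a b
  proof -
    have c: "a \<in> carrier G" "b \<in> carrier G" "b \<otimes> inv a \<in> orb x" using ab cayley_rel_iff[OF Xc] x(2) by blast+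
    then have "l b \<otimes> inv (l a) \<in> X" using quotient_orb[OF l c(1,2)] orb_trans x(2) by blast
    then show ?thesis using c l cayley_rel_iff[OF Xc] by simp
  qed
  show ?thesis
  proof (intro equalityI subsetI)
    fix z assume "z \<in> cayley_rel G X"
    then obtain a b where z: "z = (a, b)" "(a, b) \<in> cayley_rel G X" by (cases z) blast
    have "(k (pinv k a), k (pinv k b)) \<in> rel_image k (cayley_rel G X)"
      by (rule mem_rel_image[OF sub[OF M_inv[OF k] z(2)]])
    then show "z \<in> rel_image k (cayley_rel G X)" using k z(1) by simp
  qed (use sub[OF k] in \<open>auto simp: rel_image_def\<close>)
qed

text \<open>For a 2-closed group this is the nontrivial half of the statement that the automorphism
  group of its S-ring is the group itself.\<close>

lemma preserved_pairs:
  assumes f: "\<And>X. X \<in> orbs \<Longrightarrow> rel_image f (cayley_rel G X) \<subseteq> cayley_rel G X"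
    and x: "x \<in> carrier G" and y: "y \<in> carrier G"
  shows "\<exists>k\<in>M. k x = f x \<and> k y = f y"
proof -
  let ?X = "orb (y \<otimes> inv x)"
  have X: "?X \<in> orbs" "?X \<subseteq> carrier G" using x y orb_sub unfolding orbs_def by auto
  have "(x, y) \<in> cayley_rel G ?X" using x y orb_self cayley_rel_iff[OF X(2)] by blast
  then have "(f x, f y) \<in> cayley_rel G ?X" by (rule subsetD[OF f[OF X(1)] mem_rel_image])
  then show ?thesis using orb_quotient[OF x y] cayley_rel_iff[OF X(2)] by metis
qed

end

section \<open>Coordinates\<close>

lemma UNIV_bit: "UNIV = {0, 1 :: bit}"
  by (auto intro: bit.exhaust)

instance bit :: finite
  by standard (simp add: UNIV_bit)

type_synonym bit5 = "bit \<times> bit \<times> bit \<times> bit \<times> bit"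

lemma card_bit5: "card (UNIV :: bit5 set) = 32"
  by (simp flip: UNIV_Times_UNIV add: card_cartesian_product UNIV_bit)

lemma bit5_char2: "x + x = (0 :: bit5)"
  by (cases x) (simp add: zero_prod_def plus_prod_def)

definition bit_int :: "bit \<Rightarrow> int" where "bit_int b = (if b = 1 then 1 else 0)"

lemma bit_int_add: "bit_int (a + b) = (bit_int a + bit_int b) mod 2"
  by (cases a; cases b) (simp_all add: bit_int_def)

lemma bit_int_eq: "bit_int a = bit_int b \<longleftrightarrow> a = b"
  by (cases a; cases b) (simp_all add: bit_int_def)

definition bit_vec :: "bit5 \<Rightarrow> nat \<Rightarrow> int" where
  "bit_vec = (\<lambda>(a, b, c, d, e). \<lambda>i\<in>{..<5}.
     bit_int (if i = 0 then a else if i = 1 then b else if i = 2 then c else if i = 3 then d else e))"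

lemma bit_vec_iso:
  "bit_vec x \<in> carrier (product_group {..<5} (\<lambda>_. integer_mod_group 2))"
  "bit_vec (x + y) = bit_vec x \<otimes>\<^bsub>product_group {..<5} (\<lambda>_. integer_mod_group 2)\<^esub> bit_vec y"
  "inj bit_vec" "range bit_vec = carrier (product_group {..<5} (\<lambda>_. integer_mod_group 2))"
proof -
  show mem: "bit_vec x \<in> carrier (product_group {..<5} (\<lambda>_. integer_mod_group 2))" for x
    by (auto simp: bit_vec_def bit_int_def carrier_integer_mod_group split: prod.split)
  obtain a b c d e where x: "x = (a, b, c, d, e)" by (metis prod.exhaust)
  obtain a' b' c' d' e' where y: "y = (a', b', c', d', e')" by (metis prod.exhaust)
  show "bit_vec (x + y) = bit_vec x \<otimes>\<^bsub>product_group {..<5} (\<lambda>_. integer_mod_group 2)\<^esub> bit_vec y"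
    unfolding x y by (rule ext) (simp add: bit_vec_def flip: bit_int_add)
  show inj: "inj bit_vec"
  proof (rule injI)
    fix x y assume xy: "bit_vec x = bit_vec y"
    obtain a b c d e where x: "x = (a, b, c, d, e)" by (metis prod.exhaust)
    obtain a' b' c' d' e' where y: "y = (a', b', c', d', e')" by (metis prod.exhaust)
    from fun_cong[OF xy, of 0] fun_cong[OF xy, of 1] fun_cong[OF xy, of 2] fun_cong[OF xy, of 3] fun_cong[OF xy, of 4]
    show "x = y" unfolding x y by (simp add: bit_vec_def bit_int_eq)
  qed
  show "range bit_vec = carrier (product_group {..<5} (\<lambda>_. integer_mod_group 2))"
  proof (rule card_subset_eq)
    show "finite (carrier (product_group {..<5::nat} (\<lambda>_. integer_mod_group 2)))"
      by (auto simp: carrier_integer_mod_group intro!: finite_PiE)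
    show "card (range bit_vec) = card (carrier (product_group {..<5::nat} (\<lambda>_. integer_mod_group 2)))"
      using inj by (simp add: card_image card_bit5 carrier_integer_mod_group card_PiE)
  qed (use mem in blast)
qed

text \<open>The commutator lies in both subgroups.\<close>

lemma (in group) normal_disjoint_commute:
  assumes H: "H \<lhd> G" and P: "P \<lhd> G" and HP: "H \<inter> P = {\<one>}" and x: "x \<in> H" and y: "y \<in> P"
  shows "x \<otimes> y = y \<otimes> x"
proof -
  have Hs: "subgroup H G" and Ps: "subgroup P G" using H P normal_imp_subgroup by auto
  have c: "x \<in> carrier G" "y \<in> carrier G" using subgroup.mem_carrier[OF Hs x] subgroup.mem_carrier[OF Ps y] by auto
  have "x \<otimes> y \<otimes> inv x \<in> P" using normal.inv_op_closed2[OF P c(1) y] .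
  then have "(x \<otimes> y \<otimes> inv x) \<otimes> inv y \<in> P" using subgroup.m_closed[OF Ps] subgroup.m_inv_closed[OF Ps y] by blast
  moreover have "y \<otimes> inv x \<otimes> inv y \<in> H" using normal.inv_op_closed2[OF H c(2) subgroup.m_inv_closed[OF Hs x]] .
  then have "x \<otimes> (y \<otimes> inv x \<otimes> inv y) \<in> H" using subgroup.m_closed[OF Hs x] by blast
  ultimately have "x \<otimes> y \<otimes> inv x \<otimes> inv y = \<one>" using HP c by (auto simp: m_assoc)
  then have "x \<otimes> y \<otimes> inv (y \<otimes> x) = \<one>" using c by (simp add: inv_mult_group m_assoc)
  then show ?thesis using c by (metis inv_equality inv_inv m_closed inv_closed)
qed

text \<open>The cyclic factor is parametrised by all integers, so that \<open>pt\<close> is a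
  homomorphism on a type of class \<open>ab_group_add\<close> without reference to
  \<open>p\<close>.\<close>

lemma ex_coordinates:
  fixes G :: "('a, 'b) monoid_scheme" (structure)
  assumes p: "0 < (p::nat)" and G: "group G" and H: "H \<lhd> G" and P: "P \<lhd> G"
    and HP: "H \<inter> P = {\<one>}" "H <#> P = carrier G"
    and isoH: "G\<lparr>carrier := H\<rparr> \<cong> product_group {..<5::nat} (\<lambda>_. integer_mod_group 2)"
    and isoP: "G\<lparr>carrier := P\<rparr> \<cong> integer_mod_group p"
  shows "\<exists>pt :: bit5 \<times> int \<Rightarrow> 'a. (\<forall>g h. pt (g + h) = pt g \<otimes> pt h) \<and>
    (\<forall>g h. pt g = pt h \<longleftrightarrow> fst g = fst h \<and> [snd g = snd h] (mod int p)) \<and> range pt = carrier G"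
proof -
  interpret group G by fact
  have Hs: "subgroup H G" and Ps: "subgroup P G" using H P normal_imp_subgroup by auto
  note HPc = subgroup.mem_carrier[OF Hs] subgroup.mem_carrier[OF Ps]
  have "product_group {..<5::nat} (\<lambda>_. integer_mod_group 2) \<cong> G\<lparr>carrier := H\<rparr>"
    using group.iso_sym[OF subgroup.subgroup_is_group[OF Hs G] isoH] .
  then obtain a where a: "a \<in> iso (product_group {..<5::nat} (\<lambda>_. integer_mod_group 2)) (G\<lparr>carrier := H\<rparr>)"
    unfolding is_iso_def by blast
  have "integer_mod_group p \<cong> G\<lparr>carrier := P\<rparr>"
    using group.iso_sym[OF subgroup.subgroup_is_group[OF Ps G] isoP] .
  then obtain b where b: "b \<in> iso (integer_mod_group p) (G\<lparr>carrier := P\<rparr>)" unfolding is_iso_def by blast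
  define a' where "a' x = a (bit_vec x)" for x
  define b' where "b' i = b (i mod int p)" for i
  have a'_add: "a' (x + y) = a' x \<otimes> a' y" for x y
    using hom_mult[of a "product_group {..<5::nat} (\<lambda>_. integer_mod_group 2)" "G\<lparr>carrier := H\<rparr>"] a
      bit_vec_iso(1)[of x] bit_vec_iso(1)[of y] bit_vec_iso(2)[of x y] by (simp add: a'_def iso_def)
  have bij_a: "bij_betw a (range bit_vec) H" using a bit_vec_iso(4) by (simp add: iso_def)
  then have a'_range: "range a' = H" by (auto simp: a'_def bij_betw_def)
  have a'_inj: "a' x = a' y \<longleftrightarrow> x = y" for x y
    using bij_a bit_vec_iso(3) unfolding a'_def bij_betw_def by (metis inj_eq inj_onD rangeI)
  have md: "i mod int p \<in> carrier (integer_mod_group p)" for i using p by (simp add: carrier_integer_mod_group)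
  have b'_add: "b' (i + j) = b' i \<otimes> b' j" for i j
    using hom_mult[of b "integer_mod_group p" "G\<lparr>carrier := P\<rparr>" "i mod int p" "j mod int p"] b md
    by (simp add: b'_def iso_def mod_add_eq)
  have bij_b: "bij_betw b (carrier (integer_mod_group p)) P" using b by (simp add: iso_def)
  have b'_range: "range b' = P"
  proof (intro equalityI subsetI)
    fix z assume "z \<in> range b'"
    then show "z \<in> P" using bij_betwE[OF bij_b] md by (auto simp: b'_def)
  next
    fix z assume "z \<in> P"
    then obtain i where "i \<in> carrier (integer_mod_group p)" "z = b i" using bij_b by (auto simp: bij_betw_def)
    then have "z = b' i" using p by (simp add: b'_def carrier_integer_mod_group)
    then show "z \<in> range b'" by blast
  qed
  have b'_inj: "b' i = b' j \<longleftrightarrow> [i = j] (mod int p)" for i j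
    using inj_on_eq_iff[OF bij_betw_imp_inj_on[OF bij_b] md md] by (simp add: b'_def cong_def)
  have mem: "a' x \<in> H" "b' i \<in> P" for x i using a'_range b'_range by blast+
  then have memc: "a' x \<in> carrier G" "b' i \<in> carrier G" for x i using HPc by blast+
  define pt where "pt g = a' (fst g) \<otimes> b' (snd g)" for g
  have "pt (g + h) = pt g \<otimes> pt h" for g h
  proof -
    have "pt (g + h) = a' (fst g) \<otimes> (a' (fst h) \<otimes> b' (snd g)) \<otimes> b' (snd h)"
      by (simp add: pt_def a'_add b'_add memc m_assoc)
    also have "a' (fst h) \<otimes> b' (snd g) = b' (snd g) \<otimes> a' (fst h)"
      by (rule normal_disjoint_commute[OF H P HP(1) mem])
    finally show ?thesis by (simp add: pt_def memc m_assoc)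
  qed
  moreover have "pt g = pt h \<longleftrightarrow> fst g = fst h \<and> [snd g = snd h] (mod int p)" for g h
  proof -
    have "a' x = a' y \<and> b' i = b' j" if e: "a' x \<otimes> b' i = a' y \<otimes> b' j" for x y i j
    proof -
      have "inv (a' y) \<otimes> a' x = inv (a' y) \<otimes> (a' x \<otimes> b' i \<otimes> inv (b' i))" by (simp add: memc m_assoc)
      also have "\<dots> = b' j \<otimes> inv (b' i)" unfolding e by (simp add: memc m_assoc[symmetric])
      finally have q: "inv (a' y) \<otimes> a' x = b' j \<otimes> inv (b' i)" .
      moreover have "inv (a' y) \<otimes> a' x \<in> H" using subgroup.m_closed[OF Hs subgroup.m_inv_closed[OF Hs]] mem by blast
      moreover have "b' j \<otimes> inv (b' i) \<in> P" using subgroup.m_closed[OF Ps _ subgroup.m_inv_closed[OF Ps]] mem by blast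
      ultimately have "inv (a' y) \<otimes> a' x = \<one>" "b' j \<otimes> inv (b' i) = \<one>" using HP(1) by auto
      then show ?thesis using memc by (metis inv_equality inv_inv inv_closed)
    qed
    then show ?thesis unfolding pt_def using a'_inj b'_inj by metis
  qed
  moreover have "range pt = carrier G"
  proof (intro equalityI subsetI)
    fix z assume "z \<in> carrier G"
    then obtain x y where "x \<in> H" "y \<in> P" "z = x \<otimes> y" using HP(2) unfolding set_mult_def by blast
    moreover then obtain u i where "x = a' u" "y = b' i" using a'_range b'_range by blast
    ultimately have "z = pt (u, i)" by (simp add: pt_def)
    then show "z \<in> range pt" by blast
  qed (use memc in \<open>auto simp: pt_def\<close>)
  ultimately show ?thesis by blast
qed

section \<open>The CI property\<close>

text \<open>The permutations in \<^const>\<open>BijGroup\<close> are undefined outside the carrier, those of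
  \<^const>\<open>permutes\<close> are the identity there; \<open>ext_id\<close> translates the former into the latter.\<close>

definition ext_id :: "'a set \<Rightarrow> ('a \<Rightarrow> 'a) \<Rightarrow> 'a \<Rightarrow> 'a" where
  "ext_id \<Omega> f x = (if x \<in> \<Omega> then f x else x)"

lemma ext_id_in [simp]: "x \<in> \<Omega> \<Longrightarrow> ext_id \<Omega> f x = f x"
  by (simp add: ext_id_def)

lemma ext_id_permutes: "bij_betw f \<Omega> \<Omega> \<Longrightarrow> ext_id \<Omega> f permutes \<Omega>"
proof (rule bij_imp_permutes)
  assume "bij_betw f \<Omega> \<Omega>"
  then show "bij_betw (ext_id \<Omega> f) \<Omega> \<Omega>" by (subst bij_betw_cong[of _ _ f]) auto
qed (simp add: ext_id_def)

lemma Bij_bij_betw: "f \<in> Bij \<Omega> \<Longrightarrow> bij_betw f \<Omega> \<Omega>"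
  by (simp add: Bij_def)

lemma restrict_permutes_Bij: "f permutes \<Omega> \<Longrightarrow> restrict f \<Omega> \<in> Bij \<Omega>"
  using permutes_imp_bij[of f \<Omega>] by (simp add: Bij_def bij_betw_restrict_eq)

lemma ext_id_restrict: "f permutes \<Omega> \<Longrightarrow> ext_id \<Omega> (restrict f \<Omega>) = f"
  by (rule ext) (simp add: ext_id_def permutes_not_in)

lemma pgrp_ext_id:
  assumes K: "subgroup K (BijGroup \<Omega>)" shows "pgrp \<Omega> (ext_id \<Omega> ` K)"
proof -
  interpret B: group "BijGroup \<Omega>" by (rule group_BijGroup)
  have sub: "f \<in> Bij \<Omega>" if "f \<in> K" for f using subgroup.mem_carrier[OF K that] by (simp add: BijGroup_def)
  have mult: "ext_id \<Omega> (f \<otimes>\<^bsub>BijGroup \<Omega>\<^esub> g) = ext_id \<Omega> f \<circ> ext_id \<Omega> g" if "f \<in> K" "g \<in> K" for f g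
  proof
    have "x \<in> \<Omega> \<Longrightarrow> g x \<in> \<Omega>" for x using sub[OF that(2)] Bij_imp_funcset by blast
    then show "ext_id \<Omega> (f \<otimes>\<^bsub>BijGroup \<Omega>\<^esub> g) x = (ext_id \<Omega> f \<circ> ext_id \<Omega> g) x" for x
      using sub[OF that(1)] sub[OF that(2)] by (simp add: ext_id_def BijGroup_def compose_def)
  qed
  have one: "ext_id \<Omega> \<one>\<^bsub>BijGroup \<Omega>\<^esub> = id" by (rule ext) (simp add: ext_id_def BijGroup_def)
  show ?thesis
    unfolding pgrp_def
  proof (intro conjI ballI)
    show "id \<in> ext_id \<Omega> ` K" using one subgroup.one_closed[OF K] by (metis imageI)
    fix k assume "k \<in> ext_id \<Omega> ` K"
    then obtain f where f: "f \<in> K" "k = ext_id \<Omega> f" by blast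
    show "k permutes \<Omega>" unfolding f(2) by (rule ext_id_permutes[OF Bij_bij_betw[OF sub[OF f(1)]]])
    have fi: "inv\<^bsub>BijGroup \<Omega>\<^esub> f \<in> K" by (rule subgroup.m_inv_closed[OF K f(1)])
    have "f \<in> carrier (BijGroup \<Omega>)" by (rule subgroup.mem_carrier[OF K f(1)])
    then have "k \<circ> ext_id \<Omega> (inv\<^bsub>BijGroup \<Omega>\<^esub> f) = id" "ext_id \<Omega> (inv\<^bsub>BijGroup \<Omega>\<^esub> f) \<circ> k = id"
      unfolding f(2) mult[OF f(1) fi, symmetric] mult[OF fi f(1), symmetric] by (simp_all add: one)
    then have "pinv k = ext_id \<Omega> (inv\<^bsub>BijGroup \<Omega>\<^esub> f)" by (rule inv_unique_comp)
    then show "pinv k \<in> ext_id \<Omega> ` K" using fi by (metis imageI)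
    fix l assume "l \<in> ext_id \<Omega> ` K"
    then obtain g where g: "g \<in> K" "l = ext_id \<Omega> g" by blast
    show "k \<circ> l \<in> ext_id \<Omega> ` K"
      unfolding f(2) g(2) mult[OF f(1) g(1), symmetric] using subgroup.m_closed[OF K f(1) g(1)] by (rule imageI)
  qed
qed

lemma rel_image_cong:
  "R \<subseteq> \<Omega> \<times> \<Omega> \<Longrightarrow> (\<And>x. x \<in> \<Omega> \<Longrightarrow> f x = g x) \<Longrightarrow> rel_image f R = rel_image g R"
  unfolding rel_image_def by (rule Collect_cong) (metis mem_Sigma_iff subsetD)

lemma rel_image_comp: "rel_image (f \<circ> g) R = rel_image f (rel_image g R)"
  unfolding rel_image_def by auto

lemma S_ring_basic_subset:
  assumes "finite (carrier G)" "S_ring G A" "X \<in> basic_sets G A" shows "X \<subseteq> carrier G"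
proof -
  obtain S where S: "is_basic_sets G A S" using assms(2) unfolding S_ring_def by blast
  then have "X \<in> S" using assms basic_sets_eq by metis
  then show ?thesis using S unfolding is_basic_sets_def partition_on_def by blast
qed

section \<open>Automorphisms and Cayley relations\<close>

context group begin

lemma cayley_rel_sub: "X \<subseteq> carrier G \<Longrightarrow> cayley_rel G X \<subseteq> carrier G \<times> carrier G"
  unfolding cayley_rel_def by auto

lemma rel_image_auto:
  assumes s: "\<sigma> \<in> auto G" and X: "X \<subseteq> carrier G"
  shows "rel_image \<sigma> (cayley_rel G X) = cayley_rel G (\<sigma> ` X)"
proof -
  have bij: "bij_betw \<sigma> (carrier G) (carrier G)" and hom: "\<sigma> \<in> hom G G" using s by (auto simp: auto_def Bij_def)
  show ?thesis
  proof (intro equalityI subsetI)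
    fix z assume "z \<in> rel_image \<sigma> (cayley_rel G X)"
    then obtain g x where "z = (\<sigma> g, \<sigma> (x \<otimes> g))" "g \<in> carrier G" "x \<in> X"
      unfolding rel_image_def cayley_rel_def by blast
    moreover then have "\<sigma> (x \<otimes> g) = \<sigma> x \<otimes> \<sigma> g" using hom_mult[OF hom] X by blast
    moreover have "\<sigma> g \<in> carrier G" using \<open>g \<in> carrier G\<close> bij_betwE[OF bij] by blast
    ultimately show "z \<in> cayley_rel G (\<sigma> ` X)" unfolding cayley_rel_def by blast
  next
    fix z assume "z \<in> cayley_rel G (\<sigma> ` X)"
    then obtain h x where h: "z = (h, \<sigma> x \<otimes> h)" "h \<in> carrier G" "x \<in> X" unfolding cayley_rel_def by blast
    then obtain g where g: "g \<in> carrier G" "h = \<sigma> g" using bij by (auto simp: bij_betw_def)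
    then have "\<sigma> (x \<otimes> g) = \<sigma> x \<otimes> h" using hom_mult[OF hom] X h by blast
    then have "z = (\<sigma> g, \<sigma> (x \<otimes> g))" using h g by simp
    moreover have "(g, x \<otimes> g) \<in> cayley_rel G X" using g h unfolding cayley_rel_def by blast
    ultimately show "z \<in> rel_image \<sigma> (cayley_rel G X)" unfolding rel_image_def by blast
  qed
qed

text \<open>A permutation that normalises the right translations belongs to the holomorph: divided
  by its value \<open>c\<close> at the identity it is an automorphism, and \<open>c\<close> is moved
  inside as the image of some \<open>d\<close>.\<close>

lemma intertwiner_auto:
  assumes fin: "finite (carrier G)" and comm: "\<And>x y. x \<in> carrier G \<Longrightarrow> y \<in> carrier G \<Longrightarrow> x \<otimes> y = y \<otimes> x"
    and n: "n permutes carrier G"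
    and tw: "\<And>a. a \<in> carrier G \<Longrightarrow> \<exists>a'\<in>carrier G. \<forall>x\<in>carrier G. n x \<otimes> a = n (x \<otimes> a')"
  shows "\<exists>\<sigma>\<in>auto G. \<exists>d\<in>carrier G. \<forall>x\<in>carrier G. n x = \<sigma> (x \<otimes> d)"
proof -
  have nc: "n x \<in> carrier G" if "x \<in> carrier G" for x using that permutes_in_image[OF n] by blast
  have inj: "x = y" if "n x = n y" for x y using permutes_inj[OF n] that by (metis injD)
  define c where "c = n \<one>"
  have c: "c \<in> carrier G" using nc by (simp add: c_def)
  define \<sigma> where "\<sigma> = (\<lambda>x\<in>carrier G. inv c \<otimes> n x)"
  have s: "\<sigma> x = inv c \<otimes> n x" "\<sigma> x \<in> carrier G" if "x \<in> carrier G" for x using that c nc by (simp_all add: \<sigma>_def)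
  have ns: "n x = c \<otimes> \<sigma> x" if "x \<in> carrier G" for x
    using that c nc by (simp add: s m_assoc[symmetric])
  have key: "n y \<otimes> \<sigma> x = n (y \<otimes> x)" if x: "x \<in> carrier G" and y: "y \<in> carrier G" for x y
  proof -
    obtain a' where a': "a' \<in> carrier G" "\<And>z. z \<in> carrier G \<Longrightarrow> n z \<otimes> \<sigma> x = n (z \<otimes> a')" using tw[OF s(2)[OF x]] by blast
    have "n a' = n x" using a'(2)[OF one_closed] ns[OF x] a'(1) by (simp add: c_def)
    then have "a' = x" by (rule inj)
    then show ?thesis using a'(2)[OF y] by simp
  qed
  have hom: "\<sigma> (y \<otimes> x) = \<sigma> y \<otimes> \<sigma> x" if "x \<in> carrier G" "y \<in> carrier G" for x y
    using key[OF that] that c nc s by (simp add: m_assoc)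
  have inj_s: "inj_on \<sigma> (carrier G)"
  proof (rule inj_onI)
    fix x y assume xy: "x \<in> carrier G" "y \<in> carrier G" "\<sigma> x = \<sigma> y"
    then have "n x = n y" using ns by simp
    then show "x = y" by (rule inj)
  qed
  have surj_s: "\<sigma> ` carrier G = carrier G" using endo_inj_surj[OF fin _ inj_s] s(2) by blast
  then have "bij_betw \<sigma> (carrier G) (carrier G)" using inj_s by (simp add: bij_betw_def)
  moreover have "\<sigma> \<in> extensional (carrier G)" by (simp add: \<sigma>_def)
  ultimately have "\<sigma> \<in> auto G" using hom s(2) by (auto simp: auto_def Bij_def hom_def)
  moreover obtain d where d: "d \<in> carrier G" "\<sigma> d = c" using surj_s c by (metis imageE)
  have "n x = \<sigma> (x \<otimes> d)" if "x \<in> carrier G" for x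
    using hom[OF d(1) that] ns[OF that] comm[OF c s(2)[OF that]] d(2) by simp
  ultimately show ?thesis using d(1) by blast
qed

end

context translation_group begin

text \<open>Conjugating by an automorphism gives the S-ring onto which the automorphism maps; it
  serves as the target ring in the definition of \<open>S_ring_Iso\<close>.\<close>

lemma orb_conj:
  assumes s: "\<sigma> permutes carrier G" and hom: "\<And>x y. x \<in> carrier G \<Longrightarrow> y \<in> carrier G \<Longrightarrow> \<sigma> (x \<otimes> y) = \<sigma> x \<otimes> \<sigma> y"
  defines "M' \<equiv> (\<lambda>k. \<sigma> \<circ> k \<circ> pinv \<sigma>) ` M"
  shows "translation_group G M'" "translation_group.orbs G M' = (`) \<sigma> ` orbs"
proof -
  have l: "pinv \<sigma> (\<sigma> x) = x" "\<sigma> (pinv \<sigma> x) = x" for x using permutes_inverses[OF s] by auto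
  have sc: "\<sigma> x \<in> carrier G \<longleftrightarrow> x \<in> carrier G" for x by (rule permutes_in_image[OF s])
  have ic: "pinv \<sigma> x \<in> carrier G \<longleftrightarrow> x \<in> carrier G" for x by (rule permutes_in_image[OF permutes_inv[OF s]])
  have s1: "\<sigma> \<one> = \<one>"
  proof -
    have "\<sigma> \<one> \<otimes> \<sigma> \<one> = \<sigma> \<one>" using hom[OF one_closed one_closed] by simp
    then show ?thesis using sc[of \<one>] by (simp add: l_cancel_one)
  qed
  show tg: "translation_group G M'"
  proof (unfold_locales)
    show "finite (carrier G)" by (rule fin)
    show "pgrp (carrier G) M'"
      unfolding pgrp_def
    proof (intro conjI ballI)
      have "\<sigma> \<circ> id \<circ> pinv \<sigma> = id" by (rule ext) (simp add: l)
      then show "id \<in> M'" unfolding M'_def using M_id by (metis imageI)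
      fix k assume "k \<in> M'"
      then obtain k0 where k: "k0 \<in> M" "k = \<sigma> \<circ> k0 \<circ> pinv \<sigma>" unfolding M'_def by blast
      show "k permutes carrier G" unfolding k(2)
        by (intro permutes_compose permutes_inv s M_perm[OF k(1)])
      have "pinv k = \<sigma> \<circ> pinv k0 \<circ> pinv \<sigma>"
        by (rule inv_unique_comp; rule ext) (simp_all add: k l)
      then show "pinv k \<in> M'" unfolding M'_def using M_inv[OF k(1)] by (metis imageI)
      fix j assume "j \<in> M'"
      then obtain j0 where j: "j0 \<in> M" "j = \<sigma> \<circ> j0 \<circ> pinv \<sigma>" unfolding M'_def by blast
      have "k \<circ> j = \<sigma> \<circ> (k0 \<circ> j0) \<circ> pinv \<sigma>" by (rule ext) (simp add: k j l)
      then show "k \<circ> j \<in> M'" unfolding M'_def using M_comp[OF k(1) j(1)] by (metis imageI)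
    qed
    fix g assume g: "g \<in> carrier G"
    then obtain t where t: "t \<in> M" "\<And>x. x \<in> carrier G \<Longrightarrow> t x = x \<otimes> pinv \<sigma> g" using transl[of "pinv \<sigma> g"] ic by blast
    have "(\<sigma> \<circ> t \<circ> pinv \<sigma>) x = x \<otimes> g" if "x \<in> carrier G" for x using that g by (simp add: t(2) ic hom l)
    then show "\<exists>t\<in>M'. \<forall>x\<in>carrier G. t x = x \<otimes> g" unfolding M'_def using t(1) by blast
  qed
  interpret T: translation_group G M' by (rule tg)
  have "T.orb (\<sigma> x) = \<sigma> ` orb x" for x
  proof -
    have fix1: "k \<one> = \<one> \<longleftrightarrow> (\<sigma> \<circ> k \<circ> pinv \<sigma>) \<one> = \<one>" if "k \<in> M" for k
      using l s1 by (metis comp_apply)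
    show ?thesis
    proof (intro equalityI subsetI)
      fix z assume "z \<in> T.orb (\<sigma> x)"
      then obtain k where k: "k \<in> M" "(\<sigma> \<circ> k \<circ> pinv \<sigma>) \<one> = \<one>" "z = (\<sigma> \<circ> k \<circ> pinv \<sigma>) (\<sigma> x)"
        unfolding T.orb_def unfolding M'_def by blast
      have "k x \<in> orb x" using k(1,2) fix1 unfolding orb_def by blast
      moreover have "z = \<sigma> (k x)" using k(3) l by simp
      ultimately show "z \<in> \<sigma> ` orb x" by blast
    next
      fix z assume "z \<in> \<sigma> ` orb x"
      then obtain k where k: "k \<in> M" "k \<one> = \<one>" "z = \<sigma> (k x)" unfolding orb_def by blast
      have "z = (\<sigma> \<circ> k \<circ> pinv \<sigma>) (\<sigma> x)" using k(3) l by simp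
      moreover have "\<sigma> \<circ> k \<circ> pinv \<sigma> \<in> M'" unfolding M'_def using k(1) by (rule imageI)
      ultimately show "z \<in> T.orb (\<sigma> x)" unfolding T.orb_def mem_Collect_eq using iffD1[OF fix1[OF k(1)] k(2)]
        by (intro exI[of _ "\<sigma> \<circ> k \<circ> pinv \<sigma>"] conjI) (simp_all only:)
    qed
  qed
  then have "T.orb ` \<sigma> ` carrier G = (`) \<sigma> ` orb ` carrier G" unfolding image_image by (intro image_cong refl)
  then show "T.orbs = (`) \<sigma> ` orbs" unfolding T.orbs_def orbs_def permutes_image[OF s] .
qed

text \<open>\<open>F\<close> takes basic relations to Cayley relations, and these are invariant
  under right translations. So translations pulled back along \<open>F\<close> preserve the basic
  relations, which for 2-closed \<open>K\<close> puts them into \<open>K\<close>.\<close>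

lemma pull_back_translation:
  assumes F: "F permutes carrier G"
    and im: "\<And>X. X \<in> orbs \<Longrightarrow> \<exists>X'\<subseteq>carrier G. rel_image F (cayley_rel G X) = cayley_rel G X'"
    and a: "a \<in> carrier G" and X: "X \<in> orbs"
  shows "rel_image (pinv F \<circ> ext_id (carrier G) (\<lambda>x. x \<otimes> a) \<circ> F) (cayley_rel G X) \<subseteq> cayley_rel G X"
proof
  fix z assume "z \<in> rel_image (pinv F \<circ> ext_id (carrier G) (\<lambda>x. x \<otimes> a) \<circ> F) (cayley_rel G X)"
  then obtain u v where z: "z = (pinv F (ext_id (carrier G) (\<lambda>x. x \<otimes> a) (F u)), pinv F (ext_id (carrier G) (\<lambda>x. x \<otimes> a) (F v)))"
    "(u, v) \<in> cayley_rel G X" unfolding rel_image_def by auto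
  obtain X' where X': "X' \<subseteq> carrier G" "rel_image F (cayley_rel G X) = cayley_rel G X'" using im[OF X] by blast
  have "(F u, F v) \<in> cayley_rel G X'" using mem_rel_image[OF z(2), of F] X'(2) by simp
  then have c: "F u \<in> carrier G" "F v \<in> carrier G" "F v \<otimes> inv (F u) \<in> X'" using cayley_rel_iff[OF X'(1)] by blast+
  have "(F v \<otimes> a) \<otimes> inv (F u \<otimes> a) = F v \<otimes> inv (F u)"
    using c a by (simp add: inv_mult_group m_assoc) (simp add: m_assoc[symmetric])
  then have "(F u \<otimes> a, F v \<otimes> a) \<in> cayley_rel G X'" using c a cayley_rel_iff[OF X'(1)] by simp
  then obtain u' v' where w: "(u', v') \<in> cayley_rel G X" "F u \<otimes> a = F u'" "F v \<otimes> a = F v'"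
    unfolding X'(2)[symmetric] rel_image_def by blast
  have "z = (u', v')" using z(1) c w permutes_inverses[OF F] by simp
  then show "z \<in> cayley_rel G X" using w(1) by simp
qed

end

text \<open>An isomorphism \<open>F\<close> pulls the translations back to a second regular subgroup
  of \<open>K\<close>. If \<open>k\<close> conjugates the first into the second, then
  \<open>F \<circ> k\<close> normalises the translations and is an automorphism after a translation;
  the remaining factors lie in \<open>K\<close>.\<close>

theorem CI_of_coordinates:
  fixes G :: "('a, 'b) monoid_scheme" (structure) and pt :: "bit5 \<times> int \<Rightarrow> 'a"
  assumes p: "prime p" "odd p" and G: "group G" and K: "K \<in> Sup2_groups G"
    and hom: "\<And>g h. pt (g + h) = pt g \<otimes> pt h" and range: "range pt = carrier G"
    and pt_eq: "\<And>g h. pt g = pt h \<longleftrightarrow> fst g = fst h \<and> [snd g = snd h] (mod int p)"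
  shows "CI_S_ring G (V_ring K G)"
proof -
  interpret group G by fact
  let ?O = "carrier G"
  define M where "M = ext_id ?O ` K"
  have Ks: "subgroup K (BijGroup ?O)" "right_translations G \<subseteq> K" "two_closure ?O K = K"
    using K by (auto simp: Sup2_groups_def Sup_groups_def)
  have K_Bij: "f \<in> Bij ?O" if "f \<in> K" for f using subgroup.mem_carrier[OF Ks(1) that] by (simp add: BijGroup_def)
  have M: "pgrp ?O M" unfolding M_def by (rule pgrp_ext_id[OF Ks(1)])
  have comm: "x \<otimes> y = y \<otimes> x" if xy: "x \<in> ?O" "y \<in> ?O" for x y
  proof -
    obtain g h where "x = pt g" "y = pt h" using xy unfolding range[symmetric] by blast
    then show ?thesis using hom[of g h] hom[of h g] by (simp add: add.commute)
  qed
  have fin: "finite ?O"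
  proof -
    have p0: "0 < p" using p(1) prime_gt_0_nat by blast
    have "pt g = pt (fst g, snd g mod int p)" for g by (simp add: pt_eq cong_def)
    moreover have "(fst g, snd g mod int p) \<in> UNIV \<times> {0..<int p}" for g :: "bit5 \<times> int" using p0 by simp
    ultimately have "?O \<subseteq> pt ` (UNIV \<times> {0..<int p})" unfolding range[symmetric] by blast
    then show ?thesis by (rule finite_subset) simp
  qed
  have trK: "ext_id ?O (\<lambda>x. x \<otimes> g) \<in> M" if g: "g \<in> ?O" for g
  proof -
    have "(\<lambda>x\<in>?O. x \<otimes> g) \<in> K" using Ks(2) g unfolding right_translations_def by blast
    moreover have "ext_id ?O (\<lambda>x\<in>?O. x \<otimes> g) = ext_id ?O (\<lambda>x. x \<otimes> g)" by (rule ext) (simp add: ext_id_def)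
    ultimately show ?thesis unfolding M_def by (metis imageI)
  qed
  have closed: "f \<in> M" if f: "f permutes ?O" and pairs: "\<And>x y. x \<in> ?O \<Longrightarrow> y \<in> ?O \<Longrightarrow> \<exists>k\<in>M. k x = f x \<and> k y = f y" for f
  proof -
    have "\<exists>k\<in>K. k x = restrict f ?O x \<and> k y = restrict f ?O y" if xy: "x \<in> ?O" "y \<in> ?O" for x y
      using pairs[OF xy] xy unfolding M_def by auto
    then have "restrict f ?O \<in> two_closure ?O K"
      unfolding two_closure_eq[OF Ks(1)] using restrict_permutes_Bij[OF f] by blast
    then have "restrict f ?O \<in> K" using Ks(3) by simp
    then show ?thesis unfolding M_def using ext_id_restrict[OF f] by (metis imageI)
  qed
  interpret TG: translation_group G M
  proof
    show "\<exists>t\<in>M. \<forall>x\<in>?O. t x = x \<otimes> g" if "g \<in> ?O" for g using trK[OF that] by (intro bexI[of _ "ext_id ?O (\<lambda>x. x \<otimes> g)"]) auto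
  qed (fact fin M)+
  interpret R: regular_setup ?O M p pt
  proof
    show "\<exists>t\<in>M. \<forall>h. t (pt h) = pt (g + h)" for g
    proof -
      have "pt h \<in> ?O" for h using range by blast
      then show ?thesis using trK[of "pt g"] comm by (intro bexI[of _ "ext_id ?O (\<lambda>x. x \<otimes> pt g)"]) (auto simp: hom)
    qed
  qed (fact p bit5_char2 card_bit5 pt_eq range M closed)+
  have V: "V_ring K G = int_span TG.orbs"
  proof -
    have "orbit (perm_group ?O (point_stabilizer ?O K \<one>)) (\<lambda>f. f) x = TG.orb x" if x: "x \<in> ?O" for x
    proof (intro equalityI subsetI)
      fix z assume "z \<in> orbit (perm_group ?O (point_stabilizer ?O K \<one>)) (\<lambda>f. f) x"
      then obtain f where f: "f \<in> K" "f \<one> = \<one>" "z = f x"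
        unfolding orbit_def point_stabilizer_def stabilizer_def by auto
      then have "ext_id ?O f \<in> M \<and> ext_id ?O f \<one> = \<one> \<and> z = ext_id ?O f x" unfolding M_def using x by simp
      then show "z \<in> TG.orb x" unfolding TG.orb_def by blast
    next
      fix z assume "z \<in> TG.orb x"
      then obtain f where "f \<in> K" "ext_id ?O f \<one> = \<one>" "z = ext_id ?O f x"
        unfolding TG.orb_def unfolding M_def by blast
      then show "z \<in> orbit (perm_group ?O (point_stabilizer ?O K \<one>)) (\<lambda>f. f) x"
        unfolding orbit_def point_stabilizer_def stabilizer_def using x by auto
    qed
    then show ?thesis unfolding V_ring_def orbits_def TG.orbs_def Setcompr_eq_image by (simp cong: image_cong)
  qed
  have orbs_sub: "X \<subseteq> ?O" if "X \<in> TG.orbs" for X using that TG.orb_sub unfolding TG.orbs_def by blast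
  have rel_ext: "rel_image f (cayley_rel G X) = rel_image (ext_id ?O f) (cayley_rel G X)" if "X \<subseteq> ?O" for f X
    by (rule rel_image_cong[OF cayley_rel_sub[OF that]]) simp
  have Aut: "S_ring_Aut G (V_ring K G) = K"
  proof (intro equalityI subsetI)
    fix f assume "f \<in> S_ring_Aut G (V_ring K G)"
    then have f: "f \<in> Bij ?O" "\<And>X. X \<in> TG.orbs \<Longrightarrow> rel_image f (cayley_rel G X) = cayley_rel G X"
      unfolding S_ring_Aut_def V TG.basic_sets_orbs by blast+
    have "\<exists>k\<in>K. k x = f x \<and> k y = f y" if xy: "x \<in> ?O" "y \<in> ?O" for x y
      using TG.preserved_pairs[OF _ xy, of f] f(2) xy unfolding M_def by auto
    then have "f \<in> two_closure ?O K" unfolding two_closure_eq[OF Ks(1)] using f(1) by blast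
    then show "f \<in> K" using Ks(3) by simp
  next
    fix f assume f: "f \<in> K"
    then have "rel_image f (cayley_rel G X) = cayley_rel G X" if "X \<in> TG.orbs" for X
      using TG.M_preserves[OF _ that, of "ext_id ?O f"] rel_ext[OF orbs_sub[OF that]] unfolding M_def by simp
    then show "f \<in> S_ring_Aut G (V_ring K G)" unfolding S_ring_Aut_def V TG.basic_sets_orbs using K_Bij[OF f] by blast
  qed
  have "S_ring_Iso G (V_ring K G) = {compose ?O \<sigma> f | f \<sigma>. f \<in> K \<and> \<sigma> \<in> auto G}"
  proof (intro equalityI subsetI)
    fix f assume "f \<in> S_ring_Iso G (V_ring K G)"
    then obtain A' where f: "f \<in> Bij ?O" and A': "S_ring G A'"
      "{rel_image f (cayley_rel G X) | X. X \<in> TG.orbs} = {cayley_rel G X' | X'. X' \<in> basic_sets G A'}"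
      unfolding S_ring_Iso_def V TG.basic_sets_orbs by blast
    define F where "F = ext_id ?O f"
    have F: "F permutes ?O" unfolding F_def by (rule ext_id_permutes[OF Bij_bij_betw[OF f]])
    have Fc: "F x \<in> ?O \<longleftrightarrow> x \<in> ?O" "pinv F x \<in> ?O \<longleftrightarrow> x \<in> ?O" for x
      by (rule permutes_in_image[OF F], rule permutes_in_image[OF permutes_inv[OF F]])
    have Fi: "pinv F (F x) = x" "F (pinv F x) = x" for x using permutes_inverses[OF F] by auto
    have im: "\<exists>X'\<subseteq>?O. rel_image F (cayley_rel G X) = cayley_rel G X'" if X: "X \<in> TG.orbs" for X
    proof -
      have "rel_image f (cayley_rel G X) \<in> {cayley_rel G X' | X'. X' \<in> basic_sets G A'}"
        unfolding A'(2)[symmetric] using X by blast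
      then obtain X' where "X' \<in> basic_sets G A'" "rel_image f (cayley_rel G X) = cayley_rel G X'" by blast
      then show ?thesis using S_ring_basic_subset[OF fin A'(1)] rel_ext[OF orbs_sub[OF X]] unfolding F_def by metis
    qed
    define \<beta> where "\<beta> g = pinv F \<circ> ext_id ?O (\<lambda>x. x \<otimes> pt g) \<circ> F" for g
    have ptc: "pt g \<in> ?O" for g using range by blast
    have \<beta>: "\<beta> g x = pinv F (F x \<otimes> pt g)" if "x \<in> ?O" for g x using that by (simp add: \<beta>_def Fc)
    have \<beta>_perm: "\<beta> g permutes ?O" for g
      unfolding \<beta>_def using trK[OF ptc] TG.M_perm F by (intro permutes_compose permutes_inv) auto
    have \<beta>_M: "\<beta> g \<in> M" for g
      by (rule closed[OF \<beta>_perm], rule TG.preserved_pairs)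
        (unfold \<beta>_def, rule TG.pull_back_translation[OF F im ptc], assumption+)
    have "R.regrep \<beta>"
      unfolding R.regrep_def
    proof (intro conjI allI ballI impI)
      show "\<beta> g \<in> M" for g by (rule \<beta>_M)
      show "\<beta> (g + h) = \<beta> g \<circ> \<beta> h" for g h
      proof (rule R.perm_eqI[OF \<beta>_perm])
        show "\<beta> g \<circ> \<beta> h permutes ?O" by (intro permutes_compose \<beta>_perm)
        fix x
        have "pinv F (F (pt x) \<otimes> pt h) \<in> ?O" using ptc Fc by simp
        moreover have "F (pt x) \<in> ?O" using ptc Fc by simp
        ultimately show "\<beta> (g + h) (pt x) = (\<beta> g \<circ> \<beta> h) (pt x)"
          using ptc comm[of "pt g" "pt h"] by (simp add: \<beta> Fi hom m_assoc)
      qed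
    next
      fix g :: "bit5 \<times> int" and \<omega> assume w: "\<omega> \<in> ?O" "\<beta> g \<omega> = \<omega>"
      then have "F \<omega> \<otimes> pt g = F \<omega>" using Fi(2)[of "F \<omega> \<otimes> pt g"] by (simp add: \<beta>)
      then have "pt g = \<one>" using w(1) ptc Fc by (simp add: r_cancel_one)
      moreover have "pt 0 = \<one>" using hom[of 0 0] ptc[of 0] by simp
      ultimately have "pt g = pt 0" by simp
      then show "fst g = 0" "int p dvd snd g" unfolding pt_eq by (simp_all add: cong_0_iff)
    next
      fix g :: "bit5 \<times> int" assume "fst g = 0" "int p dvd snd g"
      then have "pt g = pt 0" by (simp add: pt_eq cong_0_iff)
      then have g1: "pt g = \<one>" using hom[of 0 0] ptc[of 0] by simp
      show "\<beta> g = id" by (rule R.perm_eqI[OF \<beta>_perm permutes_id]) (use ptc in \<open>simp add: \<beta> g1 Fc Fi\<close>)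
    next
      fix \<omega> \<omega>' assume w: "\<omega> \<in> ?O" "\<omega>' \<in> ?O"
      then have "inv (F \<omega>) \<otimes> F \<omega>' \<in> range pt" using Fc range by simp
      then obtain g where g: "inv (F \<omega>) \<otimes> F \<omega>' = pt g" by blast
      have "\<beta> g \<omega> = \<omega>'" using w Fc by (simp add: \<beta> g[symmetric] m_assoc[symmetric] Fi)
      then show "\<exists>g. \<beta> g \<omega> = \<omega>'" by blast
    qed
    from R.regular_conjugate[OF this] obtain k where k: "k \<in> M" "\<And>g. \<exists>g'. \<beta> g = k \<circ> R.tr g' \<circ> pinv k" by blast
    have ki: "pinv k (k x) = x" "k (pinv k x) = x" for x using k(1) by simp_all
    define n where "n = F \<circ> k"
    have n: "n permutes ?O" unfolding n_def using F TG.M_perm[OF k(1)] by (rule permutes_compose[rotated])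
    have "\<exists>a'\<in>?O. \<forall>x\<in>?O. n x \<otimes> a = n (x \<otimes> a')" if a: "a \<in> ?O" for a
    proof -
      obtain g where g: "a = pt g" using a range by blast
      obtain g' where g': "\<beta> g = k \<circ> R.tr g' \<circ> pinv k" using k(2) by blast
      have "n x \<otimes> a = n (x \<otimes> pt g')" if x: "x \<in> ?O" for x
      proof -
        obtain h where h: "x = pt h" using x range by blast
        have "\<beta> g (k x) = k (R.tr g' x)" unfolding g' by (simp add: ki)
        moreover have "R.tr g' x = x \<otimes> pt g'" unfolding h R.tr(2) hom using comm ptc by blast
        ultimately have "pinv F (F (k x) \<otimes> a) = k (x \<otimes> pt g')" using \<beta>[of "k x" g] x k(1) g by simp
        then show ?thesis unfolding n_def comp_apply using Fi(2) by metis
      qed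
      then show ?thesis using ptc by blast
    qed
    from intertwiner_auto[OF fin comm n this] obtain \<sigma> d where
      s: "\<sigma> \<in> auto G" "d \<in> ?O" "\<And>x. x \<in> ?O \<Longrightarrow> n x = \<sigma> (x \<otimes> d)" by blast
    \<comment> \<open>What remains of \<open>f\<close> when the automorphism is split off: the
      inverse of \<open>k\<close> followed by a translation, both in \<open>M\<close>.\<close>
    define l where "l = ext_id ?O (\<lambda>x. x \<otimes> d) \<circ> pinv k"
    have "l \<in> M" unfolding l_def by (rule TG.M_comp[OF trK[OF s(2)] TG.M_inv[OF k(1)]])
    then obtain f' where f': "f' \<in> K" "l = ext_id ?O f'" unfolding M_def by blast
    have "f = compose ?O \<sigma> f'"
    proof
      fix x show "f x = compose ?O \<sigma> f' x"
      proof (cases "x \<in> ?O")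
        case True
        have kx: "pinv k x \<in> ?O" using True TG.M_inv[OF k(1)] by simp
        have "f x = n (pinv k x)" using True by (simp add: n_def ki F_def)
        also have "\<dots> = \<sigma> (l x)" using s(3)[OF kx] kx by (simp add: l_def)
        also have "l x = f' x" using f'(2) True by simp
        finally show ?thesis using True by (simp add: compose_def)
      next
        case False
        then show ?thesis using f by (simp add: Bij_def compose_def extensional_def)
      qed
    qed
    then show "f \<in> {compose ?O \<sigma> f | f \<sigma>. f \<in> K \<and> \<sigma> \<in> auto G}" using f'(1) s(1) by blast
  next
    fix f assume "f \<in> {compose ?O \<sigma> f | f \<sigma>. f \<in> K \<and> \<sigma> \<in> auto G}"
    then obtain f' \<sigma> where f: "f = compose ?O \<sigma> f'" "f' \<in> K" "\<sigma> \<in> auto G" by blast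
    have sB: "\<sigma> \<in> Bij ?O" and shom: "\<sigma> \<in> hom G G" using f(3) by (auto simp: auto_def)
    define s where "s = ext_id ?O \<sigma>"
    have s: "s permutes ?O" unfolding s_def by (rule ext_id_permutes[OF Bij_bij_betw[OF sB]])
    have s_hom: "s (x \<otimes> y) = s x \<otimes> s y" if "x \<in> ?O" "y \<in> ?O" for x y
      using that hom_mult[OF shom that] by (simp add: s_def)
    let ?M = "(\<lambda>k. s \<circ> k \<circ> pinv s) ` M"
    interpret T: translation_group G ?M by (rule TG.orb_conj(1)[OF s s_hom])
    have Torbs: "T.orbs = (`) s ` TG.orbs" by (rule TG.orb_conj(2)[OF s s_hom])
    have fB: "f \<in> Bij ?O" unfolding f(1) by (rule compose_Bij[OF sB K_Bij[OF f(2)]])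
    have rel: "rel_image f (cayley_rel G X) = cayley_rel G (s ` X)" if X: "X \<in> TG.orbs" for X
    proof -
      have Xs: "X \<subseteq> ?O" by (rule orbs_sub[OF X])
      have "rel_image f (cayley_rel G X) = rel_image (\<sigma> \<circ> f') (cayley_rel G X)"
        by (rule rel_image_cong[OF cayley_rel_sub[OF Xs]]) (simp add: f(1) compose_def)
      also have "\<dots> = rel_image \<sigma> (cayley_rel G X)"
        unfolding rel_image_comp rel_ext[OF Xs, of f'] using TG.M_preserves[OF _ X] f(2) unfolding M_def by simp
      also have "\<dots> = cayley_rel G (\<sigma> ` X)" by (rule rel_image_auto[OF f(3) Xs])
      also have "\<sigma> ` X = s ` X" using Xs by (intro image_cong) (auto simp: s_def)
      finally show ?thesis .
    qed
    have "{rel_image f (cayley_rel G X) | X. X \<in> TG.orbs} = {cayley_rel G X' | X'. X' \<in> T.orbs}"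
      unfolding Torbs Setcompr_eq_image image_image by (rule image_cong[OF refl rel])
    then show "f \<in> S_ring_Iso G (V_ring K G)"
      unfolding S_ring_Iso_def V TG.basic_sets_orbs mem_Collect_eq
      by (intro conjI exI[of _ "int_span T.orbs"]) (simp_all only: T.basic_sets_orbs T.S_ring_orbs fB)
  qed
  then show ?thesis unfolding CI_S_ring_def Aut using TG.S_ring_orbs V by simp
qed

theorem theorem9p1:
  fixes G :: "('a, 'b) monoid_scheme" (structure)
    and H P :: "'a set" and K :: "('a \<Rightarrow> 'a) set" and p :: nat
  assumes "prime p" and "odd p"
    and "group G"
    and "H \<lhd> G" and "P \<lhd> G" and "H \<inter> P = {\<one>}" and "H <#> P = carrier G"
    and "G\<lparr>carrier := H\<rparr> \<cong> product_group {..<5::nat} (\<lambda>_. integer_mod_group 2)"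
    and "G\<lparr>carrier := P\<rparr> \<cong> integer_mod_group p"
    and "K \<in> Sup2_min G"
  shows "CI_S_ring G (V_ring K G)"
proof -
  have "0 < p" using assms(1) prime_gt_0_nat by blast
  from ex_coordinates[OF this assms(3-9)] obtain pt :: "bit5 \<times> int \<Rightarrow> 'a"
    where "(\<forall>g h. pt (g + h) = pt g \<otimes> pt h) \<and>
      (\<forall>g h. pt g = pt h \<longleftrightarrow> fst g = fst h \<and> [snd g = snd h] (mod int p)) \<and> range pt = carrier G" ..
  moreover have "K \<in> Sup2_groups G" using assms(10) by (simp add: Sup2_min_def)
  ultimately show ?thesis using CI_of_coordinates[OF assms(1-3), of K pt] by blast
qed

end
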